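(* Consider the matrix SDE on the space $\mathcal{S}_p$ of symmetric real $p\times p$ matrices $$dX_t=g(X_t)\,dB_t\,h(X_t)+h(X_t)\,dB_t^T\,g(X_t)+b(X_t)\,dt,$$ where $g,h,b:\mathbb{R}\to\mathbb{R}$, $B_t$ is a Brownian $p\times p$ matrix and $X_0\in\tilde{\mathcal{S}}_p$, the set of symmetric matrices with $p$ different eigenvalues. Suppose that $$|g(x)h(x)-g(y)h(y)|^2\le\rho(|x-y|),\quad x,y\in\mathbb{R},\ x\ne y,$$ where $\rho:(0,\infty)\to(0,\infty)$ is a Borel function such that $\int_{0^+}\rho^{-1}(x)\,dx=\infty$, that the function $G(x,y)=g^2(x)h^2(y)+g^2(y)h^2(x)$ is locally Lipschitz and strictly positive on $\{x\ne y\}$, and that $b$ is locally Lipschitz. Then, for $t<\tau$, pathwise uniqueness holds for the eigenvalue and eigenvector processes $\Lambda_t=\mathrm{diag}(\lambda_i(t))$, $H_t=(h_{ij}(t))$ of $X_t$, solutions of the system of SDEs $$d\lambda_i=2g(\lambda_i)h(\lambda_i)\,d\nu_i+\Big(b(\lambda_i)+\sum_{k\ne i}\frac{G(\lambda_i,\lambda_k)}{\lambda_i-\lambda_k}\Big)dt,\quad 1\le i\le p,$$ $$dh_{ij}=\sum_{k\ne j}h_{ik}\frac{\sqrt{G(\lambda_j,\lambda_k)}}{\lambda_j-\lambda_k}\,d\beta_{kj}-\frac12h_{ij}\sum_{k\ne j}\frac{G(\lambda_j,\lambda_k)}{(\lambda_k-\lambda_j)^2}\,dt,\quad 1\le i,j\le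 p,$$ where $(\nu_i)_i$ and $(\beta_{kj})_{k<j}$ are independent Brownian motions and $\beta_{jk}=\beta_{kj}$.
   Context: A Brownian $p\times p$ matrix has independent standard real Brownian motions as entries. For $g:\mathbb{R}\to\mathbb{R}$ and $X=H\Lambda H^T\in\mathcal{S}_p$ ($H$ orthogonal, $\Lambda$ diagonal), $g(X)=Hg(\Lambda)H^T$. The eigenvalues of $X_t$ are ordered increasingly, $\lambda_1(t)\le\ldots\le\lambda_p(t)$, and $H_t$ is an orthogonal matrix of eigenvectors, $X_t=H_t\Lambda_tH_t^T$, with $\Lambda,H$ chosen as smooth functions of $X$ until the first collision time $\tau=\inf\{t:\lambda_i(t)=\lambda_j(t)\text{ for some }i\ne j\}$. $\rho^{-1}(x)$ means $1/\rho(x)$, and $\int_{0^+}\rho^{-1}(x)dx=\infty$ means $\int_0^\varepsilon\frac{dx}{\rho(x)}=\infty$ for every $\varepsilon>0$. Pathwise uniqueness for $t<\tau$ means that two solutions of the $(\Lambda,H)$-system on the same filtered probability space, driven by the same Brownian motions $(\nu_i),(\beta_{kj})$ and with the same initial value $(\Lambda_0,H_0)$ coming from a diagonalization $X_0=H_0\Lambda_0H_0^T$, a.s. coincide up to the first collision time. *)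

theory Defs
  imports "HOL-Probability.Probability"
begin

section \<open>Symmetric matrices and their diagonalizations\<close>

definition diag_matrix :: "real^'n \<Rightarrow> real^'n^'n" where
  "diag_matrix \<Lambda> = (\<chi> i j. if i = j then \<Lambda> $ i else 0)"

definition eigenvalues :: "real^'n^'n \<Rightarrow> real set" where
  "eigenvalues X = {c. \<exists>v. v \<noteq> 0 \<and> X *v v = c *\<^sub>R v}"

definition sym_distinct :: "(real^'n^'n) set" where
  "sym_distinct = {X. transpose X = X \<and> card (eigenvalues X) = CARD('n)}"

definition diagonalizes ::
    "real^('n::{finite,linorder})^('n::{finite,linorder}) \<Rightarrow> real^('n::{finite,linorder}) \<Rightarrow>
     real^('n::{finite,linorder})^('n::{finite,linorder}) \<Rightarrow> bool" where
  "diagonalizes X \<Lambda> H \<longleftrightarrow>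
     orthogonal_matrix H \<and> (\<forall>i j. i \<le> j \<longrightarrow> \<Lambda> $ i \<le> \<Lambda> $ j) \<and>
     X = H ** diag_matrix \<Lambda> ** transpose H"

definition locally_lipschitz_on ::
    "'a::metric_space set \<Rightarrow> ('a \<Rightarrow> 'b::metric_space) \<Rightarrow> bool" where
  "locally_lipschitz_on U f \<longleftrightarrow>
     (\<forall>x\<in>U. \<exists>r>0. \<exists>C. C-lipschitz_on (ball x r \<inter> U) f)"

section \<open>Filtered probability spaces and Brownian motion\<close>

text \<open>Time is \<open>[0, \<infinity>)\<close> inside the type \<open>real\<close>; the members of \<open>F\<close> at negative times play no
  role. The usual conditions are not required.\<close>

definition filtered_prob_space :: "'a measure \<Rightarrow> (real \<Rightarrow> 'a measure) \<Rightarrow> bool" where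
  "filtered_prob_space M F \<longleftrightarrow>
     prob_space M \<and> filtration (space M) F \<and> (\<forall>t. subalgebra M (F t))"

definition adapted :: "(real \<Rightarrow> 'a measure) \<Rightarrow> (real \<Rightarrow> 'a \<Rightarrow> 'b::topological_space) \<Rightarrow> bool" where
  "adapted F X \<longleftrightarrow> (\<forall>t\<ge>0. X t \<in> borel_measurable (F t))"

definition brownian_motion ::
    "'a measure \<Rightarrow> (real \<Rightarrow> 'a measure) \<Rightarrow> (real \<Rightarrow> 'a \<Rightarrow> real) \<Rightarrow> bool" where
  "brownian_motion M F W \<longleftrightarrow>
     adapted F W \<and>
     (AE \<omega> in M. W 0 \<omega> = 0) \<and>
     (\<forall>\<omega>\<in>space M. continuous_on {0..} (\<lambda>t. W t \<omega>)) \<and>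
     (\<forall>s t. 0 \<le> s \<longrightarrow> s < t \<longrightarrow>
        distributed M lborel (\<lambda>\<omega>. W t \<omega> - W s \<omega>) (normal_density 0 (sqrt (t - s))) \<and>
        prob_space.indep_set M (sets (F s))
          (sets (vimage_algebra (space M) (\<lambda>\<omega>. W t \<omega> - W s \<omega>) borel)))"

text \<open>Independence of the processes \<open>W k\<close> as random elements of the path space
  \<open>\<real>\<close> to the power \<open>[0, \<infinity>)\<close>.\<close>

definition independent_brownian_motions ::
    "'a measure \<Rightarrow> (real \<Rightarrow> 'a measure) \<Rightarrow> 'k set \<Rightarrow> ('k \<Rightarrow> real \<Rightarrow> 'a \<Rightarrow> real) \<Rightarrow> bool" where
  "independent_brownian_motions M F K W \<longleftrightarrow>
     (\<forall>k\<in>K. brownian_motion M F (W k)) \<and>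
     prob_space.indep_vars M (\<lambda>_. PiM {0..} (\<lambda>_. borel)) (\<lambda>k \<omega>. \<lambda>t\<in>{0..}. W k t \<omega>) K"

section \<open>The stochastic integral\<close>

text \<open>The triple \<open>(n, s, \<xi>)\<close> stands for the process equal to \<open>\<xi> i\<close> on \<open>(s i, s (i + 1)]\<close>,
  \<open>i < n\<close>, and to 0 elsewhere.\<close>

type_synonym 'a simple_process = "nat \<times> (nat \<Rightarrow> real) \<times> (nat \<Rightarrow> 'a \<Rightarrow> real)"

fun simple_process :: "'a measure \<Rightarrow> (real \<Rightarrow> 'a measure) \<Rightarrow> 'a simple_process \<Rightarrow> bool" where
  "simple_process M F (n, s, \<xi>) \<longleftrightarrow>
     0 \<le> s 0 \<and> (\<forall>i<n. s i \<le> s (Suc i)) \<and>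
     (\<forall>i<n. \<xi> i \<in> borel_measurable (F (s i)) \<and> (\<exists>C. \<forall>\<omega>\<in>space M. \<bar>\<xi> i \<omega>\<bar> \<le> C))"

fun simple_val :: "'a simple_process \<Rightarrow> real \<Rightarrow> 'a \<Rightarrow> real" where
  "simple_val (n, s, \<xi>) t \<omega> = (\<Sum>i<n. \<xi> i \<omega> * indicator {s i<..s (Suc i)} t)"

fun simple_integral ::
    "'a simple_process \<Rightarrow> (real \<Rightarrow> 'a \<Rightarrow> real) \<Rightarrow> real \<Rightarrow> 'a \<Rightarrow> real" where
  "simple_integral (n, s, \<xi>) W t \<omega> =
     (\<Sum>i<n. \<xi> i \<omega> * (W (min t (s (Suc i))) \<omega> - W (min t (s i)) \<omega>))"

text \<open>Progressive measurability of \<open>f\<close> on the stochastic interval \<open>[0, \<tau>)\<close>.\<close>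

definition progressive_before ::
    "(real \<Rightarrow> 'a measure) \<Rightarrow> ('a \<Rightarrow> ereal) \<Rightarrow> (real \<Rightarrow> 'a \<Rightarrow> real) \<Rightarrow> bool" where
  "progressive_before F \<tau> f \<longleftrightarrow>
     (\<forall>T\<ge>0. (\<lambda>(t, \<omega>). if ereal t < \<tau> \<omega> then f t \<omega> else 0)
        \<in> borel_measurable (restrict_space borel {0..T} \<Otimes>\<^sub>M F T))"

text \<open>\<open>Y\<close> is a version of the Ito integral \<open>\<integral>f dW\<close> on \<open>[0, \<tau>)\<close>, for progressive \<open>f\<close> with
  \<open>\<integral> f\<^sup>2 ds < \<infinity>\<close> over \<open>[0, T]\<close> for all \<open>T < \<tau>\<close>, almost surely: almost surely, locally uniformly on
  \<open>[0, \<tau>)\<close>, it is the limit of the elementary integrals of simple processes that converge to \<open>f\<close>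
  in \<open>L\<^sup>2[0, T]\<close> for all \<open>T < \<tau>\<close>. The usual construction by limits in probability and
  localization gives the same integral, by passing to subsequences.\<close>

definition has_ito_integral_before ::
    "'a measure \<Rightarrow> (real \<Rightarrow> 'a measure) \<Rightarrow> ('a \<Rightarrow> ereal) \<Rightarrow>
     (real \<Rightarrow> 'a \<Rightarrow> real) \<Rightarrow> (real \<Rightarrow> 'a \<Rightarrow> real) \<Rightarrow> (real \<Rightarrow> 'a \<Rightarrow> real) \<Rightarrow> bool" where
  "has_ito_integral_before M F \<tau> W f Y \<longleftrightarrow>
     progressive_before F \<tau> f \<and>
     (\<exists>P. (\<forall>m. simple_process M F (P m)) \<and>
       (AE \<omega> in M. \<forall>T\<ge>0. ereal T < \<tau> \<omega> \<longrightarrow>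
          ((\<lambda>m. \<integral>\<^sup>+ s\<in>{0..T}. ennreal ((simple_val (P m) s \<omega> - f s \<omega>)\<^sup>2) \<partial>lborel)
             \<longlonglongrightarrow> 0) \<and>
          uniform_limit {0..T} (\<lambda>m t. simple_integral (P m) W t \<omega>) (\<lambda>t. Y t \<omega>) sequentially))"

text \<open>\<open>dX = (\<Sum>k\<in>K. \<sigma> k dW\<^sub>k) + \<mu> dt\<close> on \<open>[0, \<tau>)\<close>.\<close>

definition has_stochastic_differential_before ::
    "'a measure \<Rightarrow> (real \<Rightarrow> 'a measure) \<Rightarrow> ('a \<Rightarrow> ereal) \<Rightarrow> 'k set \<Rightarrow>
     ('k \<Rightarrow> real \<Rightarrow> 'a \<Rightarrow> real) \<Rightarrow> ('k \<Rightarrow> real \<Rightarrow> 'a \<Rightarrow> real) \<Rightarrow> (real \<Rightarrow> 'a \<Rightarrow> real) \<Rightarrow>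
     (real \<Rightarrow> 'a \<Rightarrow> real) \<Rightarrow> bool" where
  "has_stochastic_differential_before M F \<tau> K W \<sigma> \<mu> X \<longleftrightarrow>
     (\<exists>Y. (\<forall>k\<in>K. has_ito_integral_before M F \<tau> (W k) (\<sigma> k) (Y k)) \<and>
       (AE \<omega> in M. \<forall>t\<ge>0. ereal t < \<tau> \<omega> \<longrightarrow>
          set_integrable lborel {0..t} (\<lambda>s. \<mu> s \<omega>) \<and>
          X t \<omega> = X 0 \<omega> + (\<Sum>k\<in>K. Y k t \<omega>) + (LINT s:{0..t}|lborel. \<mu> s \<omega>)))"

section \<open>The eigenvalue and eigenvector system\<close>

definition G_fun :: "(real \<Rightarrow> real) \<Rightarrow> (real \<Rightarrow> real) \<Rightarrow> real \<Rightarrow> real \<Rightarrow> real" where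
  "G_fun g h x y = (g x)\<^sup>2 * (h y)\<^sup>2 + (g y)\<^sup>2 * (h x)\<^sup>2"

definition collision_time :: "(real \<Rightarrow> 'a \<Rightarrow> real^'n) \<Rightarrow> 'a \<Rightarrow> ereal" where
  "collision_time L \<omega> =
     Inf {ereal t | t. 0 \<le> t \<and> (\<exists>i j. i \<noteq> j \<and> L t \<omega> $ i = L t \<omega> $ j)}"

text \<open>Only the values of \<open>H\<close> before the collision time matter.\<close>

definition eigensystem_solution ::
    "'a measure \<Rightarrow> (real \<Rightarrow> 'a measure) \<Rightarrow>
     (real \<Rightarrow> real) \<Rightarrow> (real \<Rightarrow> real) \<Rightarrow> (real \<Rightarrow> real) \<Rightarrow>
     ('n \<Rightarrow> real \<Rightarrow> 'a \<Rightarrow> real) \<Rightarrow> ('n \<Rightarrow> 'n \<Rightarrow> real \<Rightarrow> 'a \<Rightarrow> real) \<Rightarrow>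
     (real \<Rightarrow> 'a \<Rightarrow> real^'n) \<Rightarrow> (real \<Rightarrow> 'a \<Rightarrow> real^'n^'n) \<Rightarrow> bool" where
  "eigensystem_solution M F g h b \<nu> \<beta> L H \<longleftrightarrow>
     adapted F L \<and> adapted F H \<and>
     (\<forall>\<omega>\<in>space M. continuous_on {0..} (\<lambda>t. L t \<omega>)) \<and>
     (\<forall>\<omega>\<in>space M. continuous_on {t. 0 \<le> t \<and> ereal t < collision_time L \<omega>} (\<lambda>t. H t \<omega>)) \<and>
     (\<forall>i. has_stochastic_differential_before M F (collision_time L) {i} \<nu>
        (\<lambda>_ t \<omega>. 2 * g (L t \<omega> $ i) * h (L t \<omega> $ i))
        (\<lambda>t \<omega>. b (L t \<omega> $ i) +
           (\<Sum>k\<in>UNIV - {i}. G_fun g h (L t \<omega> $ i) (L t \<omega> $ k) / (L t \<omega> $ i - L t \<omega> $ k)))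
        (\<lambda>t \<omega>. L t \<omega> $ i)) \<and>
     (\<forall>i j. has_stochastic_differential_before M F (collision_time L) (UNIV - {j}) (\<lambda>k. \<beta> k j)
        (\<lambda>k t \<omega>. H t \<omega> $ i $ k *
           (sqrt (G_fun g h (L t \<omega> $ j) (L t \<omega> $ k)) / (L t \<omega> $ j - L t \<omega> $ k)))
        (\<lambda>t \<omega>. - (1/2) * H t \<omega> $ i $ j *
           (\<Sum>k\<in>UNIV - {j}. G_fun g h (L t \<omega> $ j) (L t \<omega> $ k) / (L t \<omega> $ k - L t \<omega> $ j)\<^sup>2))
        (\<lambda>t \<omega>. H t \<omega> $ i $ j))"

text \<open>The driving noise: \<open>\<nu> i\<close> for all \<open>i\<close> and \<open>\<beta> k j\<close> for \<open>k < j\<close> are jointly independent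
  Brownian motions, and \<open>\<beta>\<close> is extended symmetrically; \<open>\<beta> j j\<close> is not used.\<close>

definition eigensystem_noise ::
    "'a measure \<Rightarrow> (real \<Rightarrow> 'a measure) \<Rightarrow>
     ('n::{finite,linorder} \<Rightarrow> real \<Rightarrow> 'a \<Rightarrow> real) \<Rightarrow> ('n \<Rightarrow> 'n \<Rightarrow> real \<Rightarrow> 'a \<Rightarrow> real) \<Rightarrow> bool" where
  "eigensystem_noise M F \<nu> \<beta> \<longleftrightarrow>
     independent_brownian_motions M F (range Inl \<union> Inr ` {(k, j). k < j})
       (case_sum \<nu> (\<lambda>(k, j). \<beta> k j)) \<and>
     (\<forall>j k. \<beta> j k = \<beta> k j)"

end

theory Submission
  imports Defs
begin

text \<open>
  For the eigenvalues, fix a compact set of configurations on which all gaps are bounded below, and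
  stop both solutions when one of them leaves it. There the drift is Lipschitz, so Ito's formula,
  applied to \<open>\<phi>(\<lambda>\<^sub>i - \<lambda>'\<^sub>i)\<close> with Yamada-Watanabe approximations \<open>\<phi>\<close> of the absolute value, bounds
  \<open>u(t) = \<Sum>\<^sub>i E \<bar>\<lambda>\<^sub>i - \<lambda>'\<^sub>i\<bar>\<close> by a multiple of its own integral, and Gronwall gives \<open>u = 0\<close>. Letting the
  compact sets grow identifies the eigenvalues up to the first collision, hence also the collision
  times. The eigenvector equations are then linear with common, locally bounded coefficients, and
  Cauchy-Schwarz, the Ito isometry and Gronwall identify the eigenvectors.

  Only inequalities in expectation are needed from Ito's formula. They are obtained by summing a
  conditional second order Taylor expansion over a grid that refines the break points of the
  simple integrands. Localization is built into the sum: a cell counts only if it begins before the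
  exit time and the integrand has not yet used up a fixed budget of its square integral, which
  replaces stopping times between grid points.

  Since \<open>\<rho>\<close> is merely Borel, the second derivative of \<open>\<phi>\<close> is built from the modulus of continuity
  of \<open>g h\<close> instead, which is continuous and whose square is dominated by \<open>\<rho>\<close>.
\<close>

section \<open>Test functions\<close>

text \<open>The stochastic integral is available only as an almost sure, locally uniform limit of
  elementary integrals. Its integrand is bounded only up to an exit time, and the bounds of the
  approximating simple processes may grow along the sequence. So every error made on an elementary
  integral is kept proportional to its own energy, the integral of the squared integrand: the budget
  caps the energy uniformly, and the mesh is chosen after the bound of each simple process is known.
  Upper bounds on E \<phi> survive each passage to the limit, because discarding cells drops only
  nonnegative terms and Fatou's lemma goes in the right direction.

  The square has an unbounded derivative, so the isometry is reached through cosines. Nothing says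
  that H stays orthogonal or is continuous at a collision, so its entries are bounded by
  localization as well. A priori one solution could collide before the other; continuity at the
  earlier collision time excludes this.\<close>

locale test_function =
  fixes \<phi> \<phi>1 \<phi>2 :: "real \<Rightarrow> real" and C1 C2 :: real
  assumes deriv1: "\<And>x. (\<phi> has_real_derivative \<phi>1 x) (at x)"
    and deriv2: "\<And>x. (\<phi>1 has_real_derivative \<phi>2 x) (at x)"
    and bound1: "\<And>x. \<bar>\<phi>1 x\<bar> \<le> C1"
    and bound2: "\<And>x. \<bar>\<phi>2 x\<bar> \<le> C2"
    and uniform2: "uniformly_continuous_on UNIV \<phi>2"
    and nonneg: "\<And>x. 0 \<le> \<phi> x"
    and zero: "\<phi> 0 = 0"
begin

lemma C1_nonneg: "0 \<le> C1" and C2_nonneg: "0 \<le> C2"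
  using bound1[of 0] bound2[of 0] by linarith+

lemma continuous: "continuous_on UNIV \<phi>" "continuous_on UNIV \<phi>1" "continuous_on UNIV \<phi>2"
  using deriv1 deriv2 uniformly_continuous_imp_continuous[OF uniform2]
  by (blast intro: continuous_at_imp_continuous_on DERIV_isCont)+

lemma measurable [measurable]:
  "\<phi> \<in> borel_measurable borel" "\<phi>1 \<in> borel_measurable borel" "\<phi>2 \<in> borel_measurable borel"
  using continuous by (auto intro: borel_measurable_continuous_onI)

lemma lipschitz: "\<bar>\<phi> x - \<phi> y\<bar> \<le> C1 * \<bar>x - y\<bar>"
  using field_differentiable_bound[of UNIV \<phi> \<phi>1 C1 y x] deriv1 bound1
  by (simp add: abs_minus_commute has_field_derivative_at_within)

lemma modulus2:
  assumes "0 < \<epsilon>"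
  obtains K where "0 \<le> K" "\<And>x y. \<bar>\<phi>2 x - \<phi>2 y\<bar> \<le> \<epsilon> + K * (x - y)\<^sup>2"
proof -
  obtain d where d: "d > 0" "\<And>x y. \<bar>x - y\<bar> < d \<Longrightarrow> \<bar>\<phi>2 x - \<phi>2 y\<bar> < \<epsilon>"
    using uniform2 assms unfolding uniformly_continuous_on_def dist_real_def by (metis UNIV_I)
  have "\<bar>\<phi>2 x - \<phi>2 y\<bar> \<le> \<epsilon> + (2 * C2 / d\<^sup>2) * (x - y)\<^sup>2" for x y
  proof (cases "\<bar>x - y\<bar> < d")
    case True
    then show ?thesis using d(2)[OF True] C2_nonneg d(1)
      by (smt (verit) divide_nonneg_nonneg mult_nonneg_nonneg zero_le_power2)
  next
    case False
    then have "d\<^sup>2 \<le> (x - y)\<^sup>2" using d(1) by (simp add: abs_le_square_iff[symmetric])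
    then have "2 * C2 * d\<^sup>2 \<le> 2 * C2 * (x - y)\<^sup>2" using C2_nonneg by (intro mult_left_mono) auto
    then have "2 * C2 \<le> (2 * C2 / d\<^sup>2) * (x - y)\<^sup>2" using d(1) by (simp add: field_simps)
    moreover have "\<bar>\<phi>2 x - \<phi>2 y\<bar> \<le> 2 * C2" using bound2[of x] bound2[of y] by linarith
    ultimately show ?thesis using assms by linarith
  qed
  then show thesis using C2_nonneg that[of "2 * C2 / d\<^sup>2"] by simp
qed

lemma taylor:
  assumes K: "\<And>x y. \<bar>\<phi>2 x - \<phi>2 y\<bar> \<le> \<epsilon> + K * (x - y)\<^sup>2" and "0 \<le> K"
  shows "\<phi> (x + d) - \<phi> x \<le> \<phi>1 x * d + \<phi>2 x * d\<^sup>2 / 2 + (\<epsilon> + K * d\<^sup>2) * d\<^sup>2 / 2"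
proof (cases "d = 0")
  case False
  define diff where "diff = (\<lambda>m::nat. if m = 0 then \<phi> else if m = 1 then \<phi>1 else \<phi>2)"
  have "\<exists>t. (if x + d < x then x + d < t \<and> t < x else x < t \<and> t < x + d) \<and>
      \<phi> (x + d) = (\<Sum>m<2. (diff m x / fact m) * (x + d - x) ^ m) + (diff 2 t / fact 2) * (x + d - x) ^ 2"
    using False deriv1 deriv2
    by (intro Taylor[where a="min x (x + d)" and b="max x (x + d)"])
       (auto simp: diff_def less_Suc_eq numeral_2_eq_2)
  then obtain t where t': "if x + d < x then x + d < t \<and> t < x else x < t \<and> t < x + d"
      "\<phi> (x + d) = (\<Sum>m<2. (diff m x / fact m) * (x + d - x) ^ m) + (diff 2 t / fact 2) * (x + d - x) ^ 2"
    by blast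
  then have t: "\<bar>t - x\<bar> \<le> \<bar>d\<bar>" "\<phi> (x + d) = \<phi> x + \<phi>1 x * d + \<phi>2 t / 2 * d\<^sup>2"
    by (auto simp: diff_def numeral_2_eq_2 split: if_splits)
  have "\<phi>2 t - \<phi>2 x \<le> \<epsilon> + K * (t - x)\<^sup>2" using K[of t x] by linarith
  also have "\<dots> \<le> \<epsilon> + K * d\<^sup>2"
    using t(1) \<open>0 \<le> K\<close> by (intro add_left_mono mult_left_mono) (auto simp: abs_le_square_iff)
  finally have "(\<phi>2 t - \<phi>2 x) * d\<^sup>2 \<le> (\<epsilon> + K * d\<^sup>2) * d\<^sup>2" by (intro mult_right_mono) auto
  then show ?thesis using t(2) by (simp add: field_simps)
qed simp

lemma taylor_sum:
  assumes K: "\<And>x y. \<bar>\<phi>2 x - \<phi>2 y\<bar> \<le> \<epsilon> + K * (x - y)\<^sup>2" and "0 \<le> K" "0 < \<epsilon>"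
  shows "\<phi> (x + u + v) - \<phi> x \<le> \<phi>1 x * u + \<phi>1 x * v + \<phi>2 x * u\<^sup>2 / 2
    + (C2 / 2 + 1) * \<epsilon> * u\<^sup>2 + (C2 / (2 * \<epsilon>) + C2 / 2 + \<epsilon>) * v\<^sup>2 + 4 * K * (u ^ 4 + v ^ 4)"
proof -
  let ?d = "u + v"
  have sq: "?d\<^sup>2 \<le> 2 * u\<^sup>2 + 2 * v\<^sup>2"
    using zero_le_power2[of "u - v"] by (simp add: power2_eq_square algebra_simps)
  have "(?d\<^sup>2)\<^sup>2 \<le> (2 * u\<^sup>2 + 2 * v\<^sup>2)\<^sup>2" using sq by (intro power_mono) auto
  also have "\<dots> \<le> 8 * (u ^ 4 + v ^ 4)"
    using zero_le_power2[of "u\<^sup>2 - v\<^sup>2"] by (simp add: power2_sum power2_diff power_mult_distrib)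
  finally have quart: "?d\<^sup>2 * ?d\<^sup>2 \<le> 8 * (u ^ 4 + v ^ 4)" by (simp add: power2_eq_square)
  have cross: "2 * \<bar>u * v\<bar> \<le> \<epsilon> * u\<^sup>2 + v\<^sup>2 / \<epsilon>"
  proof -
    have "0 \<le> (\<epsilon> * \<bar>u\<bar> - \<bar>v\<bar>)\<^sup>2" by simp
    also have "\<dots> = \<epsilon>\<^sup>2 * u\<^sup>2 + v\<^sup>2 - \<epsilon> * (2 * \<bar>u * v\<bar>)"
      by (simp add: power2_diff power_mult_distrib abs_mult)
    finally have "2 * \<bar>u * v\<bar> \<le> (\<epsilon>\<^sup>2 * u\<^sup>2 + v\<^sup>2) / \<epsilon>"
      using \<open>0 < \<epsilon>\<close> by (simp add: pos_le_divide_eq mult.commute)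
    also have "\<dots> = \<epsilon> * u\<^sup>2 + v\<^sup>2 / \<epsilon>"
      using \<open>0 < \<epsilon>\<close> by (simp add: add_divide_distrib power2_eq_square)
    finally show ?thesis .
  qed
  have "\<phi>2 x * ?d\<^sup>2 - \<phi>2 x * u\<^sup>2 = \<phi>2 x * (2 * (u * v) + v\<^sup>2)"
    by (simp add: power2_eq_square algebra_simps)
  also have "\<dots> \<le> \<bar>\<phi>2 x\<bar> * \<bar>2 * (u * v) + v\<^sup>2\<bar>" by (metis abs_ge_self abs_mult)
  also have "\<dots> \<le> C2 * (2 * \<bar>u * v\<bar> + v\<^sup>2)"
    using bound2[of x] C2_nonneg by (intro mult_mono) (auto simp: abs_mult intro: order_trans[OF abs_triangle_ineq])
  also have "\<dots> \<le> C2 * (\<epsilon> * u\<^sup>2 + v\<^sup>2 / \<epsilon> + v\<^sup>2)"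
    using cross C2_nonneg by (intro mult_left_mono) auto
  finally have a: "\<phi>2 x * ?d\<^sup>2 / 2 \<le> \<phi>2 x * u\<^sup>2 / 2 + C2 / 2 * (\<epsilon> * u\<^sup>2 + v\<^sup>2 / \<epsilon> + v\<^sup>2)" by simp
  have "(\<epsilon> + K * ?d\<^sup>2) * ?d\<^sup>2 = \<epsilon> * ?d\<^sup>2 + K * (?d\<^sup>2 * ?d\<^sup>2)" by (simp add: algebra_simps)
  also have "\<dots> \<le> \<epsilon> * (2 * u\<^sup>2 + 2 * v\<^sup>2) + K * (8 * (u ^ 4 + v ^ 4))"
    using sq quart assms by (intro add_mono mult_left_mono) auto
  finally have b: "(\<epsilon> + K * ?d\<^sup>2) * ?d\<^sup>2 / 2 \<le> \<epsilon> * (u\<^sup>2 + v\<^sup>2) + 4 * K * (u ^ 4 + v ^ 4)"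
    by (simp add: distrib_left)
  have "\<phi> (x + u + v) - \<phi> x \<le> \<phi>1 x * ?d + \<phi>2 x * ?d\<^sup>2 / 2 + (\<epsilon> + K * ?d\<^sup>2) * ?d\<^sup>2 / 2"
    using taylor[OF K \<open>0 \<le> K\<close>, of x ?d] by (simp add: add.assoc)
  also have "\<dots> \<le> \<phi>1 x * ?d + (\<phi>2 x * u\<^sup>2 / 2 + C2 / 2 * (\<epsilon> * u\<^sup>2 + v\<^sup>2 / \<epsilon> + v\<^sup>2))
      + (\<epsilon> * (u\<^sup>2 + v\<^sup>2) + 4 * K * (u ^ 4 + v ^ 4))"
    by (intro add_mono order_refl a b)
  also have "\<dots> = \<phi>1 x * u + \<phi>1 x * v + \<phi>2 x * u\<^sup>2 / 2
    + (C2 / 2 + 1) * \<epsilon> * u\<^sup>2 + (C2 / (2 * \<epsilon>) + C2 / 2 + \<epsilon>) * v\<^sup>2 + 4 * K * (u ^ 4 + v ^ 4)"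
    by (simp add: algebra_simps add_divide_distrib)
  finally show ?thesis .
qed

end

text \<open>This is the theorem of Steinhaus. A compact K in A and an open U around K are taken with
  U of less than twice the measure of K. A short translate of K still lies in U, so it cannot be
  disjoint from K.\<close>

lemma difference_set_neighbourhood:
  fixes A :: "real set"
  assumes A: "A \<in> sets borel" "bounded A" "emeasure lborel A \<noteq> 0"
  obtains d where "0 < d" "\<And>s. \<bar>s\<bar> < d \<Longrightarrow> \<exists>x\<in>A. x + s \<in> A"
proof -
  have Al: "A \<in> sets lebesgue" "A \<in> lmeasurable"
    using A by (auto intro!: bounded_set_imp_lmeasurable)
  have "emeasure lebesgue A = emeasure lborel A" using A(1) by simp
  then have "measure lebesgue A \<noteq> 0"
    using A(3) emeasure_eq_measure2[OF Al(2)] by auto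
  then have mA: "0 < measure lebesgue A" using measure_nonneg[of lebesgue A] by linarith
  obtain K where K: "closed K" "K \<subseteq> A" "A - K \<in> lmeasurable" "emeasure lebesgue (A - K) < ennreal (measure lebesgue A)"
    using sets_lebesgue_inner_closed[OF Al(1) mA] by blast
  have "compact K" using K(1,2) A(2) by (meson bounded_subset compact_eq_bounded_closed)
  have Kl: "K \<in> lmeasurable" using \<open>compact K\<close> by (rule lmeasurable_compact)
  have "measure lebesgue (A - K) < measure lebesgue A"
    using K(3,4) by (simp add: emeasure_eq_measure2 ennreal_less_iff)
  then have mK: "0 < measure lebesgue K"
    using measurable_measure_Diff[OF Al(2) _ K(2)] Kl by auto
  obtain U where U: "open U" "K \<subseteq> U" "U - K \<in> lmeasurable" "emeasure lebesgue (U - K) < ennreal (measure lebesgue K)"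
    using sets_lebesgue_outer_open[OF fmeasurableD[OF Kl] mK] by blast
  have "measure lebesgue (U - K) < measure lebesgue K"
    using U(3,4) by (simp add: emeasure_eq_measure2 ennreal_less_iff)
  moreover have "U = K \<union> (U - K)" using U(2) by auto
  then have Ul: "U \<in> lmeasurable" and "measure lebesgue U \<le> measure lebesgue K + measure lebesgue (U - K)"
    using fmeasurable.Un[OF Kl U(3)] measure_Un_le[OF fmeasurableD[OF Kl] fmeasurableD[OF U(3)]] by auto
  ultimately have U_less: "measure lebesgue U < measure lebesgue K + measure lebesgue K" by simp
  obtain d where d: "0 < d" "(\<Union>x\<in>K. ball x d) \<subseteq> U"
    using compact_subset_open_imp_ball_epsilon_subset[OF \<open>compact K\<close> U(1,2)] by blast
  show thesis
  proof
    fix s :: real assume s: "\<bar>s\<bar> < d"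
    have sub: "(+) s ` K \<subseteq> U"
      using d(2) s by (force simp: dist_real_def)
    have "K \<inter> (+) s ` K \<noteq> {}"
    proof
      assume "K \<inter> (+) s ` K = {}"
      then have "measure lebesgue (K \<union> (+) s ` K) = measure lebesgue K + measure lebesgue ((+) s ` K)"
        using Kl by (intro measure_Un_AE) (auto simp: measurable_translation)
      also have "\<dots> = measure lebesgue K + measure lebesgue K" by (simp add: measure_translation)
      finally have eq: "measure lebesgue (K \<union> (+) s ` K) = measure lebesgue K + measure lebesgue K" .
      have "K \<union> (+) s ` K \<in> lmeasurable" using Kl by (intro fmeasurable.Un measurable_translation)
      then have "measure lebesgue K + measure lebesgue K \<le> measure lebesgue U"
        unfolding eq[symmetric] using Ul sub U(2) by (intro measure_mono_fmeasurable fmeasurableD) auto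
      then show False using U_less by simp
    qed
    then show "\<exists>x\<in>A. x + s \<in> A" using K(2) by (auto simp: add.commute)
  qed (rule d)
qed

section \<open>Modulus of continuity and approximations of the absolute value\<close>

context
  fixes q \<rho> :: "real \<Rightarrow> real"
  assumes \<rho>_measurable: "\<rho> \<in> borel_measurable (restrict_space borel {0<..})"
    and \<rho>_pos: "\<And>x. x > 0 \<Longrightarrow> \<rho> x > 0"
    and \<rho>_int: "\<And>\<epsilon>. \<epsilon> > 0 \<Longrightarrow> (\<integral>\<^sup>+ x\<in>{0<..<\<epsilon>}. ennreal (1 / \<rho> x) \<partial>lborel) = \<infinity>"
    and q: "\<And>x y. x \<noteq> y \<Longrightarrow> \<bar>q x - q y\<bar>\<^sup>2 \<le> \<rho> \<bar>x - y\<bar>"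
begin

lemma \<rho>_extension_measurable: "(\<lambda>x. if 0 < x then \<rho> x else 1) \<in> borel_measurable borel"
  using \<rho>_measurable
  by (subst measurable_If_restrict_space_iff) (auto simp: greaterThan_def)

text \<open>The function \<open>\<rho>\<close> need not be continuous or monotone. But non-integrability of \<open>1 / \<rho>\<close>
  makes every set \<open>{\<rho> < \<eta>\<^sup>2}\<close> non-null near 0, so that differences of two of its
  elements fill a neighbourhood of 0.\<close>

lemma uniform_modulus:
  assumes "0 < \<eta>"
  obtains d where "0 < d" "\<And>x s. \<bar>s\<bar> < d \<Longrightarrow> \<bar>q (x + s) - q x\<bar> < \<eta>"
proof -
  define A where "A = {x \<in> {0<..<1}. (if 0 < x then \<rho> x else 1) < (\<eta> / 2)\<^sup>2}"
  have A: "A \<in> sets borel"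
    unfolding A_def using \<rho>_extension_measurable by measurable
  have "bounded A" by (rule bounded_subset[of "{0..1}"]) (auto simp: A_def)
  have "emeasure lborel A \<noteq> 0"
  proof
    assume "emeasure lborel A = 0"
    then have "AE x in lborel. x \<notin> A" using A by (intro AE_not_in) (auto intro: null_setsI)
    then have "AE x in lborel. ennreal (1 / \<rho> x) * indicator {0<..<1} x
        \<le> ennreal (1 / (\<eta> / 2)\<^sup>2) * indicator {0<..<1} x"
    proof eventually_elim
      case (elim x)
      show ?case
      proof (cases "x \<in> {0<..<1}")
        case True
        then have "(\<eta> / 2)\<^sup>2 \<le> \<rho> x" using elim by (auto simp: A_def)
        then have "1 / \<rho> x \<le> 1 / (\<eta> / 2)\<^sup>2"
          using assms \<rho>_pos[of x] True by (intro divide_left_mono mult_pos_pos) auto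
        then show ?thesis using True by (simp add: ennreal_leI)
      qed simp
    qed
    then have "(\<integral>\<^sup>+ x\<in>{0<..<1}. ennreal (1 / \<rho> x) \<partial>lborel)
        \<le> (\<integral>\<^sup>+ x. ennreal (1 / (\<eta> / 2)\<^sup>2) * indicator {0<..<1} (x :: real) \<partial>lborel)"
      by (rule nn_integral_mono_AE)
    also have "\<dots> < \<infinity>" by (simp add: nn_integral_cmult_indicator)
    finally show False using \<rho>_int[of 1] by simp
  qed
  then obtain d where d: "0 < d" "\<And>s. \<bar>s\<bar> < d \<Longrightarrow> \<exists>x\<in>A. x + s \<in> A"
    using difference_set_neighbourhood[OF A \<open>bounded A\<close>] by blast
  have small: "\<bar>q (y + r) - q y\<bar> < \<eta> / 2" if "r \<in> A" for r y
  proof -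
    have r: "0 < r" "\<rho> r < (\<eta> / 2)\<^sup>2" using that by (auto simp: A_def split: if_splits)
    then have "\<bar>q (y + r) - q y\<bar>\<^sup>2 < (\<eta> / 2)\<^sup>2" using q[of "y + r" y] by simp
    then show ?thesis using assms power2_less_imp_less by fastforce
  qed
  have "\<bar>q (x + s) - q x\<bar> < \<eta>" if s: "\<bar>s\<bar> < d" for x s
  proof -
    \<comment> \<open>Both r and r + s are positive steps along which q varies by less than \<eta> /
      2. Hence x and x + s are compared through the common base point x - r.\<close>
    obtain r where r: "r \<in> A" "r + s \<in> A" using d(2)[OF s] by blast
    have "\<bar>q x - q (x - r)\<bar> < \<eta> / 2" "\<bar>q (x + s) - q (x - r)\<bar> < \<eta> / 2"
      using small[OF r(1), of "x - r"] small[OF r(2), of "x - r"] by (simp_all add: add.commute)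
    then show ?thesis by linarith
  qed
  with d(1) show thesis by (rule that)
qed

lemma q_continuous: "continuous_on UNIV q"
  unfolding continuous_on_iff
proof (intro ballI allI impI)
  fix x \<eta> :: real assume "0 < \<eta>"
  then obtain d where "0 < d" "\<And>x s. \<bar>s\<bar> < d \<Longrightarrow> \<bar>q (x + s) - q x\<bar> < \<eta>" using uniform_modulus by metis
  then show "\<exists>d>0. \<forall>y\<in>UNIV. dist y x < d \<longrightarrow> dist (q y) (q x) < \<eta>"
    unfolding dist_real_def by (metis add.commute diff_add_cancel)
qed

text \<open>The supremum is over base points for the exact shift r, not over all shifts up to r.
  This is what keeps \<open>(modulus r)\<^sup>2\<close> below \<rho> at the same point r although
  \<rho> may oscillate.\<close>

definition modulus :: "real \<Rightarrow> real" where "modulus r = (SUP x. \<bar>q (x + r) - q x\<bar>)"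

lemma modulus_bdd: "bdd_above (range (\<lambda>x. \<bar>q (x + r) - q x\<bar>))"
proof (cases "r = 0")
  case False
  have "\<bar>q (x + r) - q x\<bar> \<le> sqrt (\<rho> \<bar>r\<bar>)" for x
    using q[of "x + r" x] False by (simp add: real_le_rsqrt)
  then show ?thesis by (rule bdd_aboveI2)
qed simp

lemma modulus_ge: "\<bar>q (x + r) - q x\<bar> \<le> modulus r"
  unfolding modulus_def by (rule cSUP_upper[OF _ modulus_bdd]) simp

lemma modulus_leI: "(\<And>x. \<bar>q (x + r) - q x\<bar> \<le> b) \<Longrightarrow> modulus r \<le> b"
  unfolding modulus_def by (rule cSUP_least) auto

lemma modulus_nonneg: "0 \<le> modulus r"
  using modulus_ge[of 0 r] by linarith

lemma modulus_square_le: "0 < r \<Longrightarrow> (modulus r)\<^sup>2 \<le> \<rho> r"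
proof -
  assume r: "0 < r"
  have "modulus r \<le> sqrt (\<rho> r)"
    using q[of "x + r" x for x] r by (intro modulus_leI real_le_rsqrt) simp
  then have "(modulus r)\<^sup>2 \<le> (sqrt (\<rho> r))\<^sup>2" using modulus_nonneg by (rule power_mono)
  then show ?thesis using \<rho>_pos[OF r] by simp
qed

lemma modulus_minus: "modulus (- r) = modulus r"
proof -
  have "modulus (- r) \<le> modulus r" for r
  proof (rule modulus_leI)
    show "\<bar>q (x + - r) - q x\<bar> \<le> modulus r" for x using modulus_ge[of "x - r" r] by simp
  qed
  from this[of r] this[of "- r"] show ?thesis by simp
qed

text \<open>Subadditivity in the shift: a shift by r is a shift by s followed by one by r - s.
  Continuity everywhere thus reduces to smallness at 0, which is
  \<open>uniform_modulus\<close>.\<close>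

lemma modulus_diff: "\<bar>modulus r - modulus s\<bar> \<le> modulus (r - s)"
proof -
  have le: "modulus r \<le> modulus s + modulus (r - s)" for r s
  proof (rule modulus_leI)
    fix x
    show "\<bar>q (x + r) - q x\<bar> \<le> modulus s + modulus (r - s)"
      using modulus_ge[of x s] modulus_ge[of "x + s" "r - s"] by (simp add: algebra_simps)
  qed
  show ?thesis using le[of r s] le[of s r] modulus_minus[of "r - s"] by simp
qed

lemma modulus_continuous: "continuous_on UNIV modulus"
  unfolding continuous_on_iff
proof (intro ballI allI impI)
  fix r \<eta> :: real assume \<eta>: "0 < \<eta>"
  then obtain d where d: "0 < d" "\<And>x s. \<bar>s\<bar> < d \<Longrightarrow> \<bar>q (x + s) - q x\<bar> < \<eta> / 2"
    using uniform_modulus[of "\<eta> / 2"] by (metis half_gt_zero)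
  have "dist (modulus s) (modulus r) < \<eta>" if "dist s r < d" for s
  proof -
    have "modulus (s - r) \<le> \<eta> / 2" using d(2) that by (intro modulus_leI less_imp_le) (simp add: dist_real_def)
    then show ?thesis using modulus_diff[of s r] \<eta> by (simp add: dist_real_def)
  qed
  with d(1) show "\<exists>d>0. \<forall>s\<in>UNIV. dist s r < d \<longrightarrow> dist (modulus s) (modulus r) < \<eta>" by blast
qed

lemma mollifier_exists:
  assumes \<epsilon>: "0 < \<epsilon>" and c: "0 < c"
  obtains \<psi> where "continuous_on UNIV \<psi>" "\<And>x. 0 \<le> \<psi> x" "\<And>x. \<psi> (- x) = \<psi> x"
    "\<And>x. \<epsilon> \<le> \<bar>x\<bar> \<Longrightarrow> \<psi> x = 0" "(LINT x:{0..\<epsilon>}|lborel. \<psi> x) = 1"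
    "\<And>x y. \<psi> (x - y) * (q x - q y)\<^sup>2 \<le> c"
proof -
  \<comment> \<open>A continuous cutoff with values in {0..1}, zero from \<epsilon> on, which at
    each x with 0 < \<bar>x\<bar> < \<epsilon> is eventually equal to 1. In \<open>k\<close> the
    summand 1 / (n + 1) keeps the denominator positive where the modulus vanishes.\<close>
  define \<theta> where "\<theta> = (\<lambda>n x. min 1 (real n * \<bar>x\<bar>) * max 0 (min 1 (real n * (\<epsilon> - \<bar>x\<bar>))))"
  define k where "k = (\<lambda>n x. \<theta> n x / ((modulus x)\<^sup>2 + inverse (real (Suc n))))"
  have den: "0 < (modulus x)\<^sup>2 + inverse (real (Suc n))" for n x
    by (intro add_nonneg_pos) auto
  have k_cont: "continuous_on UNIV (k n)" for n
    unfolding k_def \<theta>_def using den[of _ n]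
    by (intro continuous_intros modulus_continuous) (metis less_irrefl)
  have k_meas [measurable]: "k n \<in> borel_measurable borel" for n
    using k_cont by (rule borel_measurable_continuous_onI)
  have \<theta>: "0 \<le> \<theta> n x" "\<theta> n x \<le> 1" for n x
    unfolding \<theta>_def by (auto intro!: mult_le_one)
  have k_nonneg: "0 \<le> k n x" for n x unfolding k_def using \<theta>[of n x] den[of x n] by simp
  have k_even: "k n (- x) = k n x" for n x by (simp add: k_def \<theta>_def modulus_minus)
  have k_out: "k n x = 0" if "\<epsilon> \<le> \<bar>x\<bar>" for n x
  proof -
    have "real n * (\<epsilon> - \<bar>x\<bar>) \<le> 0" using that by (simp add: mult_nonneg_nonpos)
    then show ?thesis by (simp add: k_def \<theta>_def)
  qed
  define J where "J = (\<lambda>n. LINT x:{0..\<epsilon>}|lborel. k n x)"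
  have int: "set_integrable lborel {0..\<epsilon>} (k n)" for n
    unfolding set_integrable_def
    by (rule borel_integrable_compact) (use k_cont in \<open>auto intro: continuous_on_subset\<close>)
  have J: "(\<integral>\<^sup>+ x\<in>{0..\<epsilon>}. ennreal (k n x) \<partial>lborel) = ennreal (J n)" for n
  proof -
    have "(\<integral>\<^sup>+ x\<in>{0..\<epsilon>}. ennreal (k n x) \<partial>lborel) = (\<integral>\<^sup>+ x. ennreal (indicator {0..\<epsilon>} x *\<^sub>R k n x) \<partial>lborel)"
      by (rule nn_integral_cong) (auto simp: indicator_def)
    also have "\<dots> = ennreal (J n)"
      unfolding J_def set_lebesgue_integral_def using int[of n] k_nonneg
      by (intro nn_integral_eq_integral) (auto simp: set_integrable_def)
    finally show ?thesis .
  qed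
  \<comment> \<open>If all the integrals stayed below 1 / c, Fatou's lemma would bound the divergent
    integral of 1 / \<rho> by 1 / c.\<close>
  have "\<exists>n. 1 / c < J n"
  proof (rule ccontr)
    assume "\<nexists>n. 1 / c < J n"
    then have J_le: "J n \<le> 1 / c" for n by (simp add: not_less)
    have "(\<integral>\<^sup>+ x\<in>{0<..<\<epsilon>}. ennreal (1 / \<rho> x) \<partial>lborel)
        \<le> (\<integral>\<^sup>+ x. liminf (\<lambda>n. ennreal (k n x) * indicator {0..\<epsilon>} x) \<partial>lborel)"
    proof (rule nn_integral_mono)
      fix x :: real
      show "ennreal (1 / \<rho> x) * indicator {0<..<\<epsilon>} x \<le> liminf (\<lambda>n. ennreal (k n x) * indicator {0..\<epsilon>} x)"
      proof (cases "x \<in> {0<..<\<epsilon>}")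
        case True
        then have x: "0 < x" "x < \<epsilon>" by auto
        have "\<forall>\<^sub>F n in sequentially. \<theta> n x = 1"
        proof -
          have "filterlim (\<lambda>n. real n * x) at_top sequentially" "filterlim (\<lambda>n. real n * (\<epsilon> - x)) at_top sequentially"
            using x by (auto intro!: filterlim_at_top_mult_tendsto_pos[OF tendsto_const] filterlim_real_sequentially
                filterlim_tendsto_pos_mult_at_top simp: mult.commute)
          then have "\<forall>\<^sub>F n in sequentially. 1 \<le> real n * x" "\<forall>\<^sub>F n in sequentially. 1 \<le> real n * (\<epsilon> - x)"
            unfolding filterlim_at_top by auto
          then show ?thesis by eventually_elim (use x in \<open>auto simp: \<theta>_def\<close>)
        qed
        then have ev: "\<forall>\<^sub>F n in sequentially. ennreal (1 / (\<rho> x + inverse (real (Suc n)))) \<le> ennreal (k n x)"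
        proof eventually_elim
          case (elim n)
          then show ?case unfolding k_def
            using modulus_square_le[OF x(1)] den[of x n] by (auto intro!: ennreal_leI divide_left_mono mult_pos_pos)
        qed
        have "(\<lambda>n. ennreal (1 / (\<rho> x + inverse (real (Suc n))))) \<longlonglongrightarrow> ennreal (1 / (\<rho> x + 0))"
          using \<rho>_pos[OF x(1)] by (intro tendsto_ennrealI tendsto_intros LIMSEQ_inverse_real_of_nat) auto
        then have "ennreal (1 / \<rho> x) = liminf (\<lambda>n. ennreal (1 / (\<rho> x + inverse (real (Suc n)))))"
          by (simp add: lim_imp_Liminf)
        also have "\<dots> \<le> liminf (\<lambda>n. ennreal (k n x))" using ev by (rule Liminf_mono)
        finally show ?thesis using x by simp
      qed simp
    qed
    also have "\<dots> \<le> liminf (\<lambda>n. \<integral>\<^sup>+ x\<in>{0..\<epsilon>}. ennreal (k n x) \<partial>lborel)"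
      by (rule nn_integral_liminf) measurable
    also have "\<dots> \<le> ennreal (1 / c)"
      unfolding J using J_le by (intro Liminf_le always_eventually allI ennreal_leI) auto
    finally show False using \<rho>_int[OF \<epsilon>] by (simp add: top_unique)
  qed
  then obtain n where n: "1 / c < J n" by blast
  then have Jpos: "0 < J n" using c by (metis divide_pos_pos less_trans zero_less_one)
  show thesis
  proof (rule that[of "\<lambda>x. k n x / J n"])
    show "continuous_on UNIV (\<lambda>x. k n x / J n)" using k_cont Jpos by (intro continuous_intros) auto
    show "(LINT x:{0..\<epsilon>}|lborel. k n x / J n) = 1" using Jpos by (simp add: J_def)
    fix x y
    have sq: "(q x - q y)\<^sup>2 \<le> (modulus (x - y))\<^sup>2"
      using modulus_ge[of y "x - y"] modulus_nonneg[of "x - y"] by (simp add: abs_le_square_iff[symmetric])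
    have "k n (x - y) * (q x - q y)\<^sup>2 \<le> k n (x - y) * (modulus (x - y))\<^sup>2"
      using sq k_nonneg by (intro mult_left_mono) auto
    also have "\<dots> = \<theta> n (x - y) * ((modulus (x - y))\<^sup>2 / ((modulus (x - y))\<^sup>2 + inverse (real (Suc n))))"
      by (simp add: k_def)
    also have "\<dots> \<le> 1 * 1"
      using \<theta> den[of "x - y" n] by (intro mult_mono) (auto simp del: of_nat_Suc)
    finally have "k n (x - y) / J n * (q x - q y)\<^sup>2 \<le> 1 / J n" using Jpos by (simp add: divide_right_mono)
    also have "1 / J n \<le> c" using n c Jpos by (simp add: field_simps)
    finally show "k n (x - y) / J n * (q x - q y)\<^sup>2 \<le> c" .
  qed (use k_nonneg k_even k_out Jpos in auto)
qed

end

text \<open>The function \<psi> is integrated twice from 0. The first primitive is odd, increases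
  from 0 to 1 on {0..\<epsilon>} and stays 1 afterwards, hence approximates the sign; the second is
  even and lags behind the absolute value by at most \<epsilon>.\<close>

lemma test_function_of_mollifier:
  assumes \<epsilon>: "0 < \<epsilon>" and \<psi>: "continuous_on UNIV \<psi>" "\<And>x. 0 \<le> \<psi> x" "\<And>x. \<psi> (- x) = \<psi> x"
    "\<And>x. \<epsilon> \<le> \<bar>x\<bar> \<Longrightarrow> \<psi> x = 0" "(LINT x:{0..\<epsilon>}|lborel. \<psi> x) = 1"
  obtains \<phi> \<phi>1 B where "test_function \<phi> \<phi>1 \<psi> 1 B" "\<And>x. \<bar>x\<bar> - \<epsilon> \<le> \<phi> x"
proof -
  have "isCont \<psi> x" for x using \<psi>(1) by (simp add: continuous_on_eq_continuous_at)
  then obtain F where F: "\<And>x. (F has_real_derivative \<psi> x) (at x)"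
    using einterval_antiderivative[of "- \<infinity>" \<infinity> \<psi>] by (auto simp: has_real_derivative_iff_has_vector_derivative)
  define \<phi>1 where "\<phi>1 = (\<lambda>x. F x - F 0)"
  have d1: "(\<phi>1 has_real_derivative \<psi> x) (at x)" for x
    unfolding \<phi>1_def using DERIV_diff[OF F DERIV_const] by simp
  then have "isCont \<phi>1 x" for x by (rule DERIV_isCont)
  then obtain G where G: "\<And>x. (G has_real_derivative \<phi>1 x) (at x)"
    using einterval_antiderivative[of "- \<infinity>" \<infinity> \<phi>1] by (auto simp: has_real_derivative_iff_has_vector_derivative)
  define \<phi> where "\<phi> = (\<lambda>x. G x - G 0)"
  have d0: "(\<phi> has_real_derivative \<phi>1 x) (at x)" for x
    unfolding \<phi>_def using DERIV_diff[OF G DERIV_const] by simp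
  have mono1: "\<phi>1 x \<le> \<phi>1 y" if "x \<le> y" for x y
    using DERIV_nonneg_imp_nondecreasing[OF that, of \<phi>1] d1 \<psi>(2) by blast
  have zero1: "\<phi>1 0 = 0" by (simp add: \<phi>1_def)
  have odd1: "\<phi>1 (- x) = - \<phi>1 x" for x
  proof -
    have "((\<lambda>x. \<phi>1 x + \<phi>1 (- x)) has_real_derivative \<psi> x + \<psi> (- x) * (- 1)) (at x)" for x
      by (intro DERIV_add d1 DERIV_chain2[OF d1]) (auto intro!: derivative_eq_intros)
    then have "((\<lambda>x. \<phi>1 x + \<phi>1 (- x)) has_real_derivative 0) (at x)" for x using \<psi>(3) by simp
    then have "\<phi>1 x + \<phi>1 (- x) = \<phi>1 0 + \<phi>1 (- 0)" by (intro DERIV_isconst_all) auto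
    then show ?thesis using zero1 by simp
  qed
  have one1: "\<phi>1 \<epsilon> = 1"
  proof -
    have "(LINT x:{0..\<epsilon>}|lborel. \<psi> x) = \<phi>1 \<epsilon> - \<phi>1 0"
      unfolding set_lebesgue_integral_def
      using integral_FTC_atLeastAtMost[of 0 \<epsilon> \<phi>1 \<psi>] \<epsilon> d1 \<psi>(1)
      by (auto simp: has_real_derivative_iff_has_vector_derivative[symmetric]
          intro: has_field_derivative_at_within continuous_on_subset)
    then show ?thesis using \<psi>(5) zero1 by simp
  qed
  have const1: "\<phi>1 x = 1" if "\<epsilon> \<le> x" for x
  proof (cases "x = \<epsilon>")
    case False
    then have "\<epsilon> < x" using that by simp
    from MVT2[OF this, of \<phi>1 \<psi>] d1 obtain z where "\<epsilon> < z" "\<phi>1 x - \<phi>1 \<epsilon> = (x - \<epsilon>) * \<psi> z" by blast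
    then show ?thesis using \<psi>(4)[of z] one1 by simp
  qed (use one1 in simp)
  have le1: "\<phi>1 x \<le> 1" for x using mono1[of x \<epsilon>] const1[of x] one1 by (cases "x \<le> \<epsilon>") auto
  have \<phi>_even: "\<phi> (- x) = \<phi> x" for x
  proof -
    have "((\<lambda>x. \<phi> x - \<phi> (- x)) has_real_derivative \<phi>1 x - \<phi>1 (- x) * (- 1)) (at x)" for x
      by (intro DERIV_diff d0 DERIV_chain2[OF d0]) (auto intro!: derivative_eq_intros)
    then have "((\<lambda>x. \<phi> x - \<phi> (- x)) has_real_derivative 0) (at x)" for x using odd1 by simp
    then have "\<phi> x - \<phi> (- x) = \<phi> 0 - \<phi> (- 0)" by (intro DERIV_isconst_all) auto
    then show ?thesis by simp
  qed
  have \<phi>_nonneg: "0 \<le> \<phi> x" if "0 \<le> x" for x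
  proof -
    have "\<phi> 0 \<le> \<phi> x"
      using mono1[of 0] zero1 d0 by (intro DERIV_nonneg_imp_nondecreasing[OF that]) force
    then show ?thesis by (simp add: \<phi>_def)
  qed
  have \<phi>_ge: "x - \<epsilon> \<le> \<phi> x" if "0 \<le> x" for x
  proof (cases "x \<le> \<epsilon>")
    case False
    then have "\<epsilon> < x" by simp
    from MVT2[OF this, of \<phi> \<phi>1] d0 obtain z where "\<epsilon> < z" "\<phi> x - \<phi> \<epsilon> = (x - \<epsilon>) * \<phi>1 z" by blast
    then show ?thesis using const1[of z] \<phi>_nonneg[of \<epsilon>] \<epsilon> by simp
  qed (use \<phi>_nonneg[OF that] in simp)
  \<comment> \<open>Clipping to the interval from -\<epsilon> to \<epsilon> does not change \<psi>,
    which vanishes at both ends and beyond. Uniform continuity and boundedness on the whole line are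
    thereby inherited from a compact interval.\<close>
  have cut: "\<psi> x = \<psi> (max (- \<epsilon>) (min \<epsilon> x))" for x
    using \<psi>(4)[of x] \<psi>(4)[of \<epsilon>] \<psi>(4)[of "- \<epsilon>"] \<epsilon> by (auto simp: max_def min_def)
  have ucont: "uniformly_continuous_on UNIV \<psi>"
  proof -
    have "uniformly_continuous_on {- \<epsilon>..\<epsilon>} \<psi>"
      by (rule compact_uniformly_continuous) (use \<psi>(1) in \<open>auto intro: continuous_on_subset\<close>)
    show ?thesis
      unfolding uniformly_continuous_on_def
    proof (intro allI impI)
      fix e :: real assume "0 < e"
      then obtain d where d: "0 < d" "\<And>x y. x \<in> {- \<epsilon>..\<epsilon>} \<Longrightarrow> y \<in> {- \<epsilon>..\<epsilon>} \<Longrightarrow> dist y x < d \<Longrightarrow> dist (\<psi> y) (\<psi> x) < e"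
        using \<open>uniformly_continuous_on {- \<epsilon>..\<epsilon>} \<psi>\<close> unfolding uniformly_continuous_on_def by metis
      have "dist (\<psi> y) (\<psi> x) < e" if "dist y x < d" for x y
        unfolding cut[of x] cut[of y]
        by (rule d(2)) (use that \<epsilon> in \<open>auto simp: dist_real_def max_def min_def abs_if split: if_splits\<close>)
      then show "\<exists>d>0. \<forall>x\<in>UNIV. \<forall>x'\<in>UNIV. dist x' x < d \<longrightarrow> dist (\<psi> x') (\<psi> x) < e" using d(1) by blast
    qed
  qed
  have "compact (\<psi> ` {- \<epsilon>..\<epsilon>})"
    using \<psi>(1) by (intro compact_continuous_image) (auto intro: continuous_on_subset)
  then obtain B where "\<And>y. y \<in> \<psi> ` {- \<epsilon>..\<epsilon>} \<Longrightarrow> norm y \<le> B"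
    using compact_imp_bounded bounded_iff by metis
  then have B: "\<bar>\<psi> x\<bar> \<le> B" for x
    unfolding cut[of x] using \<epsilon> by auto
  show thesis
  proof (rule that)
    show "test_function \<phi> \<phi>1 \<psi> 1 B"
    proof
      show "\<bar>\<phi>1 x\<bar> \<le> 1" for x using le1[of x] le1[of "- x"] odd1[of x] by simp
      show "0 \<le> \<phi> x" for x using \<phi>_nonneg[of x] \<phi>_nonneg[of "- x"] \<phi>_even[of x] by (cases "0 \<le> x") auto
    qed (use d0 d1 B ucont in \<open>auto simp: \<phi>_def\<close>)
    show "\<bar>x\<bar> - \<epsilon> \<le> \<phi> x" for x using \<phi>_ge[of x] \<phi>_ge[of "- x"] \<phi>_even[of x] by (cases "0 \<le> x") auto
  qed
qed

section \<open>Brownian increments and one step of Ito's formula\<close>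

locale filtered_brownian =
  fixes M :: "'a measure" and F :: "real \<Rightarrow> 'a measure" and W :: "real \<Rightarrow> 'a \<Rightarrow> real"
  assumes filtered: "filtered_prob_space M F"
    and brownian: "brownian_motion M F W"
begin

sublocale prob_space M
  using filtered by (simp add: filtered_prob_space_def)

lemma space_F [simp]: "space (F t) = space M"
  using filtered by (simp add: filtered_prob_space_def subalgebra_def)

lemma sets_F_mono: "s \<le> t \<Longrightarrow> sets (F s) \<subseteq> sets (F t)"
  using filtered by (auto simp: filtered_prob_space_def filtration_def)

lemma sets_F_M: "sets (F s) \<subseteq> sets M"
  using filtered by (auto simp: filtered_prob_space_def subalgebra_def)

lemma measurable_F_M: "X \<in> measurable (F s) N \<Longrightarrow> X \<in> measurable M N"
  by (rule measurable_from_subalg[of M "F s"])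
     (use filtered in \<open>auto simp: filtered_prob_space_def\<close>)

lemma measurable_F_mono: "X \<in> measurable (F s) N \<Longrightarrow> s \<le> t \<Longrightarrow> X \<in> measurable (F t) N"
  by (rule measurable_from_subalg[of "F t" "F s"])
     (use sets_F_mono in \<open>auto simp: subalgebra_def\<close>)

lemma W_measurable_F: "0 \<le> t \<Longrightarrow> W t \<in> borel_measurable (F t)"
  using brownian by (simp add: brownian_motion_def adapted_def)

lemma W_measurable [measurable]: "0 \<le> t \<Longrightarrow> W t \<in> borel_measurable M"
  using W_measurable_F measurable_F_M by blast

context
  fixes s t :: real
  assumes st: "0 \<le> s" "s < t"
begin

lemma increment_distributed:
  "distributed M lborel (\<lambda>\<omega>. W t \<omega> - W s \<omega>) (normal_density 0 (sqrt (t - s)))"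
  using brownian st by (auto simp: brownian_motion_def)

lemma increment_moment_integrable: "integrable M (\<lambda>\<omega>. (W t \<omega> - W s \<omega>) ^ k)"
  using distributed_integrable[OF increment_distributed, of "\<lambda>x. x ^ k"]
    integrable_normal_moment[of "sqrt (t - s)" 0 k] st
  by simp

lemma increment_moment:
  "expectation (\<lambda>\<omega>. (W t \<omega> - W s \<omega>) ^ k) = (\<integral>x. normal_density 0 (sqrt (t - s)) x * x ^ k \<partial>lborel)"
  using distributed_integral[OF increment_distributed, of "\<lambda>x. x ^ k"] by simp

lemma increment_mean: "expectation (\<lambda>\<omega>. W t \<omega> - W s \<omega>) = 0"
  using increment_moment[of 1] integral_normal_moment_odd[of "sqrt (t - s)" 0 0] st by simp

lemma increment_square: "expectation (\<lambda>\<omega>. (W t \<omega> - W s \<omega>)\<^sup>2) = t - s"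
  using increment_moment[of 2] integral_normal_moment_even[of "sqrt (t - s)" 0 1] st by simp

lemma increment_fourth: "expectation (\<lambda>\<omega>. (W t \<omega> - W s \<omega>) ^ 4) = 3 * (t - s)\<^sup>2"
  using increment_moment[of 4] integral_normal_moment_even[of "sqrt (t - s)" 0 2] st
  by (simp add: fact_numeral power_divide power2_eq_square)

lemma increment_indep:
  assumes U: "U \<in> borel_measurable (F s)"
  shows "indep_var borel U borel (\<lambda>\<omega>. W t \<omega> - W s \<omega>)"
proof -
  let ?V = "\<lambda>\<omega>. W t \<omega> - W s \<omega>"
  have V [measurable]: "?V \<in> borel_measurable M"
    using W_measurable[of s] W_measurable[of t] st by simp
  have ind: "indep_set (sets (F s)) (sets (vimage_algebra (space M) ?V borel))"
    using brownian st by (auto simp: brownian_motion_def)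
  have 1: "sigma_sets (space M) {U -` A \<inter> space M |A. A \<in> sets borel} \<subseteq> sets (F s)"
    using sets.sigma_sets_subset[of "{U -` A \<inter> space M |A. A \<in> sets borel}" "F s"]
      measurable_sets[OF U] by fastforce
  have 2: "sigma_sets (space M) {?V -` A \<inter> space M |A. A \<in> sets borel}
      = sets (vimage_algebra (space M) ?V borel)"
    by (simp add: sets_vimage_algebra)
  have "indep_set (sigma_sets (space M) {U -` A \<inter> space M |A. A \<in> sets borel})
      (sigma_sets (space M) {?V -` A \<inter> space M |A. A \<in> sets borel})"
    using ind unfolding 2 indep_sets2_eq using 1 by blast
  then show ?thesis
    unfolding indep_var_eq using measurable_F_M[OF U] V by auto
qed

text \<open>This takes the place of conditioning on \<open>F s\<close>: a factor known at time s
  splits off from every power of the later increment, by independence.\<close>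

lemma bounded_times_increment_power:
  assumes U: "U \<in> borel_measurable (F s)" "\<And>\<omega>. \<omega> \<in> space M \<Longrightarrow> \<bar>U \<omega>\<bar> \<le> c"
  shows "integrable M (\<lambda>\<omega>. U \<omega> * (W t \<omega> - W s \<omega>) ^ k)"
    and "expectation (\<lambda>\<omega>. U \<omega> * (W t \<omega> - W s \<omega>) ^ k)
      = expectation U * expectation (\<lambda>\<omega>. (W t \<omega> - W s \<omega>) ^ k)"
proof -
  have "indep_var borel ((\<lambda>x. x) \<circ> U) borel ((\<lambda>x. x ^ k) \<circ> (\<lambda>\<omega>. W t \<omega> - W s \<omega>))"
    by (rule indep_var_compose[OF increment_indep[OF U(1)]]) auto
  then have ind: "indep_var borel U borel (\<lambda>\<omega>. (W t \<omega> - W s \<omega>) ^ k)"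
    by (simp add: o_def)
  have "integrable M U"
    by (rule integrable_const_bound[where B=c]) (use U measurable_F_M in auto)
  with ind increment_moment_integrable
  show "integrable M (\<lambda>\<omega>. U \<omega> * (W t \<omega> - W s \<omega>) ^ k)"
    and "expectation (\<lambda>\<omega>. U \<omega> * (W t \<omega> - W s \<omega>) ^ k)
      = expectation U * expectation (\<lambda>\<omega>. (W t \<omega> - W s \<omega>) ^ k)"
    by (auto intro: indep_var_integrable indep_var_lebesgue_integral)
qed

end

lemma ito_step:
  assumes test: "test_function \<phi> \<phi>1 \<phi>2 C1 C2"
    and st: "0 \<le> s" "s < t"
    and K: "\<And>x y. \<bar>\<phi>2 x - \<phi>2 y\<bar> \<le> \<epsilon> + K * (x - y)\<^sup>2" "0 \<le> K" "0 < \<epsilon>"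
    and X: "X \<in> borel_measurable (F s)"
    and \<xi>: "\<xi> \<in> borel_measurable (F s)" "\<And>\<omega>. \<omega> \<in> space M \<Longrightarrow> \<bar>\<xi> \<omega>\<bar> \<le> c"
    and \<theta>: "\<theta> \<in> borel_measurable (F s)" "\<And>\<omega>. \<omega> \<in> space M \<Longrightarrow> 0 \<le> \<theta> \<omega> \<and> \<theta> \<omega> \<le> 1"
    and v: "v \<in> borel_measurable M" "\<And>\<omega>. \<omega> \<in> space M \<Longrightarrow> \<bar>v \<omega>\<bar> \<le> B"
  defines "X' \<equiv> \<lambda>\<omega>. X \<omega> + \<xi> \<omega> * (W t \<omega> - W s \<omega>) + v \<omega>"
  shows "integrable M (\<lambda>\<omega>. \<theta> \<omega> * (\<phi> (X' \<omega>) - \<phi> (X \<omega>)))"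
    and "integrable M (\<lambda>\<omega>. \<theta> \<omega> * (\<phi>1 (X \<omega>) * v \<omega> + \<phi>2 (X \<omega>) * (\<xi> \<omega>)\<^sup>2 * (t - s) / 2))"
    and "integrable M (\<lambda>\<omega>. \<theta> \<omega> * (\<xi> \<omega>)\<^sup>2)"
    and "expectation (\<lambda>\<omega>. \<theta> \<omega> * (\<phi> (X' \<omega>) - \<phi> (X \<omega>)))
      \<le> expectation (\<lambda>\<omega>. \<theta> \<omega> * (\<phi>1 (X \<omega>) * v \<omega> + \<phi>2 (X \<omega>) * (\<xi> \<omega>)\<^sup>2 * (t - s) / 2))
        + ((C2 / 2 + 1) * \<epsilon> + 12 * K * c\<^sup>2 * (t - s)) * (t - s) * expectation (\<lambda>\<omega>. \<theta> \<omega> * (\<xi> \<omega>)\<^sup>2)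
        + ((C2 / (2 * \<epsilon>) + C2 / 2 + \<epsilon>) * B\<^sup>2 + 4 * K * B ^ 4)"
proof -
  interpret test_function \<phi> \<phi>1 \<phi>2 C1 C2 by (rule test)
  note [measurable] = measurable_F_M[OF X] measurable_F_M[OF \<xi>(1)] measurable_F_M[OF \<theta>(1)] v(1)
  have [measurable]: "W t \<in> borel_measurable M" "W s \<in> borel_measurable M" using st by auto
  let ?D = "\<lambda>\<omega>. W t \<omega> - W s \<omega>"
  obtain \<omega>0 where "\<omega>0 \<in> space M" using not_empty by blast
  then have c: "0 \<le> c" and B: "0 \<le> B" using \<xi>(2) v(2) by force+
  have \<xi>2: "(\<xi> \<omega>)\<^sup>2 \<le> c\<^sup>2" if "\<omega> \<in> space M" for \<omega>
    using \<xi>(2)[OF that] c by (simp add: abs_le_square_iff[symmetric])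
  have int_bdd: "integrable M U" if "U \<in> borel_measurable M" "\<And>\<omega>. \<omega> \<in> space M \<Longrightarrow> \<bar>U \<omega>\<bar> \<le> r"
    for U :: "'a \<Rightarrow> real" and r
    by (rule integrable_const_bound[where B=r]) (use that in auto)
  have Ubd: "\<bar>\<theta> \<omega> * x\<bar> \<le> y" if "\<omega> \<in> space M" "\<bar>x\<bar> \<le> y" for \<omega> x y
    using \<theta>(2)[OF that(1)] that(2) mult_mono[of "\<bar>\<theta> \<omega>\<bar>" 1 "\<bar>x\<bar>" y] by (auto simp: abs_mult)
  \<comment> \<open>These are the coefficients of the first, second and fourth power of the Brownian
    increment. They are bounded and known at time s, so the first power averages out. The drift
    increment v may depend on the path up to time t and is therefore estimated separately.\<close>
  define U1 U2 U4 where "U1 = (\<lambda>\<omega>. \<theta> \<omega> * (\<phi>1 (X \<omega>) * \<xi> \<omega>))"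
    and "U2 = (\<lambda>\<omega>. \<theta> \<omega> * ((\<phi>2 (X \<omega>) / 2 + (C2 / 2 + 1) * \<epsilon>) * (\<xi> \<omega>)\<^sup>2))"
    and "U4 = (\<lambda>\<omega>. \<theta> \<omega> * (4 * K * \<xi> \<omega> ^ 4))"
  have mF: "U1 \<in> borel_measurable (F s)" "U2 \<in> borel_measurable (F s)" "U4 \<in> borel_measurable (F s)"
    unfolding U1_def U2_def U4_def using X \<xi>(1) \<theta>(1) by measurable
  have b1: "\<bar>U1 \<omega>\<bar> \<le> C1 * c" if "\<omega> \<in> space M" for \<omega>
    unfolding U1_def using bound1[of "X \<omega>"] \<xi>(2)[OF that] C1_nonneg
    by (intro Ubd[OF that]) (auto simp: abs_mult intro!: mult_mono)
  have b2: "\<bar>U2 \<omega>\<bar> \<le> (C2 / 2 + (C2 / 2 + 1) * \<epsilon>) * c\<^sup>2" if "\<omega> \<in> space M" for \<omega>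
    unfolding U2_def
  proof (intro Ubd[OF that])
    have "\<bar>\<phi>2 (X \<omega>) / 2 + (C2 / 2 + 1) * \<epsilon>\<bar> \<le> C2 / 2 + (C2 / 2 + 1) * \<epsilon>"
      using bound2[of "X \<omega>"] C2_nonneg K(3)
      by (intro order_trans[OF abs_triangle_ineq] add_mono) (auto simp: abs_mult)
    then show "\<bar>(\<phi>2 (X \<omega>) / 2 + (C2 / 2 + 1) * \<epsilon>) * (\<xi> \<omega>)\<^sup>2\<bar> \<le> (C2 / 2 + (C2 / 2 + 1) * \<epsilon>) * c\<^sup>2"
      unfolding abs_mult using \<xi>2[OF that] by (intro mult_mono) auto
  qed
  have \<xi>4: "\<xi> \<omega> ^ 4 \<le> c\<^sup>2 * (\<xi> \<omega>)\<^sup>2" if "\<omega> \<in> space M" for \<omega>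
    using mult_right_mono[OF \<xi>2[OF that], of "(\<xi> \<omega>)\<^sup>2"] by (simp add: power2_eq_square power4_eq_xxxx mult.assoc)
  have b4: "\<bar>U4 \<omega>\<bar> \<le> 4 * K * (c\<^sup>2 * c\<^sup>2)" if "\<omega> \<in> space M" for \<omega>
    unfolding U4_def
  proof (intro Ubd[OF that])
    have "\<xi> \<omega> ^ 4 \<le> c\<^sup>2 * c\<^sup>2"
      using \<xi>4[OF that] mult_left_mono[OF \<xi>2[OF that], of "c\<^sup>2"] by simp
    then show "\<bar>4 * K * \<xi> \<omega> ^ 4\<bar> \<le> 4 * K * (c\<^sup>2 * c\<^sup>2)"
      using K(2) by (auto simp: abs_mult mult_left_mono)
  qed
  note m1 = bounded_times_increment_power[OF st mF(1) b1, of 1]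
  note m2 = bounded_times_increment_power[OF st mF(2) b2, of 2]
  note m4 = bounded_times_increment_power[OF st mF(3) b4, of 4]
  define V where "V = (\<lambda>\<omega>. \<theta> \<omega> * (\<phi>1 (X \<omega>) * v \<omega>))"
  have iV: "integrable M V"
    unfolding V_def
    by (rule int_bdd[of _ "C1 * B"], measurable, rule Ubd)
       (use bound1 v(2) C1_nonneg in \<open>auto simp: abs_mult intro!: mult_mono\<close>)
  define E where "E = (C2 / (2 * \<epsilon>) + C2 / 2 + \<epsilon>) * B\<^sup>2 + 4 * K * B ^ 4"
  have E0: "0 \<le> E" unfolding E_def using C2_nonneg K by simp
  show i1: "integrable M (\<lambda>\<omega>. \<theta> \<omega> * (\<phi> (X' \<omega>) - \<phi> (X \<omega>)))"
  proof (rule Bochner_Integration.integrable_bound)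
    show "integrable M (\<lambda>\<omega>. C1 * (c * \<bar>?D \<omega>\<bar> + B))"
      using increment_moment_integrable[OF st, of 1] by (intro integrable_mult_right Bochner_Integration.integrable_add) auto
    show "AE \<omega> in M. norm (\<theta> \<omega> * (\<phi> (X' \<omega>) - \<phi> (X \<omega>))) \<le> norm (C1 * (c * \<bar>?D \<omega>\<bar> + B))"
    proof (rule AE_I2)
      fix \<omega> assume w: "\<omega> \<in> space M"
      have "\<bar>\<phi> (X' \<omega>) - \<phi> (X \<omega>)\<bar> \<le> C1 * \<bar>X' \<omega> - X \<omega>\<bar>" by (rule lipschitz)
      also have "\<bar>X' \<omega> - X \<omega>\<bar> \<le> \<bar>\<xi> \<omega>\<bar> * \<bar>?D \<omega>\<bar> + \<bar>v \<omega>\<bar>"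
        unfolding X'_def by (simp add: abs_mult[symmetric])
      also have "\<dots> \<le> c * \<bar>?D \<omega>\<bar> + B"
        using \<xi>(2)[OF w] v(2)[OF w] by (intro add_mono mult_right_mono) auto
      finally have "\<bar>\<phi> (X' \<omega>) - \<phi> (X \<omega>)\<bar> \<le> C1 * (c * \<bar>?D \<omega>\<bar> + B)"
        using C1_nonneg by (simp add: mult_left_mono)
      from Ubd[OF w this] show "norm (\<theta> \<omega> * (\<phi> (X' \<omega>) - \<phi> (X \<omega>))) \<le> norm (C1 * (c * \<bar>?D \<omega>\<bar> + B))"
        by simp
    qed
  qed (simp add: X'_def)
  show i2: "integrable M (\<lambda>\<omega>. \<theta> \<omega> * (\<phi>1 (X \<omega>) * v \<omega> + \<phi>2 (X \<omega>) * (\<xi> \<omega>)\<^sup>2 * (t - s) / 2))"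
  proof (rule int_bdd[of _ "C1 * B + C2 * c\<^sup>2 * (t - s) / 2"], measurable, rule Ubd)
    fix \<omega> assume w: "\<omega> \<in> space M"
    have "\<bar>\<phi>1 (X \<omega>) * v \<omega>\<bar> \<le> C1 * B" "\<bar>\<phi>2 (X \<omega>) * (\<xi> \<omega>)\<^sup>2\<bar> \<le> C2 * c\<^sup>2"
      unfolding abs_mult using bound1 bound2 v(2)[OF w] \<xi>2[OF w] C1_nonneg C2_nonneg
      by (auto intro!: mult_mono)
    then have "\<bar>\<phi>1 (X \<omega>) * v \<omega>\<bar> \<le> C1 * B" "\<bar>\<phi>2 (X \<omega>) * (\<xi> \<omega>)\<^sup>2 * (t - s) / 2\<bar> \<le> C2 * c\<^sup>2 * (t - s) / 2"
      using st by (auto simp: abs_mult)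
    then show "\<bar>\<phi>1 (X \<omega>) * v \<omega> + \<phi>2 (X \<omega>) * (\<xi> \<omega>)\<^sup>2 * (t - s) / 2\<bar> \<le> C1 * B + C2 * c\<^sup>2 * (t - s) / 2"
      by (intro order_trans[OF abs_triangle_ineq] add_mono)
  qed auto
  show i3: "integrable M (\<lambda>\<omega>. \<theta> \<omega> * (\<xi> \<omega>)\<^sup>2)"
    by (rule int_bdd[of _ "c\<^sup>2"], measurable, rule Ubd) (use \<xi>2 in auto)
  have "expectation (\<lambda>\<omega>. \<theta> \<omega> * (\<phi> (X' \<omega>) - \<phi> (X \<omega>)))
    \<le> expectation (\<lambda>\<omega>. U1 \<omega> * ?D \<omega> ^ 1 + U2 \<omega> * ?D \<omega> ^ 2 + U4 \<omega> * ?D \<omega> ^ 4 + V \<omega> + E)"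
  proof (rule integral_mono[OF i1])
    show "integrable M (\<lambda>\<omega>. U1 \<omega> * ?D \<omega> ^ 1 + U2 \<omega> * ?D \<omega> ^ 2 + U4 \<omega> * ?D \<omega> ^ 4 + V \<omega> + E)"
      using m1(1) m2(1) m4(1) iV by (intro Bochner_Integration.integrable_add) auto
    fix \<omega> assume w: "\<omega> \<in> space M"
    let ?u = "\<xi> \<omega> * ?D \<omega>"
    have "\<phi> (X' \<omega>) - \<phi> (X \<omega>) \<le> \<phi>1 (X \<omega>) * ?u + \<phi>1 (X \<omega>) * v \<omega> + \<phi>2 (X \<omega>) * ?u\<^sup>2 / 2
        + (C2 / 2 + 1) * \<epsilon> * ?u\<^sup>2 + (C2 / (2 * \<epsilon>) + C2 / 2 + \<epsilon>) * (v \<omega>)\<^sup>2 + 4 * K * (?u ^ 4 + v \<omega> ^ 4)"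
      unfolding X'_def by (rule taylor_sum[OF K(1,2,3)])
    also have "\<dots> = \<phi>1 (X \<omega>) * \<xi> \<omega> * ?D \<omega> + \<phi>1 (X \<omega>) * v \<omega>
        + (\<phi>2 (X \<omega>) / 2 + (C2 / 2 + 1) * \<epsilon>) * (\<xi> \<omega>)\<^sup>2 * ?D \<omega> ^ 2 + 4 * K * \<xi> \<omega> ^ 4 * ?D \<omega> ^ 4
        + ((C2 / (2 * \<epsilon>) + C2 / 2 + \<epsilon>) * (v \<omega>)\<^sup>2 + 4 * K * v \<omega> ^ 4)"
      unfolding power_mult_distrib by (simp add: algebra_simps)
    also have "\<dots> \<le> \<phi>1 (X \<omega>) * \<xi> \<omega> * ?D \<omega> + \<phi>1 (X \<omega>) * v \<omega>
        + (\<phi>2 (X \<omega>) / 2 + (C2 / 2 + 1) * \<epsilon>) * (\<xi> \<omega>)\<^sup>2 * ?D \<omega> ^ 2 + 4 * K * \<xi> \<omega> ^ 4 * ?D \<omega> ^ 4 + E"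
    proof -
      have "(v \<omega>)\<^sup>2 \<le> B\<^sup>2" using v(2)[OF w] B by (simp add: abs_le_square_iff[symmetric])
      moreover have "v \<omega> ^ 4 \<le> B ^ 4"
        using power_mono[OF calculation, of 2] by simp
      ultimately show ?thesis unfolding E_def using C2_nonneg K
        by (intro add_left_mono add_mono mult_left_mono) auto
    qed
    finally have "\<theta> \<omega> * (\<phi> (X' \<omega>) - \<phi> (X \<omega>)) \<le> \<theta> \<omega> * (\<phi>1 (X \<omega>) * \<xi> \<omega> * ?D \<omega> + \<phi>1 (X \<omega>) * v \<omega>
        + (\<phi>2 (X \<omega>) / 2 + (C2 / 2 + 1) * \<epsilon>) * (\<xi> \<omega>)\<^sup>2 * ?D \<omega> ^ 2 + 4 * K * \<xi> \<omega> ^ 4 * ?D \<omega> ^ 4 + E)"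
      using \<theta>(2)[OF w] by (intro mult_left_mono) auto
    also have "\<dots> = U1 \<omega> * ?D \<omega> ^ 1 + U2 \<omega> * ?D \<omega> ^ 2 + U4 \<omega> * ?D \<omega> ^ 4 + V \<omega> + \<theta> \<omega> * E"
      unfolding U1_def U2_def U4_def V_def by (simp add: algebra_simps)
    also have "\<dots> \<le> U1 \<omega> * ?D \<omega> ^ 1 + U2 \<omega> * ?D \<omega> ^ 2 + U4 \<omega> * ?D \<omega> ^ 4 + V \<omega> + E"
      using mult_right_mono[of "\<theta> \<omega>" 1 E] \<theta>(2)[OF w] E0 by simp
    finally show "\<theta> \<omega> * (\<phi> (X' \<omega>) - \<phi> (X \<omega>))
      \<le> U1 \<omega> * ?D \<omega> ^ 1 + U2 \<omega> * ?D \<omega> ^ 2 + U4 \<omega> * ?D \<omega> ^ 4 + V \<omega> + E" .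
  qed
  also have "\<dots> = expectation (\<lambda>\<omega>. U1 \<omega> * ?D \<omega> ^ 1) + expectation (\<lambda>\<omega>. U2 \<omega> * ?D \<omega> ^ 2)
      + expectation (\<lambda>\<omega>. U4 \<omega> * ?D \<omega> ^ 4) + expectation V + E"
    using m1(1) m2(1) m4(1) iV by (simp add: prob_space)
  also have "\<dots> = (t - s) * expectation U2 + 3 * (t - s)\<^sup>2 * expectation U4 + expectation V + E"
    using m1(2) m2(2) m4(2) increment_mean[OF st] increment_square[OF st] increment_fourth[OF st] by simp
  also have "expectation U4 \<le> 4 * K * c\<^sup>2 * expectation (\<lambda>\<omega>. \<theta> \<omega> * (\<xi> \<omega>)\<^sup>2)"
  proof -
    have "expectation U4 \<le> expectation (\<lambda>\<omega>. 4 * K * c\<^sup>2 * (\<theta> \<omega> * (\<xi> \<omega>)\<^sup>2))"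
    proof (rule integral_mono)
      show "integrable M U4" by (rule int_bdd[OF measurable_F_M[OF mF(3)] b4])
      show "U4 \<omega> \<le> 4 * K * c\<^sup>2 * (\<theta> \<omega> * (\<xi> \<omega>)\<^sup>2)" if "\<omega> \<in> space M" for \<omega>
        using mult_left_mono[OF \<xi>4[OF that], of "4 * K * \<theta> \<omega>"] K(2) \<theta>(2)[OF that]
        unfolding U4_def by (simp add: ac_simps)
    qed (use i3 in auto)
    then show ?thesis by simp
  qed
  also have "(t - s) * expectation U2 + 3 * (t - s)\<^sup>2 * (4 * K * c\<^sup>2 * expectation (\<lambda>\<omega>. \<theta> \<omega> * (\<xi> \<omega>)\<^sup>2))
      + expectation V + E
    = expectation (\<lambda>\<omega>. \<theta> \<omega> * (\<phi>1 (X \<omega>) * v \<omega> + \<phi>2 (X \<omega>) * (\<xi> \<omega>)\<^sup>2 * (t - s) / 2))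
        + ((C2 / 2 + 1) * \<epsilon> + 12 * K * c\<^sup>2 * (t - s)) * (t - s) * expectation (\<lambda>\<omega>. \<theta> \<omega> * (\<xi> \<omega>)\<^sup>2) + E"
  proof -
    have "expectation (\<lambda>\<omega>. \<theta> \<omega> * (\<phi>1 (X \<omega>) * v \<omega> + \<phi>2 (X \<omega>) * (\<xi> \<omega>)\<^sup>2 * (t - s) / 2))
      = expectation (\<lambda>\<omega>. V \<omega> + (t - s) * U2 \<omega> - (t - s) * (C2 / 2 + 1) * \<epsilon> * (\<theta> \<omega> * (\<xi> \<omega>)\<^sup>2))"
      by (rule Bochner_Integration.integral_cong) (auto simp: V_def U2_def algebra_simps)
    also have "\<dots> = expectation V + (t - s) * expectation U2
        - (t - s) * (C2 / 2 + 1) * \<epsilon> * expectation (\<lambda>\<omega>. \<theta> \<omega> * (\<xi> \<omega>)\<^sup>2)"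
      using iV i3 int_bdd[OF measurable_F_M[OF mF(2)] b2] by simp
    finally show ?thesis by (simp add: algebra_simps power2_eq_square)
  qed
  finally show "expectation (\<lambda>\<omega>. \<theta> \<omega> * (\<phi> (X' \<omega>) - \<phi> (X \<omega>)))
      \<le> expectation (\<lambda>\<omega>. \<theta> \<omega> * (\<phi>1 (X \<omega>) * v \<omega> + \<phi>2 (X \<omega>) * (\<xi> \<omega>)\<^sup>2 * (t - s) / 2))
        + ((C2 / 2 + 1) * \<epsilon> + 12 * K * c\<^sup>2 * (t - s)) * (t - s) * expectation (\<lambda>\<omega>. \<theta> \<omega> * (\<xi> \<omega>)\<^sup>2)
        + ((C2 / (2 * \<epsilon>) + C2 / 2 + \<epsilon>) * B\<^sup>2 + 4 * K * B ^ 4)"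
    using st unfolding E_def by simp
qed

end

section \<open>Grids and Riemann sums along a path\<close>

text \<open>The grid enumerates a finite set consisting of the endpoints, the points of S in the
  interval and the multiples of \<delta>, cut off at t. Consecutive points leave no member of this
  set between them.\<close>

lemma grid_exists:
  fixes t \<delta> :: real
  assumes "finite S" "0 < t" "0 < \<delta>"
  obtains N r where "0 < N" "r 0 = 0" "r N = t" "\<And>i. i < N \<Longrightarrow> r i < r (Suc i)"
    "\<And>i. i < N \<Longrightarrow> r (Suc i) - r i \<le> \<delta>" "\<And>i. i < N \<Longrightarrow> {r i<..<r (Suc i)} \<inter> S = {}"
proof -
  define G where "G = {0, t} \<union> (S \<inter> {0..t}) \<union> (\<lambda>k. min t (real k * \<delta>)) ` {..nat \<lceil>t / \<delta>\<rceil>}"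
  have G: "finite G" "0 \<in> G" "t \<in> G" and G_sub: "G \<subseteq> {0..t}"
    using assms by (auto simp: G_def)
  define l where "l = sorted_list_of_set G"
  have l: "set l = G" "sorted_wrt (<) l"
    using G by (auto simp: l_def)
  have len: "length l = card G" by (simp add: l_def)
  have "card {0, t} \<le> card G" using G by (intro card_mono) auto
  then have card: "2 \<le> card G" using \<open>0 < t\<close> by simp
  define N where "N = card G - 1"
  define r where "r = (\<lambda>i. l ! i)"
  have mono: "r i < r j" if "i < j" "j \<le> N" for i j
    using l(2) that card len by (auto simp: r_def N_def sorted_wrt_iff_nth_less)
  have mem: "r i \<in> G" if "i \<le> N" for i
    using that l(1) len card nth_mem[of i l] by (simp add: r_def N_def)
  have ex: "\<exists>i\<le>N. r i = x" if x: "x \<in> G" for x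
  proof -
    obtain i where "i < length l" "l ! i = x" using x unfolding l(1)[symmetric] in_set_conv_nth by blast
    then show ?thesis using len by (intro exI[of _ i]) (simp add: r_def N_def)
  qed
  have no: "{r i<..<r (Suc i)} \<inter> G = {}" if "i < N" for i
  proof -
    have False if x: "x \<in> G" "r i < x" "x < r (Suc i)" for x
    proof -
      obtain j where j: "j \<le> N" "r j = x" using ex x(1) by blast
      have "i < j" using mono[of j i] j x(2) \<open>i < N\<close> by (metis leD less_imp_le_nat not_less_iff_gr_or_eq)
      moreover have "j < Suc i" using mono[of "Suc i" j] j x(3) \<open>i < N\<close> by (metis not_less_iff_gr_or_eq)
      ultimately show False by simp
    qed
    then show ?thesis by auto
  qed
  show thesis
  proof
    show "0 < N" using card by (simp add: N_def)
    obtain i where i: "i \<le> N" "r i = 0" using ex G(2) by blast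
    show "r 0 = 0"
      using i mono[of 0 i] mem[of 0] G_sub by (cases "i = 0") auto
    obtain j where j: "j \<le> N" "r j = t" using ex G(3) by blast
    show "r N = t"
      using j mono[of j N] mem[of N] G_sub by (cases "j = N") auto
    fix i assume i: "i < N"
    show "r i < r (Suc i)" using mono i by simp
    show "{r i<..<r (Suc i)} \<inter> S = {}"
      using no[OF i] mem[of i] mem[of "Suc i"] i G_sub by (fastforce simp: G_def)
    show "r (Suc i) - r i \<le> \<delta>"
    proof (rule ccontr)
      assume gap: "\<not> ?thesis"
      \<comment> \<open>The number k belongs to the first multiple of \<delta> strictly after
        \<open>r i\<close>. In a cell longer than \<delta> this multiple would lie strictly inside,
        yet it is a grid point.\<close>
      define k where "k = nat \<lfloor>r i / \<delta>\<rfloor> + 1"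
      have ri: "0 \<le> r i" "r i < t" "r (Suc i) \<le> t"
        using mem[of i] mem[of "Suc i"] mono[of i "Suc i"] i G_sub by auto
      have k: "real k = of_int \<lfloor>r i / \<delta>\<rfloor> + 1" using ri \<open>0 < \<delta>\<close> by (simp add: k_def)
      have "r i / \<delta> < real k" "real k \<le> r i / \<delta> + 1" unfolding k by linarith+
      then have "r i < real k * \<delta>" "real k * \<delta> \<le> r i + \<delta>" using \<open>0 < \<delta>\<close> by (auto simp: field_simps)
      then have kk: "r i < real k * \<delta>" "real k * \<delta> < r (Suc i)" using gap by auto
      then have "real k * \<delta> < t" using ri by simp
      then have "real k \<le> t / \<delta>" using \<open>0 < \<delta>\<close> by (simp add: field_simps)
      then have "k \<le> nat \<lceil>t / \<delta>\<rceil>" by linarith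
      moreover have "min t (real k * \<delta>) = real k * \<delta>" using \<open>real k * \<delta> < t\<close> by simp
      ultimately have "real k * \<delta> \<in> G" unfolding G_def by (metis UnI2 atMost_iff imageI)
      then show False using no[OF i] kk by auto
    qed
  qed
qed

lemma set_integrable_bounded:
  fixes k :: "real \<Rightarrow> real"
  assumes [measurable]: "k \<in> borel_measurable borel" "A \<in> sets borel"
    and "A \<subseteq> {x..y}" "\<And>s. s \<in> A \<Longrightarrow> \<bar>k s\<bar> \<le> B"
  shows "set_integrable lborel A k"
  unfolding set_integrable_def
proof (rule Bochner_Integration.integrable_bound[of _ "\<lambda>s. \<bar>B\<bar> * indicator {x..y} s"])
  show "integrable lborel (\<lambda>s. \<bar>B\<bar> * indicator {x..y} s :: real)"
    by (intro integrable_mult_right integrable_real_indicator) (auto simp: emeasure_lborel_Icc_eq)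
  show "(\<lambda>s. indicator A s *\<^sub>R k s) \<in> borel_measurable lborel" by measurable
  have "norm (indicator A s *\<^sub>R k s) \<le> norm (\<bar>B\<bar> * indicator {x..y} s)" for s
    using assms(3) assms(4)[of s] by (cases "s \<in> A") (auto simp: indicator_def)
  then show "AE s in lborel. norm (indicator A s *\<^sub>R k s) \<le> norm (\<bar>B\<bar> * indicator {x..y} s)" by simp
qed

text \<open>Adapted processes enter a cell of the grid through their value at its left endpoint.\<close>

definition left_step :: "nat \<Rightarrow> (nat \<Rightarrow> real) \<Rightarrow> (nat \<Rightarrow> real) \<Rightarrow> real \<Rightarrow> real" where
  "left_step N r y s = (\<Sum>i<N. y i * indicator {r i<..r (Suc i)} s)"

lemma left_step_measurable [measurable]: "left_step N r y \<in> borel_measurable borel"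
  unfolding left_step_def by measurable

context
  fixes N :: nat and r :: "nat \<Rightarrow> real"
  assumes r_less: "\<And>i. i < N \<Longrightarrow> r i < r (Suc i)"
begin

lemma grid_mono: "i \<le> j \<Longrightarrow> j \<le> N \<Longrightarrow> r i \<le> r j"
proof (induction j rule: dec_induct)
  case (step j)
  then show ?case using r_less[of j] by simp
qed simp

lemma left_step_eq:
  assumes "i < N" "r i < s" "s \<le> r (Suc i)"
  shows "left_step N r y s = y i"
proof -
  have "indicator {r j<..r (Suc j)} s = (if j = i then 1 else 0 :: real)" if "j < N" for j
  proof (cases i j rule: linorder_cases)
    case less
    then have "r (Suc i) \<le> r j" using grid_mono that by simp
    with assms less show ?thesis by (auto simp: indicator_def)
  next
    case greater
    then have "r (Suc j) \<le> r i" using grid_mono assms by simp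
    with assms greater show ?thesis by (auto simp: indicator_def)
  qed (use assms in auto)
  then have "left_step N r y s = (\<Sum>j<N. if j = i then y i else 0)"
    unfolding left_step_def by (intro sum.cong) auto
  then show ?thesis using assms by simp
qed

lemma grid_cell:
  assumes "r 0 < s" "s \<le> r N"
  obtains i where "i < N" "r i < s" "s \<le> r (Suc i)"
proof -
  define j where "j = (LEAST j. s \<le> r j)"
  have j: "s \<le> r j" "j \<le> N" unfolding j_def using assms by (auto intro: LeastI Least_le)
  then obtain i where i: "j = Suc i" using assms by (cases j) auto
  then have "\<not> s \<le> r i" using not_less_Least[of i "\<lambda>j. s \<le> r j"] j_def by simp
  then show thesis using that[of i] i j by auto
qed

lemma left_step_bounded:
  assumes "\<And>i. i < N \<Longrightarrow> \<bar>y i\<bar> \<le> B" "0 \<le> B"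
  shows "\<bar>left_step N r y s\<bar> \<le> B"
proof (cases "r 0 < s \<and> s \<le> r N")
  case True
  then obtain i where "i < N" "r i < s" "s \<le> r (Suc i)" using grid_cell by blast
  then show ?thesis using assms by (simp add: left_step_eq)
next
  case False
  then have "\<not> (r i < s \<and> s \<le> r (Suc i))" if "i < N" for i
    using that grid_mono[of 0 i] grid_mono[of "Suc i" N] by auto
  then have "left_step N r y s = 0" unfolding left_step_def by (intro sum.neutral) auto
  then show ?thesis using assms by simp
qed

lemma left_step_integral:
  assumes k: "\<And>i. i < N \<Longrightarrow> set_integrable lborel {r i<..r (Suc i)} k"
  shows "integrable lborel (\<lambda>s. left_step N r y s * k s)"
    and "(LINT s|lborel. left_step N r y s * k s)
      = (\<Sum>i<N. y i * (LINT s:{r i<..r (Suc i)}|lborel. k s))"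
proof -
  have eq: "left_step N r y s * k s = (\<Sum>i<N. y i * (indicator {r i<..r (Suc i)} s *\<^sub>R k s))" for s
    unfolding left_step_def by (simp only: sum_distrib_right mult.assoc real_scaleR_def)
  have i: "integrable lborel (\<lambda>s. y i * (indicator {r i<..r (Suc i)} s *\<^sub>R k s))" if "i < N" for i
    using k[OF that] unfolding set_integrable_def by (rule integrable_mult_right)
  then show "integrable lborel (\<lambda>s. left_step N r y s * k s)"
    unfolding eq by (intro Bochner_Integration.integrable_sum) auto
  have "(LINT s|lborel. left_step N r y s * k s)
      = (\<Sum>i<N. LINT s|lborel. y i * (indicator {r i<..r (Suc i)} s *\<^sub>R k s))"
    unfolding eq using i by (intro Bochner_Integration.integral_sum) auto
  then show "(LINT s|lborel. left_step N r y s * k s)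
      = (\<Sum>i<N. y i * (LINT s:{r i<..r (Suc i)}|lborel. k s))"
    by (simp add: set_lebesgue_integral_def)
qed

end

lemma square_integrals_tendsto:
  fixes f :: "real \<Rightarrow> real" and p :: "nat \<Rightarrow> real \<Rightarrow> real"
  assumes f: "continuous_on {0..U} f" "\<And>s. s \<in> {0..U} \<Longrightarrow> \<bar>f s\<bar> \<le> C" and "0 \<le> U"
    and p: "\<And>m. p m \<in> borel_measurable borel" "\<And>m s. \<bar>p m s\<bar> \<le> c m"
    and conv: "(\<lambda>m. \<integral>\<^sup>+ s\<in>{0..U}. ennreal ((p m s - f s)\<^sup>2) \<partial>lborel) \<longlonglongrightarrow> 0"
  shows "(\<lambda>m. LINT s:{0..U}|lborel. \<bar>(p m s)\<^sup>2 - (f s)\<^sup>2\<bar>) \<longlonglongrightarrow> 0"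
proof -
  define f' where "f' = (\<lambda>s. indicator {0..U} s * f s)"
  have [measurable]: "f' \<in> borel_measurable borel"
    unfolding f'_def using borel_measurable_continuous_on_indicator[OF _ f(1)] by simp
  note [measurable] = p(1)
  have C: "0 \<le> C" using f(2)[of 0] \<open>0 \<le> U\<close> by force
  have f'_eq: "f' s = f s" if "s \<in> {0..U}" for s using that by (simp add: f'_def)
  have f'_le: "\<bar>f' s\<bar> \<le> C" for s
    using f(2)[of s] C by (cases "s \<in> {0..U}") (auto simp: f'_def)
  define D where "D = (\<lambda>m. LINT s:{0..U}|lborel. (p m s - f' s)\<^sup>2)"
  have c: "0 \<le> c m" for m using p(2)[of m 0] by linarith
  have bd: "(p m s - f' s)\<^sup>2 \<le> (c m + C)\<^sup>2" for m s
    using p(2)[of m s] f'_le[of s] by (subst abs_le_square_iff[symmetric]) linarith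
  have intD: "set_integrable lborel {0..U} (\<lambda>s. (p m s - f' s)\<^sup>2)" for m
    by (rule set_integrable_bounded[of _ _ 0 U "(c m + C)\<^sup>2"]) (use bd in auto)
  have "(\<integral>\<^sup>+ s\<in>{0..U}. ennreal ((p m s - f s)\<^sup>2) \<partial>lborel) = ennreal (D m)" for m
  proof -
    have "(\<integral>\<^sup>+ s\<in>{0..U}. ennreal ((p m s - f s)\<^sup>2) \<partial>lborel)
        = (\<integral>\<^sup>+ s. ennreal (indicator {0..U} s *\<^sub>R (p m s - f' s)\<^sup>2) \<partial>lborel)"
      by (rule nn_integral_cong) (auto simp: f'_eq indicator_def)
    also have "\<dots> = ennreal (D m)"
      unfolding D_def set_lebesgue_integral_def
      using intD[of m] unfolding set_integrable_def by (rule nn_integral_eq_integral) auto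
    finally show ?thesis .
  qed
  moreover have D0: "0 \<le> D m" for m
    unfolding D_def set_lebesgue_integral_def by (rule integral_nonneg_AE) auto
  ultimately have Dlim: "D \<longlonglongrightarrow> 0" using conv by (simp add: tendsto_ennreal_iff flip: ennreal_0)
  have int: "set_integrable lborel {0..U} (\<lambda>s. \<bar>(p m s)\<^sup>2 - (f' s)\<^sup>2\<bar>)" for m
  proof (rule set_integrable_bounded[of _ _ 0 U "(c m)\<^sup>2 + C\<^sup>2"])
    fix s
    have "(p m s)\<^sup>2 \<le> (c m)\<^sup>2" "(f' s)\<^sup>2 \<le> C\<^sup>2"
      using p(2)[of m s] f'_le[of s] by (subst abs_le_square_iff[symmetric], linarith)+
    then show "\<bar>\<bar>(p m s)\<^sup>2 - (f' s)\<^sup>2\<bar>\<bar> \<le> (c m)\<^sup>2 + C\<^sup>2"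
      using zero_le_power2[of "p m s"] zero_le_power2[of "f' s"] by linarith
  qed auto
  let ?V = "\<lambda>m. LINT s:{0..U}|lborel. \<bar>(p m s)\<^sup>2 - (f' s)\<^sup>2\<bar>"
  have V0: "0 \<le> ?V m" for m
    unfolding set_lebesgue_integral_def by (rule integral_nonneg_AE) auto
  have le: "?V m \<le> (1 + C\<^sup>2 / \<eta>) * D m + \<eta> * U" if "0 < \<eta>" for m \<eta>
  proof -
    have "?V m \<le> (LINT s:{0..U}|lborel. (1 + C\<^sup>2 / \<eta>) * (p m s - f' s)\<^sup>2 + \<eta>)"
    proof (rule set_integral_mono[OF int])
      show "set_integrable lborel {0..U} (\<lambda>s. (1 + C\<^sup>2 / \<eta>) * (p m s - f' s)\<^sup>2 + \<eta>)"
        using intD[of m] \<open>0 \<le> U\<close>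
        by (intro set_integral_add set_integrable_mult_right) (auto simp: set_integrable_def)
      fix s
      let ?d = "p m s - f' s"
      have "(p m s)\<^sup>2 - (f' s)\<^sup>2 = ?d\<^sup>2 + 2 * f' s * ?d" by (simp add: power2_eq_square algebra_simps)
      then have "\<bar>(p m s)\<^sup>2 - (f' s)\<^sup>2\<bar> \<le> ?d\<^sup>2 + 2 * \<bar>f' s\<bar> * \<bar>?d\<bar>"
        using abs_triangle_ineq[of "?d\<^sup>2" "2 * f' s * ?d"] by (simp add: abs_mult)
      also have "\<dots> \<le> ?d\<^sup>2 + 2 * C * \<bar>?d\<bar>"
        using f'_le[of s] by (intro add_left_mono mult_right_mono) auto
      also have "2 * C * \<bar>?d\<bar> \<le> \<eta> + C\<^sup>2 / \<eta> * ?d\<^sup>2"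
      proof -
        have "0 \<le> (\<eta> - C * \<bar>?d\<bar>)\<^sup>2" by simp
        then have "\<eta> * (2 * C * \<bar>?d\<bar>) \<le> \<eta>\<^sup>2 + C\<^sup>2 * ?d\<^sup>2"
          by (simp add: power2_diff[of \<eta>] power_mult_distrib mult_ac)
        then have "2 * C * \<bar>?d\<bar> \<le> (\<eta>\<^sup>2 + C\<^sup>2 * ?d\<^sup>2) / \<eta>"
          using \<open>0 < \<eta>\<close> by (simp add: pos_le_divide_eq mult.commute)
        then show ?thesis using \<open>0 < \<eta>\<close> by (simp add: add_divide_distrib power2_eq_square)
      qed
      finally show "\<bar>(p m s)\<^sup>2 - (f' s)\<^sup>2\<bar> \<le> (1 + C\<^sup>2 / \<eta>) * ?d\<^sup>2 + \<eta>" by (simp add: algebra_simps)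
    qed
    also have "\<dots> = (1 + C\<^sup>2 / \<eta>) * D m + \<eta> * U"
      using set_integrable_mult_right[OF intD[of m], of "1 + C\<^sup>2 / \<eta>"] \<open>0 \<le> U\<close> unfolding D_def
      by (subst set_integral_add)
         (auto simp: set_integrable_def set_lebesgue_integral_def measure_lborel_Icc)
    finally show ?thesis .
  qed
  have "?V \<longlonglongrightarrow> 0"
  proof (rule LIMSEQ_I)
    fix e :: real assume e: "0 < e"
    define \<eta> where "\<eta> = e / (2 * (U + 1))"
    have \<eta>: "0 < \<eta>" using e \<open>0 \<le> U\<close> by (simp add: \<eta>_def)
    have \<eta>U: "\<eta> * U < e / 2" using e \<open>0 \<le> U\<close> by (simp add: \<eta>_def field_simps)
    have "(\<lambda>m. (1 + C\<^sup>2 / \<eta>) * D m) \<longlonglongrightarrow> (1 + C\<^sup>2 / \<eta>) * 0" by (intro tendsto_intros Dlim)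
    then have "\<forall>\<^sub>F m in sequentially. (1 + C\<^sup>2 / \<eta>) * D m < e / 2"
      using e by (intro order_tendstoD) auto
    then obtain n where n: "\<And>m. n \<le> m \<Longrightarrow> (1 + C\<^sup>2 / \<eta>) * D m < e / 2"
      by (auto simp: eventually_sequentially)
    have "norm (?V m - 0) < e" if "n \<le> m" for m
    proof -
      have "?V m < e" using n[OF that] le[OF \<eta>, of m] \<eta>U by linarith
      then show ?thesis using V0[of m] by simp
    qed
    then show "\<exists>n. \<forall>m\<ge>n. norm (?V m - 0) < e" by blast
  qed
  moreover have "?V m = (LINT s:{0..U}|lborel. \<bar>(p m s)\<^sup>2 - (f s)\<^sup>2\<bar>)" for m
    by (rule set_lebesgue_integral_cong) (auto simp: f'_eq)
  ultimately show ?thesis by simp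
qed

lemma set_integral_Ioc_split:
  fixes k :: "real \<Rightarrow> real"
  assumes "x \<le> y" "y \<le> z" "set_integrable lborel {x<..z} k"
  shows "(LINT s:{x<..z}|lborel. k s) = (LINT s:{x<..y}|lborel. k s) + (LINT s:{y<..z}|lborel. k s)"
proof -
  have eq: "{x<..z} = {x<..y} \<union> {y<..z}" using assms by auto
  have "set_integrable lborel {x<..y} k" "set_integrable lborel {y<..z} k"
    using assms by (auto intro: set_integrable_subset)
  then show ?thesis unfolding eq by (intro set_integral_Un) auto
qed

context
  fixes T C :: real and a A :: "real \<Rightarrow> real"
  assumes a: "continuous_on {0..T} a" "\<And>s. s \<in> {0..T} \<Longrightarrow> \<bar>a s\<bar> \<le> C"
    and A: "\<And>s. 0 \<le> s \<Longrightarrow> A s = (LINT u:{0..min s T}|lborel. a u)"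
begin

lemma stopped_integrand_integrable:
  "set_integrable lborel {x<..y} (\<lambda>s. indicator {0..T} s * a s)"
  "set_integrable lborel {x..y} (\<lambda>s. indicator {0..T} s * a s)"
proof -
  have "\<bar>indicator {0..T} s * a s\<bar> \<le> \<bar>C\<bar>" for s
    using a(2)[of s] by (cases "s \<in> {0..T}") auto
  then show "set_integrable lborel {x<..y} (\<lambda>s. indicator {0..T} s * a s)"
    "set_integrable lborel {x..y} (\<lambda>s. indicator {0..T} s * a s)"
    using borel_measurable_continuous_on_indicator[OF _ a(1)]
    by (auto intro!: set_integrable_bounded[where x=x and y=y and B="\<bar>C\<bar>"])
qed

lemma stopped_integral_increment:
  assumes "0 \<le> x" "x \<le> y"
  shows "A y - A x = (LINT s:{x<..y}|lborel. indicator {0..T} s * a s)"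
proof -
  let ?a = "\<lambda>s. indicator {0..T} s * a s"
  have A': "A s = (LINT u:{0..s}|lborel. ?a u)" if "0 \<le> s" for s
    unfolding A[OF that] set_lebesgue_integral_def
    by (rule Bochner_Integration.integral_cong) (auto simp: indicator_def)
  have eq: "{0..y} = {0..x} \<union> {x<..y}" using assms by auto
  have "(LINT u:{0..y}|lborel. ?a u) = (LINT u:{0..x}|lborel. ?a u) + (LINT u:{x<..y}|lborel. ?a u)"
    unfolding eq using assms by (intro set_integral_Un stopped_integrand_integrable) auto
  then show ?thesis using A'[of y] A'[of x] assms by simp
qed

lemma stopped_integral_lipschitz:
  assumes "0 \<le> C" "0 \<le> x" "x \<le> y"
  shows "\<bar>A y - A x\<bar> \<le> C * (y - x)"
proof -
  let ?a = "\<lambda>s. indicator {0..T} s * a s"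
  note int = stopped_integrand_integrable(1)[of x y]
  have le: "\<bar>?a s\<bar> \<le> C" for s using a(2)[of s] \<open>0 \<le> C\<close> by (auto simp: indicator_def)
  have "\<bar>A y - A x\<bar> \<le> (LINT s:{x<..y}|lborel. \<bar>?a s\<bar>)"
    unfolding stopped_integral_increment[OF assms(2,3)] using set_integral_norm_bound[OF int] by simp
  also have "\<dots> \<le> (LINT s:{x<..y}|lborel. C)"
    using le assms int
    by (intro set_integral_mono set_integrable_abs) (auto simp: set_integrable_def emeasure_lborel_Ioc)
  also have "\<dots> = C * (y - x)" using assms by (simp add: set_lebesgue_integral_def)
  finally show ?thesis .
qed

end

locale approximating_grids = test_function \<phi> \<phi>1 \<phi>2 C1 C2
  for \<phi> \<phi>1 \<phi>2 :: "real \<Rightarrow> real" and C1 C2 :: real +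
  fixes T t C Bd :: real and f a A Y :: "real \<Rightarrow> real" and p I :: "nat \<Rightarrow> real \<Rightarrow> real"
    and r :: "nat \<Rightarrow> nat \<Rightarrow> real" and N :: "nat \<Rightarrow> nat" and c \<delta> :: "nat \<Rightarrow> real"
  assumes T: "0 \<le> T" and t: "0 < t"
    and f: "continuous_on {0..T} f" "\<And>s. s \<in> {0..T} \<Longrightarrow> \<bar>f s\<bar> \<le> C"
    and a: "continuous_on {0..T} a" "\<And>s. s \<in> {0..T} \<Longrightarrow> \<bar>a s\<bar> \<le> C"
    and A: "\<And>s. 0 \<le> s \<Longrightarrow> A s = (LINT u:{0..min s T}|lborel. a u)"
    and Y: "continuous_on {0..T} Y"
    and I: "uniform_limit {0..T} I Y sequentially"
    and p: "\<And>m. p m \<in> borel_measurable borel" "\<And>m s. \<bar>p m s\<bar> \<le> c m"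
    and p_lim: "(\<lambda>m. \<integral>\<^sup>+ s\<in>{0..T}. ennreal ((p m s - f s)\<^sup>2) \<partial>lborel) \<longlonglongrightarrow> 0"
    and r0: "\<And>m. r m 0 = 0" and rN: "\<And>m. r m (N m) = t"
    and r_less: "\<And>m i. i < N m \<Longrightarrow> r m i < r m (Suc i)"
    and mesh: "\<And>m i. i < N m \<Longrightarrow> r m (Suc i) - r m i \<le> \<delta> m"
    and \<delta>: "\<And>m. \<delta> m \<le> 1 / (real m + 1)" "\<And>m. (c m)\<^sup>2 * \<delta> m \<le> 1 / (real m + 1)"
    and const: "\<And>m i s. i < N m \<Longrightarrow> s \<in> {r m i<..r m (Suc i)} \<Longrightarrow> p m s = p m (r m (Suc i))"
    and Bd: "C\<^sup>2 * t + 1 \<le> Bd"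
begin

definition U where "U = min t T"

text \<open>The weight of cell i. The sum includes the energy of cell i itself; this is still known
  at the left endpoint, because p is constant on the cell and its value there is determined before
  the cell begins.\<close>

definition \<theta> :: "nat \<Rightarrow> nat \<Rightarrow> real" where
  "\<theta> m i = of_bool (r m i \<le> T \<and>
    (\<Sum>j\<le>i. (p m (r m (Suc j)))\<^sup>2 * (r m (Suc j) - r m j)) \<le> Bd)"

definition X :: "nat \<Rightarrow> nat \<Rightarrow> real" where "X m i = I m (r m i) + A (r m i)"

definition a' where "a' = (\<lambda>s. indicator {0..T} s * a s)"
definition f' where "f' = (\<lambda>s. indicator {0..T} s * f s)"

lemma U: "0 \<le> U" "U \<le> t" "U \<le> T" using T t by (auto simp: U_def)

lemma C: "0 \<le> C" using f(2)[of 0] T by force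

lemma c: "0 \<le> c m" using p(2)[of m 0] by linarith

lemma \<delta>_pos: "0 < \<delta> m"
proof -
  have "N m \<noteq> 0" using r0[of m] rN[of m] t by (metis less_irrefl)
  then show ?thesis using r_less[of 0 m] mesh[of 0 m] by simp
qed

lemma \<delta>_lim: "\<delta> \<longlonglongrightarrow> 0"
proof (rule tendsto_sandwich[of "\<lambda>_. 0" \<delta> _ "\<lambda>m. 1 / (real m + 1)"])
  show "(\<lambda>m. 1 / (real m + 1)) \<longlonglongrightarrow> 0" using LIMSEQ_inverse_real_of_nat by (simp add: inverse_eq_divide add.commute)
qed (use \<delta> \<delta>_pos in \<open>auto intro!: always_eventually less_imp_le\<close>)

lemma r_le_t: "i \<le> N m \<Longrightarrow> r m i \<le> t" and r_nonneg: "i \<le> N m \<Longrightarrow> 0 \<le> r m i"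
  using grid_mono[of "N m" "r m" i "N m"] grid_mono[of "N m" "r m" 0 i] r_less r0 rN by auto

lemma a'_measurable [measurable]: "a' \<in> borel_measurable borel"
  and f'_measurable [measurable]: "f' \<in> borel_measurable borel"
  unfolding a'_def f'_def
  using borel_measurable_continuous_on_indicator[OF _ a(1)]
    borel_measurable_continuous_on_indicator[OF _ f(1)] by auto

lemma a'_bound: "\<bar>a' s\<bar> \<le> C" and f'_bound: "\<bar>f' s\<bar> \<le> C"
  using a(2)[of s] f(2)[of s] C by (auto simp: a'_def f'_def indicator_def)

lemma A_increment: "0 \<le> x \<Longrightarrow> x \<le> y \<Longrightarrow> A y - A x = (LINT s:{x<..y}|lborel. a' s)"
  unfolding a'_def using stopped_integral_increment[OF a A] by blast

lemma A_lipschitz: "0 \<le> x \<Longrightarrow> x \<le> y \<Longrightarrow> \<bar>A y - A x\<bar> \<le> C * (y - x)"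
  using stopped_integral_lipschitz[OF a A] C by blast

lemma p_square_integrable: "set_integrable lborel {x<..y} (\<lambda>s. (p m s)\<^sup>2)"
proof (rule set_integrable_bounded[where x=x and y=y and B="(c m)\<^sup>2"])
  show "\<bar>(p m s)\<^sup>2\<bar> \<le> (c m)\<^sup>2" for s
    using p(2)[of m s] by (simp add: abs_le_square_iff[symmetric])
qed (use p in auto)

lemma cell_integral:
  assumes "i < N m"
  shows "(LINT s:{r m i<..r m (Suc i)}|lborel. (p m s)\<^sup>2)
    = (p m (r m (Suc i)))\<^sup>2 * (r m (Suc i) - r m i)"
proof -
  have "(LINT s:{r m i<..r m (Suc i)}|lborel. (p m s)\<^sup>2)
      = (LINT s:{r m i<..r m (Suc i)}|lborel. (p m (r m (Suc i)))\<^sup>2)"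
    by (rule set_lebesgue_integral_cong) (simp, metis const[OF assms])
  then show ?thesis using r_less[OF assms] by (simp add: set_lebesgue_integral_def)
qed

lemma partial_sum_integral:
  assumes "i \<le> N m"
  shows "(\<Sum>j<i. (p m (r m (Suc j)))\<^sup>2 * (r m (Suc j) - r m j)) = (LINT s:{0<..r m i}|lborel. (p m s)\<^sup>2)"
  using assms
proof (induction i)
  case 0
  then show ?case by (simp add: r0 set_lebesgue_integral_def)
next
  case (Suc i)
  then have "0 \<le> r m i" "r m i \<le> r m (Suc i)" using r_nonneg[of i m] r_less[of i m] by auto
  with Suc show ?case
    by (subst set_integral_Ioc_split[of 0 "r m i"]) (auto simp: cell_integral p_square_integrable)
qed

abbreviation (input) defect where
  "defect m \<equiv> (LINT s:{0..U}|lborel. \<bar>(p m s)\<^sup>2 - (f' s)\<^sup>2\<bar>)"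

lemma defect_lim: "defect \<longlonglongrightarrow> 0"
proof -
  have "(\<lambda>m. LINT s:{0..U}|lborel. \<bar>(p m s)\<^sup>2 - (f s)\<^sup>2\<bar>) \<longlonglongrightarrow> 0"
  proof (rule square_integrals_tendsto[where C=C and c=c])
    show "continuous_on {0..U} f" using f(1) U by (auto intro: continuous_on_subset)
    show "(\<lambda>m. \<integral>\<^sup>+ s\<in>{0..U}. ennreal ((p m s - f s)\<^sup>2) \<partial>lborel) \<longlonglongrightarrow> 0"
    proof (rule tendsto_sandwich[OF _ _ tendsto_const p_lim])
      show "\<forall>\<^sub>F m in sequentially. (\<integral>\<^sup>+ s\<in>{0..U}. ennreal ((p m s - f s)\<^sup>2) \<partial>lborel)
          \<le> (\<integral>\<^sup>+ s\<in>{0..T}. ennreal ((p m s - f s)\<^sup>2) \<partial>lborel)"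
        using U by (intro always_eventually allI nn_integral_mono) (auto simp: indicator_def)
    qed simp
  qed (use f(2) U p in auto)
  moreover have "(LINT s:{0..U}|lborel. \<bar>(p m s)\<^sup>2 - (f s)\<^sup>2\<bar>) = defect m" for m
    by (rule set_lebesgue_integral_cong) (use U in \<open>auto simp: f'_def\<close>)
  ultimately show ?thesis by simp
qed

lemma \<theta>_eventually_one:
  "\<forall>\<^sub>F m in sequentially. \<forall>i<N m. r m i \<le> T \<longrightarrow> \<theta> m i = 1"
proof -
  have "(\<lambda>m. defect m + 1 / (real m + 1)) \<longlonglongrightarrow> 0 + 0"
    by (intro tendsto_add defect_lim)
      (use LIMSEQ_inverse_real_of_nat in \<open>simp add: inverse_eq_divide add.commute\<close>)
  then have "\<forall>\<^sub>F m in sequentially. defect m + 1 / (real m + 1) < 1" by (rule order_tendstoD) auto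
  then show ?thesis
  proof eventually_elim
    case (elim m)
    have "(\<Sum>j\<le>i. (p m (r m (Suc j)))\<^sup>2 * (r m (Suc j) - r m j)) \<le> Bd" if i: "i < N m" "r m i \<le> T" for i
    proof -
      have ri: "r m i \<le> U" using i r_le_t[of i m] by (simp add: U_def)
      have int: "set_integrable lborel {0<..U} (\<lambda>s. \<bar>(p m s)\<^sup>2 - (f' s)\<^sup>2\<bar>)"
          "set_integrable lborel {0..U} (\<lambda>s. \<bar>(p m s)\<^sup>2 - (f' s)\<^sup>2\<bar>)"
      proof -
        have "\<bar>\<bar>(p m s)\<^sup>2 - (f' s)\<^sup>2\<bar>\<bar> \<le> (c m)\<^sup>2 + C\<^sup>2" for s
        proof -
          have "(p m s)\<^sup>2 \<le> (c m)\<^sup>2" "(f' s)\<^sup>2 \<le> C\<^sup>2"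
            using p(2)[of m s] f'_bound[of s] by (subst abs_le_square_iff[symmetric], linarith)+
          then show ?thesis using zero_le_power2[of "p m s"] zero_le_power2[of "f' s"] by linarith
        qed
        then show "set_integrable lborel {0<..U} (\<lambda>s. \<bar>(p m s)\<^sup>2 - (f' s)\<^sup>2\<bar>)"
          "set_integrable lborel {0..U} (\<lambda>s. \<bar>(p m s)\<^sup>2 - (f' s)\<^sup>2\<bar>)"
          using p(1)[of m]
          by (auto intro!: set_integrable_bounded[where x=0 and y=U and B="(c m)\<^sup>2 + C\<^sup>2"])
      qed
      have "(\<Sum>j<i. (p m (r m (Suc j)))\<^sup>2 * (r m (Suc j) - r m j)) = (LINT s:{0<..r m i}|lborel. (p m s)\<^sup>2)"
        using i by (intro partial_sum_integral) simp
      also have "\<dots> \<le> (LINT s:{0<..r m i}|lborel. (p m s)\<^sup>2) + (LINT s:{r m i<..U}|lborel. (p m s)\<^sup>2)"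
        unfolding set_lebesgue_integral_def by (simp add: integral_nonneg_AE)
      also have "\<dots> = (LINT s:{0<..U}|lborel. (p m s)\<^sup>2)"
        using ri r_nonneg[of i m] i by (intro set_integral_Ioc_split[symmetric] p_square_integrable) auto
      also have "\<dots> \<le> (LINT s:{0<..U}|lborel. C\<^sup>2 + \<bar>(p m s)\<^sup>2 - (f' s)\<^sup>2\<bar>)"
      proof (rule set_integral_mono[OF p_square_integrable])
        show "set_integrable lborel {0<..U} (\<lambda>s. C\<^sup>2 + \<bar>(p m s)\<^sup>2 - (f' s)\<^sup>2\<bar>)"
          using int U by (intro set_integral_add) (auto simp: set_integrable_def emeasure_lborel_Ioc)
        show "(p m s)\<^sup>2 \<le> C\<^sup>2 + \<bar>(p m s)\<^sup>2 - (f' s)\<^sup>2\<bar>" for s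
        proof -
          have "(f' s)\<^sup>2 \<le> C\<^sup>2" using f'_bound[of s] by (subst abs_le_square_iff[symmetric], linarith)
          then show ?thesis by linarith
        qed
      qed
      also have "\<dots> = C\<^sup>2 * U + (LINT s:{0<..U}|lborel. \<bar>(p m s)\<^sup>2 - (f' s)\<^sup>2\<bar>)"
        using int U by (subst set_integral_add) (auto simp: set_integrable_def emeasure_lborel_Ioc set_lebesgue_integral_def)
      also have "\<dots> \<le> C\<^sup>2 * t + defect m"
      proof (intro add_mono mult_left_mono)
        show "(LINT s:{0<..U}|lborel. \<bar>(p m s)\<^sup>2 - (f' s)\<^sup>2\<bar>) \<le> defect m"
          unfolding set_lebesgue_integral_def using int unfolding set_integrable_def
          by (intro integral_mono) (auto simp: indicator_def)
      qed (use U in auto)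
      finally have 1: "(\<Sum>j<i. (p m (r m (Suc j)))\<^sup>2 * (r m (Suc j) - r m j)) \<le> C\<^sup>2 * t + defect m" .
      \<comment> \<open>The current cell may reach beyond T, where convergence of p to f is not
        known. Its energy is therefore bounded through the mesh alone.\<close>
      have "(p m (r m (Suc i)))\<^sup>2 * (r m (Suc i) - r m i) \<le> (c m)\<^sup>2 * \<delta> m"
        using mesh[OF i(1)] p(2) r_less[OF i(1)] c[of m]
        by (intro mult_mono) (auto simp: abs_le_square_iff[symmetric])
      also have "\<dots> \<le> 1 / (real m + 1)" by (rule \<delta>)
      finally show ?thesis using 1 elim Bd by (simp add: lessThan_Suc_atMost[symmetric])
    qed
    then show ?case by (auto simp: \<theta>_def)
  qed
qed

text \<open>The left endpoint of the cell containing s moves with m. Uniform convergence of I,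
  together with continuity of Y, is what permits evaluation at such moving points.\<close>

lemma left_endpoint_limit:
  assumes s: "0 < s" "s \<le> U" and k: "continuous_on UNIV k"
  shows "(\<lambda>m. left_step (N m) (r m) (\<lambda>i. \<theta> m i * k (X m i)) s) \<longlonglongrightarrow> (k (Y s + A s) :: real)"
proof -
  have "\<exists>i. i < N m \<and> r m i < s \<and> s \<le> r m (Suc i)" for m
    using grid_cell[of "N m" "r m" s] r_less[of _ m] r0[of m] rN[of m] s U(2) by (metis order_trans)
  then obtain j where j: "\<And>m. j m < N m" "\<And>m. r m (j m) < s" "\<And>m. s \<le> r m (Suc (j m))" by metis
  have lim: "(\<lambda>m. r m (j m)) \<longlonglongrightarrow> s"
  proof (rule tendsto_sandwich[of "\<lambda>m. s - \<delta> m" _ _ "\<lambda>_. s"])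
    show "(\<lambda>m. s - \<delta> m) \<longlonglongrightarrow> s" using tendsto_diff[OF tendsto_const \<delta>_lim, of s] by simp
    have "s - \<delta> m \<le> r m (j m)" for m using mesh[OF j(1)[of m]] j(3)[of m] by linarith
    then show "\<forall>\<^sub>F m in sequentially. s - \<delta> m \<le> r m (j m)" by simp
  qed (use j(2) in \<open>auto intro!: always_eventually less_imp_le\<close>)
  have rj: "r m (j m) \<in> {0..T}" for m
    using r_nonneg[of "j m" m] j(1,2)[of m] s U by (simp add: less_imp_le)
  have "(\<lambda>m. I m (r m (j m)) - Y (r m (j m))) \<longlonglongrightarrow> 0"
  proof (rule LIMSEQ_I)
    fix e :: real assume "0 < e"
    with I have "\<forall>\<^sub>F m in sequentially. \<forall>x\<in>{0..T}. dist (I m x) (Y x) < e" by (auto dest: uniform_limitD)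
    then obtain n where "\<forall>m\<ge>n. \<forall>x\<in>{0..T}. \<bar>I m x - Y x\<bar> < e"
      unfolding eventually_sequentially dist_real_def by blast
    then show "\<exists>n. \<forall>m\<ge>n. norm (I m (r m (j m)) - Y (r m (j m)) - 0) < e"
      using rj by (intro exI[of _ n]) simp
  qed
  moreover have "(\<lambda>m. Y (r m (j m))) \<longlonglongrightarrow> Y s"
    by (rule continuous_on_tendsto_compose[OF Y lim]) (use rj s U in auto)
  moreover have "(\<lambda>m. A (r m (j m))) \<longlonglongrightarrow> A s"
  proof (rule LIM_zero_cancel, rule Lim_null_comparison)
    show "\<forall>\<^sub>F m in sequentially. norm (A (r m (j m)) - A s) \<le> C * (s - r m (j m))"
      using A_lipschitz[of "r m (j m)" s for m] j(2) rj
      by (intro always_eventually allI) (simp add: abs_minus_commute less_imp_le)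
    show "(\<lambda>m. C * (s - r m (j m))) \<longlonglongrightarrow> 0"
      using tendsto_mult[OF tendsto_const[of C] tendsto_diff[OF tendsto_const[of s] lim]] by simp
  qed
  ultimately have "(\<lambda>m. (I m (r m (j m)) - Y (r m (j m))) + Y (r m (j m)) + A (r m (j m))) \<longlonglongrightarrow> 0 + Y s + A s"
    by (intro tendsto_add)
  then have "(\<lambda>m. X m (j m)) \<longlonglongrightarrow> Y s + A s" by (simp add: X_def)
  then have "(\<lambda>m. k (X m (j m))) \<longlonglongrightarrow> k (Y s + A s)"
    by (rule continuous_on_tendsto_compose[OF k]) auto
  moreover have "\<forall>\<^sub>F m in sequentially. k (X m (j m)) = left_step (N m) (r m) (\<lambda>i. \<theta> m i * k (X m i)) s"
    using \<theta>_eventually_one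
  proof eventually_elim
    case (elim m)
    then have "\<theta> m (j m) = 1" using j(1)[of m] rj[of m] by simp
    then show ?case using left_step_eq[of "N m" "r m" "j m" s] r_less j by simp
  qed
  ultimately show ?thesis by (rule Lim_transform_eventually)
qed

lemma \<theta>_bounds: "0 \<le> \<theta> m i" "\<theta> m i \<le> 1" by (auto simp: \<theta>_def)

lemma weight_bound: "(\<And>x. \<bar>k x\<bar> \<le> B) \<Longrightarrow> \<bar>\<theta> m i * k x\<bar> \<le> (B :: real)"
  using mult_mono[of "\<theta> m i" 1 "\<bar>k x\<bar>" B] \<theta>_bounds by (simp add: abs_mult)

lemma left_step_outside: "\<not> (0 < s \<and> s \<le> t) \<Longrightarrow> left_step (N m) (r m) y s = 0"
proof -
  assume s: "\<not> (0 < s \<and> s \<le> t)"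
  have "s \<notin> {r m i<..r m (Suc i)}" if "i < N m" for i
    using r_nonneg[of i m] r_le_t[of "Suc i" m] s that by auto
  then show ?thesis unfolding left_step_def by (intro sum.neutral) simp
qed

lemma Z_continuous: "continuous_on {0..U} (\<lambda>s. Y s + A s)"
proof (intro continuous_on_add)
  show "continuous_on {0..U} Y" using Y U by (auto intro: continuous_on_subset)
  have "C-lipschitz_on {0..U} A"
    using A_lipschitz C by (intro lipschitz_on_leI) (auto simp: dist_real_def abs_minus_commute)
  then show "continuous_on {0..U} A" by (rule lipschitz_on_continuous_on)
qed

lemma left_step_integral_limit:
  assumes k: "continuous_on UNIV k" "\<And>x. \<bar>k x\<bar> \<le> B"
    and g: "g \<in> borel_measurable borel" "\<And>s. \<bar>g s\<bar> \<le> D" "\<And>s. T < s \<Longrightarrow> g s = 0"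
  shows "(\<lambda>m. LINT s|lborel. left_step (N m) (r m) (\<lambda>i. \<theta> m i * k (X m i)) s * g s)
      \<longlonglongrightarrow> (LINT s|lborel. indicator {0..U} s *\<^sub>R k (Y s + A s) * g s)"
    and "integrable lborel (\<lambda>s. indicator {0..U} s *\<^sub>R k (Y s + A s) * g s)"
proof -
  have B: "0 \<le> B" using k(2)[of 0] by linarith
  have D: "0 \<le> D" using g(2)[of 0] by linarith
  note [measurable] = g(1)
  have "continuous_on {0..U} (\<lambda>s. k (Y s + A s))"
    by (rule continuous_on_compose2[OF k(1) Z_continuous]) auto
  then have [measurable]: "(\<lambda>s. indicator {0..U} s *\<^sub>R k (Y s + A s)) \<in> borel_measurable borel"
    by (intro borel_measurable_continuous_on_indicator) auto
  let ?L = "\<lambda>m s. left_step (N m) (r m) (\<lambda>i. \<theta> m i * k (X m i)) s"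
  let ?w = "\<lambda>s. B * D * indicator {0..t} s"
  have w: "integrable lborel ?w"
    by (intro integrable_mult_right integrable_real_indicator) (auto simp: emeasure_lborel_Icc_eq)
  have le: "\<bar>?L m s * g s\<bar> \<le> ?w s" for m s
  proof (cases "0 < s \<and> s \<le> t")
    case True
    have "\<bar>?L m s\<bar> \<le> B" using r_less B k(2) by (intro left_step_bounded weight_bound) auto
    then show ?thesis unfolding abs_mult using g(2)[of s] True B by (auto intro!: mult_mono)
  qed (use left_step_outside B D in \<open>auto simp: indicator_def\<close>)
  have conv: "AE s in lborel. (\<lambda>m. ?L m s * g s) \<longlonglongrightarrow> indicator {0..U} s *\<^sub>R k (Y s + A s) * g s"
    using AE_lborel_singleton[of 0]
  proof eventually_elim
    case (elim s)
    show ?case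
    proof (cases "0 < s \<and> s \<le> U")
      case True
      then show ?thesis using tendsto_mult[OF left_endpoint_limit[OF _ _ k(1)] tendsto_const, of s "g s"] by simp
    next
      case False
      \<comment> \<open>Since U is the minimum of t and T, a time after U is either after t, where
        the step function vanishes, or after T, where g does. Times up to 0 lie outside all cells;
        the point 0 itself is removed as a null set.\<close>
      then have "\<not> (0 < s \<and> s \<le> t) \<or> g s = 0" using g(3)[of s] by (auto simp: U_def)
      then have "(\<lambda>m. ?L m s * g s) = (\<lambda>_. 0)" using left_step_outside by auto
      moreover have "s \<notin> {0..U}" using False elim by auto
      ultimately show ?thesis by simp
    qed
  qed
  have "(\<lambda>s. indicator {0..U} s *\<^sub>R k (Y s + A s) * g s) \<in> borel_measurable lborel" by measurable
  then show "(\<lambda>m. LINT s|lborel. ?L m s * g s) \<longlonglongrightarrow> (LINT s|lborel. indicator {0..U} s *\<^sub>R k (Y s + A s) * g s)"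
    by (rule integral_dominated_convergence[OF _ _ w conv]) (use le in auto)
  have "(\<lambda>s. indicator {0..U} s *\<^sub>R k (Y s + A s) * g s) \<in> borel_measurable lborel" by measurable
  then show "integrable lborel (\<lambda>s. indicator {0..U} s *\<^sub>R k (Y s + A s) * g s)"
    by (rule integrable_dominated_convergence[OF _ _ w conv]) (use le in auto)
qed

theorem riemann_sum_limit:
  "(\<lambda>m. \<Sum>i<N m. \<theta> m i * (\<phi>1 (X m i) * (A (r m (Suc i)) - A (r m i))
      + \<phi>2 (X m i) * (p m (r m (Suc i)))\<^sup>2 * (r m (Suc i) - r m i) / 2))
    \<longlonglongrightarrow> (LINT s:{0..U}|lborel. \<phi>1 (Y s + A s) * a s + \<phi>2 (Y s + A s) * (f s)\<^sup>2 / 2)"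
proof -
  let ?L1 = "\<lambda>m s. left_step (N m) (r m) (\<lambda>i. \<theta> m i * \<phi>1 (X m i)) s"
  let ?L2 = "\<lambda>m s. left_step (N m) (r m) (\<lambda>i. \<theta> m i * \<phi>2 (X m i)) s"
  have f'2: "\<bar>(f' s)\<^sup>2\<bar> \<le> C\<^sup>2" for s
    using f'_bound[of s] C by (simp add: abs_le_square_iff[symmetric])
  have cell_int: "set_integrable lborel {r m i<..r m (Suc i)} g"
    if "g \<in> borel_measurable borel" "\<And>s. \<bar>g s\<bar> \<le> B" for g :: "real \<Rightarrow> real" and B m i
    by (rule set_integrable_bounded[where x="r m i" and y="r m (Suc i)" and B=B]) (use that in auto)
  have "(\<lambda>s. (f' s)\<^sup>2) \<in> borel_measurable borel"
    "\<And>s. T < s \<Longrightarrow> (f' s)\<^sup>2 = 0" "\<And>s. T < s \<Longrightarrow> a' s = 0"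
    by (measurable, auto simp: f'_def a'_def)
  note lim1 = left_step_integral_limit[OF continuous(2) bound1 a'_measurable a'_bound this(3)]
    and lim2 = left_step_integral_limit[OF continuous(3) bound2 this(1) f'2 this(2)]
  have "(\<lambda>m. LINT s|lborel. ?L2 m s * ((p m s)\<^sup>2 - (f' s)\<^sup>2)) \<longlonglongrightarrow> 0"
  proof (rule Lim_null_comparison)
    let ?w = "\<lambda>m s. C2 * (indicator {0..U} s * \<bar>(p m s)\<^sup>2 - (f' s)\<^sup>2\<bar> + (c m)\<^sup>2 * indicator {T<..T + \<delta> m} s)"
    show "\<forall>\<^sub>F m in sequentially. norm (LINT s|lborel. ?L2 m s * ((p m s)\<^sup>2 - (f' s)\<^sup>2))
        \<le> C2 * (defect m + 1 / (real m + 1))"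
    proof (intro always_eventually allI)
      fix m
      note [measurable] = p(1)[of m]
      have p2: "(p m s)\<^sup>2 \<le> (c m)\<^sup>2" for s using p(2)[of m s] by (simp add: abs_le_square_iff[symmetric])
      have bd: "\<bar>(p m s)\<^sup>2 - (f' s)\<^sup>2\<bar> \<le> (c m)\<^sup>2 + C\<^sup>2" for s
        using p2[of s] f'2[of s] zero_le_power2[of "p m s"] zero_le_power2[of "f' s"] by linarith
      have i1: "integrable lborel (\<lambda>s. indicator {0..U} s * \<bar>(p m s)\<^sup>2 - (f' s)\<^sup>2\<bar>)"
        using set_integrable_bounded[of "\<lambda>s. \<bar>(p m s)\<^sup>2 - (f' s)\<^sup>2\<bar>" "{0..U}" 0 U] bd
        by (auto simp: set_integrable_def)
      have i2: "integrable lborel (\<lambda>s. (c m)\<^sup>2 * indicator {T<..T + \<delta> m} s :: real)"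
        using \<delta>_pos[of m] by (intro integrable_mult_right integrable_real_indicator) (auto simp: emeasure_lborel_Ioc)
      have w: "integrable lborel (?w m)"
        by (rule integrable_mult_right, rule Bochner_Integration.integrable_add[OF i1 i2])
      have L2: "\<bar>?L2 m s\<bar> \<le> C2" for s
        using r_less C2_nonneg bound2 by (intro left_step_bounded weight_bound) auto
      have le: "\<bar>?L2 m s * ((p m s)\<^sup>2 - (f' s)\<^sup>2)\<bar> \<le> ?w m s" for s
      proof (cases "0 < s \<and> s \<le> t")
        case st: True
        show ?thesis
        proof (cases "s \<le> T")
          case True
          then show ?thesis using mult_right_mono[OF L2[of s], of "\<bar>(p m s)\<^sup>2 - (f' s)\<^sup>2\<bar>"] st
            by (simp add: abs_mult U_def)
        next
          case False
          obtain i where i: "i < N m" "r m i < s" "s \<le> r m (Suc i)"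
            using grid_cell[of "N m" "r m" s] r_less[of _ m] r0[of m] rN[of m] st by metis
          have L: "?L2 m s = \<theta> m i * \<phi>2 (X m i)" using left_step_eq[of "N m" "r m" i s] r_less i by simp
          show ?thesis
          proof (cases "r m i \<le> T")
            case True
            then have "s \<in> {T<..T + \<delta> m}" using i mesh[OF i(1)] False by auto
            moreover have "f' s = 0" using False by (simp add: f'_def)
            ultimately show ?thesis using mult_mono[OF L2[of s] p2[of s]] C2_nonneg False
              by (simp add: abs_mult U_def)
          next
            case False
            then show ?thesis unfolding L using C2_nonneg by (simp add: \<theta>_def)
          qed
        qed
      qed (use left_step_outside C2_nonneg in auto)
      have "norm (LINT s|lborel. ?L2 m s * ((p m s)\<^sup>2 - (f' s)\<^sup>2)) \<le> (LINT s|lborel. ?w m s)"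
      proof (rule Bochner_Integration.integral_norm_bound_integral[OF _ w])
        show "integrable lborel (\<lambda>s. ?L2 m s * ((p m s)\<^sup>2 - (f' s)\<^sup>2))"
          by (rule Bochner_Integration.integrable_bound[OF w])
             (use le in \<open>auto intro: order_trans[OF _ abs_ge_self]\<close>)
      qed (use le in auto)
      also have "\<dots> = C2 * (defect m + (c m)\<^sup>2 * \<delta> m)"
        using i1 i2 \<delta>_pos[of m] by (simp add: set_lebesgue_integral_def)
      also have "\<dots> \<le> C2 * (defect m + 1 / (real m + 1))"
        using \<delta>(2) C2_nonneg by (intro mult_left_mono) auto
      finally show "norm (LINT s|lborel. ?L2 m s * ((p m s)\<^sup>2 - (f' s)\<^sup>2)) \<le> C2 * (defect m + 1 / (real m + 1))" .
    qed
    have "(\<lambda>m. C2 * (defect m + 1 / (real m + 1))) \<longlonglongrightarrow> C2 * (0 + 0)"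
      by (intro tendsto_mult tendsto_const tendsto_add defect_lim)
        (use LIMSEQ_inverse_real_of_nat in \<open>simp add: inverse_eq_divide add.commute\<close>)
    then show "(\<lambda>m. C2 * (defect m + 1 / (real m + 1))) \<longlonglongrightarrow> 0" by simp
  qed
  then have "(\<lambda>m. (LINT s|lborel. ?L1 m s * a' s) + (LINT s|lborel. ?L2 m s * (f' s)\<^sup>2) / 2
        + (LINT s|lborel. ?L2 m s * ((p m s)\<^sup>2 - (f' s)\<^sup>2)) / 2)
      \<longlonglongrightarrow> (LINT s|lborel. indicator {0..U} s *\<^sub>R \<phi>1 (Y s + A s) * a' s)
        + (LINT s|lborel. indicator {0..U} s *\<^sub>R \<phi>2 (Y s + A s) * (f' s)\<^sup>2) / 2 + 0 / 2"
    by (intro tendsto_add tendsto_divide lim1(1) lim2(1) tendsto_const) auto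
  moreover have "(LINT s|lborel. ?L1 m s * a' s) + (LINT s|lborel. ?L2 m s * (f' s)\<^sup>2) / 2
        + (LINT s|lborel. ?L2 m s * ((p m s)\<^sup>2 - (f' s)\<^sup>2)) / 2
      = (\<Sum>i<N m. \<theta> m i * (\<phi>1 (X m i) * (A (r m (Suc i)) - A (r m i))
      + \<phi>2 (X m i) * (p m (r m (Suc i)))\<^sup>2 * (r m (Suc i) - r m i) / 2))" for m
  proof -
    note [measurable] = p(1)[of m]
    have p2: "\<bar>(p m s)\<^sup>2\<bar> \<le> (c m)\<^sup>2" for s using p(2)[of m s] by (simp add: abs_le_square_iff[symmetric])
    have ci: "set_integrable lborel {r m i<..r m (Suc i)} (\<lambda>s. (p m s)\<^sup>2)"
      "set_integrable lborel {r m i<..r m (Suc i)} (\<lambda>s. (f' s)\<^sup>2)"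
      "set_integrable lborel {r m i<..r m (Suc i)} a'" if "i < N m" for i
      using p2 f'2 a'_bound by (auto intro!: cell_int)
    note j1 = left_step_integral[of "N m" "r m", OF r_less ci(1), where y="\<lambda>i. \<theta> m i * \<phi>2 (X m i)"]
      and j2 = left_step_integral(1)[of "N m" "r m", OF r_less ci(2), where y="\<lambda>i. \<theta> m i * \<phi>2 (X m i)"]
      and j3 = left_step_integral(2)[of "N m" "r m", OF r_less ci(3), where y="\<lambda>i. \<theta> m i * \<phi>1 (X m i)"]
    have "(LINT s|lborel. ?L2 m s * ((p m s)\<^sup>2 - (f' s)\<^sup>2))
        = (LINT s|lborel. ?L2 m s * (p m s)\<^sup>2) - (LINT s|lborel. ?L2 m s * (f' s)\<^sup>2)"
      using j1(1) j2 by (simp add: right_diff_distrib)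
    then have "(LINT s|lborel. ?L1 m s * a' s) + (LINT s|lborel. ?L2 m s * (f' s)\<^sup>2) / 2
        + (LINT s|lborel. ?L2 m s * ((p m s)\<^sup>2 - (f' s)\<^sup>2)) / 2
      = (LINT s|lborel. ?L1 m s * a' s) + (LINT s|lborel. ?L2 m s * (p m s)\<^sup>2) / 2" by (simp add: field_simps)
    also have "\<dots> = (\<Sum>i<N m. \<theta> m i * \<phi>1 (X m i) * (A (r m (Suc i)) - A (r m i)))
        + (\<Sum>i<N m. \<theta> m i * \<phi>2 (X m i) * ((p m (r m (Suc i)))\<^sup>2 * (r m (Suc i) - r m i))) / 2"
    proof -
      have "A (r m (Suc i)) - A (r m i) = (LINT s:{r m i<..r m (Suc i)}|lborel. a' s)" if "i < N m" for i
        using that r_nonneg[of i m] r_less[of i m] by (intro A_increment) auto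
      then have "(LINT s|lborel. ?L1 m s * a' s)
          = (\<Sum>i<N m. \<theta> m i * \<phi>1 (X m i) * (A (r m (Suc i)) - A (r m i)))"
        using j3 by simp
      moreover have "(LINT s|lborel. ?L2 m s * (p m s)\<^sup>2)
          = (\<Sum>i<N m. \<theta> m i * \<phi>2 (X m i) * ((p m (r m (Suc i)))\<^sup>2 * (r m (Suc i) - r m i)))"
        using j1(2) by (simp add: cell_integral)
      ultimately show ?thesis by simp
    qed
    also have "\<dots> = (\<Sum>i<N m. \<theta> m i * (\<phi>1 (X m i) * (A (r m (Suc i)) - A (r m i))
      + \<phi>2 (X m i) * (p m (r m (Suc i)))\<^sup>2 * (r m (Suc i) - r m i) / 2))"
      unfolding sum_divide_distrib sum.distrib[symmetric] by (rule sum.cong) (auto simp: algebra_simps)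
    finally show ?thesis .
  qed
  moreover have "(LINT s|lborel. indicator {0..U} s *\<^sub>R \<phi>1 (Y s + A s) * a' s)
        + (LINT s|lborel. indicator {0..U} s *\<^sub>R \<phi>2 (Y s + A s) * (f' s)\<^sup>2) / 2
      = (LINT s:{0..U}|lborel. \<phi>1 (Y s + A s) * a s + \<phi>2 (Y s + A s) * (f s)\<^sup>2 / 2)"
  proof -
    have "(LINT s|lborel. indicator {0..U} s *\<^sub>R \<phi>1 (Y s + A s) * a' s)
        + (LINT s|lborel. indicator {0..U} s *\<^sub>R \<phi>2 (Y s + A s) * (f' s)\<^sup>2) / 2
      = (LINT s|lborel. indicator {0..U} s *\<^sub>R \<phi>1 (Y s + A s) * a' s
        + indicator {0..U} s *\<^sub>R \<phi>2 (Y s + A s) * (f' s)\<^sup>2 / 2)"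
      using lim1(2) lim2(2) by simp
    also have "\<dots> = (LINT s:{0..U}|lborel. \<phi>1 (Y s + A s) * a s + \<phi>2 (Y s + A s) * (f s)\<^sup>2 / 2)"
      unfolding set_lebesgue_integral_def
      by (rule Bochner_Integration.integral_cong) (use U in \<open>auto simp: a'_def f'_def indicator_def\<close>)
    finally show ?thesis .
  qed
  ultimately show ?thesis by simp
qed

end

section \<open>Ito's formula as an inequality\<close>

lemma weighted_telescope:
  fixes \<theta> a :: "nat \<Rightarrow> real"
  assumes "\<And>i. i < n \<Longrightarrow> \<theta> (Suc i) \<le> \<theta> i" "\<And>i. 0 \<le> a i"
  shows "\<theta> n * a (Suc n) \<le> \<theta> 0 * a 0 + (\<Sum>i<Suc n. \<theta> i * (a (Suc i) - a i))"
  using assms(1)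
proof (induction n)
  case (Suc n)
  have "\<theta> (Suc n) * a (Suc n) \<le> \<theta> n * a (Suc n)"
    using Suc.prems[of n] assms(2) by (intro mult_right_mono) auto
  with Suc show ?case by (simp add: algebra_simps)
qed (simp add: algebra_simps)

text \<open>The last term that is counted certifies that the whole sum up to it stays within B, and
  all counted terms are part of that sum. If the last term is not counted, it contributes 0 and
  induction applies.\<close>

lemma sum_within_budget:
  fixes a :: "nat \<Rightarrow> real"
  assumes "\<And>i. i < n \<Longrightarrow> 0 \<le> a i" "0 \<le> B"
  shows "(\<Sum>i<n. of_bool (P i \<and> (\<Sum>j\<le>i. a j) \<le> B) * a i) \<le> B"
  using assms(1)
proof (induction n)
  case (Suc n)
  show ?case
  proof (cases "P n \<and> (\<Sum>j\<le>n. a j) \<le> B")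
    case True
    have "(\<Sum>i<Suc n. of_bool (P i \<and> (\<Sum>j\<le>i. a j) \<le> B) * a i) \<le> (\<Sum>j\<le>n. a j)"
      using Suc.prems by (subst lessThan_Suc_atMost, intro sum_mono) auto
    with True show ?thesis by linarith
  qed (use Suc in auto)
qed (use assms in simp)

context filtered_brownian
begin

lemma W_continuous: "\<omega> \<in> space M \<Longrightarrow> continuous_on {0..} (\<lambda>t. W t \<omega>)"
  using brownian by (simp add: brownian_motion_def)

text \<open>Simple processes and their elementary integrals, seen as functions of time that are only
  constrained between consecutive break points: in this form they can be subtracted and combined
  with arbitrarily fine grids.\<close>

definition step_process ::
    "real set \<Rightarrow> (real \<Rightarrow> 'a \<Rightarrow> real) \<Rightarrow> (real \<Rightarrow> 'a \<Rightarrow> real) \<Rightarrow> bool" where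
  "step_process S p I \<longleftrightarrow>
     finite S \<and> (\<exists>c. \<forall>s. \<forall>\<omega>\<in>space M. \<bar>p s \<omega>\<bar> \<le> c) \<and>
     (\<forall>\<omega>. (\<lambda>s. p s \<omega>) \<in> borel_measurable borel) \<and>
     (\<forall>\<omega>\<in>space M. I 0 \<omega> = 0 \<and> continuous_on {0..} (\<lambda>s. I s \<omega>)) \<and>
     (\<forall>u v. 0 \<le> u \<longrightarrow> u < v \<longrightarrow> {u<..<v} \<inter> S = {} \<longrightarrow>
        p v \<in> borel_measurable (F u) \<and>
        (\<forall>\<omega>\<in>space M. I v \<omega> - I u \<omega> = p v \<omega> * (W v \<omega> - W u \<omega>) \<and> (\<forall>s\<in>{u<..v}. p s \<omega> = p v \<omega>)))"

lemma step_process_diff: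
  assumes "step_process S p I" "step_process S' p' I'"
  shows "step_process (S \<union> S') (\<lambda>s \<omega>. p s \<omega> - p' s \<omega>) (\<lambda>s \<omega>. I s \<omega> - I' s \<omega>)"
proof -
  obtain c c' where c: "\<And>s \<omega>. \<omega> \<in> space M \<Longrightarrow> \<bar>p s \<omega>\<bar> \<le> c" "\<And>s \<omega>. \<omega> \<in> space M \<Longrightarrow> \<bar>p' s \<omega>\<bar> \<le> c'"
    using assms unfolding step_process_def by metis
  have "\<bar>p s \<omega> - p' s \<omega>\<bar> \<le> c + c'" if "\<omega> \<in> space M" for s \<omega>
    using c(1)[OF that, of s] c(2)[OF that, of s] by linarith
  then have "\<forall>s. \<forall>\<omega>\<in>space M. \<bar>p s \<omega> - p' s \<omega>\<bar> \<le> c + c'" by blast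
  moreover have "(\<lambda>\<omega>. p v \<omega> - p' v \<omega>) \<in> borel_measurable (F u) \<and>
      (\<forall>\<omega>\<in>space M. I v \<omega> - I' v \<omega> - (I u \<omega> - I' u \<omega>) = (p v \<omega> - p' v \<omega>) * (W v \<omega> - W u \<omega>)
        \<and> (\<forall>s\<in>{u<..v}. p s \<omega> - p' s \<omega> = p v \<omega> - p' v \<omega>))"
    if uv: "0 \<le> u" "u < v" "{u<..<v} \<inter> (S \<union> S') = {}" for u v
  proof -
    have *: "{u<..<v} \<inter> S = {}" "{u<..<v} \<inter> S' = {}" using uv by auto
    with assms uv have 1: "p v \<in> borel_measurable (F u)"
      "\<And>\<omega>. \<omega> \<in> space M \<Longrightarrow> I v \<omega> - I u \<omega> = p v \<omega> * (W v \<omega> - W u \<omega>) \<and> (\<forall>s\<in>{u<..v}. p s \<omega> = p v \<omega>)"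
      and 2: "p' v \<in> borel_measurable (F u)"
      "\<And>\<omega>. \<omega> \<in> space M \<Longrightarrow> I' v \<omega> - I' u \<omega> = p' v \<omega> * (W v \<omega> - W u \<omega>) \<and> (\<forall>s\<in>{u<..v}. p' s \<omega> = p' v \<omega>)"
      unfolding step_process_def by blast+
    have "I v \<omega> - I' v \<omega> - (I u \<omega> - I' u \<omega>) = (p v \<omega> - p' v \<omega>) * (W v \<omega> - W u \<omega>)"
      if "\<omega> \<in> space M" for \<omega>
      using 1(2)[OF that] 2(2)[OF that] by (simp add: left_diff_distrib)
    moreover have "\<forall>s\<in>{u<..v}. p s \<omega> - p' s \<omega> = p v \<omega> - p' v \<omega>" if "\<omega> \<in> space M" for \<omega>
      using 1(2)[OF that] 2(2)[OF that] by metis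
    moreover have "(\<lambda>\<omega>. p v \<omega> - p' v \<omega>) \<in> borel_measurable (F u)"
      using 1(1) 2(1) by (rule borel_measurable_diff)
    ultimately show ?thesis by blast
  qed
  moreover have "finite (S \<union> S')" "\<forall>\<omega>. (\<lambda>s. p s \<omega> - p' s \<omega>) \<in> borel_measurable borel"
    using assms unfolding step_process_def by (simp_all add: borel_measurable_diff)
  moreover have "I 0 \<omega> - I' 0 \<omega> = 0 \<and> continuous_on {0..} (\<lambda>s. I s \<omega> - I' s \<omega>)" if "\<omega> \<in> space M" for \<omega>
    using assms that unfolding step_process_def by (simp add: continuous_on_diff)
  ultimately show ?thesis unfolding step_process_def by blast
qed

lemma step_process_simple:
  assumes "simple_process M F P"
  shows "\<exists>S. step_process S (simple_val P) (simple_integral P W)"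
proof -
  obtain n s \<xi> where P: "P = (n, s, \<xi>)" by (cases P) auto
  have s0: "0 \<le> s 0" and s_le: "\<And>i. i < n \<Longrightarrow> s i \<le> s (Suc i)"
    and \<xi>: "\<And>i. i < n \<Longrightarrow> \<xi> i \<in> borel_measurable (F (s i))"
      "\<And>i. i < n \<Longrightarrow> \<exists>C. \<forall>\<omega>\<in>space M. \<bar>\<xi> i \<omega>\<bar> \<le> C"
    using assms by (auto simp: P)
  have s_nonneg: "0 \<le> s i" if "i \<le> n" for i
    using that
  proof (induction i)
    case (Suc i)
    then show ?case using s_le[of i] by simp
  qed (use s0 in simp)
  obtain c where c: "\<And>i \<omega>. i < n \<Longrightarrow> \<omega> \<in> space M \<Longrightarrow> \<bar>\<xi> i \<omega>\<bar> \<le> c i" using \<xi>(2) by metis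
  have "step_process (s ` {..n}) (simple_val P) (simple_integral P W)"
    unfolding step_process_def
  proof (intro conjI allI impI ballI)
    show "\<exists>c. \<forall>t. \<forall>\<omega>\<in>space M. \<bar>simple_val P t \<omega>\<bar> \<le> c"
    proof (intro exI allI ballI)
      fix t \<omega> assume w: "\<omega> \<in> space M"
      have "\<bar>simple_val P t \<omega>\<bar> \<le> (\<Sum>i<n. \<bar>\<xi> i \<omega> * indicator {s i<..s (Suc i)} t\<bar>)"
        unfolding P simple_val.simps by (rule sum_abs)
      also have "\<dots> \<le> (\<Sum>i<n. \<bar>c i\<bar>)"
        using c[OF _ w] by (intro sum_mono) (force simp: indicator_def)
      finally show "\<bar>simple_val P t \<omega>\<bar> \<le> (\<Sum>i<n. \<bar>c i\<bar>)" .
    qed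
    show "(\<lambda>t. simple_val P t \<omega>) \<in> borel_measurable borel" for \<omega>
      unfolding P simple_val.simps by measurable
    fix \<omega> assume w: "\<omega> \<in> space M"
    have "min 0 (s i) = 0" if "i \<le> n" for i using s_nonneg[OF that] by simp
    then show "simple_integral P W 0 \<omega> = 0" by (auto simp: P intro!: sum.neutral)
    show "continuous_on {0..} (\<lambda>t. simple_integral P W t \<omega>)"
      unfolding P simple_integral.simps
      by (intro continuous_intros continuous_on_compose2[OF W_continuous[OF w]])
         (use s_nonneg in auto)
  next
    fix u v :: real assume uv: "0 \<le> u" "u < v" "{u<..<v} \<inter> s ` {..n} = {}"
    \<comment> \<open>With no break point inside the open interval, each step of the process either
      covers all of (u, v] or misses it. The terms that survive at v therefore have s i \<le> u,
      which makes the value at the right endpoint known at time u.\<close>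
    have no: "s i \<le> u \<or> v \<le> s i" if "i \<le> n" for i using uv(3) that by (force simp: not_le)
    have ind: "indicator {s i<..s (Suc i)} x = (of_bool (s i \<le> u \<and> v \<le> s (Suc i)) :: real)"
      if "i < n" "u < x" "x \<le> v" for i x
      using no[of i] no[of "Suc i"] that by (auto simp: indicator_def)
    show "simple_val P v \<in> borel_measurable (F u)"
    proof -
      have "(\<lambda>\<omega>. \<xi> i \<omega> * of_bool (s i \<le> u \<and> v \<le> s (Suc i))) \<in> borel_measurable (F u)" if "i < n" for i
      proof (cases "s i \<le> u")
        case True
        then have [measurable]: "\<xi> i \<in> borel_measurable (F u)"
          using measurable_F_mono[OF \<xi>(1)[OF that]] by simp
        show ?thesis by measurable
      qed auto
      then have "(\<lambda>\<omega>. \<Sum>i<n. \<xi> i \<omega> * of_bool (s i \<le> u \<and> v \<le> s (Suc i))) \<in> borel_measurable (F u)"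
        by (intro borel_measurable_sum) auto
      moreover have "simple_val P v = (\<lambda>\<omega>. \<Sum>i<n. \<xi> i \<omega> * of_bool (s i \<le> u \<and> v \<le> s (Suc i)))"
        using ind uv by (auto simp: P fun_eq_iff intro!: sum.cong)
      ultimately show ?thesis by simp
    qed
    fix \<omega> assume w: "\<omega> \<in> space M"
    show "simple_val P x \<omega> = simple_val P v \<omega>" if "x \<in> {u<..v}" for x
      unfolding P simple_val.simps using that ind uv by (intro sum.cong) auto
    show "simple_integral P W v \<omega> - simple_integral P W u \<omega> = simple_val P v \<omega> * (W v \<omega> - W u \<omega>)"
      unfolding P simple_integral.simps simple_val.simps sum_subtractf[symmetric] sum_distrib_right
    proof (rule sum.cong)
      fix i assume i: "i \<in> {..<n}"
      then have "s i \<le> s (Suc i)" using s_le by simp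
      moreover have "s i \<le> u \<or> v \<le> s i" "s (Suc i) \<le> u \<or> v \<le> s (Suc i)" using no i by auto
      ultimately have "W (min v (s (Suc i))) \<omega> - W (min v (s i)) \<omega> - (W (min u (s (Suc i))) \<omega> - W (min u (s i)) \<omega>)
          = indicator {s i<..s (Suc i)} v * (W v \<omega> - W u \<omega>)"
        using uv(2) by (auto simp: min_def indicator_def)
      then show "\<xi> i \<omega> * (W (min v (s (Suc i))) \<omega> - W (min v (s i)) \<omega>)
          - \<xi> i \<omega> * (W (min u (s (Suc i))) \<omega> - W (min u (s i)) \<omega>)
          = \<xi> i \<omega> * indicator {s i<..s (Suc i)} v * (W v \<omega> - W u \<omega>)"
        by (metis mult.assoc right_diff_distrib)
    qed simp
  qed simp
  then show ?thesis by blast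
qed

text \<open>The notion \<open>step_process\<close> constrains only increments between break points.
  Adaptedness follows by adding these up from time 0 along a grid that contains the break
  points.\<close>

lemma step_process_adapted:
  assumes step: "step_process S p I" and t: "0 \<le> t"
  shows "I t \<in> borel_measurable (F t)"
proof (cases "t = 0")
  case True
  have "I 0 \<in> borel_measurable (F 0) \<longleftrightarrow> (\<lambda>_. 0 :: real) \<in> borel_measurable (F 0)"
    by (rule measurable_cong) (use step in \<open>auto simp: step_process_def\<close>)
  then show ?thesis using True by simp
next
  case False
  have "finite S" using step by (simp add: step_process_def)
  then obtain N r where r: "0 < N" "r 0 = 0" "r N = t" "\<And>i. i < N \<Longrightarrow> r i < r (Suc i)"
      "\<And>i. i < N \<Longrightarrow> {r i<..<r (Suc i)} \<inter> S = {}"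
    using grid_exists[of S t 1] t False by (metis le_less zero_less_one)
  have "i \<le> N \<Longrightarrow> I (r i) \<in> borel_measurable (F (r i))" for i
  proof (induction i)
    case 0
    have "I (r 0) \<in> borel_measurable (F (r 0)) \<longleftrightarrow> (\<lambda>_. 0 :: real) \<in> borel_measurable (F (r 0))"
      by (rule measurable_cong) (use step r(2) in \<open>auto simp: step_process_def\<close>)
    then show ?case by simp
  next
    case (Suc i)
    then have i: "i < N" by simp
    have le: "0 \<le> r i" "r i < r (Suc i)" using grid_mono[of N r 0 i] r i by auto
    have cell: "p (r (Suc i)) \<in> borel_measurable (F (r i))"
      "\<And>\<omega>. \<omega> \<in> space M \<Longrightarrow> I (r (Suc i)) \<omega> - I (r i) \<omega> = p (r (Suc i)) \<omega> * (W (r (Suc i)) \<omega> - W (r i) \<omega>)"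
      using step le r(5)[OF i] unfolding step_process_def by blast+
    have [measurable]: "I (r i) \<in> borel_measurable (F (r (Suc i)))" "p (r (Suc i)) \<in> borel_measurable (F (r (Suc i)))"
      "W (r i) \<in> borel_measurable (F (r (Suc i)))" "W (r (Suc i)) \<in> borel_measurable (F (r (Suc i)))"
      using measurable_F_mono[OF Suc.IH] measurable_F_mono[OF cell(1)] measurable_F_mono[OF W_measurable_F]
        W_measurable_F[of "r (Suc i)"] i le by auto
    have "I (r (Suc i)) \<in> borel_measurable (F (r (Suc i))) \<longleftrightarrow>
        (\<lambda>\<omega>. I (r i) \<omega> + p (r (Suc i)) \<omega> * (W (r (Suc i)) \<omega> - W (r i) \<omega>)) \<in> borel_measurable (F (r (Suc i)))"
      by (rule measurable_cong) (use cell(2) in \<open>fastforce simp: algebra_simps\<close>)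
    then show ?case by simp
  qed
  from this[of N] show ?thesis using r by simp
qed

lemma ito_sum:
  fixes T :: "'a \<Rightarrow> real" and N :: nat and r :: "nat \<Rightarrow> real"
  assumes test: "test_function \<phi> \<phi>1 \<phi>2 C1 C2"
    and K: "\<And>x y. \<bar>\<phi>2 x - \<phi>2 y\<bar> \<le> \<epsilon> + K * (x - y)\<^sup>2" "0 \<le> K" "0 < \<epsilon>"
    and step: "step_process S p I"
    and p: "\<And>s \<omega>. \<omega> \<in> space M \<Longrightarrow> \<bar>p s \<omega>\<bar> \<le> c"
    and grid: "0 < N" "r 0 = 0" "r N = t" "\<And>i. i < N \<Longrightarrow> r i < r (Suc i)"
      "\<And>i. i < N \<Longrightarrow> r (Suc i) - r i \<le> \<delta>" "\<And>i. i < N \<Longrightarrow> {r i<..<r (Suc i)} \<inter> S = {}"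
    and T: "\<And>s. 0 \<le> s \<Longrightarrow> {\<omega> \<in> space M. s \<le> T \<omega>} \<in> sets (F s)"
    and A: "\<And>s. 0 \<le> s \<Longrightarrow> A s \<in> borel_measurable (F s)" "\<And>\<omega>. \<omega> \<in> space M \<Longrightarrow> A 0 \<omega> = 0"
      "\<And>\<omega> x y. \<omega> \<in> space M \<Longrightarrow> 0 \<le> x \<Longrightarrow> x \<le> y \<Longrightarrow> \<bar>A y \<omega> - A x \<omega>\<bar> \<le> C * (y - x)"
    and C: "0 \<le> C" and Bd: "0 \<le> Bd"
  defines "\<theta> \<equiv> \<lambda>i \<omega>. of_bool (r i \<le> T \<omega> \<and> (\<Sum>j\<le>i. (p (r (Suc j)) \<omega>)\<^sup>2 * (r (Suc j) - r j)) \<le> Bd) :: real"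
    and "X \<equiv> \<lambda>i \<omega>. I (r i) \<omega> + A (r i) \<omega>"
  defines "R \<equiv> \<lambda>\<omega>. \<Sum>i<N. \<theta> i \<omega> * (\<phi>1 (X i \<omega>) * (A (r (Suc i)) \<omega> - A (r i) \<omega>)
      + \<phi>2 (X i \<omega>) * (p (r (Suc i)) \<omega>)\<^sup>2 * (r (Suc i) - r i) / 2)"
  shows "integrable M (\<lambda>\<omega>. \<theta> (N - 1) \<omega> * \<phi> (X N \<omega>))"
    and "integrable M R" and "\<And>\<omega>. \<omega> \<in> space M \<Longrightarrow> \<bar>R \<omega>\<bar> \<le> C1 * C * t + C2 * Bd / 2"
    and "expectation (\<lambda>\<omega>. \<theta> (N - 1) \<omega> * \<phi> (X N \<omega>)) \<le> expectation R
      + ((C2 / 2 + 1) * \<epsilon> + 12 * K * c\<^sup>2 * \<delta>) * Bd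
      + ((C2 / (2 * \<epsilon>) + C2 / 2 + \<epsilon>) * C\<^sup>2 * \<delta> + 4 * K * C ^ 4 * \<delta> ^ 3) * t"
proof -
  interpret test_function \<phi> \<phi>1 \<phi>2 C1 C2 by (rule test)
  define d where "d = (\<lambda>i. r (Suc i) - r i)"
  have d: "0 < d i" "d i \<le> \<delta>" if "i < N" for i using grid(4,5)[OF that] by (auto simp: d_def)
  have sum_d: "(\<Sum>i<N. d i) = t" unfolding d_def sum_lessThan_telescope using grid by simp
  have r_nonneg: "0 \<le> r i" if "i \<le> N" for i
    using grid_mono[of N r 0 i] grid that by simp
  have step_cell: "p (r (Suc i)) \<in> borel_measurable (F (r i))"
    "\<And>\<omega>. \<omega> \<in> space M \<Longrightarrow> I (r (Suc i)) \<omega> - I (r i) \<omega> = p (r (Suc i)) \<omega> * (W (r (Suc i)) \<omega> - W (r i) \<omega>)"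
    if "i < N" for i
    using step grid(4,6)[OF that] r_nonneg[of i] that unfolding step_process_def by (blast dest: less_imp_le_nat)+
  have X_meas: "X i \<in> borel_measurable (F (r i))" if "i \<le> N" for i
    unfolding X_def using step_process_adapted[OF step r_nonneg[OF that]] A(1)[OF r_nonneg[OF that]]
    by (rule borel_measurable_add)
  \<comment> \<open>All values of p in the sum belong to cells starting no later than
    \<open>r i\<close>, so each is known at \<open>r i\<close>, including the one named by the right
    endpoint of cell i.\<close>
  have \<theta>_meas: "\<theta> i \<in> borel_measurable (F (r i))" if i: "i < N" for i
  proof -
    have "(\<lambda>\<omega>. (p (r (Suc j)) \<omega>)\<^sup>2 * (r (Suc j) - r j)) \<in> borel_measurable (F (r i))" if "j \<le> i" for j
    proof -
      have "r j \<le> r i" using grid_mono[of N r j i] grid(4) that i by simp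
      then have [measurable]: "p (r (Suc j)) \<in> borel_measurable (F (r i))"
        using step_cell(1)[of j] that i by (auto intro: measurable_F_mono)
      show ?thesis by measurable
    qed
    then have [measurable]: "(\<lambda>\<omega>. \<Sum>j\<le>i. (p (r (Suc j)) \<omega>)\<^sup>2 * (r (Suc j) - r j)) \<in> borel_measurable (F (r i))"
      by (intro borel_measurable_sum) auto
    have "{\<omega> \<in> space (F (r i)). r i \<le> T \<omega>} \<in> sets (F (r i))"
      using T[of "r i"] r_nonneg[of i] i by simp
    then have [measurable]: "Measurable.pred (F (r i)) (\<lambda>\<omega>. r i \<le> T \<omega>)" by (simp add: pred_def)
    show ?thesis unfolding \<theta>_def by measurable
  qed
  have \<theta>_01: "0 \<le> \<theta> i \<omega> \<and> \<theta> i \<omega> \<le> 1" for i \<omega> by (simp add: \<theta>_def)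
  have \<theta>_dec: "\<theta> (Suc i) \<omega> \<le> \<theta> i \<omega>" if "Suc i < N" for i \<omega>
  proof -
    have "r i \<le> r (Suc i)" "0 \<le> (p (r (Suc (Suc i))) \<omega>)\<^sup>2 * (r (Suc (Suc i)) - r (Suc i))"
      using grid(4)[of i] grid(4)[of "Suc i"] that by auto
    then show ?thesis unfolding \<theta>_def by auto
  qed
  let ?v = "\<lambda>i \<omega>. A (r (Suc i)) \<omega> - A (r i) \<omega>"
  have v_meas: "?v i \<in> borel_measurable M" if "i < N" for i
    using r_nonneg that by (intro borel_measurable_diff measurable_F_M[OF A(1)]) auto
  have v_bound: "\<bar>?v i \<omega>\<bar> \<le> C * d i" if "i < N" "\<omega> \<in> space M" for i \<omega>
    using A(3)[OF that(2) r_nonneg[of i], of "r (Suc i)"] grid(4)[OF that(1)] that by (simp add: d_def)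
  let ?s = "\<lambda>i \<omega>. \<theta> i \<omega> * (\<phi> (X (Suc i) \<omega>) - \<phi> (X i \<omega>))"
  let ?q = "\<lambda>i \<omega>. \<theta> i \<omega> * (\<phi>1 (X i \<omega>) * ?v i \<omega> + \<phi>2 (X i \<omega>) * (p (r (Suc i)) \<omega>)\<^sup>2 * (r (Suc i) - r i) / 2)"
  let ?e = "\<lambda>i. ((C2 / 2 + 1) * \<epsilon> + 12 * K * c\<^sup>2 * d i) * d i * expectation (\<lambda>\<omega>. \<theta> i \<omega> * (p (r (Suc i)) \<omega>)\<^sup>2)
        + ((C2 / (2 * \<epsilon>) + C2 / 2 + \<epsilon>) * (C * d i)\<^sup>2 + 4 * K * (C * d i) ^ 4)"
  have cell: "integrable M (?s i)" "integrable M (?q i)"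
      "integrable M (\<lambda>\<omega>. \<theta> i \<omega> * (p (r (Suc i)) \<omega>)\<^sup>2)"
      "expectation (?s i) \<le> expectation (?q i) + ?e i" if i: "i < N" for i
  proof -
    have st: "0 \<le> r i" "r i < r (Suc i)" using r_nonneg[of i] grid(4) i by auto
    have X_Suc: "X (Suc i) \<omega> = X i \<omega> + p (r (Suc i)) \<omega> * (W (r (Suc i)) \<omega> - W (r i) \<omega>) + ?v i \<omega>"
      if "\<omega> \<in> space M" for \<omega>
      using step_cell(2)[OF i that] by (simp add: X_def)
    note step = ito_step[OF test st K X_meas[OF less_imp_le[OF i]] step_cell(1)[OF i] p \<theta>_meas[OF i] \<theta>_01
        v_meas[OF i] v_bound[OF i]]
    let ?s' = "\<lambda>\<omega>. \<theta> i \<omega> * (\<phi> (X i \<omega> + p (r (Suc i)) \<omega> * (W (r (Suc i)) \<omega> - W (r i) \<omega>) + ?v i \<omega>) - \<phi> (X i \<omega>))"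
    have eq: "expectation (?s i) = expectation ?s'" "integrable M (?s i) \<longleftrightarrow> integrable M ?s'"
      by (rule Bochner_Integration.integral_cong Bochner_Integration.integrable_cong; use X_Suc in simp)+
    show "integrable M (?s i)" "integrable M (?q i)"
      "integrable M (\<lambda>\<omega>. \<theta> i \<omega> * (p (r (Suc i)) \<omega>)\<^sup>2)"
      "expectation (?s i) \<le> expectation (?q i) + ?e i"
      unfolding eq d_def using step[unfolded d_def] by (simp_all add: add.assoc)
  qed
  have R: "R = (\<lambda>\<omega>. \<Sum>i<N. ?q i \<omega>)" by (simp add: R_def)
  show iR: "integrable M R" unfolding R using cell(2) by (intro Bochner_Integration.integrable_sum) auto
  \<comment> \<open>Weights belong to cells and the values of X to grid points, so the final value
    at N carries the weight of the last cell N - 1. The initial term vanishes because X starts at 0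
    and \<phi> 0 = 0.\<close>
  have tele: "\<theta> (N - 1) \<omega> * \<phi> (X N \<omega>) \<le> (\<Sum>i<N. ?s i \<omega>)" if w: "\<omega> \<in> space M" for \<omega>
  proof -
    have "I 0 \<omega> = 0" using step w by (auto simp: step_process_def)
    then have "\<phi> (X 0 \<omega>) = 0" using A(2)[OF w] zero grid(2) by (simp add: X_def)
    then show ?thesis
      using weighted_telescope[of "N - 1" "\<lambda>i. \<theta> i \<omega>" "\<lambda>i. \<phi> (X i \<omega>)"] \<theta>_dec nonneg grid(1) by simp
  qed
  have i_sum: "integrable M (\<lambda>\<omega>. \<Sum>i<N. ?s i \<omega>)"
    using cell(1) by (intro Bochner_Integration.integrable_sum) auto
  show iL: "integrable M (\<lambda>\<omega>. \<theta> (N - 1) \<omega> * \<phi> (X N \<omega>))"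
  proof (rule Bochner_Integration.integrable_bound[OF i_sum])
    have [measurable]: "\<theta> (N - 1) \<in> borel_measurable M" "X N \<in> borel_measurable M"
      using \<theta>_meas[of "N - 1"] X_meas[of N] grid(1) by (auto intro: measurable_F_M)
    show "(\<lambda>\<omega>. \<theta> (N - 1) \<omega> * \<phi> (X N \<omega>)) \<in> borel_measurable M" by measurable
    show "AE \<omega> in M. norm (\<theta> (N - 1) \<omega> * \<phi> (X N \<omega>)) \<le> norm (\<Sum>i<N. ?s i \<omega>)"
      using tele \<theta>_01 nonneg by (intro AE_I2) (force simp: abs_mult intro: order_trans)
  qed
  have budget: "(\<Sum>i<N. \<theta> i \<omega> * (p (r (Suc i)) \<omega>)\<^sup>2 * d i) \<le> Bd" for \<omega>
    using sum_within_budget[of N "\<lambda>i. (p (r (Suc i)) \<omega>)\<^sup>2 * d i" Bd "\<lambda>i. r i \<le> T \<omega>"] d(1) Bd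
    unfolding \<theta>_def d_def by (simp add: mult.assoc less_imp_le)
  show "\<bar>R \<omega>\<bar> \<le> C1 * C * t + C2 * Bd / 2" if w: "\<omega> \<in> space M" for \<omega>
  proof -
    have "\<bar>R \<omega>\<bar> \<le> (\<Sum>i<N. \<bar>?q i \<omega>\<bar>)" unfolding R by (rule sum_abs)
    also have "\<dots> \<le> (\<Sum>i<N. C1 * C * d i + C2 / 2 * (\<theta> i \<omega> * (p (r (Suc i)) \<omega>)\<^sup>2 * d i))"
    proof (rule sum_mono)
      fix i assume "i \<in> {..<N}"
      then have i: "i < N" by simp
      have "\<bar>\<phi>1 (X i \<omega>) * ?v i \<omega>\<bar> \<le> C1 * (C * d i)"
        unfolding abs_mult using bound1 v_bound[OF i w] C1_nonneg by (intro mult_mono) auto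
      moreover have "\<theta> i \<omega> * \<bar>\<phi>1 (X i \<omega>) * ?v i \<omega>\<bar> \<le> 1 * \<bar>\<phi>1 (X i \<omega>) * ?v i \<omega>\<bar>"
        using \<theta>_01 by (intro mult_right_mono) auto
      ultimately have 1: "\<theta> i \<omega> * \<bar>\<phi>1 (X i \<omega>) * ?v i \<omega>\<bar> \<le> C1 * C * d i" by (simp add: mult.assoc)
      have "\<theta> i \<omega> * \<bar>\<phi>2 (X i \<omega>) * (p (r (Suc i)) \<omega>)\<^sup>2 * (r (Suc i) - r i) / 2\<bar>
          = \<bar>\<phi>2 (X i \<omega>)\<bar> * (\<theta> i \<omega> * (p (r (Suc i)) \<omega>)\<^sup>2 * d i / 2)"
        using d(1)[OF i] by (simp add: abs_mult d_def)
      also have "\<dots> \<le> C2 * (\<theta> i \<omega> * (p (r (Suc i)) \<omega>)\<^sup>2 * d i / 2)"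
        using bound2 \<theta>_01[of i \<omega>] d(1)[OF i] by (intro mult_right_mono) auto
      finally have 2: "\<theta> i \<omega> * \<bar>\<phi>2 (X i \<omega>) * (p (r (Suc i)) \<omega>)\<^sup>2 * (r (Suc i) - r i) / 2\<bar>
          \<le> C2 / 2 * (\<theta> i \<omega> * (p (r (Suc i)) \<omega>)\<^sup>2 * d i)" by simp
      have "\<bar>?q i \<omega>\<bar> \<le> \<theta> i \<omega> * \<bar>\<phi>1 (X i \<omega>) * ?v i \<omega>\<bar>
          + \<theta> i \<omega> * \<bar>\<phi>2 (X i \<omega>) * (p (r (Suc i)) \<omega>)\<^sup>2 * (r (Suc i) - r i) / 2\<bar>"
        unfolding abs_mult[of "\<theta> i \<omega>"] distrib_left[symmetric] using \<theta>_01[of i \<omega>] abs_triangle_ineq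
        by (metis abs_of_nonneg mult_left_mono)
      with 1 2 show "\<bar>?q i \<omega>\<bar> \<le> C1 * C * d i + C2 / 2 * (\<theta> i \<omega> * (p (r (Suc i)) \<omega>)\<^sup>2 * d i)"
        by linarith
    qed
    also have "\<dots> = C1 * C * t + C2 / 2 * (\<Sum>i<N. \<theta> i \<omega> * (p (r (Suc i)) \<omega>)\<^sup>2 * d i)"
      by (simp only: sum.distrib sum_distrib_left[symmetric] sum_d)
    also have "\<dots> \<le> C1 * C * t + C2 / 2 * Bd" using budget C2_nonneg by (intro add_left_mono mult_left_mono) auto
    finally show ?thesis by simp
  qed
  have "expectation (\<lambda>\<omega>. \<theta> (N - 1) \<omega> * \<phi> (X N \<omega>)) \<le> expectation (\<lambda>\<omega>. \<Sum>i<N. ?s i \<omega>)"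
    using iL i_sum tele by (rule integral_mono)
  also have "\<dots> = (\<Sum>i<N. expectation (?s i))" using cell(1) by (intro Bochner_Integration.integral_sum) auto
  also have "\<dots> \<le> (\<Sum>i<N. expectation (?q i) + ?e i)" using cell(4) by (intro sum_mono) auto
  also have "\<dots> = expectation R + (\<Sum>i<N. ?e i)"
    unfolding R sum.distrib using cell(2) by (subst Bochner_Integration.integral_sum) auto
  also have "(\<Sum>i<N. ?e i) \<le> (\<Sum>i<N. ((C2 / 2 + 1) * \<epsilon> + 12 * K * c\<^sup>2 * \<delta>)
        * expectation (\<lambda>\<omega>. \<theta> i \<omega> * (p (r (Suc i)) \<omega>)\<^sup>2 * d i)
      + ((C2 / (2 * \<epsilon>) + C2 / 2 + \<epsilon>) * C\<^sup>2 * \<delta> + 4 * K * C ^ 4 * \<delta> ^ 3) * d i)"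
  proof (intro sum_mono add_mono)
    fix i assume "i \<in> {..<N}"
    then have i: "i < N" by simp
    have E0: "0 \<le> expectation (\<lambda>\<omega>. \<theta> i \<omega> * (p (r (Suc i)) \<omega>)\<^sup>2)"
      using \<theta>_01 by (intro integral_nonneg_AE AE_I2) auto
    have "((C2 / 2 + 1) * \<epsilon> + 12 * K * c\<^sup>2 * d i) * (d i * expectation (\<lambda>\<omega>. \<theta> i \<omega> * (p (r (Suc i)) \<omega>)\<^sup>2))
        \<le> ((C2 / 2 + 1) * \<epsilon> + 12 * K * c\<^sup>2 * \<delta>) * (d i * expectation (\<lambda>\<omega>. \<theta> i \<omega> * (p (r (Suc i)) \<omega>)\<^sup>2))"
      using d[OF i] E0 K(2) by (intro mult_right_mono add_left_mono mult_left_mono) auto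
    then show "((C2 / 2 + 1) * \<epsilon> + 12 * K * c\<^sup>2 * d i) * d i * expectation (\<lambda>\<omega>. \<theta> i \<omega> * (p (r (Suc i)) \<omega>)\<^sup>2)
        \<le> ((C2 / 2 + 1) * \<epsilon> + 12 * K * c\<^sup>2 * \<delta>) * expectation (\<lambda>\<omega>. \<theta> i \<omega> * (p (r (Suc i)) \<omega>)\<^sup>2 * d i)"
      by (simp add: mult_ac)
    have d2: "(d i)\<^sup>2 \<le> \<delta> * d i" using d[OF i] by (simp add: power2_eq_square)
    have "(d i) ^ 3 \<le> \<delta> ^ 3" using d[OF i] by (intro power_mono) auto
    then have d4: "(d i) ^ 4 \<le> \<delta> ^ 3 * d i"
      using d[OF i] mult_right_mono[of "(d i) ^ 3" "\<delta> ^ 3" "d i"] by (simp add: power_Suc2[symmetric] numeral_eq_Suc)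
    have "(C2 / (2 * \<epsilon>) + C2 / 2 + \<epsilon>) * (C * d i)\<^sup>2 + 4 * K * (C * d i) ^ 4
        = (C2 / (2 * \<epsilon>) + C2 / 2 + \<epsilon>) * C\<^sup>2 * (d i)\<^sup>2 + 4 * K * C ^ 4 * (d i) ^ 4"
      by (simp add: power_mult_distrib)
    also have "\<dots> \<le> (C2 / (2 * \<epsilon>) + C2 / 2 + \<epsilon>) * C\<^sup>2 * (\<delta> * d i) + 4 * K * C ^ 4 * (\<delta> ^ 3 * d i)"
      using d2 d4 K C2_nonneg C by (intro add_mono mult_left_mono) auto
    finally show "(C2 / (2 * \<epsilon>) + C2 / 2 + \<epsilon>) * (C * d i)\<^sup>2 + 4 * K * (C * d i) ^ 4
        \<le> ((C2 / (2 * \<epsilon>) + C2 / 2 + \<epsilon>) * C\<^sup>2 * \<delta> + 4 * K * C ^ 4 * \<delta> ^ 3) * d i"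
      by (simp add: distrib_right mult.assoc)
  qed
  also have "\<dots> = ((C2 / 2 + 1) * \<epsilon> + 12 * K * c\<^sup>2 * \<delta>) * expectation (\<lambda>\<omega>. \<Sum>i<N. \<theta> i \<omega> * (p (r (Suc i)) \<omega>)\<^sup>2 * d i)
      + ((C2 / (2 * \<epsilon>) + C2 / 2 + \<epsilon>) * C\<^sup>2 * \<delta> + 4 * K * C ^ 4 * \<delta> ^ 3) * t"
    unfolding sum.distrib sum_distrib_left[symmetric] sum_d
    using cell(3) by (subst Bochner_Integration.integral_sum) auto
  also have "expectation (\<lambda>\<omega>. \<Sum>i<N. \<theta> i \<omega> * (p (r (Suc i)) \<omega>)\<^sup>2 * d i) \<le> Bd"
  proof -
    have "expectation (\<lambda>\<omega>. \<Sum>i<N. \<theta> i \<omega> * (p (r (Suc i)) \<omega>)\<^sup>2 * d i) \<le> expectation (\<lambda>_. Bd)"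
      using cell(3) budget by (intro integral_mono Bochner_Integration.integrable_sum integrable_mult_left) auto
    then show ?thesis by (simp add: prob_space)
  qed
  finally show "expectation (\<lambda>\<omega>. \<theta> (N - 1) \<omega> * \<phi> (X N \<omega>)) \<le> expectation R
      + ((C2 / 2 + 1) * \<epsilon> + 12 * K * c\<^sup>2 * \<delta>) * Bd
      + ((C2 / (2 * \<epsilon>) + C2 / 2 + \<epsilon>) * C\<^sup>2 * \<delta> + 4 * K * C ^ 4 * \<delta> ^ 3) * t"
    using d(1)[OF grid(1)] d(2)[OF grid(1)] K C2_nonneg by (simp add: mult_left_mono)
qed

text \<open>The left side passes to the limit by Fatou's lemma and the right side by dominated
  convergence. The mesh goes to 0 first with \<epsilon> fixed, then \<epsilon> goes to 0. Comparing
  with an integrable majorant Q instead of the limiting integral avoids any measurability question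
  about Y, which is determined only almost surely.\<close>

theorem ito_inequality:
  fixes T :: "'a \<Rightarrow> real" and f a A Y :: "real \<Rightarrow> 'a \<Rightarrow> real" and Z Q :: "'a \<Rightarrow> real"
  assumes test: "test_function \<phi> \<phi>1 \<phi>2 C1 C2"
    and step: "\<And>m. step_process (S m) (p m) (I m)"
    and t: "0 < t" and C: "0 \<le> C"
    and T: "\<And>s. 0 \<le> s \<Longrightarrow> {\<omega> \<in> space M. s \<le> T \<omega>} \<in> sets (F s)"
    and lim: "AE \<omega> in M. 0 \<le> T \<omega> \<longrightarrow>
        uniform_limit {0..T \<omega>} (\<lambda>m s. I m s \<omega>) (\<lambda>s. Y s \<omega>) sequentially \<and>
        (\<lambda>m. \<integral>\<^sup>+ s\<in>{0..T \<omega>}. ennreal ((p m s \<omega> - f s \<omega>)\<^sup>2) \<partial>lborel) \<longlonglongrightarrow> 0"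
    and f: "\<And>\<omega>. \<omega> \<in> space M \<Longrightarrow> continuous_on {0..T \<omega>} (\<lambda>s. f s \<omega>)"
      "\<And>\<omega> s. \<omega> \<in> space M \<Longrightarrow> s \<in> {0..T \<omega>} \<Longrightarrow> \<bar>f s \<omega>\<bar> \<le> C"
    and a: "\<And>\<omega>. \<omega> \<in> space M \<Longrightarrow> continuous_on {0..T \<omega>} (\<lambda>s. a s \<omega>)"
      "\<And>\<omega> s. \<omega> \<in> space M \<Longrightarrow> s \<in> {0..T \<omega>} \<Longrightarrow> \<bar>a s \<omega>\<bar> \<le> C"
    and A: "\<And>s. 0 \<le> s \<Longrightarrow> A s \<in> borel_measurable (F s)"
      "\<And>\<omega> s. \<omega> \<in> space M \<Longrightarrow> 0 \<le> s \<Longrightarrow> A s \<omega> = (LINT u:{0..min s (T \<omega>)}|lborel. a u \<omega>)"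
    and Z: "AE \<omega> in M. t \<le> T \<omega> \<longrightarrow> Z \<omega> = Y t \<omega> + A t \<omega>"
    and Q: "integrable M Q"
      "AE \<omega> in M. (LINT s:{0..min t (T \<omega>)}|lborel. \<phi>1 (Y s \<omega> + A s \<omega>) * a s \<omega>
        + \<phi>2 (Y s \<omega> + A s \<omega>) * (f s \<omega>)\<^sup>2 / 2) \<le> Q \<omega>"
  shows "(\<integral>\<^sup>+ \<omega>. indicator {\<omega>. t \<le> T \<omega>} \<omega> * ennreal (\<phi> (Z \<omega>)) \<partial>M) \<le> ennreal (expectation Q)"
proof -
  interpret test_function \<phi> \<phi>1 \<phi>2 C1 C2 by (rule test)
  obtain c0 where c0: "\<And>m s \<omega>. \<omega> \<in> space M \<Longrightarrow> \<bar>p m s \<omega>\<bar> \<le> c0 m"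
    using step unfolding step_process_def by metis
  obtain \<omega>0 where \<omega>0: "\<omega>0 \<in> space M" using not_empty by blast
  define c where "c = (\<lambda>m. \<bar>c0 m\<bar>)"
  have c: "\<bar>p m s \<omega>\<bar> \<le> c m" if "\<omega> \<in> space M" for m s \<omega>
    using c0[OF that, of m s] by (simp add: c_def)
  define \<delta> where "\<delta> = (\<lambda>m. 1 / ((real m + 1) * ((c m)\<^sup>2 + 1)))"
  have \<delta>0: "0 < \<delta> m" for m unfolding \<delta>_def by (simp add: add_nonneg_pos)
  have pos: "0 < real m + 1" "0 < (c m)\<^sup>2 + 1" for m by (auto simp: add_nonneg_pos)
  have \<delta>: "\<delta> m \<le> 1 / (real m + 1)" "(c m)\<^sup>2 * \<delta> m \<le> 1 / (real m + 1)" for m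
  proof -
    have "1 * (real m + 1) \<le> ((c m)\<^sup>2 + 1) * (real m + 1)" by (intro mult_right_mono) auto
    then show "\<delta> m \<le> 1 / (real m + 1)" unfolding \<delta>_def
      using pos[of m] by (intro divide_left_mono mult_pos_pos) (auto simp: mult.commute)
    have "(c m)\<^sup>2 * \<delta> m = (1 / (real m + 1)) * ((c m)\<^sup>2 / ((c m)\<^sup>2 + 1))" by (simp add: \<delta>_def)
    also have "\<dots> \<le> (1 / (real m + 1)) * 1"
      using pos[of m] by (intro mult_left_mono) auto
    finally show "(c m)\<^sup>2 * \<delta> m \<le> 1 / (real m + 1)" by simp
  qed
  have "\<exists>N r. 0 < N \<and> r 0 = 0 \<and> r N = t \<and> (\<forall>i<N. r i < r (Suc i)) \<and>
      (\<forall>i<N. r (Suc i) - r i \<le> \<delta> m) \<and> (\<forall>i<N. {r i<..<r (Suc i)} \<inter> S m = {})" for m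
  proof -
    have "finite (S m)" using step by (simp add: step_process_def)
    from grid_exists[OF this t \<delta>0[of m]] show ?thesis by metis
  qed
  then obtain N r where N: "\<And>m. 0 < N m" and r0: "\<And>m. r m 0 = (0 :: real)" and rN: "\<And>m. r m (N m) = t"
    and r_less: "\<And>m i. i < N m \<Longrightarrow> r m i < r m (Suc i)"
    and mesh: "\<And>m i. i < N m \<Longrightarrow> r m (Suc i) - r m i \<le> \<delta> m"
    and cells: "\<And>m i. i < N m \<Longrightarrow> {r m i<..<r m (Suc i)} \<inter> S m = {}"
    by metis
  define Bd where "Bd = C\<^sup>2 * t + 1"
  have Bd: "0 \<le> Bd" using t by (simp add: Bd_def)
  have A_zero: "A 0 \<omega> = 0" if "\<omega> \<in> space M" for \<omega>
  proof -
    have "A 0 \<omega> = (LINT u:{0..min 0 (T \<omega>)}|lborel. a u \<omega>)" using A(2)[OF that] by simp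
    also have "\<dots> = 0"
      unfolding set_lebesgue_integral_def
    proof (rule integral_eq_zero_AE)
      show "AE u in lborel. indicator {0..min 0 (T \<omega>)} u *\<^sub>R a u \<omega> = 0"
        using AE_lborel_singleton[of 0] by eventually_elim (auto simp: indicator_def)
    qed
    finally show ?thesis .
  qed
  have A_lip: "\<bar>A y \<omega> - A x \<omega>\<bar> \<le> C * (y - x)" if "\<omega> \<in> space M" "0 \<le> x" "x \<le> y" for \<omega> x y
    using stopped_integral_lipschitz[of "T \<omega>" "\<lambda>s. a s \<omega>" C "\<lambda>s. A s \<omega>" x y]
      a[OF that(1)] A(2)[OF that(1)] that C by blast
  define \<theta> where "\<theta> = (\<lambda>m i \<omega>. of_bool (r m i \<le> T \<omega> \<and>
      (\<Sum>j\<le>i. (p m (r m (Suc j)) \<omega>)\<^sup>2 * (r m (Suc j) - r m j)) \<le> Bd) :: real)"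
  define X where "X = (\<lambda>m i \<omega>. I m (r m i) \<omega> + A (r m i) \<omega>)"
  define R where "R = (\<lambda>m \<omega>. \<Sum>i<N m. \<theta> m i \<omega> * (\<phi>1 (X m i \<omega>) * (A (r m (Suc i)) \<omega> - A (r m i) \<omega>)
      + \<phi>2 (X m i \<omega>) * (p m (r m (Suc i)) \<omega>)\<^sup>2 * (r m (Suc i) - r m i) / 2))"
  define V where "V = (\<lambda>m \<omega>. \<theta> m (N m - 1) \<omega> * \<phi> (X m (N m) \<omega>))"
  have sum: "integrable M (V m)" "integrable M (R m)"
    "\<And>\<omega>. \<omega> \<in> space M \<Longrightarrow> \<bar>R m \<omega>\<bar> \<le> C1 * C * t + C2 * Bd / 2"
    "expectation (V m) \<le> expectation (R m) + ((C2 / 2 + 1) * \<epsilon> + 12 * K * (c m)\<^sup>2 * \<delta> m) * Bd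
      + ((C2 / (2 * \<epsilon>) + C2 / 2 + \<epsilon>) * C\<^sup>2 * \<delta> m + 4 * K * C ^ 4 * \<delta> m ^ 3) * t"
    if K: "\<And>x y. \<bar>\<phi>2 x - \<phi>2 y\<bar> \<le> \<epsilon> + K * (x - y)\<^sup>2" "0 \<le> K" "0 < \<epsilon>" for \<epsilon> K m
  proof -
    note ito = ito_sum[where S="S m" and p="p m" and I="I m" and c="c m" and N="N m" and r="r m" and \<delta>="\<delta> m"
        and T=T and A=A, OF test K step c N r0 rN r_less mesh cells T A(1) A_zero A_lip C Bd]
    show "integrable M (V m)" unfolding V_def \<theta>_def X_def by (rule ito(1))
    show "integrable M (R m)" unfolding R_def \<theta>_def X_def by (rule ito(2))
    show "\<bar>R m \<omega>\<bar> \<le> C1 * C * t + C2 * Bd / 2" if "\<omega> \<in> space M" for \<omega>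
      unfolding R_def \<theta>_def X_def by (rule ito(3)) (use that in auto)
    show "expectation (V m) \<le> expectation (R m) + ((C2 / 2 + 1) * \<epsilon> + 12 * K * (c m)\<^sup>2 * \<delta> m) * Bd
        + ((C2 / (2 * \<epsilon>) + C2 / 2 + \<epsilon>) * C\<^sup>2 * \<delta> m + 4 * K * C ^ 4 * \<delta> m ^ 3) * t"
      unfolding V_def R_def \<theta>_def X_def by (rule ito(4))
  qed
  \<comment> \<open>Integrability and the bound on R do not mention \<epsilon>, so any one choice in
    \<open>sum\<close>, here \<epsilon> = 1, delivers them.\<close>
  have basic: "integrable M (V m)" "integrable M (R m)"
    "\<And>\<omega>. \<omega> \<in> space M \<Longrightarrow> \<bar>R m \<omega>\<bar> \<le> C1 * C * t + C2 * Bd / 2" for m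
  proof -
    obtain K where K: "0 \<le> K" "\<And>x y. \<bar>\<phi>2 x - \<phi>2 y\<bar> \<le> 1 + K * (x - y)\<^sup>2"
      using modulus2[of 1] by auto
    show "integrable M (V m)" "integrable M (R m)"
      "\<And>\<omega>. \<omega> \<in> space M \<Longrightarrow> \<bar>R m \<omega>\<bar> \<le> C1 * C * t + C2 * Bd / 2"
      using sum(1,2,3)[OF K(2,1)] by simp_all
  qed
  have V_nonneg: "0 \<le> V m \<omega>" for m \<omega> unfolding V_def \<theta>_def using nonneg by simp
  have AE_lim: "AE \<omega> in M. (\<lambda>m. max 0 (R m \<omega> - Q \<omega>)) \<longlonglongrightarrow> 0 \<and>
      (t \<le> T \<omega> \<longrightarrow> (\<lambda>m. V m \<omega>) \<longlonglongrightarrow> \<phi> (Z \<omega>))"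
    using lim Z Q(2) AE_space
  proof eventually_elim
    case (elim \<omega>)
    note w = \<open>\<omega> \<in> space M\<close>
    show ?case
    proof (cases "0 \<le> T \<omega>")
      case True
      have cont_Y: "continuous_on {0..T \<omega>} (\<lambda>s. Y s \<omega>)"
      proof (rule uniform_limit_theorem)
        show "uniform_limit {0..T \<omega>} (\<lambda>m s. I m s \<omega>) (\<lambda>s. Y s \<omega>) sequentially" using elim True by simp
        have "continuous_on {0..} (\<lambda>s. I m s \<omega>)" for m using step[of m] w by (simp add: step_process_def)
        then show "\<forall>\<^sub>F m in sequentially. continuous_on {0..T \<omega>} (\<lambda>s. I m s \<omega>)"
          by (intro always_eventually allI) (rule continuous_on_subset[of "{0..}"], auto)
      qed simp
      interpret G: approximating_grids \<phi> \<phi>1 \<phi>2 C1 C2 "T \<omega>" t C Bd "\<lambda>s. f s \<omega>" "\<lambda>s. a s \<omega>"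
        "\<lambda>s. A s \<omega>" "\<lambda>s. Y s \<omega>" "\<lambda>m s. p m s \<omega>" "\<lambda>m s. I m s \<omega>" r N c \<delta>
      proof
        show "uniform_limit {0..T \<omega>} (\<lambda>m s. I m s \<omega>) (\<lambda>s. Y s \<omega>) sequentially"
          "(\<lambda>m. \<integral>\<^sup>+ s\<in>{0..T \<omega>}. ennreal ((p m s \<omega> - f s \<omega>)\<^sup>2) \<partial>lborel) \<longlonglongrightarrow> 0"
          using elim True by auto
        show "p m s \<omega> = p m (r m (Suc i)) \<omega>" if "i < N m" "s \<in> {r m i<..r m (Suc i)}" for m i s
        proof -
          have "0 \<le> r m i" using grid_mono[of "N m" "r m" 0 i] r_less r0 that(1) by simp
          then show ?thesis using step[of m] r_less[OF that(1)] cells[OF that(1)] that(2) w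
            unfolding step_process_def by blast
        qed
        show "(\<lambda>s. p m s \<omega>) \<in> borel_measurable borel" for m using step[of m] by (simp add: step_process_def)
      qed (use True t f a A w cont_Y c r0 rN r_less mesh \<delta> in \<open>auto simp: Bd_def\<close>)
      have eq: "G.\<theta> m i = \<theta> m i \<omega>" "G.X m i = X m i \<omega>" for m i
        by (simp_all add: G.\<theta>_def \<theta>_def G.X_def X_def)
      have "(\<lambda>m. R m \<omega>) \<longlonglongrightarrow> (LINT s:{0..min t (T \<omega>)}|lborel. \<phi>1 (Y s \<omega> + A s \<omega>) * a s \<omega>
        + \<phi>2 (Y s \<omega> + A s \<omega>) * (f s \<omega>)\<^sup>2 / 2)" (is "_ \<longlonglongrightarrow> ?l")
        using G.riemann_sum_limit unfolding eq G.U_def R_def .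
      then have "(\<lambda>m. max 0 (R m \<omega> - Q \<omega>)) \<longlonglongrightarrow> max 0 (?l - Q \<omega>)" by (intro tendsto_intros)
      moreover have "max 0 (?l - Q \<omega>) = 0" using elim by simp
      moreover have "(\<lambda>m. V m \<omega>) \<longlonglongrightarrow> \<phi> (Z \<omega>)" if tT: "t \<le> T \<omega>"
      proof -
        have "(\<lambda>m. I m t \<omega>) \<longlonglongrightarrow> Y t \<omega>"
          using elim True tT t by (intro tendsto_uniform_limitI[OF G.I]) auto
        then have "(\<lambda>m. I m t \<omega> + A t \<omega>) \<longlonglongrightarrow> Z \<omega>" using elim tT by (auto intro!: tendsto_intros)
        then have "(\<lambda>m. \<phi> (I m t \<omega> + A t \<omega>)) \<longlonglongrightarrow> \<phi> (Z \<omega>)"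
          by (rule continuous_on_tendsto_compose[OF continuous(1)]) auto
        moreover have "\<forall>\<^sub>F m in sequentially. \<phi> (I m t \<omega> + A t \<omega>) = V m \<omega>"
          using G.\<theta>_eventually_one
        proof eventually_elim
          case (elim m)
          have "r m (N m - 1) \<le> T \<omega>" using G.r_le_t[of "N m - 1" m] tT by simp
          then have "\<theta> m (N m - 1) \<omega> = 1" using elim N[of m] unfolding eq by simp
          then show ?case by (simp add: V_def X_def rN)
        qed
        ultimately show ?thesis by (rule Lim_transform_eventually)
      qed
      ultimately show ?thesis by simp
    next
      \<comment> \<open>A negative exit time means that nothing may be counted. All grid points are
        at least 0, so every weight vanishes, and Q is nonnegative because the integral it majorizes
        runs over an empty interval.\<close>
      case False
      have "r m i \<ge> 0" if "i < N m" for m i using grid_mono[of "N m" "r m" 0 i] r_less r0 that by simp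
      then have "\<theta> m i \<omega> = 0" if "i < N m" for m i
        using False that unfolding \<theta>_def by (simp, meson order_trans)
      then have "R m \<omega> = 0" for m unfolding R_def by simp
      moreover have "0 \<le> Q \<omega>" using elim False t by (simp add: set_lebesgue_integral_def)
      ultimately show ?thesis using False t by simp
    qed
  qed
  \<comment> \<open>Only the positive part of R - Q matters for an upper bound. It tends to 0 almost
    surely, whereas R - Q itself may converge to something negative.\<close>
  define e where "e = (\<lambda>m. expectation (\<lambda>\<omega>. max 0 (R m \<omega> - Q \<omega>)))"
  have [measurable]: "R m \<in> borel_measurable M" "Q \<in> borel_measurable M" "V m \<in> borel_measurable M" for m
    using basic Q(1) by auto
  have e_lim: "e \<longlonglongrightarrow> 0"
  proof -
    have "(\<lambda>m. expectation (\<lambda>\<omega>. max 0 (R m \<omega> - Q \<omega>))) \<longlonglongrightarrow> expectation (\<lambda>_. 0)"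
    proof (rule integral_dominated_convergence)
      show "integrable M (\<lambda>\<omega>. (C1 * C * t + C2 * Bd / 2) + \<bar>Q \<omega>\<bar>)" using Q(1) by simp
      show "AE \<omega> in M. (\<lambda>m. max 0 (R m \<omega> - Q \<omega>)) \<longlonglongrightarrow> 0" using AE_lim by eventually_elim simp
      show "AE \<omega> in M. norm (max 0 (R m \<omega> - Q \<omega>)) \<le> (C1 * C * t + C2 * Bd / 2) + \<bar>Q \<omega>\<bar>" for m
      proof (rule AE_I2)
        fix \<omega> assume "\<omega> \<in> space M"
        from basic(3)[OF this, of m]
        show "norm (max 0 (R m \<omega> - Q \<omega>)) \<le> (C1 * C * t + C2 * Bd / 2) + \<bar>Q \<omega>\<bar>" by (simp add: max_def) linarith
      qed
    qed auto
    then show ?thesis by (simp add: e_def)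
  qed
  have R_le: "expectation (R m) \<le> expectation Q + e m" for m
  proof -
    have int: "integrable M (\<lambda>\<omega>. max 0 (R m \<omega> - Q \<omega>))" using basic(2)[of m] Q(1) by auto
    have "expectation (R m) \<le> expectation (\<lambda>\<omega>. Q \<omega> + max 0 (R m \<omega> - Q \<omega>))"
      using int Q(1) basic(2)[of m] by (intro integral_mono) auto
    also have "\<dots> = expectation Q + e m" unfolding e_def using int Q(1) by simp
    finally show ?thesis .
  qed
  let ?L = "\<integral>\<^sup>+ \<omega>. indicator {\<omega>. t \<le> T \<omega>} \<omega> * ennreal (\<phi> (Z \<omega>)) \<partial>M"
  have fatou: "?L \<le> liminf (\<lambda>m. ennreal (expectation (V m)))"
  proof -
    have "?L \<le> (\<integral>\<^sup>+ \<omega>. liminf (\<lambda>m. ennreal (V m \<omega>)) \<partial>M)"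
    proof (rule nn_integral_mono_AE)
      show "AE \<omega> in M. indicator {\<omega>. t \<le> T \<omega>} \<omega> * ennreal (\<phi> (Z \<omega>)) \<le> liminf (\<lambda>m. ennreal (V m \<omega>))"
        using AE_lim
      proof eventually_elim
        case (elim \<omega>)
        show ?case
        proof (cases "t \<le> T \<omega>")
          case True
          then have "(\<lambda>m. ennreal (V m \<omega>)) \<longlonglongrightarrow> ennreal (\<phi> (Z \<omega>))" using elim by (auto intro: tendsto_ennrealI)
          then have "liminf (\<lambda>m. ennreal (V m \<omega>)) = ennreal (\<phi> (Z \<omega>))" by (intro lim_imp_Liminf) auto
          with True show ?thesis by simp
        qed simp
      qed
    qed
    also have "\<dots> \<le> liminf (\<lambda>m. \<integral>\<^sup>+ \<omega>. ennreal (V m \<omega>) \<partial>M)" by (rule nn_integral_liminf) simp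
    also have "(\<lambda>m. \<integral>\<^sup>+ \<omega>. ennreal (V m \<omega>) \<partial>M) = (\<lambda>m. ennreal (expectation (V m)))"
      using basic(1) V_nonneg by (auto simp: fun_eq_iff intro!: nn_integral_eq_integral)
    finally show ?thesis .
  qed
  have bound: "?L \<le> ennreal (expectation Q + (C2 / 2 + 1) * \<epsilon> * Bd)" if \<epsilon>: "0 < \<epsilon>" for \<epsilon>
  proof -
    obtain K where K: "0 \<le> K" "\<And>x y. \<bar>\<phi>2 x - \<phi>2 y\<bar> \<le> \<epsilon> + K * (x - y)\<^sup>2" using modulus2[OF \<epsilon>] by auto
    define h where "h = (\<lambda>m. 1 / (real m + 1))"
    have h: "0 \<le> h m" "h m \<le> 1" for m by (auto simp: h_def)
    have h_lim: "h \<longlonglongrightarrow> 0" unfolding h_def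
      using LIMSEQ_inverse_real_of_nat by (simp add: inverse_eq_divide add.commute)
    define G where "G = (C2 / (2 * \<epsilon>) + C2 / 2 + \<epsilon>) * C\<^sup>2"
    have G: "0 \<le> G" using C2_nonneg \<epsilon> by (simp add: G_def)
    define u where "u = (\<lambda>m. expectation Q + e m + ((C2 / 2 + 1) * \<epsilon> + 12 * K * h m) * Bd
      + (G * h m + 4 * K * C ^ 4 * h m) * t)"
    have "expectation (V m) \<le> u m" for m
    proof -
      have "expectation (V m) \<le> expectation (R m) + ((C2 / 2 + 1) * \<epsilon> + 12 * K * (c m)\<^sup>2 * \<delta> m) * Bd
          + (G * \<delta> m + 4 * K * C ^ 4 * \<delta> m ^ 3) * t"
        using sum(4)[OF K(2,1) \<epsilon>] by (simp add: G_def)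
      also have "\<dots> \<le> u m" unfolding u_def
      proof (intro add_mono mult_right_mono order_refl mult_left_mono R_le)
        have "12 * K * ((c m)\<^sup>2 * \<delta> m) \<le> 12 * K * h m"
          using \<delta>(2)[of m] K(1) unfolding h_def by (intro mult_left_mono) auto
        then show "12 * K * (c m)\<^sup>2 * \<delta> m \<le> 12 * K * h m" by (simp add: mult.assoc)
        show le: "\<delta> m \<le> h m" using \<delta>(1) by (simp add: h_def)
        have "\<delta> m \<le> 1" using le h(2) by (rule order_trans)
        have "\<delta> m * \<delta> m ^ 2 \<le> h m * 1"
          using le \<open>\<delta> m \<le> 1\<close> \<delta>0[of m] h[of m] by (intro mult_mono power_le_one) auto
        then show "\<delta> m ^ 3 \<le> h m" by (simp add: power_Suc[symmetric] numeral_3_eq_3 power2_eq_square)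
      qed (use Bd t K G C \<epsilon> C2_nonneg in auto)
      finally show ?thesis .
    qed
    then have "liminf (\<lambda>m. ennreal (expectation (V m))) \<le> liminf (\<lambda>m. ennreal (u m))"
      by (intro Liminf_mono always_eventually allI ennreal_leI)
    also have "\<dots> = ennreal (expectation Q + 0 + ((C2 / 2 + 1) * \<epsilon> + 12 * K * 0) * Bd
      + (G * 0 + 4 * K * C ^ 4 * 0) * t)"
      unfolding u_def by (intro lim_imp_Liminf tendsto_ennrealI tendsto_intros e_lim h_lim) auto
    finally show ?thesis using fatou by simp
  qed
  have "(\<lambda>n. ennreal (expectation Q + (C2 / 2 + 1) * inverse (real (Suc n)) * Bd))
      \<longlonglongrightarrow> ennreal (expectation Q + (C2 / 2 + 1) * 0 * Bd)"
    by (intro tendsto_ennrealI tendsto_intros LIMSEQ_inverse_real_of_nat)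
  then show ?thesis
    using bound[of "inverse (real (Suc n))" for n] by (intro LIMSEQ_le_const) auto
qed

end

section \<open>Stopped processes\<close>

lemma cos_test_function:
  assumes "0 < (R :: real)"
  shows "test_function (\<lambda>x. 2 * R\<^sup>2 * (1 - cos (x / R))) (\<lambda>x. 2 * R * sin (x / R)) (\<lambda>x. 2 * cos (x / R)) (2 * R) 2"
proof
  show "((\<lambda>x. 2 * R\<^sup>2 * (1 - cos (x / R))) has_real_derivative 2 * R * sin (x / R)) (at x)" for x
    using assms by (auto intro!: derivative_eq_intros simp: power2_eq_square)
  show "((\<lambda>x. 2 * R * sin (x / R)) has_real_derivative 2 * cos (x / R)) (at x)" for x
    using assms by (auto intro!: derivative_eq_intros)
  show "\<bar>2 * R * sin (x / R)\<bar> \<le> 2 * R" for x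
    using assms abs_sin_le_one[of "x / R"] by (simp add: abs_mult)
  show "\<bar>2 * cos (x / R)\<bar> \<le> 2" for x
    using abs_cos_le_one[of "x / R"] by (simp add: abs_mult)
  show "uniformly_continuous_on UNIV (\<lambda>x. 2 * cos (x / R))"
  proof (rule lipschitz_on_uniformly_continuous, rule lipschitz_onI)
    fix x y :: real
    have "\<bar>2 * cos (x / R) - 2 * cos (y / R)\<bar> \<le> (2 / R) * \<bar>x - y\<bar>"
    proof (rule field_differentiable_bound[of UNIV "\<lambda>x. 2 * cos (x / R)" "\<lambda>x. - 2 / R * sin (x / R)", simplified real_norm_def])
      show "((\<lambda>x. 2 * cos (x / R)) has_field_derivative - 2 / R * sin (x / R)) (at x within UNIV)" for x
        using assms by (auto intro!: derivative_eq_intros)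
      show "\<bar>- 2 / R * sin (x / R)\<bar> \<le> 2 / R" for x
        using assms abs_sin_le_one[of "x / R"] by (simp add: abs_mult divide_right_mono)
    qed auto
    then show "dist (2 * cos (x / R)) (2 * cos (y / R)) \<le> 2 / R * dist x y" by (simp add: dist_real_def)
  qed (use assms in simp)
qed (use assms in auto)

lemma cos_test_function_limit:
  "(\<lambda>n. 2 * (real (Suc n))\<^sup>2 * (1 - cos (x / real (Suc n)))) \<longlonglongrightarrow> x\<^sup>2"
proof (cases "x = 0")
  case False
  define y where "y = (\<lambda>n. x / (2 * real (Suc n)))"
  have "(\<lambda>n. x / 2 * inverse (real (Suc n))) \<longlonglongrightarrow> x / 2 * 0"
    by (intro tendsto_intros LIMSEQ_inverse_real_of_nat)
  then have "y \<longlonglongrightarrow> 0" unfolding y_def by (simp add: field_simps)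
  moreover have y0: "y n \<noteq> 0" for n using False by (simp add: y_def)
  ultimately have y: "filterlim y (at 0) sequentially" by (simp add: filterlim_at)
  have "((\<lambda>h. sin h / h) \<longlongrightarrow> 1) (at (0 :: real))"
    using DERIV_sin[of "0 :: real"] by (simp add: has_field_derivative_iff)
  then have "(\<lambda>n. sin (y n) / y n) \<longlonglongrightarrow> 1" using y by (rule filterlim_compose)
  then have "(\<lambda>n. x\<^sup>2 * (sin (y n) / y n)\<^sup>2) \<longlonglongrightarrow> x\<^sup>2 * 1\<^sup>2" by (intro tendsto_intros)
  moreover have "2 * (real (Suc n))\<^sup>2 * (1 - cos (x / real (Suc n))) = x\<^sup>2 * (sin (y n) / y n)\<^sup>2" for n
  proof -
    have "x / real (Suc n) = 2 * y n" by (simp add: y_def del: of_nat_Suc)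
    then have "1 - cos (x / real (Suc n)) = 2 * (sin (y n))\<^sup>2" by (simp add: cos_double_sin)
    moreover have "x = 2 * real (Suc n) * y n" by (simp add: y_def del: of_nat_Suc)
    then have "x\<^sup>2 * (sin (y n) / y n)\<^sup>2 = 4 * (real (Suc n))\<^sup>2 * (sin (y n))\<^sup>2"
      using y0[of n] by (simp add: power_mult_distrib power_divide del: of_nat_Suc)
    ultimately show ?thesis by simp
  qed
  ultimately show ?thesis by simp
qed simp

context filtered_brownian
begin

theorem isometry_inequality:
  fixes T :: "'a \<Rightarrow> real" and f Y :: "real \<Rightarrow> 'a \<Rightarrow> real" and Z Q :: "'a \<Rightarrow> real"
  assumes step: "\<And>m. step_process (S m) (p m) (I m)"
    and t: "0 < t" and C: "0 \<le> C"
    and T: "\<And>s. 0 \<le> s \<Longrightarrow> {\<omega> \<in> space M. s \<le> T \<omega>} \<in> sets (F s)"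
    and lim: "AE \<omega> in M. 0 \<le> T \<omega> \<longrightarrow>
        uniform_limit {0..T \<omega>} (\<lambda>m s. I m s \<omega>) (\<lambda>s. Y s \<omega>) sequentially \<and>
        (\<lambda>m. \<integral>\<^sup>+ s\<in>{0..T \<omega>}. ennreal ((p m s \<omega> - f s \<omega>)\<^sup>2) \<partial>lborel) \<longlonglongrightarrow> 0"
    and f: "\<And>\<omega>. \<omega> \<in> space M \<Longrightarrow> continuous_on {0..T \<omega>} (\<lambda>s. f s \<omega>)"
      "\<And>\<omega> s. \<omega> \<in> space M \<Longrightarrow> s \<in> {0..T \<omega>} \<Longrightarrow> \<bar>f s \<omega>\<bar> \<le> C"
    and Z: "Z \<in> borel_measurable M" "AE \<omega> in M. t \<le> T \<omega> \<longrightarrow> Z \<omega> = Y t \<omega>"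
    and Q: "integrable M Q" "AE \<omega> in M. (LINT s:{0..min t (T \<omega>)}|lborel. (f s \<omega>)\<^sup>2) \<le> Q \<omega>"
  shows "(\<integral>\<^sup>+ \<omega>. indicator {\<omega>. t \<le> T \<omega>} \<omega> * ennreal ((Z \<omega>)\<^sup>2) \<partial>M) \<le> ennreal (expectation Q)"
proof -
  let ?\<phi> = "\<lambda>n x. 2 * (real (Suc n))\<^sup>2 * (1 - cos (x / real (Suc n)))"
  have le: "(\<integral>\<^sup>+ \<omega>. indicator {\<omega>. t \<le> T \<omega>} \<omega> * ennreal (?\<phi> n (Z \<omega>)) \<partial>M) \<le> ennreal (expectation Q)" for n
  proof (rule ito_inequality[OF cos_test_function step t C T lim f, where a="\<lambda>_ _. 0" and A="\<lambda>_ _. 0"])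
    show "AE \<omega> in M. (LINT s:{0..min t (T \<omega>)}|lborel. 2 * real (Suc n) * sin ((Y s \<omega> + 0) / real (Suc n)) * 0
        + 2 * cos ((Y s \<omega> + 0) / real (Suc n)) * (f s \<omega>)\<^sup>2 / 2) \<le> Q \<omega>"
      using Q(2) AE_space
    proof eventually_elim
      case (elim \<omega>)
      have "continuous_on {0..min t (T \<omega>)} (\<lambda>s. (f s \<omega>)\<^sup>2)"
        by (intro continuous_intros continuous_on_subset[OF f(1)]) (use elim in auto)
      then have int: "integrable lborel (\<lambda>s. indicator {0..min t (T \<omega>)} s *\<^sub>R (f s \<omega>)\<^sup>2)"
        by (rule borel_integrable_compact[rotated]) simp
      have "(LINT s:{0..min t (T \<omega>)}|lborel. 2 * real (Suc n) * sin ((Y s \<omega> + 0) / real (Suc n)) * 0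
          + 2 * cos ((Y s \<omega> + 0) / real (Suc n)) * (f s \<omega>)\<^sup>2 / 2)
        \<le> (LINT s:{0..min t (T \<omega>)}|lborel. (f s \<omega>)\<^sup>2)"
        unfolding set_lebesgue_integral_def
      proof (rule integral_mono'[OF int])
        fix s
        have "cos (Y s \<omega> / real (Suc n)) * (f s \<omega>)\<^sup>2 \<le> 1 * (f s \<omega>)\<^sup>2" by (intro mult_right_mono) auto
        then show "indicator {0..min t (T \<omega>)} s *\<^sub>R (2 * real (Suc n) * sin ((Y s \<omega> + 0) / real (Suc n)) * 0
          + 2 * cos ((Y s \<omega> + 0) / real (Suc n)) * (f s \<omega>)\<^sup>2 / 2) \<le> indicator {0..min t (T \<omega>)} s *\<^sub>R (f s \<omega>)\<^sup>2"
          by (simp add: indicator_def)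
      qed simp
      with elim show ?case by simp
    qed
  qed (use C Z Q in \<open>auto simp: set_lebesgue_integral_def\<close>)
  have "{\<omega> \<in> space M. t \<le> T \<omega>} \<in> sets M" using T[of t] t sets_F_M by auto
  then have [measurable]: "Measurable.pred M (\<lambda>\<omega>. t \<le> T \<omega>)" by (simp add: pred_def)
  note [measurable] = Z(1)
  have "(\<integral>\<^sup>+ \<omega>. indicator {\<omega>. t \<le> T \<omega>} \<omega> * ennreal ((Z \<omega>)\<^sup>2) \<partial>M)
      = (\<integral>\<^sup>+ \<omega>. liminf (\<lambda>n. indicator {\<omega>. t \<le> T \<omega>} \<omega> * ennreal (?\<phi> n (Z \<omega>))) \<partial>M)"
  proof (rule nn_integral_cong)
    fix \<omega>
    have "(\<lambda>n. ennreal (?\<phi> n (Z \<omega>))) \<longlonglongrightarrow> ennreal ((Z \<omega>)\<^sup>2)"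
      by (intro tendsto_ennrealI cos_test_function_limit)
    then have "liminf (\<lambda>n. ennreal (?\<phi> n (Z \<omega>))) = ennreal ((Z \<omega>)\<^sup>2)" by (intro lim_imp_Liminf) auto
    then show "indicator {\<omega>. t \<le> T \<omega>} \<omega> * ennreal ((Z \<omega>)\<^sup>2)
        = liminf (\<lambda>n. indicator {\<omega>. t \<le> T \<omega>} \<omega> * ennreal (?\<phi> n (Z \<omega>)))"
      by (cases "t \<le> T \<omega>") (auto simp: Liminf_const)
  qed
  also have "\<dots> \<le> liminf (\<lambda>n. \<integral>\<^sup>+ \<omega>. indicator {\<omega>. t \<le> T \<omega>} \<omega> * ennreal (?\<phi> n (Z \<omega>)) \<partial>M)"
    by (rule nn_integral_liminf) measurable
  also have "\<dots> \<le> ennreal (expectation Q)"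
    using le by (intro Liminf_le always_eventually allI) auto
  finally show ?thesis .
qed

text \<open>The events are formulated as s \<le> T because good behaviour on {0..s} is a closed
  condition. It can be tested at the rationals before s, so the event is a countable intersection of
  events in \<open>F s\<close>, for the filtration as given.\<close>

lemma exit_time_exists:
  assumes good: "\<And>r. 0 \<le> r \<Longrightarrow> {\<omega> \<in> space M. good r \<omega>} \<in> sets (F r)"
    and closed: "\<And>\<omega> s. \<omega> \<in> space M \<Longrightarrow> 0 < s \<Longrightarrow> (\<And>r. r \<in> \<rat> \<Longrightarrow> 0 \<le> r \<Longrightarrow> r < s \<Longrightarrow> good r \<omega>) \<Longrightarrow>
      (\<forall>r\<in>{0..s}. good r \<omega>)"
    and B: "0 \<le> B"
  obtains T :: "'a \<Rightarrow> real" where "T \<in> borel_measurable M"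
    "\<And>s. 0 \<le> s \<Longrightarrow> {\<omega> \<in> space M. s \<le> T \<omega>} \<in> sets (F s)"
    "\<And>\<omega> s. \<omega> \<in> space M \<Longrightarrow> 0 \<le> s \<Longrightarrow> s \<le> T \<omega> \<longleftrightarrow> s \<le> B \<and> (\<forall>r\<in>{0..s}. good r \<omega>)"
proof -
  define D where "D = (\<lambda>\<omega>. {s \<in> {0..B}. \<forall>r\<in>{0..s}. good r \<omega>})"
  \<comment> \<open>The value -1 marks paths that are bad already at time 0. For them the interval
    {0..T} is empty and all statements on it are vacuous.\<close>
  define T where "T = (\<lambda>\<omega>. if good 0 \<omega> then Sup (D \<omega>) else - 1)"
  have iff: "s \<le> T \<omega> \<longleftrightarrow> s \<le> B \<and> (\<forall>r\<in>{0..s}. good r \<omega>)" if w: "\<omega> \<in> space M" and s: "0 \<le> s" for \<omega> s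
  proof (cases "good 0 \<omega>")
    case True
    then have D0: "0 \<in> D \<omega>" using B by (auto simp: D_def)
    have bdd: "bdd_above (D \<omega>)" by (rule bdd_aboveI[of _ B]) (auto simp: D_def)
    have S0: "0 \<le> Sup (D \<omega>)" using D0 bdd by (rule cSup_upper)
    have SB: "Sup (D \<omega>) \<le> B" using D0 by (intro cSup_least) (auto simp: D_def)
    have below: "good r \<omega>" if r: "0 \<le> r" "r < Sup (D \<omega>)" for r
    proof -
      obtain d where "d \<in> D \<omega>" "r < d" using r D0 less_cSup_iff[OF _ bdd, of r] by blast
      then show ?thesis using r by (auto simp: D_def)
    qed
    have all: "\<forall>r\<in>{0..Sup (D \<omega>)}. good r \<omega>"
    proof (cases "Sup (D \<omega>) = 0")
      case False
      then show ?thesis using S0 below by (intro closed[OF w]) auto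
    qed (use True in auto)
    have "s \<le> Sup (D \<omega>)" if "s \<le> B" "\<forall>r\<in>{0..s}. good r \<omega>"
      using that s by (intro cSup_upper[OF _ bdd]) (auto simp: D_def)
    moreover have "T \<omega> = Sup (D \<omega>)" using True by (simp add: T_def)
    ultimately show ?thesis using all SB by auto
  next
    case False
    then show ?thesis using s by (auto simp: T_def)
  qed
  have sets_T: "{\<omega> \<in> space M. s \<le> T \<omega>} \<in> sets (F s)" if s: "0 \<le> s" for s
  proof (cases "s = 0")
    case True
    have "{\<omega> \<in> space M. s \<le> T \<omega>} = {\<omega> \<in> space M. good 0 \<omega>}" using iff[of _ 0] B True by auto
    then show ?thesis using good[of 0] True by simp
  next
    case False
    then have s: "0 < s" using s by simp
    show ?thesis
    proof (cases "s \<le> B")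
      case True
      have "{\<omega> \<in> space M. s \<le> T \<omega>} = (\<Inter>r\<in>\<rat> \<inter> {0..<s}. {\<omega> \<in> space M. good r \<omega>})"
      proof (intro set_eqI iffI)
        fix \<omega> assume "\<omega> \<in> (\<Inter>r\<in>\<rat> \<inter> {0..<s}. {\<omega> \<in> space M. good r \<omega>})"
        moreover have "0 \<in> \<rat> \<inter> {0..<s}" using s by auto
        ultimately have "\<omega> \<in> space M" "\<And>r. r \<in> \<rat> \<Longrightarrow> 0 \<le> r \<Longrightarrow> r < s \<Longrightarrow> good r \<omega>" by auto
        then show "\<omega> \<in> {\<omega> \<in> space M. s \<le> T \<omega>}" using closed[of \<omega> s] iff[of \<omega> s] s True by auto
      qed (use iff s in auto)
      moreover have "(\<Inter>r\<in>\<rat> \<inter> {0..<s}. {\<omega> \<in> space M. good r \<omega>}) \<in> sets (F s)"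
      proof (rule sets.countable_INT')
        show "countable (\<rat> \<inter> {0..<s})" using countable_rat by auto
        show "\<rat> \<inter> {0..<s} \<noteq> {}" using s by (auto intro!: exI[of _ 0])
        show "(\<lambda>r. {\<omega> \<in> space M. good r \<omega>}) ` (\<rat> \<inter> {0..<s}) \<subseteq> sets (F s)"
        proof (rule image_subsetI)
          fix r assume "r \<in> \<rat> \<inter> {0..<s}"
          then show "{\<omega> \<in> space M. good r \<omega>} \<in> sets (F s)"
            using good[of r] sets_F_mono[of r s] by auto
        qed
      qed
      ultimately show ?thesis by simp
    next
      case False
      then have "{\<omega> \<in> space M. s \<le> T \<omega>} = {}" using iff[of _ s] s by auto
      then show ?thesis by (metis sets.empty_sets)
    qed
  qed
  have T_cases: "0 \<le> T \<omega> \<or> T \<omega> = - 1" if "\<omega> \<in> space M" for \<omega>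
    using iff[OF that, of 0] B by (auto simp: T_def)
  have "T \<in> borel_measurable M"
  proof (rule borel_measurableI_ge)
    fix s :: real
    consider "s \<le> - 1" | "- 1 < s" "s \<le> 0" | "0 < s" by linarith
    then show "{\<omega> \<in> space M. s \<le> T \<omega>} \<in> sets M"
    proof cases
      case 1
      then have "{\<omega> \<in> space M. s \<le> T \<omega>} = space M" using T_cases by fastforce
      then show ?thesis using sets.top by metis
    next
      case 2
      then have "{\<omega> \<in> space M. s \<le> T \<omega>} = {\<omega> \<in> space M. 0 \<le> T \<omega>}" using T_cases by fastforce
      then show ?thesis using sets_T[of 0] sets_F_M by auto
    next
      case 3
      then show ?thesis using sets_T[of s] sets_F_M by auto
    qed
  qed
  then show thesis using iff sets_T that by blast
qed

end

text \<open>Joint measurability comes from sampling the process at countably many times. Continuity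
  is known only up to T, so the sampling times must not overshoot.\<close>

lemma stopped_process_measurable:
  fixes V :: "real \<Rightarrow> 'a \<Rightarrow> real" and T :: "'a \<Rightarrow> real"
  assumes V: "\<And>s. 0 \<le> s \<Longrightarrow> V s \<in> borel_measurable N" and T [measurable]: "T \<in> borel_measurable N"
    and cont: "\<And>\<omega>. \<omega> \<in> space N \<Longrightarrow> continuous_on {0..T \<omega>} (\<lambda>s. V s \<omega>)"
  shows "(\<lambda>(\<omega>, s). indicator {0..T \<omega>} s * V s \<omega>) \<in> borel_measurable (N \<Otimes>\<^sub>M lborel)"
proof (rule borel_measurable_LIMSEQ_real)
  \<comment> \<open>Rounding down to a multiple of 1 / (n + 1) keeps the sampling time inside {0..T}
    whenever s is there.\<close>
  let ?k = "\<lambda>n s. real (nat \<lfloor>real (Suc n) * s\<rfloor>) / real (Suc n)"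
  let ?V = "\<lambda>n (\<omega>, s). (indicator {0..T \<omega>} s :: real) * V (?k n s) \<omega>"
  show "?V n \<in> borel_measurable (N \<Otimes>\<^sub>M lborel)" for n
  proof -
    have "(\<lambda>(\<omega>, s :: real). V (real i / real (Suc n)) \<omega>) \<in> borel_measurable (N \<Otimes>\<^sub>M lborel)" for i :: nat
    proof -
      have [measurable]: "V (real i / real (Suc n)) \<in> borel_measurable N" by (rule V) simp
      show ?thesis by measurable
    qed
    moreover have "(\<lambda>(\<omega> :: 'a, s). nat \<lfloor>real (Suc n) * s\<rfloor>) \<in> measurable (N \<Otimes>\<^sub>M lborel) (count_space UNIV)"
      by measurable
    ultimately have "(\<lambda>x. (case x of (\<omega>, s :: real) \<Rightarrow> V (real (case x of (\<omega>, s) \<Rightarrow> nat \<lfloor>real (Suc n) * s\<rfloor>) / real (Suc n)) \<omega>))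
        \<in> borel_measurable (N \<Otimes>\<^sub>M lborel)"
      by (rule measurable_compose_countable)
    then have [measurable]: "(\<lambda>(\<omega>, s). V (?k n s) \<omega>) \<in> borel_measurable (N \<Otimes>\<^sub>M lborel)"
      by (simp add: case_prod_unfold)
    have [measurable]: "Measurable.pred (N \<Otimes>\<^sub>M lborel) (\<lambda>(\<omega>, s). 0 \<le> s \<and> s \<le> T \<omega>)" by measurable
    have "(\<lambda>x. (if (case x of (\<omega>, s) \<Rightarrow> 0 \<le> s \<and> s \<le> T \<omega>) then (case x of (\<omega>, s) \<Rightarrow> V (?k n s) \<omega>) else 0))
        \<in> borel_measurable (N \<Otimes>\<^sub>M lborel)" by measurable
    then show ?thesis by (rule measurable_cong[THEN iffD1, rotated]) (auto simp: indicator_def)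
  qed
  fix x :: "'a \<times> real" assume x: "x \<in> space (N \<Otimes>\<^sub>M lborel)"
  obtain \<omega> s where xs: "x = (\<omega>, s)" by (cases x)
  show "(\<lambda>n. ?V n x) \<longlonglongrightarrow> (case x of (\<omega>, s) \<Rightarrow> indicator {0..T \<omega>} s * V s \<omega>)"
  proof (cases "s \<in> {0..T \<omega>}")
    case True
    have fl: "real (Suc n) * s - 1 \<le> real (nat \<lfloor>real (Suc n) * s\<rfloor>)" "real (nat \<lfloor>real (Suc n) * s\<rfloor>) \<le> real (Suc n) * s" for n
    proof -
      have "0 \<le> real (Suc n) * s" using True by simp
      then show "real (Suc n) * s - 1 \<le> real (nat \<lfloor>real (Suc n) * s\<rfloor>)" "real (nat \<lfloor>real (Suc n) * s\<rfloor>) \<le> real (Suc n) * s"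
        by linarith+
    qed
    have k: "?k n s \<le> s" "s - inverse (real (Suc n)) \<le> ?k n s" for n
      using divide_right_mono[OF fl(1)[of n], of "real (Suc n)"] divide_right_mono[OF fl(2)[of n], of "real (Suc n)"]
      by (auto simp: diff_divide_distrib inverse_eq_divide)
    have "(\<lambda>n. ?k n s) \<longlonglongrightarrow> s"
    proof (rule tendsto_sandwich)
      show "(\<lambda>n. s - inverse (real (Suc n))) \<longlonglongrightarrow> s"
        using tendsto_diff[OF tendsto_const LIMSEQ_inverse_real_of_nat, of s] by simp
    qed (use k in \<open>auto simp del: of_nat_Suc\<close>)
    moreover have "?k n s \<in> {0..T \<omega>}" for n using k(1)[of n] True by (auto intro: order_trans)
    moreover have "\<omega> \<in> space N" using x xs by (simp add: space_pair_measure)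
    ultimately have "(\<lambda>n. V (?k n s) \<omega>) \<longlonglongrightarrow> V s \<omega>"
      using True by (intro continuous_on_tendsto_compose[OF cont]) auto
    then show ?thesis using True xs by simp
  qed (simp add: xs)
qed

lemma rational_sequence_below:
  fixes t :: real
  assumes "0 < t"
  obtains x where "\<And>n. x n \<in> \<rat>" "\<And>n. 0 < x n" "\<And>n. x n < t" "x \<longlonglongrightarrow> t"
proof -
  have "\<exists>x\<in>\<rat>. max 0 (t - inverse (real (Suc n))) < x \<and> x < t" for n
    using assms by (intro Rats_dense_in_real) auto
  then obtain x where x: "\<And>n. x n \<in> \<rat>" "\<And>n. max 0 (t - inverse (real (Suc n))) < x n" "\<And>n. x n < t"
    by metis
  have "x \<longlonglongrightarrow> t"
  proof (rule tendsto_sandwich)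
    show "(\<lambda>n. t - inverse (real (Suc n))) \<longlonglongrightarrow> t"
      using tendsto_diff[OF tendsto_const LIMSEQ_inverse_real_of_nat, of t] by simp
    show "\<forall>\<^sub>F n in sequentially. t - inverse (real (Suc n)) \<le> x n"
      using x(2) by (intro always_eventually allI) (metis less_imp_le max_less_iff_conj)
    show "\<forall>\<^sub>F n in sequentially. x n \<le> t" using x(3) by (intro always_eventually allI less_imp_le)
  qed simp
  moreover have "0 < x n" for n using x(2)[of n] by simp
  ultimately show thesis using x that by blast
qed

text \<open>Iterating the inequality yields v t \<le> B (K t)^n / n! for every n, and the right side
  tends to 0. This form suits expectations of stopped processes, which may jump in t where the
  stopping probability does.\<close>

lemma gronwall_bounded_measurable:
  fixes v :: "real \<Rightarrow> real"
  assumes v: "v \<in> borel_measurable borel" "\<And>t. 0 \<le> v t" "\<And>t. v t \<le> B"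
    and K: "0 \<le> K" and le: "\<And>t. 0 < t \<Longrightarrow> v t \<le> K * (LINT s:{0..t}|lborel. v s)"
    and t: "0 < t"
  shows "v t = 0"
proof -
  note [measurable] = v(1)
  have B: "0 \<le> B" using v(2,3)[of 0] by linarith
  have int: "set_integrable lborel {0..t} v" for t
    by (rule set_integrable_bounded[where x=0 and y=t and B=B]) (use v in auto)
  have pw: "set_integrable lborel {0..t} (\<lambda>s. s ^ n)" "(LINT s:{0..t}|lborel. s ^ n) = t ^ Suc n / real (Suc n)"
    if "0 \<le> t" for n and t :: real
  proof -
    show "set_integrable lborel {0..t} (\<lambda>s. s ^ n)"
      unfolding set_integrable_def by (rule borel_integrable_compact) (auto intro!: continuous_intros)
    have "(LINT s:{0..t}|lborel. s ^ n) = (\<integral>s. s ^ n * indicator {0..t} s \<partial>lborel)"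
      unfolding set_lebesgue_integral_def by (rule Bochner_Integration.integral_cong) auto
    then show "(LINT s:{0..t}|lborel. s ^ n) = t ^ Suc n / real (Suc n)"
      using integral_power[OF that, of n] by simp
  qed
  have pow: "\<forall>t>0. v t \<le> B * (K * t) ^ n / fact n" for n
  proof (induction n)
    case (Suc n)
    show ?case
    proof (intro allI impI)
      fix t :: real assume t: "0 < t"
      have "(LINT s:{0..t}|lborel. v s) \<le> (LINT s:{0..t}|lborel. (B * K ^ n / fact n) * s ^ n)"
        unfolding set_lebesgue_integral_def
      proof (rule integral_mono_AE)
        show "integrable lborel (\<lambda>s. indicator {0..t} s *\<^sub>R v s)" using int by (simp add: set_integrable_def)
        show "integrable lborel (\<lambda>s. indicator {0..t} s *\<^sub>R ((B * K ^ n / fact n) * s ^ n))"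
          using set_integrable_mult_right[OF pw(1)[of t n], of "B * K ^ n / fact n"] t by (simp add: set_integrable_def)
        show "AE s in lborel. indicator {0..t} s *\<^sub>R v s \<le> indicator {0..t} s *\<^sub>R ((B * K ^ n / fact n) * s ^ n)"
          using AE_lborel_singleton[of 0]
        proof eventually_elim
          case (elim s)
          show ?case
          proof (cases "s \<in> {0..t}")
            case True
            then have "v s \<le> B * (K * s) ^ n / fact n" using Suc.IH elim by auto
            then show ?thesis using True by (simp add: power_mult_distrib mult.assoc)
          qed simp
        qed
      qed
      also have "\<dots> = (B * K ^ n / fact n) * (t ^ Suc n / real (Suc n))" using pw(2)[of t n] t by simp
      finally have "K * (LINT s:{0..t}|lborel. v s) \<le> K * ((B * K ^ n / fact n) * (t ^ Suc n / real (Suc n)))"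
        using K by (rule mult_left_mono)
      also have "\<dots> = B * (K * t) ^ Suc n / fact (Suc n)" by (simp add: power_mult_distrib field_simps)
      finally show "v t \<le> B * (K * t) ^ Suc n / fact (Suc n)" using le[OF t] by linarith
    qed
  qed (use v in auto)
  have "(\<lambda>n. inverse (fact n) * (K * t) ^ n) \<longlonglongrightarrow> 0"
    using summable_LIMSEQ_zero[OF summable_exp[of "K * t"]] .
  then have "(\<lambda>n. B * (inverse (fact n) * (K * t) ^ n)) \<longlonglongrightarrow> B * 0" by (intro tendsto_intros)
  moreover have "v t \<le> B * (inverse (fact n) * (K * t) ^ n)" for n
    using pow[of n, rule_format, OF t] by (simp add: divide_inverse mult_ac)
  ultimately have "v t \<le> B * 0" by (intro LIMSEQ_le_const) auto
  then show ?thesis using v(2)[of t] by simp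
qed

section \<open>Gronwall for stopped processes and differences of Ito integrals\<close>

context filtered_brownian
begin

text \<open>The expectation of G cut off at T is a bounded measurable function of time, and Fubini's
  theorem turns the expected stopped integral into the integral of that function.\<close>

lemma gronwall_process:
  fixes G :: "real \<Rightarrow> 'a \<Rightarrow> real" and T :: "'a \<Rightarrow> real"
  assumes T [measurable]: "T \<in> borel_measurable M"
    and G: "\<And>s. 0 \<le> s \<Longrightarrow> G s \<in> borel_measurable M"
      "\<And>\<omega>. \<omega> \<in> space M \<Longrightarrow> continuous_on {0..T \<omega>} (\<lambda>s. G s \<omega>)"
      "\<And>\<omega> s. \<omega> \<in> space M \<Longrightarrow> s \<in> {0..T \<omega>} \<Longrightarrow> 0 \<le> G s \<omega> \<and> G s \<omega> \<le> B"
    and G0: "AE \<omega> in M. G 0 \<omega> = 0" and K: "0 \<le> K"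
    and le: "\<And>t. 0 < t \<Longrightarrow> expectation (\<lambda>\<omega>. indicator {0..T \<omega>} t * G t \<omega>)
        \<le> K * expectation (\<lambda>\<omega>. LINT s:{0..min t (T \<omega>)}|lborel. G s \<omega>)"
  shows "AE \<omega> in M. \<forall>t\<in>{0..T \<omega>}. G t \<omega> = 0"
proof -
  let ?g = "\<lambda>\<omega> s. indicator {0..T \<omega>} s * G s \<omega>"
  have [measurable]: "(\<lambda>(\<omega>, s). ?g \<omega> s) \<in> borel_measurable (M \<Otimes>\<^sub>M lborel)"
    using stopped_process_measurable[OF G(1) T G(2)] .
  define B' where "B' = \<bar>B\<bar>"
  have g: "0 \<le> ?g \<omega> s" "?g \<omega> s \<le> B'" if "\<omega> \<in> space M" for \<omega> s
    using G(3)[OF that, of s] by (auto simp: indicator_def B'_def)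
  have B': "0 \<le> B'" by (simp add: B'_def)
  have slice [measurable]: "(\<lambda>\<omega>. ?g \<omega> s) \<in> borel_measurable M" for s
    using measurable_Pair1[of "\<lambda>(\<omega>, s). ?g \<omega> s"] measurable_compose[of "\<lambda>\<omega>. (\<omega>, s)" M "M \<Otimes>\<^sub>M lborel" "\<lambda>(\<omega>, s). ?g \<omega> s" borel]
    by (simp add: measurable_Pair2')
  have int_slice: "integrable M (\<lambda>\<omega>. ?g \<omega> s)" for s
    by (rule integrable_const_bound[where B=B']) (use g in auto)
  define v where "v = (\<lambda>s. expectation (\<lambda>\<omega>. ?g \<omega> s))"
  have v_meas: "v \<in> borel_measurable borel"
  proof -
    have "(\<lambda>(s, \<omega>). ?g \<omega> s) \<in> borel_measurable (lborel \<Otimes>\<^sub>M M)" by measurable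
    from borel_measurable_lebesgue_integral[OF this] show ?thesis by (simp add: v_def)
  qed
  interpret pair_sigma_finite M lborel
    by (intro pair_sigma_finite.intro sigma_finite_measure_axioms sigma_finite_lborel)
  have v0: "0 \<le> v t" for t unfolding v_def using g by (intro integral_nonneg_AE AE_I2)
  have vB: "v t \<le> B'" for t
  proof -
    have "v t \<le> expectation (\<lambda>_. B')" unfolding v_def using int_slice g by (intro integral_mono) auto
    then show ?thesis by (simp add: prob_space)
  qed
  have fubini: "expectation (\<lambda>\<omega>. LINT s:{0..min t (T \<omega>)}|lborel. G s \<omega>) = (LINT s:{0..t}|lborel. v s)" for t
  proof -
    have int: "integrable (M \<Otimes>\<^sub>M lborel) (\<lambda>(\<omega>, s). indicator {0..t} s * ?g \<omega> s)"
    proof (rule Bochner_Integration.integrable_bound)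
      show "integrable (M \<Otimes>\<^sub>M lborel) (\<lambda>x. B' * indicator (space M \<times> {0..t}) x)"
        by (intro integrable_mult_right integrable_real_indicator)
           (auto simp: lborel.emeasure_pair_measure_Times emeasure_space_1 emeasure_lborel_Icc_eq)
      show "AE x in M \<Otimes>\<^sub>M lborel. norm (case x of (\<omega>, s) \<Rightarrow> indicator {0..t} s * ?g \<omega> s)
          \<le> norm (B' * indicator (space M \<times> {0..t}) x)"
      proof (rule AE_I2)
        fix x :: "'a \<times> real" assume "x \<in> space (M \<Otimes>\<^sub>M lborel)"
        then obtain \<omega> s where x: "x = (\<omega>, s)" "\<omega> \<in> space M" by (auto simp: space_pair_measure)
        show "norm (case x of (\<omega>, s) \<Rightarrow> indicator {0..t} s * ?g \<omega> s) \<le> norm (B' * indicator (space M \<times> {0..t}) x)"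
          using g[OF x(2), of s] B' x by (cases "s \<in> {0..t}") auto
      qed
    qed measurable
    have "expectation (\<lambda>\<omega>. LINT s:{0..min t (T \<omega>)}|lborel. G s \<omega>)
        = expectation (\<lambda>\<omega>. \<integral>s. indicator {0..t} s * ?g \<omega> s \<partial>lborel)"
      unfolding set_lebesgue_integral_def
      by (intro Bochner_Integration.integral_cong) (auto simp: indicator_def)
    also have "\<dots> = (\<integral>s. expectation (\<lambda>\<omega>. indicator {0..t} s * ?g \<omega> s) \<partial>lborel)"
      using Fubini_integral[OF int] by simp
    also have "\<dots> = (LINT s:{0..t}|lborel. v s)"
      unfolding set_lebesgue_integral_def v_def by simp
    finally show ?thesis .
  qed
  have v_zero: "v t = 0" if "0 < t" for t
    by (rule gronwall_bounded_measurable[OF v_meas v0 vB K _ that]) (use le fubini in \<open>auto simp: v_def\<close>)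
  have "AE \<omega> in M. ?g \<omega> t = 0" if "0 < t" for t
    using v_zero[OF that] integral_nonneg_eq_0_iff_AE[OF int_slice[of t]] g unfolding v_def by auto
  \<comment> \<open>Each fixed time has its own exceptional set, so the conclusion is first drawn at
    positive rationals and then extended by left limits along the continuous path. Time 0 is covered
    by its own hypothesis.\<close>
  then have "AE \<omega> in M. \<forall>t\<in>\<rat> \<inter> {0<..}. ?g \<omega> t = 0"
    by (subst AE_ball_countable) (use countable_rat in auto)
  then show ?thesis using G0 AE_space
  proof eventually_elim
    case (elim \<omega>)
    show ?case
    proof
      fix t assume t: "t \<in> {0..T \<omega>}"
      show "G t \<omega> = 0"
      proof (cases "t = 0")
        case False
        then have "0 < t" using t by simp
        then obtain x where x: "\<And>n. x n \<in> \<rat>" "\<And>n. 0 < x n" "\<And>n. x n < t" "x \<longlonglongrightarrow> t"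
          using rational_sequence_below by metis
        note x(4)
        moreover have x_mem: "x n \<in> {0..T \<omega>}" for n using x(2,3)[of n] t by simp
        ultimately have "(\<lambda>n. G (x n) \<omega>) \<longlonglongrightarrow> G t \<omega>"
          using elim t by (intro continuous_on_tendsto_compose[OF G(2)]) auto
        moreover have "G (x n) \<omega> = 0" for n
          using elim x(1)[of n] x(2)[of n] x_mem[of n] by (auto simp: indicator_def)
        ultimately show ?thesis by (simp add: LIMSEQ_const_iff)
      qed (use elim in simp)
    qed
  qed
qed

text \<open>As \<open>T\<close> itself is not \<open>F t\<close>-measurable, the proof replaces it by \<open>T'\<close>, which stops at the same
  moments up to time \<open>t\<close>.\<close>

lemma stopped_integral_adapted:
  fixes a :: "real \<Rightarrow> 'a \<Rightarrow> real" and T :: "'a \<Rightarrow> real"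
  assumes a: "\<And>s. 0 \<le> s \<Longrightarrow> a s \<in> borel_measurable (F s)"
      "\<And>\<omega>. \<omega> \<in> space M \<Longrightarrow> continuous_on {0..T \<omega>} (\<lambda>s. a s \<omega>)"
    and T: "\<And>s. 0 \<le> s \<Longrightarrow> {\<omega> \<in> space M. s \<le> T \<omega>} \<in> sets (F s)"
    and t: "0 \<le> t"
  shows "(\<lambda>\<omega>. LINT u:{0..min t (T \<omega>)}|lborel. a u \<omega>) \<in> borel_measurable (F t)"
proof -
  define T' where "T' = (\<lambda>\<omega>. if 0 \<le> T \<omega> then min t (T \<omega>) else - 1)"
  have T'_meas: "T' \<in> borel_measurable (F t)"
  proof (rule borel_measurableI_ge)
    fix s
    have *: "{\<omega> \<in> space M. r \<le> T \<omega>} \<in> sets (F t)" if "0 \<le> r" "r \<le> t" for r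
      using T[OF that(1)] sets_F_mono[OF that(2)] by blast
    consider "s \<le> - 1" | "- 1 < s" "s \<le> 0" | "0 < s" "s \<le> t" | "t < s" "0 < s" using t by linarith
    then show "{\<omega> \<in> space (F t). s \<le> T' \<omega>} \<in> sets (F t)"
    proof cases
      case 1
      then have "{\<omega> \<in> space (F t). s \<le> T' \<omega>} = space (F t)" using t by (auto simp: T'_def)
      then show ?thesis using sets.top by metis
    next
      case 2
      then have "{\<omega> \<in> space (F t). s \<le> T' \<omega>} = {\<omega> \<in> space M. 0 \<le> T \<omega>}" using t by (auto simp: T'_def)
      then show ?thesis using *[of 0] t by simp
    next
      case 3
      then have "{\<omega> \<in> space (F t). s \<le> T' \<omega>} = {\<omega> \<in> space M. s \<le> T \<omega>}" by (auto simp: T'_def)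
      then show ?thesis using *[of s] 3 by simp
    next
      case 4
      then have "{\<omega> \<in> space (F t). s \<le> T' \<omega>} = {}" using t by (auto simp: T'_def)
      then show ?thesis by (metis sets.empty_sets)
    qed
  qed
  \<comment> \<open>Evaluating at the minimum of s and t keeps all sampled values measurable at time
    t, and it changes nothing on {0..T'}, since T' \<le> t.\<close>
  have "(\<lambda>(\<omega>, s). indicator {0..T' \<omega>} s * a (min s t) \<omega>) \<in> borel_measurable (F t \<Otimes>\<^sub>M lborel)"
  proof (rule stopped_process_measurable[OF _ T'_meas])
    show "a (min s t) \<in> borel_measurable (F t)" if "0 \<le> s" for s
      using a(1)[of "min s t"] that t by (auto intro: measurable_F_mono)
    fix \<omega> assume "\<omega> \<in> space (F t)"
    then have "continuous_on {0..T' \<omega>} (\<lambda>s. a s \<omega>)"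
      using a(2)[of \<omega>] by (auto simp: T'_def intro: continuous_on_subset)
    then show "continuous_on {0..T' \<omega>} (\<lambda>s. a (min s t) \<omega>)"
      by (rule continuous_on_eq) (auto simp: T'_def split: if_splits)
  qed
  from lborel.borel_measurable_lebesgue_integral[OF this]
  have "(\<lambda>\<omega>. \<integral>s. indicator {0..T' \<omega>} s * a (min s t) \<omega> \<partial>lborel) \<in> borel_measurable (F t)" by simp
  moreover have "(\<integral>s. indicator {0..T' \<omega>} s * a (min s t) \<omega> \<partial>lborel) = (LINT u:{0..min t (T \<omega>)}|lborel. a u \<omega>)" for \<omega>
    unfolding set_lebesgue_integral_def
    by (rule Bochner_Integration.integral_cong) (use t in \<open>auto simp: T'_def indicator_def min_def\<close>)
  ultimately show ?thesis by simp
qed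

text \<open>Both integrals are driven by the same W, so the differences of their simple approximants
  approximate the difference of the integrands. The interval {0..T} lies strictly before both
  lifetimes, hence both approximations are valid on it.\<close>

lemma ito_integral_difference:
  fixes T :: "'a \<Rightarrow> real"
  assumes ito: "has_ito_integral_before M F \<tau> W f Y" "has_ito_integral_before M F \<tau>' W f' Y'"
    and T: "\<And>\<omega>. \<omega> \<in> space M \<Longrightarrow> 0 \<le> T \<omega> \<Longrightarrow> ereal (T \<omega>) < \<tau> \<omega> \<and> ereal (T \<omega>) < \<tau>' \<omega>"
    and cont: "\<And>\<omega>. \<omega> \<in> space M \<Longrightarrow> continuous_on {0..T \<omega>} (\<lambda>s. f s \<omega>)"
      "\<And>\<omega>. \<omega> \<in> space M \<Longrightarrow> continuous_on {0..T \<omega>} (\<lambda>s. f' s \<omega>)"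
  obtains S p I where "\<And>m. step_process (S m) (p m) (I m)"
    "AE \<omega> in M. 0 \<le> T \<omega> \<longrightarrow>
        uniform_limit {0..T \<omega>} (\<lambda>m s. I m s \<omega>) (\<lambda>s. Y s \<omega> - Y' s \<omega>) sequentially \<and>
        (\<lambda>m. \<integral>\<^sup>+ s\<in>{0..T \<omega>}. ennreal ((p m s \<omega> - (f s \<omega> - f' s \<omega>))\<^sup>2) \<partial>lborel) \<longlonglongrightarrow> 0"
proof -
  obtain P where P: "\<And>m. simple_process M F (P m)"
    "AE \<omega> in M. \<forall>T\<ge>0. ereal T < \<tau> \<omega> \<longrightarrow>
      ((\<lambda>m. \<integral>\<^sup>+ s\<in>{0..T}. ennreal ((simple_val (P m) s \<omega> - f s \<omega>)\<^sup>2) \<partial>lborel) \<longlonglongrightarrow> 0) \<and>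
      uniform_limit {0..T} (\<lambda>m t. simple_integral (P m) W t \<omega>) (\<lambda>t. Y t \<omega>) sequentially"
    using ito(1) unfolding has_ito_integral_before_def by blast
  obtain P' where P': "\<And>m. simple_process M F (P' m)"
    "AE \<omega> in M. \<forall>T\<ge>0. ereal T < \<tau>' \<omega> \<longrightarrow>
      ((\<lambda>m. \<integral>\<^sup>+ s\<in>{0..T}. ennreal ((simple_val (P' m) s \<omega> - f' s \<omega>)\<^sup>2) \<partial>lborel) \<longlonglongrightarrow> 0) \<and>
      uniform_limit {0..T} (\<lambda>m t. simple_integral (P' m) W t \<omega>) (\<lambda>t. Y' t \<omega>) sequentially"
    using ito(2) unfolding has_ito_integral_before_def by blast
  obtain S S' where S: "\<And>m. step_process (S m) (simple_val (P m)) (simple_integral (P m) W)"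
    "\<And>m. step_process (S' m) (simple_val (P' m)) (simple_integral (P' m) W)"
    using step_process_simple[OF P(1)] step_process_simple[OF P'(1)] by metis
  show thesis
  proof (rule that[OF step_process_diff[OF S]])
    show "AE \<omega> in M. 0 \<le> T \<omega> \<longrightarrow>
        uniform_limit {0..T \<omega>} (\<lambda>m s. simple_integral (P m) W s \<omega> - simple_integral (P' m) W s \<omega>) (\<lambda>s. Y s \<omega> - Y' s \<omega>) sequentially \<and>
        (\<lambda>m. \<integral>\<^sup>+ s\<in>{0..T \<omega>}. ennreal ((simple_val (P m) s \<omega> - simple_val (P' m) s \<omega> - (f s \<omega> - f' s \<omega>))\<^sup>2) \<partial>lborel) \<longlonglongrightarrow> 0"
      using P(2) P'(2) AE_space
    proof eventually_elim
      case (elim \<omega>)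
      show ?case
      proof (intro impI conjI)
        assume T0: "0 \<le> T \<omega>"
        let ?p = "\<lambda>m s. simple_val (P m) s \<omega>" and ?p' = "\<lambda>m s. simple_val (P' m) s \<omega>"
        let ?n = "\<lambda>p f m. \<integral>\<^sup>+ s\<in>{0..T \<omega>}. ennreal ((p m s - f s \<omega>)\<^sup>2) \<partial>lborel"
        have lim: "?n ?p f \<longlonglongrightarrow> 0" "?n ?p' f' \<longlonglongrightarrow> 0"
          "uniform_limit {0..T \<omega>} (\<lambda>m t. simple_integral (P m) W t \<omega>) (\<lambda>t. Y t \<omega>) sequentially"
          "uniform_limit {0..T \<omega>} (\<lambda>m t. simple_integral (P' m) W t \<omega>) (\<lambda>t. Y' t \<omega>) sequentially"
          using elim T0 T[of \<omega>] by auto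
        show "uniform_limit {0..T \<omega>} (\<lambda>m s. simple_integral (P m) W s \<omega> - simple_integral (P' m) W s \<omega>) (\<lambda>s. Y s \<omega> - Y' s \<omega>) sequentially"
          using lim(3,4) by (rule uniform_limit_minus)
        have [measurable]: "?p m \<in> borel_measurable borel" "?p' m \<in> borel_measurable borel" for m
          using S unfolding step_process_def by blast+
        \<comment> \<open>Continuity on {0..T} makes the truncated integrands Borel in time, which
          is what adding the two nonnegative integrals requires.\<close>
        define h where "h = (\<lambda>s. indicator {0..T \<omega>} s *\<^sub>R f s \<omega>)"
        define h' where "h' = (\<lambda>s. indicator {0..T \<omega>} s *\<^sub>R f' s \<omega>)"
        have [measurable]: "h \<in> borel_measurable borel" "h' \<in> borel_measurable borel"
          unfolding h_def h'_def by (intro borel_measurable_continuous_on_indicator cont; use elim in simp)+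
        have le: "(\<integral>\<^sup>+ s\<in>{0..T \<omega>}. ennreal ((?p m s - ?p' m s - (f s \<omega> - f' s \<omega>))\<^sup>2) \<partial>lborel)
            \<le> 2 * ?n ?p f m + 2 * ?n ?p' f' m" for m
        proof -
          have n_eq: "?n ?p f m = (\<integral>\<^sup>+ s. ennreal (indicator {0..T \<omega>} s * (?p m s - h s)\<^sup>2) \<partial>lborel)"
            "?n ?p' f' m = (\<integral>\<^sup>+ s. ennreal (indicator {0..T \<omega>} s * (?p' m s - h' s)\<^sup>2) \<partial>lborel)"
            unfolding h_def h'_def by (intro nn_integral_cong; auto simp: indicator_def)+
          have "(\<integral>\<^sup>+ s\<in>{0..T \<omega>}. ennreal ((?p m s - ?p' m s - (f s \<omega> - f' s \<omega>))\<^sup>2) \<partial>lborel)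
              \<le> (\<integral>\<^sup>+ s. 2 * ennreal (indicator {0..T \<omega>} s * (?p m s - h s)\<^sup>2)
                + 2 * ennreal (indicator {0..T \<omega>} s * (?p' m s - h' s)\<^sup>2) \<partial>lborel)"
          proof (rule nn_integral_mono)
            fix s :: real
            have "(x - y)\<^sup>2 \<le> 2 * x\<^sup>2 + 2 * y\<^sup>2" for x y :: real
              using zero_le_power2[of "x + y"] by (simp add: power2_eq_square algebra_simps)
            from this[of "?p m s - f s \<omega>" "?p' m s - f' s \<omega>"]
            have "ennreal ((?p m s - ?p' m s - (f s \<omega> - f' s \<omega>))\<^sup>2)
                \<le> ennreal (2 * (?p m s - f s \<omega>)\<^sup>2 + 2 * (?p' m s - f' s \<omega>)\<^sup>2)"
              by (intro ennreal_leI) (simp add: algebra_simps)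
            also have "\<dots> = 2 * ennreal ((?p m s - f s \<omega>)\<^sup>2) + 2 * ennreal ((?p' m s - f' s \<omega>)\<^sup>2)"
              by (simp add: ennreal_plus ennreal_mult)
            finally show "ennreal ((?p m s - ?p' m s - (f s \<omega> - f' s \<omega>))\<^sup>2) * indicator {0..T \<omega>} s
              \<le> 2 * ennreal (indicator {0..T \<omega>} s * (?p m s - h s)\<^sup>2)
                + 2 * ennreal (indicator {0..T \<omega>} s * (?p' m s - h' s)\<^sup>2)"
              by (cases "s \<in> {0..T \<omega>}") (auto simp: h_def h'_def)
          qed
          also have "\<dots> = 2 * ?n ?p f m + 2 * ?n ?p' f' m"
            unfolding n_eq by (subst nn_integral_add) (auto simp: nn_integral_cmult)
          finally show ?thesis .
        qed
        have "(\<lambda>m. 2 * ?n ?p f m + 2 * ?n ?p' f' m) \<longlonglongrightarrow> 2 * 0 + 2 * 0"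
          by (intro tendsto_add ennreal_tendsto_cmult lim(1,2)) auto
        then have "(\<lambda>m. 2 * ?n ?p f m + 2 * ?n ?p' f' m) \<longlonglongrightarrow> 0" by simp
        then show "(\<lambda>m. \<integral>\<^sup>+ s\<in>{0..T \<omega>}. ennreal ((?p m s - ?p' m s - (f s \<omega> - f' s \<omega>))\<^sup>2) \<partial>lborel) \<longlonglongrightarrow> 0"
          by (rule tendsto_sandwich[OF _ _ tendsto_const, rotated 2])
             (use le in \<open>simp_all only: zero_le eventually_True\<close>)
      qed
    qed
  qed
qed

end

section \<open>Expectation bounds for differences of solutions\<close>

context filtered_brownian
begin

lemma measurable_stopping:
  assumes T: "\<And>s. 0 \<le> s \<Longrightarrow> {\<omega> \<in> space M. s \<le> T \<omega>} \<in> sets (F s)"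
  shows "(\<lambda>\<omega>. indicator {0..T \<omega>} t :: real) \<in> borel_measurable M"
proof (cases "0 \<le> t")
  case True
  then have "{\<omega> \<in> space M. t \<le> T \<omega>} \<in> sets M" using T[of t] sets_F_M by auto
  then have [measurable]: "Measurable.pred M (\<lambda>\<omega>. t \<le> T \<omega>)" by (simp add: pred_def)
  have "(\<lambda>\<omega>. indicator {0..T \<omega>} t :: real) = (\<lambda>\<omega>. of_bool (t \<le> T \<omega>))" using True by (auto simp: indicator_def)
  then show ?thesis by simp
next
  case False
  then have "(\<lambda>\<omega>. indicator {0..T \<omega>} t :: real) = (\<lambda>_. 0)" by (auto simp: indicator_def)
  then show ?thesis by simp
qed

lemma stopped_integral_bounded:
  fixes G :: "real \<Rightarrow> real"
  assumes G: "continuous_on {0..T} G" "\<And>s. s \<in> {0..T} \<Longrightarrow> \<bar>G s\<bar> \<le> C" and "0 \<le> C" "0 \<le> t"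
  shows "\<bar>LINT s:{0..min t T}|lborel. G s\<bar> \<le> C * t"
proof -
  have z: "(LINT u:{0..min 0 T}|lborel. G u) = 0"
    unfolding set_lebesgue_integral_def
  proof (rule integral_eq_zero_AE)
    show "AE u in lborel. indicator {0..min 0 T} u *\<^sub>R G u = 0"
      using AE_lborel_singleton[of 0] by eventually_elim (auto simp: indicator_def)
  qed
  show ?thesis
    using stopped_integral_lipschitz[of T G C "\<lambda>s. LINT u:{0..min s T}|lborel. G u" 0 t, OF G refl] z assms
    by simp
qed

lemma stopped_integral_integrable:
  fixes G :: "real \<Rightarrow> 'a \<Rightarrow> real"
  assumes T: "\<And>s. 0 \<le> s \<Longrightarrow> {\<omega> \<in> space M. s \<le> T \<omega>} \<in> sets (F s)"
    and G: "\<And>s. 0 \<le> s \<Longrightarrow> G s \<in> borel_measurable (F s)"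
      "\<And>\<omega>. \<omega> \<in> space M \<Longrightarrow> continuous_on {0..T \<omega>} (\<lambda>s. G s \<omega>)"
      "\<And>\<omega> s. \<omega> \<in> space M \<Longrightarrow> s \<in> {0..T \<omega>} \<Longrightarrow> \<bar>G s \<omega>\<bar> \<le> C"
    and C: "0 \<le> C" and t: "0 \<le> t"
  shows "integrable M (\<lambda>\<omega>. LINT s:{0..min t (T \<omega>)}|lborel. G s \<omega>)"
proof (rule integrable_const_bound[where B="C * t"])
  show "AE \<omega> in M. norm (LINT s:{0..min t (T \<omega>)}|lborel. G s \<omega>) \<le> C * t"
    using stopped_integral_bounded[OF G(2) G(3) C t] by (intro AE_I2) simp
  show "(\<lambda>\<omega>. LINT s:{0..min t (T \<omega>)}|lborel. G s \<omega>) \<in> borel_measurable M"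
    using stopped_integral_adapted[OF G(1,2) T t] by (rule measurable_F_M)
qed

theorem abs_difference_inequality:
  fixes q \<rho> :: "real \<Rightarrow> real" and T :: "'a \<Rightarrow> real" and x x' f f' Y Y' a G :: "real \<Rightarrow> 'a \<Rightarrow> real"
  assumes \<rho>: "\<rho> \<in> borel_measurable (restrict_space borel {0<..})" "\<And>x. x > 0 \<Longrightarrow> \<rho> x > 0"
      "\<And>\<epsilon>. \<epsilon> > 0 \<Longrightarrow> (\<integral>\<^sup>+ x\<in>{0<..<\<epsilon>}. ennreal (1 / \<rho> x) \<partial>lborel) = \<infinity>"
      "\<And>x y. x \<noteq> y \<Longrightarrow> \<bar>q x - q y\<bar>\<^sup>2 \<le> \<rho> \<bar>x - y\<bar>"
    and ito: "has_ito_integral_before M F \<tau> W f Y" "has_ito_integral_before M F \<tau>' W f' Y'"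
    and T: "\<And>s. 0 \<le> s \<Longrightarrow> {\<omega> \<in> space M. s \<le> T \<omega>} \<in> sets (F s)"
      "\<And>\<omega>. \<omega> \<in> space M \<Longrightarrow> 0 \<le> T \<omega> \<Longrightarrow> ereal (T \<omega>) < \<tau> \<omega> \<and> ereal (T \<omega>) < \<tau>' \<omega>"
    and C: "0 \<le> C" and t: "0 < t"
    and f: "\<And>\<omega>. \<omega> \<in> space M \<Longrightarrow> continuous_on {0..T \<omega>} (\<lambda>s. f s \<omega>)"
      "\<And>\<omega>. \<omega> \<in> space M \<Longrightarrow> continuous_on {0..T \<omega>} (\<lambda>s. f' s \<omega>)"
      "\<And>\<omega> s. \<omega> \<in> space M \<Longrightarrow> s \<in> {0..T \<omega>} \<Longrightarrow> \<bar>f s \<omega> - f' s \<omega>\<bar> \<le> C"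
      "\<And>\<omega> s. f s \<omega> - f' s \<omega> = 2 * (q (x s \<omega>) - q (x' s \<omega>))"
    and a: "\<And>s. 0 \<le> s \<Longrightarrow> a s \<in> borel_measurable (F s)"
      "\<And>\<omega>. \<omega> \<in> space M \<Longrightarrow> continuous_on {0..T \<omega>} (\<lambda>s. a s \<omega>)"
      "\<And>\<omega> s. \<omega> \<in> space M \<Longrightarrow> s \<in> {0..T \<omega>} \<Longrightarrow> \<bar>a s \<omega>\<bar> \<le> G s \<omega>"
    and G: "\<And>s. 0 \<le> s \<Longrightarrow> G s \<in> borel_measurable (F s)"
      "\<And>\<omega>. \<omega> \<in> space M \<Longrightarrow> continuous_on {0..T \<omega>} (\<lambda>s. G s \<omega>)"
      "\<And>\<omega> s. \<omega> \<in> space M \<Longrightarrow> s \<in> {0..T \<omega>} \<Longrightarrow> \<bar>G s \<omega>\<bar> \<le> C"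
    and x: "x t \<in> borel_measurable M" "x' t \<in> borel_measurable M"
      "\<And>\<omega>. \<omega> \<in> space M \<Longrightarrow> t \<in> {0..T \<omega>} \<Longrightarrow> \<bar>x t \<omega> - x' t \<omega>\<bar> \<le> C"
    and eqn: "AE \<omega> in M. \<forall>s\<in>{0..T \<omega>}. x s \<omega> - x' s \<omega> = Y s \<omega> - Y' s \<omega> + (LINT u:{0..s}|lborel. a u \<omega>)"
  shows "expectation (\<lambda>\<omega>. indicator {0..T \<omega>} t * \<bar>x t \<omega> - x' t \<omega>\<bar>)
    \<le> expectation (\<lambda>\<omega>. LINT s:{0..min t (T \<omega>)}|lborel. G s \<omega>)"
proof -
  obtain S p I where step: "\<And>m. step_process (S m) (p m) (I m)"
    and lim: "AE \<omega> in M. 0 \<le> T \<omega> \<longrightarrow>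
        uniform_limit {0..T \<omega>} (\<lambda>m s. I m s \<omega>) (\<lambda>s. Y s \<omega> - Y' s \<omega>) sequentially \<and>
        (\<lambda>m. \<integral>\<^sup>+ s\<in>{0..T \<omega>}. ennreal ((p m s \<omega> - (f s \<omega> - f' s \<omega>))\<^sup>2) \<partial>lborel) \<longlonglongrightarrow> 0"
    using ito_integral_difference[OF ito T(2) f(1,2)] by blast
  note [measurable] = x(1,2) measurable_stopping[OF T(1)]
  define A where "A = (\<lambda>s \<omega>. LINT u:{0..min s (T \<omega>)}|lborel. a u \<omega>)"
  have intG: "integrable M (\<lambda>\<omega>. LINT s:{0..min t (T \<omega>)}|lborel. G s \<omega>)"
    using stopped_integral_integrable[OF T(1) G C] t by simp
  have aC: "\<bar>a s \<omega>\<bar> \<le> C" if "\<omega> \<in> space M" "s \<in> {0..T \<omega>}" for \<omega> s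
    using a(3)[OF that] G(3)[OF that] by linarith
  have intD: "integrable M (\<lambda>\<omega>. indicator {0..T \<omega>} t * \<bar>x t \<omega> - x' t \<omega>\<bar>)"
  proof (rule integrable_const_bound[where B=C])
    show "AE \<omega> in M. norm (indicator {0..T \<omega>} t * \<bar>x t \<omega> - x' t \<omega>\<bar>) \<le> C"
      using x(3) C by (intro AE_I2) (auto simp: indicator_def)
  qed measurable
  have key: "expectation (\<lambda>\<omega>. indicator {0..T \<omega>} t * \<bar>x t \<omega> - x' t \<omega>\<bar>)
      \<le> \<epsilon> + (expectation (\<lambda>\<omega>. LINT s:{0..min t (T \<omega>)}|lborel. G s \<omega>) + 2 * \<epsilon> * t)"
    if \<epsilon>: "0 < \<epsilon>" for \<epsilon>
  proof -
    obtain \<psi> where \<psi>: "continuous_on UNIV \<psi>" "\<And>x. 0 \<le> \<psi> x" "\<And>x. \<psi> (- x) = \<psi> x"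
      "\<And>x. \<epsilon> \<le> \<bar>x\<bar> \<Longrightarrow> \<psi> x = 0" "(LINT x:{0..\<epsilon>}|lborel. \<psi> x) = 1"
      "\<And>x y. \<psi> (x - y) * (q x - q y)\<^sup>2 \<le> \<epsilon>"
      using mollifier_exists[OF \<rho> \<epsilon> \<epsilon>] by metis
    obtain \<phi> \<phi>1 B where test: "test_function \<phi> \<phi>1 \<psi> 1 B" and \<phi>_ge: "\<And>x. \<bar>x\<bar> - \<epsilon> \<le> \<phi> x"
      using test_function_of_mollifier[OF \<epsilon> \<psi>(1-5)] by metis
    interpret test: test_function \<phi> \<phi>1 \<psi> 1 B by (rule test)
    define Q where "Q = (\<lambda>\<omega>. (LINT s:{0..min t (T \<omega>)}|lborel. G s \<omega>) + 2 * \<epsilon> * t)"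
    have Q: "integrable M Q" unfolding Q_def using intG by simp
    have "(\<integral>\<^sup>+ \<omega>. indicator {\<omega>. t \<le> T \<omega>} \<omega> * ennreal (\<phi> (x t \<omega> - x' t \<omega>)) \<partial>M) \<le> ennreal (expectation Q)"
    proof (rule ito_inequality[OF test step t C T(1) lim])
      show "continuous_on {0..T \<omega>} (\<lambda>s. f s \<omega> - f' s \<omega>)" if "\<omega> \<in> space M" for \<omega>
        using f(1,2)[OF that] by (intro continuous_intros)
      show "A s \<in> borel_measurable (F s)" if "0 \<le> s" for s
        unfolding A_def by (rule stopped_integral_adapted[OF a(1,2) T(1) that])
      show "AE \<omega> in M. t \<le> T \<omega> \<longrightarrow> x t \<omega> - x' t \<omega> = Y t \<omega> - Y' t \<omega> + A t \<omega>"
        using eqn by eventually_elim (use t in \<open>auto simp: A_def min_def\<close>)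
      show "AE \<omega> in M. (LINT s:{0..min t (T \<omega>)}|lborel. \<phi>1 (Y s \<omega> - Y' s \<omega> + A s \<omega>) * a s \<omega>
          + \<psi> (Y s \<omega> - Y' s \<omega> + A s \<omega>) * (f s \<omega> - f' s \<omega>)\<^sup>2 / 2) \<le> Q \<omega>"
        using eqn AE_space
      proof eventually_elim
        case (elim \<omega>)
        let ?l = "\<lambda>s. \<phi>1 (Y s \<omega> - Y' s \<omega> + A s \<omega>) * a s \<omega> + \<psi> (Y s \<omega> - Y' s \<omega> + A s \<omega>) * (f s \<omega> - f' s \<omega>)\<^sup>2 / 2"
        let ?J = "{0..min t (T \<omega>)}"
        have "continuous_on ?J (\<lambda>s. G s \<omega>)" using G(2)[of \<omega>] elim by (auto intro: continuous_on_subset)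
        then have iG: "integrable lborel (\<lambda>s. indicator ?J s *\<^sub>R G s \<omega>)"
          by (rule borel_integrable_compact[rotated]) simp
        have i2: "integrable lborel (\<lambda>s. indicator ?J s *\<^sub>R (2 * \<epsilon>))"
          by (rule borel_integrable_compact) auto
        have "(LINT s:?J|lborel. ?l s) \<le> (\<integral>s. indicator ?J s *\<^sub>R G s \<omega> + indicator ?J s *\<^sub>R (2 * \<epsilon>) \<partial>lborel)"
          unfolding set_lebesgue_integral_def
        proof (rule integral_mono'[OF Bochner_Integration.integrable_add[OF iG i2]])
          fix s
          have G0: "0 \<le> G s \<omega>" if "s \<in> ?J" using a(3)[of \<omega> s] elim that by force
          then show "0 \<le> indicator ?J s *\<^sub>R G s \<omega> + indicator ?J s *\<^sub>R (2 * \<epsilon>)"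
            using \<epsilon> by (auto simp: indicator_def)
          have "?l s \<le> G s \<omega> + 2 * \<epsilon>" if s: "s \<in> ?J"
          proof -
            have "min s (T \<omega>) = s" using s by auto
            then have z: "Y s \<omega> - Y' s \<omega> + A s \<omega> = x s \<omega> - x' s \<omega>" using elim s by (simp add: A_def)
            have "\<phi>1 (x s \<omega> - x' s \<omega>) * a s \<omega> \<le> \<bar>\<phi>1 (x s \<omega> - x' s \<omega>)\<bar> * \<bar>a s \<omega>\<bar>"
              by (metis abs_ge_self abs_mult)
            also have "\<dots> \<le> 1 * G s \<omega>"
              using test.bound1 a(3)[of \<omega> s] elim s G0[OF s] by (intro mult_mono) auto
            finally have 1: "\<phi>1 (x s \<omega> - x' s \<omega>) * a s \<omega> \<le> G s \<omega>" by simp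
            have "\<psi> (x s \<omega> - x' s \<omega>) * (f s \<omega> - f' s \<omega>)\<^sup>2 / 2 = 2 * (\<psi> (x s \<omega> - x' s \<omega>) * (q (x s \<omega>) - q (x' s \<omega>))\<^sup>2)"
              unfolding f(4) power_mult_distrib by simp
            also have "\<dots> \<le> 2 * \<epsilon>" using \<psi>(6) by simp
            finally show ?thesis using 1 unfolding z by simp
          qed
          then show "indicator ?J s *\<^sub>R ?l s \<le> indicator ?J s *\<^sub>R G s \<omega> + indicator ?J s *\<^sub>R (2 * \<epsilon>)"
            by (cases "s \<in> ?J") auto
        qed
        also have "\<dots> = (LINT s:?J|lborel. G s \<omega>) + (LINT s:?J|lborel. 2 * \<epsilon>)"
          using iG i2 by (simp add: set_lebesgue_integral_def)
        also have "(LINT s:?J|lborel. 2 * \<epsilon>) \<le> 2 * \<epsilon> * t"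
          using t \<epsilon> by (auto simp: set_lebesgue_integral_def min_def)
        finally show ?case by (simp add: Q_def)
      qed
    qed (use f a aC Q in \<open>auto simp: A_def\<close>)
    moreover have "ennreal (expectation (\<lambda>\<omega>. indicator {0..T \<omega>} t * (\<bar>x t \<omega> - x' t \<omega>\<bar> - \<epsilon>)))
        \<le> (\<integral>\<^sup>+ \<omega>. indicator {\<omega>. t \<le> T \<omega>} \<omega> * ennreal (\<phi> (x t \<omega> - x' t \<omega>)) \<partial>M)"
    proof -
      have int: "integrable M (\<lambda>\<omega>. indicator {0..T \<omega>} t * (\<bar>x t \<omega> - x' t \<omega>\<bar> - \<epsilon>))"
      proof (rule integrable_const_bound[where B="C + \<epsilon>"])
        show "AE \<omega> in M. norm (indicator {0..T \<omega>} t * (\<bar>x t \<omega> - x' t \<omega>\<bar> - \<epsilon>)) \<le> C + \<epsilon>"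
          using x(3) C \<epsilon> by (intro AE_I2) (force simp: indicator_def)
      qed measurable
      have "ennreal (expectation (\<lambda>\<omega>. indicator {0..T \<omega>} t * (\<bar>x t \<omega> - x' t \<omega>\<bar> - \<epsilon>)))
          \<le> ennreal (expectation (\<lambda>\<omega>. max 0 (indicator {0..T \<omega>} t * (\<bar>x t \<omega> - x' t \<omega>\<bar> - \<epsilon>))))"
        using int by (intro ennreal_leI integral_mono) auto
      also have "\<dots> = (\<integral>\<^sup>+ \<omega>. ennreal (max 0 (indicator {0..T \<omega>} t * (\<bar>x t \<omega> - x' t \<omega>\<bar> - \<epsilon>))) \<partial>M)"
        using int by (intro nn_integral_eq_integral[symmetric]) auto
      also have "\<dots> \<le> (\<integral>\<^sup>+ \<omega>. indicator {\<omega>. t \<le> T \<omega>} \<omega> * ennreal (\<phi> (x t \<omega> - x' t \<omega>)) \<partial>M)"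
      proof (rule nn_integral_mono)
        fix \<omega>
        show "ennreal (max 0 (indicator {0..T \<omega>} t * (\<bar>x t \<omega> - x' t \<omega>\<bar> - \<epsilon>)))
            \<le> indicator {\<omega>. t \<le> T \<omega>} \<omega> * ennreal (\<phi> (x t \<omega> - x' t \<omega>))"
          using \<phi>_ge[of "x t \<omega> - x' t \<omega>"] test.nonneg[of "x t \<omega> - x' t \<omega>"] t
          by (cases "t \<le> T \<omega>") (auto intro!: ennreal_leI)
      qed
      finally show ?thesis .
    qed
    ultimately have "ennreal (expectation (\<lambda>\<omega>. indicator {0..T \<omega>} t * (\<bar>x t \<omega> - x' t \<omega>\<bar> - \<epsilon>))) \<le> ennreal (expectation Q)"
      by (rule order_trans[rotated])
    moreover have "0 \<le> expectation Q"
    proof (rule integral_nonneg_AE, rule AE_I2)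
      fix \<omega> assume w: "\<omega> \<in> space M"
      have "0 \<le> G s \<omega>" if "s \<in> {0..min t (T \<omega>)}" for s using a(3)[OF w, of s] that by force
      then have "0 \<le> (LINT s:{0..min t (T \<omega>)}|lborel. G s \<omega>)"
        unfolding set_lebesgue_integral_def by (intro integral_nonneg_AE AE_I2) (auto simp: indicator_def)
      then show "0 \<le> Q \<omega>" using \<epsilon> t by (simp add: Q_def)
    qed
    ultimately have 1: "expectation (\<lambda>\<omega>. indicator {0..T \<omega>} t * (\<bar>x t \<omega> - x' t \<omega>\<bar> - \<epsilon>)) \<le> expectation Q"
      by (simp add: ennreal_le_iff)
    have int_ind: "integrable M (\<lambda>\<omega>. indicator {0..T \<omega>} t * \<epsilon>)"
    proof (rule integrable_const_bound[where B=\<epsilon>])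
      show "AE \<omega> in M. norm (indicator {0..T \<omega>} t * \<epsilon>) \<le> \<epsilon>" using \<epsilon> by (intro AE_I2) (auto simp: indicator_def)
    qed measurable
    have "expectation (\<lambda>\<omega>. indicator {0..T \<omega>} t * \<bar>x t \<omega> - x' t \<omega>\<bar>)
        = expectation (\<lambda>\<omega>. indicator {0..T \<omega>} t * (\<bar>x t \<omega> - x' t \<omega>\<bar> - \<epsilon>)) + expectation (\<lambda>\<omega>. indicator {0..T \<omega>} t * \<epsilon>)"
      using intD int_ind by (simp add: right_diff_distrib)
    also have "expectation (\<lambda>\<omega>. indicator {0..T \<omega>} t * \<epsilon>) \<le> expectation (\<lambda>_. \<epsilon>)"
      using int_ind \<epsilon> by (intro integral_mono) (auto simp: indicator_def)
    also have "\<dots> = \<epsilon>" by (simp add: prob_space)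
    finally show ?thesis using 1 intG by (simp add: Q_def prob_space)
  qed
  have "(\<lambda>n. inverse (real (Suc n)) + (expectation (\<lambda>\<omega>. LINT s:{0..min t (T \<omega>)}|lborel. G s \<omega>)
        + 2 * inverse (real (Suc n)) * t))
      \<longlonglongrightarrow> 0 + (expectation (\<lambda>\<omega>. LINT s:{0..min t (T \<omega>)}|lborel. G s \<omega>) + 2 * 0 * t)"
    by (intro tendsto_intros LIMSEQ_inverse_real_of_nat)
  then show ?thesis
    using key[of "inverse (real (Suc n))" for n] by (intro LIMSEQ_le_const) (auto simp del: of_nat_Suc)
qed

text \<open>The integrals Y and Y' are fixed only up to null sets, so Y t - Y' t might fail to be
  measurable. A measurable representative Z is produced together with its second moment
  bound.\<close>

lemma ito_difference_square:
  fixes T :: "'a \<Rightarrow> real" and f f' Y Y' :: "real \<Rightarrow> 'a \<Rightarrow> real"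
  assumes ito: "has_ito_integral_before M F \<tau> W f Y" "has_ito_integral_before M F \<tau>' W f' Y'"
    and T: "\<And>s. 0 \<le> s \<Longrightarrow> {\<omega> \<in> space M. s \<le> T \<omega>} \<in> sets (F s)"
      "\<And>\<omega>. \<omega> \<in> space M \<Longrightarrow> 0 \<le> T \<omega> \<Longrightarrow> ereal (T \<omega>) < \<tau> \<omega> \<and> ereal (T \<omega>) < \<tau>' \<omega>"
    and C: "0 \<le> C" and t: "0 < t"
    and f: "\<And>\<omega>. \<omega> \<in> space M \<Longrightarrow> continuous_on {0..T \<omega>} (\<lambda>s. f s \<omega>)"
      "\<And>\<omega>. \<omega> \<in> space M \<Longrightarrow> continuous_on {0..T \<omega>} (\<lambda>s. f' s \<omega>)"
      "\<And>\<omega> s. \<omega> \<in> space M \<Longrightarrow> s \<in> {0..T \<omega>} \<Longrightarrow> \<bar>f s \<omega> - f' s \<omega>\<bar> \<le> C"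
    and Q: "integrable M Q" "AE \<omega> in M. (LINT s:{0..min t (T \<omega>)}|lborel. (f s \<omega> - f' s \<omega>)\<^sup>2) \<le> Q \<omega>" "0 \<le> expectation Q"
  obtains Z where "Z \<in> borel_measurable M" "AE \<omega> in M. t \<le> T \<omega> \<longrightarrow> Z \<omega> = Y t \<omega> - Y' t \<omega>"
    "integrable M (\<lambda>\<omega>. indicator {0..T \<omega>} t * (Z \<omega>)\<^sup>2)"
    "expectation (\<lambda>\<omega>. indicator {0..T \<omega>} t * (Z \<omega>)\<^sup>2) \<le> expectation Q"
proof -
  obtain S p I where step: "\<And>m. step_process (S m) (p m) (I m)"
    and lim: "AE \<omega> in M. 0 \<le> T \<omega> \<longrightarrow>
        uniform_limit {0..T \<omega>} (\<lambda>m s. I m s \<omega>) (\<lambda>s. Y s \<omega> - Y' s \<omega>) sequentially \<and>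
        (\<lambda>m. \<integral>\<^sup>+ s\<in>{0..T \<omega>}. ennreal ((p m s \<omega> - (f s \<omega> - f' s \<omega>))\<^sup>2) \<partial>lborel) \<longlonglongrightarrow> 0"
    using ito_integral_difference[OF ito T(2) f(1,2)] by blast
  note [measurable] = measurable_stopping[OF T(1)]
  have [measurable]: "I m t \<in> borel_measurable M" for m
    using step_process_adapted[OF step] t measurable_F_M by (metis less_imp_le)
  \<comment> \<open>The elementary integrals at time t are measurable, hence so is the function
    \<open>lim\<close> of them; where they do not converge its default value is harmless, as it is
    used only almost surely on t \<le> T.\<close>
  define Z where "Z = (\<lambda>\<omega>. lim (\<lambda>m. I m t \<omega>))"
  have [measurable]: "Z \<in> borel_measurable M" unfolding Z_def by measurable
  have Z: "AE \<omega> in M. t \<le> T \<omega> \<longrightarrow> Z \<omega> = Y t \<omega> - Y' t \<omega>"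
    using lim
  proof eventually_elim
    case (elim \<omega>)
    show ?case
    proof
      assume tT: "t \<le> T \<omega>"
      then have "uniform_limit {0..T \<omega>} (\<lambda>m s. I m s \<omega>) (\<lambda>s. Y s \<omega> - Y' s \<omega>) sequentially"
        using elim t by simp
      then have "(\<lambda>m. I m t \<omega>) \<longlonglongrightarrow> Y t \<omega> - Y' t \<omega>"
        using tT t by (intro tendsto_uniform_limitI[where f="\<lambda>m s. I m s \<omega>" and x=t]) auto
      then show "Z \<omega> = Y t \<omega> - Y' t \<omega>" unfolding Z_def by (rule limI)
    qed
  qed
  have fin: "(\<integral>\<^sup>+ \<omega>. indicator {\<omega>. t \<le> T \<omega>} \<omega> * ennreal ((Z \<omega>)\<^sup>2) \<partial>M) \<le> ennreal (expectation Q)"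
  proof (rule isometry_inequality[OF step t C T(1) lim])
    show "continuous_on {0..T \<omega>} (\<lambda>s. f s \<omega> - f' s \<omega>)" if "\<omega> \<in> space M" for \<omega>
      using f(1,2)[OF that] by (intro continuous_intros)
  qed (use f(3) Z Q in auto)
  have eq: "(\<integral>\<^sup>+ \<omega>. ennreal (indicator {0..T \<omega>} t * (Z \<omega>)\<^sup>2) \<partial>M)
      = (\<integral>\<^sup>+ \<omega>. indicator {\<omega>. t \<le> T \<omega>} \<omega> * ennreal ((Z \<omega>)\<^sup>2) \<partial>M)"
    by (rule nn_integral_cong) (use t in \<open>auto simp: indicator_def\<close>)
  have int: "integrable M (\<lambda>\<omega>. indicator {0..T \<omega>} t * (Z \<omega>)\<^sup>2)"
  proof (rule integrableI_nonneg)
    show "(\<lambda>\<omega>. indicator {0..T \<omega>} t * (Z \<omega>)\<^sup>2) \<in> borel_measurable M" by measurable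
    show "AE \<omega> in M. 0 \<le> indicator {0..T \<omega>} t * (Z \<omega>)\<^sup>2" by (rule AE_I2) simp
    show "(\<integral>\<^sup>+ \<omega>. ennreal (indicator {0..T \<omega>} t * (Z \<omega>)\<^sup>2) \<partial>M) < \<infinity>"
      unfolding eq using fin by (rule le_less_trans) simp
  qed
  have "ennreal (expectation (\<lambda>\<omega>. indicator {0..T \<omega>} t * (Z \<omega>)\<^sup>2)) \<le> ennreal (expectation Q)"
    using fin nn_integral_eq_integral[OF int] unfolding eq by simp
  then have "expectation (\<lambda>\<omega>. indicator {0..T \<omega>} t * (Z \<omega>)\<^sup>2) \<le> expectation Q"
    using Q(3) by (simp add: ennreal_le_iff)
  then show thesis using that[OF _ Z int] by simp
qed

end

section \<open>Eigenvalues and eigenvectors\<close>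

lemma closed_on_interval_of_rationals:
  fixes v :: "real \<Rightarrow> 'b::topological_space"
  assumes s: "0 < s" and cont: "continuous_on {0..s} v" and K: "closed K"
    and rat: "\<And>r. r \<in> \<rat> \<Longrightarrow> 0 \<le> r \<Longrightarrow> r < s \<Longrightarrow> v r \<in> K"
    and r: "r \<in> {0..s}"
  shows "v r \<in> K"
proof (cases "r = 0")
  case True
  then show ?thesis using rat[of 0] s by simp
next
  case False
  then have "0 < r" using r by simp
  then obtain x where x: "\<And>n. x n \<in> \<rat>" "\<And>n. 0 < x n" "\<And>n. x n < r" "x \<longlonglongrightarrow> r"
    using rational_sequence_below by metis
  have mem: "x n \<in> {0..s}" for n using x(2,3)[of n] r by simp
  have lim: "(\<lambda>n. v (x n)) \<longlonglongrightarrow> v r"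
    by (rule continuous_on_tendsto_compose[OF cont x(4) r]) (use mem in simp)
  have "v (x n) \<in> K" for n
    using rat[OF x(1)[of n]] x(2,3)[of n] r by simp
  then show ?thesis
    by (intro Lim_in_closed_set[OF K _ _ lim]) auto
qed

lemma collision_timeD:
  assumes "0 \<le> s" "ereal s < collision_time L \<omega>" "i \<noteq> j"
  shows "L s \<omega> $ i \<noteq> L s \<omega> $ j"
proof
  assume "L s \<omega> $ i = L s \<omega> $ j"
  then have "collision_time L \<omega> \<le> ereal s"
    unfolding collision_time_def by (intro Inf_lower) (use assms in auto)
  then show False using assms(2) by simp
qed

text \<open>The collision times of a continuous path form a closed set, so a finite infimum is
  attained. Hence a path without collision on a closed interval has its collision time strictly
  later.\<close>

lemma collision_time_attained:
  fixes L :: "real \<Rightarrow> 'a \<Rightarrow> real^'n"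
  assumes cont: "continuous_on {0..} (\<lambda>t. L t \<omega>)" and fin: "collision_time L \<omega> \<noteq> \<infinity>"
  obtains t i j where "0 \<le> t" "collision_time L \<omega> = ereal t" "i \<noteq> j" "L t \<omega> $ i = L t \<omega> $ j"
proof -
  define D where "D = {t \<in> {0..}. \<exists>i j. i \<noteq> j \<and> L t \<omega> $ i = L t \<omega> $ j}"
  have eq: "{ereal t | t. 0 \<le> t \<and> (\<exists>i j. i \<noteq> j \<and> L t \<omega> $ i = L t \<omega> $ j)} = ereal ` D"
    by (auto simp: D_def)
  have "D \<noteq> {}"
  proof
    assume "D = {}"
    then have "collision_time L \<omega> = \<infinity>" unfolding collision_time_def eq by (simp add: top_ereal_def)
    then show False using fin by simp
  qed
  have "closed D"
  proof -
    have "D = (\<Union>(i, j)\<in>{(i, j). i \<noteq> j}. {t \<in> {0..}. L t \<omega> $ i = L t \<omega> $ j})" by (auto simp: D_def)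
    moreover have "closed {t \<in> {0..}. L t \<omega> $ i = L t \<omega> $ j}" for i j
    proof -
      have "closed ({0..} \<inter> (\<lambda>t. L t \<omega> $ i - L t \<omega> $ j) -` {0})"
        by (intro continuous_closed_preimage continuous_intros cont)
      moreover have "{0..} \<inter> (\<lambda>t. L t \<omega> $ i - L t \<omega> $ j) -` {0} = {t \<in> {0..}. L t \<omega> $ i = L t \<omega> $ j}" by auto
      ultimately show ?thesis by simp
    qed
    ultimately show ?thesis by (auto intro!: closed_UN)
  qed
  have bdd: "bdd_below D" by (rule bdd_belowI[of _ 0]) (auto simp: D_def)
  have mem: "Inf D \<in> D" by (rule closed_contains_Inf[OF \<open>D \<noteq> {}\<close> bdd \<open>closed D\<close>])
  have "collision_time L \<omega> = ereal (Inf D)"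
    unfolding collision_time_def eq
  proof (rule antisym)
    show "Inf (ereal ` D) \<le> ereal (Inf D)" using mem by (intro Inf_lower) auto
    show "ereal (Inf D) \<le> Inf (ereal ` D)" using bdd by (intro Inf_greatest) (auto intro: cInf_lower)
  qed
  then show thesis using mem that by (auto simp: D_def)
qed

lemma less_collision_timeI:
  fixes L :: "real \<Rightarrow> 'a \<Rightarrow> real^'n"
  assumes "continuous_on {0..} (\<lambda>t. L t \<omega>)"
    and "\<And>s i j. s \<in> {0..T} \<Longrightarrow> i \<noteq> j \<Longrightarrow> L s \<omega> $ i \<noteq> L s \<omega> $ j"
  shows "ereal T < collision_time L \<omega>"
proof (cases "collision_time L \<omega> = \<infinity>")
  case False
  with assms(1) obtain t i j where t: "0 \<le> t" "collision_time L \<omega> = ereal t" "i \<noteq> j" "L t \<omega> $ i = L t \<omega> $ j"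
    by (rule collision_time_attained)
  then have "t \<notin> {0..T}" using assms(2) by blast
  then show ?thesis using t by auto
qed simp

text \<open>One parameter bounds the entries from above and, through its reciprocal, the gaps from
  below. These compact sets grow with N and exhaust the configurations with distinct
  entries.\<close>

definition separated :: "real \<Rightarrow> real^'n \<Rightarrow> bool" where
  "separated N v \<longleftrightarrow> (\<forall>i. \<bar>v $ i\<bar> \<le> N) \<and> (\<forall>i k. i \<noteq> k \<longrightarrow> 1 / N \<le> \<bar>v $ i - v $ k\<bar>)"

lemma closed_separated: "closed {v. separated N v}"
  unfolding separated_def
  by (intro closed_Collect_conj closed_Collect_all closed_Collect_imp closed_Collect_le
      continuous_intros open_Collect_const)

lemma separated_neq: "separated N v \<Longrightarrow> 0 < N \<Longrightarrow> i \<noteq> k \<Longrightarrow> v $ i \<noteq> v $ k"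
  unfolding separated_def by (metis abs_zero diff_self divide_pos_pos leD zero_less_one)

lemma continuous_path_separated:
  fixes v :: "real \<Rightarrow> real^'n"
  assumes cont: "continuous_on {0..t} v" and neq: "\<And>s i k. s \<in> {0..t} \<Longrightarrow> i \<noteq> k \<Longrightarrow> v s $ i \<noteq> v s $ k"
    and t: "0 \<le> t"
  obtains N0 where "\<And>N s. N0 \<le> N \<Longrightarrow> s \<in> {0..t} \<Longrightarrow> separated N (v s)"
proof -
  have "compact (v ` {0..t})" using cont by (intro compact_continuous_image) auto
  then obtain B where B: "\<And>s. s \<in> {0..t} \<Longrightarrow> norm (v s) \<le> B"
    using compact_imp_bounded bounded_iff by (metis imageI)
  have "\<exists>m>0. \<forall>s\<in>{0..t}. m \<le> \<bar>v s $ i - v s $ k\<bar>" if "i \<noteq> k" for i k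
  proof -
    have "continuous_on {0..t} (\<lambda>s. \<bar>v s $ i - v s $ k\<bar>)" by (intro continuous_intros cont)
    then obtain x where "x \<in> {0..t}" "\<forall>s\<in>{0..t}. \<bar>v x $ i - v x $ k\<bar> \<le> \<bar>v s $ i - v s $ k\<bar>"
      using continuous_attains_inf[of "{0..t}" "\<lambda>s. \<bar>v s $ i - v s $ k\<bar>"] t by auto
    then show ?thesis using neq[of x i k] that by (intro exI[of _ "\<bar>v x $ i - v x $ k\<bar>"]) auto
  qed
  then obtain m where m: "\<And>i k. i \<noteq> k \<Longrightarrow> 0 < m i k" "\<And>i k s. i \<noteq> k \<Longrightarrow> s \<in> {0..t} \<Longrightarrow> m i k \<le> \<bar>v s $ i - v s $ k\<bar>"
    by metis
  \<comment> \<open>The norm bound and the reciprocals of all minimal gaps are added up, so N0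
    dominates each of them at once; the summand 1 makes it positive. Terms with i = k have no
    meaning and enter only through absolute values.\<close>
  define N0 where "N0 = \<bar>B\<bar> + 1 + (\<Sum>i\<in>UNIV. \<Sum>k\<in>UNIV. \<bar>1 / m i k\<bar>)"
  have "separated N (v s)" if N: "N0 \<le> N" and s: "s \<in> {0..t}" for N s
    unfolding separated_def
  proof (intro conjI allI impI)
    have S0: "0 \<le> (\<Sum>i\<in>UNIV. \<Sum>k\<in>UNIV. \<bar>1 / m i k\<bar>)" by (intro sum_nonneg) auto
    show "\<bar>v s $ i\<bar> \<le> N" for i
      using component_le_norm_cart[of "v s" i] B[OF s] N S0 unfolding N0_def by linarith
    fix i k :: 'n assume ik: "i \<noteq> k"
    have "\<bar>1 / m i k\<bar> \<le> (\<Sum>k\<in>UNIV. \<bar>1 / m i k\<bar>)" by (intro member_le_sum) auto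
    also have "\<dots> \<le> (\<Sum>i\<in>UNIV. \<Sum>k\<in>UNIV. \<bar>1 / m i k\<bar>)"
      by (intro member_le_sum[of i UNIV "\<lambda>i. \<Sum>k\<in>UNIV. \<bar>1 / m i k\<bar>"]) (auto intro: sum_nonneg)
    finally have "1 / m i k \<le> N" using N unfolding N0_def by linarith
    moreover have "0 < N" using N S0 unfolding N0_def by linarith
    ultimately have "1 / N \<le> m i k" using m(1)[OF ik] by (simp add: field_simps)
    then show "1 / N \<le> \<bar>v s $ i - v s $ k\<bar>" using m(2)[OF ik s] by linarith
  qed
  then show thesis using that by blast
qed

lemma locally_lipschitz_on_compact:
  assumes f: "locally_lipschitz_on U f" and K: "compact K" "K \<subseteq> U"
  obtains C where "C-lipschitz_on K f"
proof -
  \<comment> \<open>Time is a dummy here: the single point 0 serves as parameter set, so that the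
    compactness theorem for time-dependent local Lipschitz families applies. It does not ask K to be
    convex.\<close>
  have ll: "local_lipschitz {0 :: real} K (\<lambda>_. f)"
    unfolding local_lipschitz_def
  proof (intro ballI)
    fix x t assume "x \<in> K" "t \<in> {0 :: real}"
    then obtain r C where r: "r > 0" "C-lipschitz_on (ball x r \<inter> U) f"
      using f K(2) unfolding locally_lipschitz_on_def by blast
    have "C-lipschitz_on (cball x (r / 2) \<inter> K) f"
      by (rule lipschitz_on_subset[OF r(2)]) (use r(1) K(2) in auto)
    then show "\<exists>u>0. \<exists>C. \<forall>t\<in>cball t u \<inter> {0}. C-lipschitz_on (cball x u \<inter> K) f"
      using r(1) by (intro exI[of _ "r / 2"]) auto
  qed
  show thesis
    by (rule local_lipschitz_compact_implies_lipschitz[OF ll K(1)]) (use that in auto)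
qed

lemma locally_lipschitz_on_continuous:
  assumes f: "locally_lipschitz_on U f" and U: "open U"
  shows "continuous_on U f"
  unfolding continuous_on_eq_continuous_at[OF U]
proof
  fix x assume x: "x \<in> U"
  then obtain r C where r: "r > 0" "C-lipschitz_on (ball x r \<inter> U) f"
    using f unfolding locally_lipschitz_on_def by blast
  have "continuous_on (ball x r \<inter> U) f" using r(2) by (rule lipschitz_on_continuous_on)
  then show "isCont f x"
    using continuous_on_eq_continuous_at[of "ball x r \<inter> U" f] x r(1) U by (auto simp: open_Int)
qed

text \<open>Cauchy-Schwarz against the constant 1, read off from the nonnegative integral of the
  squared deviation of u from its mean m.\<close>

lemma square_of_integral_le:
  fixes u :: "real \<Rightarrow> real"
  assumes u: "continuous_on {0..t} u" and t: "0 < t"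
  shows "(LINT s:{0..t}|lborel. u s)\<^sup>2 \<le> t * (LINT s:{0..t}|lborel. (u s)\<^sup>2)"
proof -
  define m where "m = (LINT s:{0..t}|lborel. u s) / t"
  have int: "set_integrable lborel {0..t} u" "set_integrable lborel {0..t} (\<lambda>s. (u s)\<^sup>2)"
    "set_integrable lborel {0..t} (\<lambda>s. m\<^sup>2)"
    unfolding set_integrable_def by (rule borel_integrable_compact; intro compact_Icc continuous_intros u)+
  have "0 \<le> (LINT s:{0..t}|lborel. (u s - m)\<^sup>2)"
    unfolding set_lebesgue_integral_def by (intro integral_nonneg_AE AE_I2) auto
  also have "\<dots> = (LINT s:{0..t}|lborel. ((u s)\<^sup>2 - (2 * m) * u s) + m\<^sup>2)"
    by (rule set_lebesgue_integral_cong) (auto simp: power2_diff)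
  also have "\<dots> = (LINT s:{0..t}|lborel. (u s)\<^sup>2) - 2 * m * (LINT s:{0..t}|lborel. u s) + m\<^sup>2 * t"
  proof -
    have mu: "set_integrable lborel {0..t} (\<lambda>s. (2 * m) * u s)" using int(1) by (rule set_integrable_mult_right)
    have "(LINT s:{0..t}|lborel. ((u s)\<^sup>2 - (2 * m) * u s) + m\<^sup>2)
        = (LINT s:{0..t}|lborel. (u s)\<^sup>2 - (2 * m) * u s) + (LINT s:{0..t}|lborel. m\<^sup>2)"
      by (rule set_integral_add(2)[OF set_integral_diff(1)[OF int(2) mu] int(3)])
    also have "(LINT s:{0..t}|lborel. m\<^sup>2) = m\<^sup>2 * t" using t by (simp add: set_lebesgue_integral_def)
    also have "(LINT s:{0..t}|lborel. (u s)\<^sup>2 - (2 * m) * u s)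
        = (LINT s:{0..t}|lborel. (u s)\<^sup>2) - (LINT s:{0..t}|lborel. (2 * m) * u s)"
      by (rule set_integral_diff(2)[OF int(2) mu])
    finally show ?thesis by simp
  qed
  also have "\<dots> = (LINT s:{0..t}|lborel. (u s)\<^sup>2) - (LINT s:{0..t}|lborel. u s)\<^sup>2 / t"
    using t by (simp add: m_def power2_eq_square field_simps)
  finally show ?thesis using t by (simp add: pos_divide_le_eq mult.commute)
qed

lemma component_measurable:
  fixes X :: "'a \<Rightarrow> 'b::real_normed_vector^'n"
  assumes "X \<in> borel_measurable N"
  shows "(\<lambda>\<omega>. X \<omega> $ i) \<in> borel_measurable N"
  by (rule measurable_compose[OF assms])
     (intro borel_measurable_continuous_onI continuous_intros)

locale eigensystem_pair =
  fixes g h b \<rho> :: "real \<Rightarrow> real"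
    and M :: "'a measure" and F :: "real \<Rightarrow> 'a measure"
    and \<nu> :: "'n::{finite,linorder} \<Rightarrow> real \<Rightarrow> 'a \<Rightarrow> real"
    and \<beta> :: "'n \<Rightarrow> 'n \<Rightarrow> real \<Rightarrow> 'a \<Rightarrow> real"
    and L L' :: "real \<Rightarrow> 'a \<Rightarrow> real^('n::{finite,linorder})"
    and H H' :: "real \<Rightarrow> 'a \<Rightarrow> real^('n::{finite,linorder})^('n::{finite,linorder})"
  assumes rho_measurable: "\<rho> \<in> borel_measurable (restrict_space borel {0<..})"
    and rho_pos: "\<And>x. x > 0 \<Longrightarrow> \<rho> x > 0"
    and rho_int: "\<And>\<epsilon>. \<epsilon> > 0 \<Longrightarrow> (\<integral>\<^sup>+ x\<in>{0<..<\<epsilon>}. ennreal (1 / \<rho> x) \<partial>lborel) = \<infinity>"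
    and gh: "\<And>x y. x \<noteq> y \<Longrightarrow> \<bar>g x * h x - g y * h y\<bar>\<^sup>2 \<le> \<rho> \<bar>x - y\<bar>"
    and G_lipschitz: "locally_lipschitz_on {(x, y). x \<noteq> y} (\<lambda>(x, y). G_fun g h x y)"
    and b_lipschitz: "locally_lipschitz_on UNIV b"
    and filtered: "filtered_prob_space M F"
    and noise: "eigensystem_noise M F \<nu> \<beta>"
    and sol: "eigensystem_solution M F g h b \<nu> \<beta> L H"
    and sol': "eigensystem_solution M F g h b \<nu> \<beta> L' H'"
    and same_init: "AE \<omega> in M. L' 0 \<omega> = L 0 \<omega> \<and> H' 0 \<omega> = H 0 \<omega>"
begin

abbreviation \<tau> where "\<tau> \<equiv> collision_time L"
abbreviation \<tau>' where "\<tau>' \<equiv> collision_time L'"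

lemma noise_component:
  "z \<in> range Inl \<union> Inr ` {(k, j). k < j} \<Longrightarrow> filtered_brownian M F (case_sum \<nu> (\<lambda>(k, j). \<beta> k j) z)"
  using filtered noise
  by unfold_locales (simp_all only: eigensystem_noise_def independent_brownian_motions_def)

lemma brownian_\<nu>: "filtered_brownian M F (\<nu> i)"
  using noise_component[of "Inl i"] by simp

lemma brownian_\<beta>: "k \<noteq> j \<Longrightarrow> filtered_brownian M F (\<beta> k j)"
proof (cases k j rule: linorder_cases)
  case less
  then show ?thesis using noise_component[of "Inr (k, j)"] by (simp add: image_iff)
next
  case greater
  then have "filtered_brownian M F (\<beta> j k)" using noise_component[of "Inr (j, k)"] by (simp add: image_iff)
  moreover have "\<beta> k j = \<beta> j k" using noise by (simp add: eigensystem_noise_def)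
  ultimately show ?thesis by simp
qed simp

text \<open>An arbitrary one of the driving motions is chosen to bring the facts about M and F into
  scope. Estimates that depend on the motion interpret the locale again for the right one.\<close>

sublocale filtered_brownian M F "\<nu> undefined" by (rule brownian_\<nu>)

lemma continuous_L: "\<omega> \<in> space M \<Longrightarrow> continuous_on {0..} (\<lambda>t. L t \<omega>)"
  and continuous_L': "\<omega> \<in> space M \<Longrightarrow> continuous_on {0..} (\<lambda>t. L' t \<omega>)"
  using sol sol' by (auto simp: eigensystem_solution_def)

lemma continuous_H:
  assumes "\<omega> \<in> space M" "ereal T < \<tau> \<omega>"
  shows "continuous_on {0..T} (\<lambda>t. H t \<omega>)"
proof (rule continuous_on_subset)
  show "continuous_on {t. 0 \<le> t \<and> ereal t < \<tau> \<omega>} (\<lambda>t. H t \<omega>)"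
    using sol assms(1) by (simp add: eigensystem_solution_def)
  show "{0..T} \<subseteq> {t. 0 \<le> t \<and> ereal t < \<tau> \<omega>}" using assms(2) by (auto intro: le_less_trans[of _ "ereal T"])
qed

lemma continuous_H':
  assumes "\<omega> \<in> space M" "ereal T < \<tau>' \<omega>"
  shows "continuous_on {0..T} (\<lambda>t. H' t \<omega>)"
proof (rule continuous_on_subset)
  show "continuous_on {t. 0 \<le> t \<and> ereal t < \<tau>' \<omega>} (\<lambda>t. H' t \<omega>)"
    using sol' assms(1) by (simp add: eigensystem_solution_def)
  show "{0..T} \<subseteq> {t. 0 \<le> t \<and> ereal t < \<tau>' \<omega>}" using assms(2) by (auto intro: le_less_trans[of _ "ereal T"])
qed

lemma adapted_LH:
  assumes "0 \<le> s"
  shows "L s \<in> borel_measurable (F s)" "L' s \<in> borel_measurable (F s)"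
    "H s \<in> borel_measurable (F s)" "H' s \<in> borel_measurable (F s)"
  using sol sol' assms by (auto simp: eigensystem_solution_def adapted_def)

lemma component_adapted:
  assumes "0 \<le> s"
  shows "(\<lambda>\<omega>. L s \<omega> $ i) \<in> borel_measurable (F s)" "(\<lambda>\<omega>. L' s \<omega> $ i) \<in> borel_measurable (F s)"
    "(\<lambda>\<omega>. H s \<omega> $ i $ j) \<in> borel_measurable (F s)" "(\<lambda>\<omega>. H' s \<omega> $ i $ j) \<in> borel_measurable (F s)"
  by (intro component_measurable adapted_LH assms)+

lemma closed_event:
  assumes "X \<in> borel_measurable (F s)" "closed K"
  shows "{\<omega> \<in> space M. X \<omega> \<in> K} \<in> sets (F s)"
proof -
  have "X -` K \<inter> space (F s) \<in> sets (F s)" using assms by (intro measurable_sets) auto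
  moreover have "X -` K \<inter> space (F s) = {\<omega> \<in> space M. X \<omega> \<in> K}" by auto
  ultimately show ?thesis by simp
qed

definition drift :: "real^('n::{finite,linorder}) \<Rightarrow> 'n \<Rightarrow> real" where
  "drift v i = b (v $ i) + (\<Sum>k\<in>UNIV - {i}. G_fun g h (v $ i) (v $ k) / (v $ i - v $ k))"

definition noise_coeff :: "real^('n::{finite,linorder}) \<Rightarrow> 'n \<Rightarrow> 'n \<Rightarrow> real" where
  "noise_coeff v j k = sqrt (G_fun g h (v $ j) (v $ k)) / (v $ j - v $ k)"

definition decay :: "real^('n::{finite,linorder}) \<Rightarrow> 'n \<Rightarrow> real" where
  "decay v j = (\<Sum>k\<in>UNIV - {j}. G_fun g h (v $ j) (v $ k) / (v $ k - v $ j)\<^sup>2)"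

lemma open_off_diagonal: "open {(x, y). x \<noteq> (y :: real)}"
proof -
  have "{(x, y). x \<noteq> (y :: real)} = {p. fst p \<noteq> snd p}" by auto
  then show ?thesis by (simp only:) (intro open_Collect_neq continuous_intros)
qed

lemma continuous_G: "continuous_on {(x, y). x \<noteq> y} (\<lambda>(x, y). G_fun g h x y)"
  using G_lipschitz open_off_diagonal by (rule locally_lipschitz_on_continuous)

lemma continuous_b: "continuous_on UNIV b"
  using b_lipschitz by (rule locally_lipschitz_on_continuous) simp

lemma continuous_gh: "continuous_on UNIV (\<lambda>x. g x * h x)"
  by (rule q_continuous[OF rho_measurable rho_pos rho_int gh])

lemma continuous_G_path:
  assumes "continuous_on S x" "continuous_on S y" "\<And>s. s \<in> S \<Longrightarrow> x s \<noteq> y s"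
  shows "continuous_on S (\<lambda>s. G_fun g h (x s) (y s))"
proof -
  have "continuous_on S (\<lambda>s. (\<lambda>(x, y). G_fun g h x y) (x s, y s))"
    by (rule continuous_on_compose2[OF continuous_G]) (use assms in \<open>auto intro!: continuous_intros\<close>)
  then show ?thesis by simp
qed

lemma continuous_coefficients:
  assumes v: "continuous_on S v" "\<And>s i k. s \<in> S \<Longrightarrow> i \<noteq> k \<Longrightarrow> v s $ i \<noteq> v s $ k"
  shows "continuous_on S (\<lambda>s. drift (v s) i)" and "continuous_on S (\<lambda>s. decay (v s) i)"
    and "i \<noteq> k \<Longrightarrow> continuous_on S (\<lambda>s. noise_coeff (v s) i k)"
proof -
  show "continuous_on S (\<lambda>s. drift (v s) i)"
    unfolding drift_def
    by (intro continuous_intros continuous_on_compose2[OF continuous_b] continuous_G_path v(1)) (use v(2) in auto)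
  show "continuous_on S (\<lambda>s. decay (v s) i)"
    unfolding decay_def
    by (intro continuous_intros continuous_G_path v(1)) (use v(2) in auto)
  show "continuous_on S (\<lambda>s. noise_coeff (v s) i k)" if "i \<noteq> k"
    unfolding noise_coeff_def
    by (intro continuous_intros continuous_G_path v(1)) (use v(2) that in auto)
qed

lemma drift_adapted:
  assumes "X \<in> borel_measurable N"
  shows "(\<lambda>\<omega>. drift (X \<omega>) i) \<in> borel_measurable N"
proof -
  have "continuous_on {(x, y). x \<noteq> y} (\<lambda>p. (case p of (x, y) \<Rightarrow> G_fun g h x y) / (fst p - snd p))"
    by (intro continuous_intros continuous_G) auto
  then have "(\<lambda>p. indicator {(x, y). x \<noteq> y} p *\<^sub>R ((case p of (x, y) \<Rightarrow> G_fun g h x y) / (fst p - snd p))) \<in> borel_measurable borel"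
    using open_off_diagonal by (intro borel_measurable_continuous_on_indicator) auto
  \<comment> \<open>On the diagonal the quotient is 0 because division by 0 is, so extending the
    continuous function by 0 reproduces it exactly.\<close>
  also have "(\<lambda>p. indicator {(x, y). x \<noteq> y} p *\<^sub>R ((case p of (x, y) \<Rightarrow> G_fun g h x y) / (fst p - snd p)))
      = (\<lambda>(x, y). G_fun g h x y / (x - y))"
    by (auto simp: fun_eq_iff indicator_def)
  finally have [measurable]: "(\<lambda>(x, y). G_fun g h x y / (x - y)) \<in> borel_measurable (borel \<Otimes>\<^sub>M borel)"
    by (simp add: borel_prod)
  have [measurable]: "b \<in> borel_measurable borel" using continuous_b by (rule borel_measurable_continuous_onI)
  note [measurable] = component_measurable[OF assms]
  have "(\<lambda>\<omega>. G_fun g h (X \<omega> $ i) (X \<omega> $ k) / (X \<omega> $ i - X \<omega> $ k)) \<in> borel_measurable N" for k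
    using measurable_compose[of "\<lambda>\<omega>. (X \<omega> $ i, X \<omega> $ k)" N "borel \<Otimes>\<^sub>M borel" "\<lambda>(x, y). G_fun g h x y / (x - y)" borel]
    by simp
  then show ?thesis unfolding drift_def by measurable
qed

context
  fixes N :: real
  assumes N: "0 < N"
begin

lemma compact_separated_pairs: "compact {(x, y). \<bar>x\<bar> \<le> N \<and> \<bar>y\<bar> \<le> N \<and> 1 / N \<le> \<bar>x - (y :: real)\<bar>}"
proof -
  have "{(x, y). \<bar>x\<bar> \<le> N \<and> \<bar>y\<bar> \<le> N \<and> 1 / N \<le> \<bar>x - (y :: real)\<bar>}
      = ({-N..N} \<times> {-N..N}) \<inter> {p. 1 / N \<le> \<bar>fst p - snd p\<bar>}" by auto
  moreover have "closed {p :: real \<times> real. 1 / N \<le> \<bar>fst p - snd p\<bar>}"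
    by (intro closed_Collect_le continuous_intros)
  ultimately show ?thesis by (simp add: compact_Int_closed compact_Times)
qed

lemma G_bounds:
  obtains C where "0 \<le> C"
    "\<And>(v :: real^('n::{finite,linorder})) i k. separated N v \<Longrightarrow> i \<noteq> k \<Longrightarrow> \<bar>G_fun g h (v $ i) (v $ k)\<bar> \<le> C"
    "\<And>(v :: real^('n::{finite,linorder})) w i k. separated N v \<Longrightarrow> separated N w \<Longrightarrow> i \<noteq> k \<Longrightarrow>
      \<bar>G_fun g h (v $ i) (v $ k) - G_fun g h (w $ i) (w $ k)\<bar> \<le> C * (\<bar>v $ i - w $ i\<bar> + \<bar>v $ k - w $ k\<bar>)"
proof -
  let ?K = "{(x, y). \<bar>x\<bar> \<le> N \<and> \<bar>y\<bar> \<le> N \<and> 1 / N \<le> \<bar>x - (y :: real)\<bar>}"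
  have sub: "?K \<subseteq> {(x, y). x \<noteq> y}" using N by auto
  obtain C1 where C1: "C1-lipschitz_on ?K (\<lambda>(x, y). G_fun g h x y)"
    using locally_lipschitz_on_compact[OF G_lipschitz compact_separated_pairs sub] by blast
  have bdd: "bounded ((\<lambda>(x, y). G_fun g h x y) ` ?K)"
    using compact_continuous_image[OF continuous_on_subset[OF continuous_G sub] compact_separated_pairs]
    by (rule compact_imp_bounded)
  obtain C2 where "\<forall>z\<in>(\<lambda>(x, y). G_fun g h x y) ` ?K. norm z \<le> C2"
    using bdd[unfolded bounded_iff] by (rule exE)
  then have C2: "norm ((\<lambda>(x, y). G_fun g h x y) p) \<le> C2" if "p \<in> ?K" for p
    using imageI[OF that] by (rule bspec)
  show thesis
  proof (rule that[of "\<bar>C1\<bar> + \<bar>C2\<bar>"])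
    fix v w :: "real^('n::{finite,linorder})" and i k :: 'n assume v: "separated N v" and ik: "i \<noteq> k"
    have vK: "(v $ i, v $ k) \<in> ?K" using v ik by (auto simp: separated_def)
    show "\<bar>G_fun g h (v $ i) (v $ k)\<bar> \<le> \<bar>C1\<bar> + \<bar>C2\<bar>" using C2[OF vK] by simp
    assume w: "separated N w"
    have wK: "(w $ i, w $ k) \<in> ?K" using w ik by (auto simp: separated_def)
    have "\<bar>G_fun g h (v $ i) (v $ k) - G_fun g h (w $ i) (w $ k)\<bar> \<le> C1 * dist (v $ i, v $ k) (w $ i, w $ k)"
      using lipschitz_onD[OF C1 vK wK] by (simp add: dist_real_def)
    also have "\<dots> \<le> (\<bar>C1\<bar> + \<bar>C2\<bar>) * (\<bar>v $ i - w $ i\<bar> + \<bar>v $ k - w $ k\<bar>)"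
    proof (rule mult_mono)
      show "dist (v $ i, v $ k) (w $ i, w $ k) \<le> \<bar>v $ i - w $ i\<bar> + \<bar>v $ k - w $ k\<bar>"
        using sqrt_sum_squares_le_sum_abs[of "v $ i - w $ i" "v $ k - w $ k"]
        by (simp add: dist_Pair_Pair dist_real_def)
    qed auto
    finally show "\<bar>G_fun g h (v $ i) (v $ k) - G_fun g h (w $ i) (w $ k)\<bar>
        \<le> (\<bar>C1\<bar> + \<bar>C2\<bar>) * (\<bar>v $ i - w $ i\<bar> + \<bar>v $ k - w $ k\<bar>)" .
  qed simp
qed

lemma drift_lipschitz:
  obtains K where "0 \<le> K" "\<And>v w i. separated N v \<Longrightarrow> separated N w \<Longrightarrow>
    \<bar>drift v i - drift w i\<bar> \<le> K * (\<Sum>k\<in>UNIV. \<bar>v $ k - w $ k\<bar>)"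
proof -
  obtain C where C: "0 \<le> C"
    "\<And>(v :: real^('n::{finite,linorder})) i k. separated N v \<Longrightarrow> i \<noteq> k \<Longrightarrow> \<bar>G_fun g h (v $ i) (v $ k)\<bar> \<le> C"
    "\<And>(v :: real^('n::{finite,linorder})) w i k. separated N v \<Longrightarrow> separated N w \<Longrightarrow> i \<noteq> k \<Longrightarrow>
      \<bar>G_fun g h (v $ i) (v $ k) - G_fun g h (w $ i) (w $ k)\<bar> \<le> C * (\<bar>v $ i - w $ i\<bar> + \<bar>v $ k - w $ k\<bar>)"
    using G_bounds by metis
  obtain B where B: "B-lipschitz_on {-N..N} b"
    using locally_lipschitz_on_compact[OF b_lipschitz compact_Icc] by blast
  define \<kappa> where "\<kappa> = N * C + N\<^sup>2 * C"
  have \<kappa>: "0 \<le> \<kappa>" using C(1) N by (simp add: \<kappa>_def)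
  show thesis
  proof (rule that[of "\<bar>B\<bar> + CARD('n) * (2 * \<kappa>)"])
    fix v w :: "real^('n::{finite,linorder})" and i :: 'n assume v: "separated N v" and w: "separated N w"
    let ?S = "\<Sum>k\<in>UNIV. \<bar>v $ k - w $ k\<bar>"
    have le_S: "\<bar>v $ k - w $ k\<bar> \<le> ?S" for k by (intro member_le_sum) auto
    have S0: "0 \<le> ?S" by (intro sum_nonneg) auto
    have "\<bar>v $ i\<bar> \<le> N" "\<bar>w $ i\<bar> \<le> N" using v w by (auto simp: separated_def)
    then have "v $ i \<in> {-N..N}" "w $ i \<in> {-N..N}" by auto
    from lipschitz_onD[OF B this] have "\<bar>b (v $ i) - b (w $ i)\<bar> \<le> B * \<bar>v $ i - w $ i\<bar>"
      by (simp add: dist_real_def)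
    also have "\<dots> \<le> \<bar>B\<bar> * ?S" using le_S by (intro mult_mono) auto
    finally have 1: "\<bar>b (v $ i) - b (w $ i)\<bar> \<le> \<bar>B\<bar> * ?S" .
    have 2: "\<bar>G_fun g h (v $ i) (v $ k) / (v $ i - v $ k) - G_fun g h (w $ i) (w $ k) / (w $ i - w $ k)\<bar> \<le> 2 * \<kappa> * ?S"
      if ik: "i \<noteq> k" for k
    proof -
      let ?x = "v $ i - v $ k" and ?y = "w $ i - w $ k"
      have x: "1 / N \<le> \<bar>?x\<bar>" and y: "1 / N \<le> \<bar>?y\<bar>" using v w ik by (auto simp: separated_def)
      have pos: "0 < \<bar>?x\<bar>" "0 < \<bar>?y\<bar>" using x y N by (metis divide_pos_pos less_le_trans zero_less_one)+
      have inv: "1 / \<bar>?x\<bar> \<le> N" "1 / \<bar>?y\<bar> \<le> N" using x y pos N by (simp_all add: field_simps)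
      let ?d = "\<bar>v $ i - w $ i\<bar> + \<bar>v $ k - w $ k\<bar>"
      have eq: "G_fun g h (v $ i) (v $ k) / ?x - G_fun g h (w $ i) (w $ k) / ?y
          = (G_fun g h (v $ i) (v $ k) - G_fun g h (w $ i) (w $ k)) * (1 / ?x)
            + G_fun g h (w $ i) (w $ k) * ((?y - ?x) * (1 / ?x * (1 / ?y)))"
      proof -
        have "p / x - q / y = (p - q) * (1 / x) + q * ((y - x) * (1 / x * (1 / y)))"
          if "x \<noteq> 0" "y \<noteq> 0" for p q x y :: real
          using that by (simp add: field_simps)
        from this[of ?x ?y] show ?thesis using pos by simp
      qed
      have "\<bar>G_fun g h (v $ i) (v $ k) / ?x - G_fun g h (w $ i) (w $ k) / ?y\<bar>
          \<le> \<bar>G_fun g h (v $ i) (v $ k) - G_fun g h (w $ i) (w $ k)\<bar> * (1 / \<bar>?x\<bar>)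
            + \<bar>G_fun g h (w $ i) (w $ k)\<bar> * (\<bar>?y - ?x\<bar> * (1 / \<bar>?x\<bar> * (1 / \<bar>?y\<bar>)))"
        unfolding eq by (intro order_trans[OF abs_triangle_ineq]) (simp add: abs_mult)
      also have "\<dots> \<le> (C * ?d) * N + C * (?d * (N * N))"
        using C(2)[OF w ik] C(3)[OF v w ik] inv pos C(1) N by (intro add_mono mult_mono) auto
      also have "\<dots> = \<kappa> * ?d" by (simp add: \<kappa>_def power2_eq_square algebra_simps)
      also have "\<dots> \<le> \<kappa> * (2 * ?S)" using le_S[of i] le_S[of k] \<kappa> by (intro mult_left_mono) auto
      finally show ?thesis by (simp add: mult_ac)
    qed
    have "\<bar>drift v i - drift w i\<bar> \<le> \<bar>b (v $ i) - b (w $ i)\<bar>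
        + \<bar>\<Sum>k\<in>UNIV - {i}. G_fun g h (v $ i) (v $ k) / (v $ i - v $ k) - G_fun g h (w $ i) (w $ k) / (w $ i - w $ k)\<bar>"
      unfolding drift_def sum_subtractf by linarith
    also have "\<dots> \<le> \<bar>B\<bar> * ?S + (\<Sum>k\<in>UNIV - {i}. 2 * \<kappa> * ?S)"
      by (intro add_mono 1 order_trans[OF sum_abs] sum_mono 2) auto
    also have "(\<Sum>k\<in>UNIV - {i}. 2 * \<kappa> * ?S) \<le> (\<Sum>k\<in>(UNIV :: 'n set). 2 * \<kappa> * ?S)"
      using \<kappa> S0 by (intro sum_mono2) auto
    also have "\<dots> = CARD('n) * (2 * \<kappa>) * ?S" by simp
    finally show "\<bar>drift v i - drift w i\<bar> \<le> (\<bar>B\<bar> + CARD('n) * (2 * \<kappa>)) * ?S"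
      by (simp add: distrib_right)
  qed (use \<kappa> in simp)
qed

text \<open>For the eigenvectors bounds suffice: the two solutions already share their eigenvalues
  there, so these coefficients are common factors and are never subtracted from one another.\<close>

lemma coefficient_bounds:
  obtains C where "0 \<le> C" "\<And>v j k. separated N v \<Longrightarrow> j \<noteq> k \<Longrightarrow> \<bar>noise_coeff v j k\<bar> \<le> C"
    "\<And>v j. separated N v \<Longrightarrow> \<bar>decay v j\<bar> \<le> C"
proof -
  obtain C where C: "0 \<le> C"
    "\<And>(v :: real^('n::{finite,linorder})) i k. separated N v \<Longrightarrow> i \<noteq> k \<Longrightarrow> \<bar>G_fun g h (v $ i) (v $ k)\<bar> \<le> C"
    using G_bounds by metis
  have inv: "1 / \<bar>v $ j - v $ k\<bar> \<le> N" "0 < \<bar>v $ j - v $ k\<bar>" if "separated N v" "j \<noteq> k" for v :: "real^('n::{finite,linorder})" and j k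
  proof -
    have x: "1 / N \<le> \<bar>v $ j - v $ k\<bar>" using that by (auto simp: separated_def)
    then show pos: "0 < \<bar>v $ j - v $ k\<bar>" using N by (metis divide_pos_pos less_le_trans zero_less_one)
    show "1 / \<bar>v $ j - v $ k\<bar> \<le> N" using x pos N by (simp add: field_simps)
  qed
  show thesis
  proof (rule that[of "sqrt C * N + CARD('n) * (C * N\<^sup>2)"])
    fix v :: "real^('n::{finite,linorder})" and j k :: 'n assume v: "separated N v"
    { assume jk: "j \<noteq> k"
      have "\<bar>noise_coeff v j k\<bar> = sqrt \<bar>G_fun g h (v $ j) (v $ k)\<bar> * (1 / \<bar>v $ j - v $ k\<bar>)"
        by (simp add: noise_coeff_def abs_divide G_fun_def)
      also have "\<dots> \<le> sqrt C * N"
        using C(2)[OF v jk] inv[OF v jk] C(1) by (intro mult_mono) auto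
      finally show "\<bar>noise_coeff v j k\<bar> \<le> sqrt C * N + CARD('n) * (C * N\<^sup>2)"
        using C(1) by (simp add: add_increasing2) }
    have "\<bar>decay v j\<bar> \<le> (\<Sum>k\<in>UNIV - {j}. C * N\<^sup>2)"
      unfolding decay_def
    proof (intro order_trans[OF sum_abs] sum_mono)
      fix k assume "k \<in> UNIV - {j}"
      then have k: "j \<noteq> k" by auto
      have "\<bar>G_fun g h (v $ j) (v $ k) / (v $ k - v $ j)\<^sup>2\<bar> = \<bar>G_fun g h (v $ j) (v $ k)\<bar> * (1 / \<bar>v $ j - v $ k\<bar>)\<^sup>2"
        by (simp add: power_divide abs_divide power2_commute)
      also have "\<dots> \<le> C * N\<^sup>2"
        using C(1,2) inv[OF v k] v k by (intro mult_mono power_mono) auto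
      finally show "\<bar>G_fun g h (v $ j) (v $ k) / (v $ k - v $ j)\<^sup>2\<bar> \<le> C * N\<^sup>2" .
    qed
    also have "\<dots> \<le> (\<Sum>k\<in>(UNIV :: 'n set). C * N\<^sup>2)" using C(1) by (intro sum_mono2) auto
    also have "\<dots> = CARD('n) * (C * N\<^sup>2)" by simp
    finally show "\<bar>decay v j\<bar> \<le> sqrt C * N + CARD('n) * (C * N\<^sup>2)"
      using C(1) N by (simp add: add_increasing)
  qed (use C(1) N in simp)
qed

end

section \<open>The integrated equations and agreement of the eigenvalues\<close>

lemma eigenvalue_equation:
  assumes "eigensystem_solution M F g h b \<nu> \<beta> X V"
  obtains Y where
    "has_ito_integral_before M F (collision_time X) (\<nu> i) (\<lambda>t \<omega>. 2 * g (X t \<omega> $ i) * h (X t \<omega> $ i)) Y"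
    "AE \<omega> in M. \<forall>t\<ge>0. ereal t < collision_time X \<omega> \<longrightarrow>
      set_integrable lborel {0..t} (\<lambda>s. drift (X s \<omega>) i) \<and>
      X t \<omega> $ i = X 0 \<omega> $ i + Y t \<omega> + (LINT s:{0..t}|lborel. drift (X s \<omega>) i)"
proof -
  have "has_stochastic_differential_before M F (collision_time X) {i} \<nu>
      (\<lambda>_ t \<omega>. 2 * g (X t \<omega> $ i) * h (X t \<omega> $ i)) (\<lambda>t \<omega>. drift (X t \<omega>) i) (\<lambda>t \<omega>. X t \<omega> $ i)"
    using assms unfolding eigensystem_solution_def drift_def by blast
  then obtain Y where Y:
    "\<forall>k\<in>{i}. has_ito_integral_before M F (collision_time X) (\<nu> k) (\<lambda>t \<omega>. 2 * g (X t \<omega> $ i) * h (X t \<omega> $ i)) (Y k)"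
    "AE \<omega> in M. \<forall>t\<ge>0. ereal t < collision_time X \<omega> \<longrightarrow>
      set_integrable lborel {0..t} (\<lambda>s. drift (X s \<omega>) i) \<and>
      X t \<omega> $ i = X 0 \<omega> $ i + (\<Sum>k\<in>{i}. Y k t \<omega>) + (LINT s:{0..t}|lborel. drift (X s \<omega>) i)"
    unfolding has_stochastic_differential_before_def by blast
  show thesis by (rule that[of "Y i"]) (use Y in simp_all)
qed

lemma eigenvector_equation:
  assumes "eigensystem_solution M F g h b \<nu> \<beta> X V"
  obtains Y where
    "\<forall>k\<in>UNIV - {j}. has_ito_integral_before M F (collision_time X) (\<beta> k j)
      (\<lambda>t \<omega>. V t \<omega> $ i $ k * noise_coeff (X t \<omega>) j k) (Y k)"
    "AE \<omega> in M. \<forall>t\<ge>0. ereal t < collision_time X \<omega> \<longrightarrow>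
      set_integrable lborel {0..t} (\<lambda>s. - (1/2) * V s \<omega> $ i $ j * decay (X s \<omega>) j) \<and>
      V t \<omega> $ i $ j = V 0 \<omega> $ i $ j + (\<Sum>k\<in>UNIV - {j}. Y k t \<omega>)
        + (LINT s:{0..t}|lborel. - (1/2) * V s \<omega> $ i $ j * decay (X s \<omega>) j)"
proof -
  have "has_stochastic_differential_before M F (collision_time X) (UNIV - {j}) (\<lambda>k. \<beta> k j)
      (\<lambda>k t \<omega>. V t \<omega> $ i $ k * noise_coeff (X t \<omega>) j k)
      (\<lambda>t \<omega>. - (1/2) * V t \<omega> $ i $ j * decay (X t \<omega>) j) (\<lambda>t \<omega>. V t \<omega> $ i $ j)"
    using assms unfolding eigensystem_solution_def noise_coeff_def decay_def by blast
  then show thesis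
    unfolding has_stochastic_differential_before_def using that by blast
qed

text \<open>The number N also caps time. Up to the exit time T the drift differences are at most K
  S, with S the sum of the absolute eigenvalue differences; adding the inequality over all indices
  gives Gronwall's inequality for S with constant \<open>CARD('n) * K\<close>.\<close>

lemma eigenvalues_agree_separated:
  assumes N: "0 < N"
  shows "AE \<omega> in M. \<forall>t\<ge>0. t \<le> N \<longrightarrow> (\<forall>r\<in>{0..t}. separated N (L r \<omega>) \<and> separated N (L' r \<omega>)) \<longrightarrow> L t \<omega> = L' t \<omega>"
proof -
  let ?good = "\<lambda>r \<omega>. separated N (L r \<omega>) \<and> separated N (L' r \<omega>)"
  obtain T where T_meas: "T \<in> borel_measurable M"
    and T: "\<And>s. 0 \<le> s \<Longrightarrow> {\<omega> \<in> space M. s \<le> T \<omega>} \<in> sets (F s)"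
    and T_iff: "\<And>\<omega> s. \<omega> \<in> space M \<Longrightarrow> 0 \<le> s \<Longrightarrow> s \<le> T \<omega> \<longleftrightarrow> s \<le> N \<and> (\<forall>r\<in>{0..s}. ?good r \<omega>)"
  proof (rule exit_time_exists[of ?good N])
    show "{\<omega> \<in> space M. ?good r \<omega>} \<in> sets (F r)" if "0 \<le> r" for r
    proof -
      have "{\<omega> \<in> space M. ?good r \<omega>}
          = {\<omega> \<in> space M. L r \<omega> \<in> {v. separated N v}} \<inter> {\<omega> \<in> space M. L' r \<omega> \<in> {v. separated N v}}" by auto
      then show ?thesis
        using closed_event[OF adapted_LH(1)[OF that] closed_separated] closed_event[OF adapted_LH(2)[OF that] closed_separated]
        by (simp only:) (rule sets.Int)
    qed
    show "\<forall>r\<in>{0..s}. ?good r \<omega>"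
      if w: "\<omega> \<in> space M" and s: "0 < s" and rat: "\<And>r. r \<in> \<rat> \<Longrightarrow> 0 \<le> r \<Longrightarrow> r < s \<Longrightarrow> ?good r \<omega>" for \<omega> s
    proof
      fix r assume r: "r \<in> {0..s}"
      have c: "continuous_on {0..s} (\<lambda>t. L t \<omega>)" "continuous_on {0..s} (\<lambda>t. L' t \<omega>)"
        using continuous_L[OF w] continuous_L'[OF w] by (auto intro: continuous_on_subset)
      show "?good r \<omega>"
        using closed_on_interval_of_rationals[OF s c(1) closed_separated _ r]
          closed_on_interval_of_rationals[OF s c(2) closed_separated _ r] rat by simp
    qed
  qed (use N in simp_all)
  have sep: "separated N (L s \<omega>)" "separated N (L' s \<omega>)" if "\<omega> \<in> space M" "s \<in> {0..T \<omega>}" for \<omega> s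
    using T_iff[OF that(1), of s] that(2) by auto
  have neq: "L s \<omega> $ i \<noteq> L s \<omega> $ k" "L' s \<omega> $ i \<noteq> L' s \<omega> $ k"
    if "\<omega> \<in> space M" "s \<in> {0..T \<omega>}" "i \<noteq> k" for \<omega> s i k
    using sep[OF that(1,2)] N that(3) by (auto dest: separated_neq)
  have bounds: "\<bar>L s \<omega> $ i\<bar> \<le> N" "\<bar>L' s \<omega> $ i\<bar> \<le> N" if "\<omega> \<in> space M" "s \<in> {0..T \<omega>}" for \<omega> s i
    using sep[OF that] by (auto simp: separated_def)
  have cont: "continuous_on {0..T \<omega>} (\<lambda>s. L s \<omega>)" "continuous_on {0..T \<omega>} (\<lambda>s. L' s \<omega>)" if "\<omega> \<in> space M" for \<omega>
    using continuous_L[OF that] continuous_L'[OF that] by (auto intro: continuous_on_subset)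
  \<comment> \<open>Both paths are separated on the closed interval up to T, so no collision occurs
    there, the endpoint included; a negative T precedes every collision anyway.\<close>
  have before: "ereal (T \<omega>) < \<tau> \<omega> \<and> ereal (T \<omega>) < \<tau>' \<omega>" if "\<omega> \<in> space M" for \<omega>
    using neq[OF that] continuous_L[OF that] continuous_L'[OF that] by (auto intro!: less_collision_timeI)
  obtain K where K: "0 \<le> K" "\<And>v w i. separated N v \<Longrightarrow> separated N w \<Longrightarrow>
      \<bar>drift v i - drift w i\<bar> \<le> K * (\<Sum>k\<in>UNIV. \<bar>v $ k - w $ k\<bar>)"
    using drift_lipschitz[OF N] by metis
  have "bounded ((\<lambda>x. g x * h x) ` {-N..N})"
    using continuous_gh by (intro compact_imp_bounded compact_continuous_image) (auto intro: continuous_on_subset)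
  then obtain Bq where Bq: "\<forall>y\<in>(\<lambda>x. g x * h x) ` {-N..N}. norm y \<le> Bq"
    unfolding bounded_iff by (rule exE)
  have Bq: "\<bar>g x * h x\<bar> \<le> \<bar>Bq\<bar>" if "\<bar>x\<bar> \<le> N" for x
    using Bq[rule_format, of "g x * h x"] that by (force simp: abs_le_iff)
  define S where "S = (\<lambda>s \<omega>. \<Sum>k\<in>UNIV. \<bar>L s \<omega> $ k - L' s \<omega> $ k\<bar>)"
  \<comment> \<open>One constant for three bounds: the difference of the noise coefficients, the
    majorant K S of the drift difference, and the distance of two eigenvalues.\<close>
  define C where "C = 4 * \<bar>Bq\<bar> + K * (CARD('n) * (2 * N)) + 2 * N"
  have C: "0 \<le> C" using K(1) N by (simp add: C_def)
  have S_adapted: "S s \<in> borel_measurable (F s)" if "0 \<le> s" for s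
    unfolding S_def by (intro borel_measurable_sum borel_measurable_abs borel_measurable_diff component_adapted that)
  have S_cont: "continuous_on {0..T \<omega>} (\<lambda>s. S s \<omega>)" if "\<omega> \<in> space M" for \<omega>
    unfolding S_def by (intro continuous_intros cont[OF that])
  have comp_le: "\<bar>L s \<omega> $ i - L' s \<omega> $ i\<bar> \<le> 2 * N" if "\<omega> \<in> space M" "s \<in> {0..T \<omega>}" for \<omega> s i
    using bounds[OF that, of i] by linarith
  have S_bound: "0 \<le> S s \<omega> \<and> S s \<omega> \<le> CARD('n) * (2 * N)" if "\<omega> \<in> space M" "s \<in> {0..T \<omega>}" for \<omega> s
  proof -
    have "S s \<omega> \<le> (\<Sum>k\<in>(UNIV :: 'n set). 2 * N)" unfolding S_def using comp_le[OF that] by (intro sum_mono) auto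
    then show ?thesis unfolding S_def by (auto intro: sum_nonneg)
  qed
  note [measurable] = measurable_stopping[OF T]
  have ineq: "expectation (\<lambda>\<omega>. indicator {0..T \<omega>} t * \<bar>L t \<omega> $ i - L' t \<omega> $ i\<bar>)
      \<le> expectation (\<lambda>\<omega>. LINT s:{0..min t (T \<omega>)}|lborel. K * S s \<omega>)" if t: "0 < t" for t i
  proof -
    interpret W: filtered_brownian M F "\<nu> i" by (rule brownian_\<nu>)
    obtain Y where Y: "has_ito_integral_before M F \<tau> (\<nu> i) (\<lambda>t \<omega>. 2 * g (L t \<omega> $ i) * h (L t \<omega> $ i)) Y"
      "AE \<omega> in M. \<forall>t\<ge>0. ereal t < \<tau> \<omega> \<longrightarrow>
        set_integrable lborel {0..t} (\<lambda>s. drift (L s \<omega>) i) \<and>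
        L t \<omega> $ i = L 0 \<omega> $ i + Y t \<omega> + (LINT s:{0..t}|lborel. drift (L s \<omega>) i)"
      by (rule eigenvalue_equation[OF sol, of i])
    obtain Y' where Y': "has_ito_integral_before M F \<tau>' (\<nu> i) (\<lambda>t \<omega>. 2 * g (L' t \<omega> $ i) * h (L' t \<omega> $ i)) Y'"
      "AE \<omega> in M. \<forall>t\<ge>0. ereal t < \<tau>' \<omega> \<longrightarrow>
        set_integrable lborel {0..t} (\<lambda>s. drift (L' s \<omega>) i) \<and>
        L' t \<omega> $ i = L' 0 \<omega> $ i + Y' t \<omega> + (LINT s:{0..t}|lborel. drift (L' s \<omega>) i)"
      by (rule eigenvalue_equation[OF sol', of i])
    have cont_gh: "continuous_on A (\<lambda>s. 2 * g (x s) * h (x s))" if "continuous_on A x" for A and x :: "real \<Rightarrow> real"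
      using continuous_on_mult_left[OF continuous_on_compose2[OF continuous_gh that], of 2] by (simp add: mult.assoc)
    show ?thesis
    proof (rule W.abs_difference_inequality[where f="\<lambda>t \<omega>. 2 * g (L t \<omega> $ i) * h (L t \<omega> $ i)"
          and f'="\<lambda>t \<omega>. 2 * g (L' t \<omega> $ i) * h (L' t \<omega> $ i)" and a="\<lambda>s \<omega>. drift (L s \<omega>) i - drift (L' s \<omega>) i"
          and q="\<lambda>x. g x * h x" and C=C, OF rho_measurable rho_pos rho_int gh Y(1) Y'(1) T _ C t])
      show "ereal (T \<omega>) < \<tau> \<omega> \<and> ereal (T \<omega>) < \<tau>' \<omega>" if "\<omega> \<in> space M" for \<omega> by (rule before[OF that])
      fix \<omega> assume w: "\<omega> \<in> space M"
      show "continuous_on {0..T \<omega>} (\<lambda>s. 2 * g (L s \<omega> $ i) * h (L s \<omega> $ i))"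
        "continuous_on {0..T \<omega>} (\<lambda>s. 2 * g (L' s \<omega> $ i) * h (L' s \<omega> $ i))"
        by (intro cont_gh continuous_intros cont[OF w])+
      show "continuous_on {0..T \<omega>} (\<lambda>s. drift (L s \<omega>) i - drift (L' s \<omega>) i)"
        using neq[OF w] by (intro continuous_on_diff continuous_coefficients cont[OF w]) auto
      show "continuous_on {0..T \<omega>} (\<lambda>s. K * S s \<omega>)" by (intro continuous_intros S_cont[OF w])
      fix s assume s: "s \<in> {0..T \<omega>}"
      show "\<bar>2 * g (L s \<omega> $ i) * h (L s \<omega> $ i) - 2 * g (L' s \<omega> $ i) * h (L' s \<omega> $ i)\<bar> \<le> C"
      proof -
        have "0 \<le> K * (CARD('n) * (2 * N))" using K(1) N by simp
        then show ?thesis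
          using Bq[OF bounds(1)[OF w s, of i]] Bq[OF bounds(2)[OF w s, of i]] N unfolding C_def mult.assoc by linarith
      qed
      show "\<bar>drift (L s \<omega>) i - drift (L' s \<omega>) i\<bar> \<le> K * S s \<omega>"
        unfolding S_def by (rule K(2)[OF sep[OF w s]])
      have "K * S s \<omega> \<le> K * (CARD('n) * (2 * N))" using S_bound[OF w s] K(1) by (intro mult_left_mono) auto
      moreover have "0 \<le> K * S s \<omega>" using S_bound[OF w s] K(1) by simp
      ultimately show "\<bar>K * S s \<omega>\<bar> \<le> C" using N unfolding C_def by linarith
    next
      show "\<bar>L t \<omega> $ i - L' t \<omega> $ i\<bar> \<le> C" if "\<omega> \<in> space M" "t \<in> {0..T \<omega>}" for \<omega>
      proof -
        have "0 \<le> K * (CARD('n) * (2 * N))" using K(1) N by simp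
        then show ?thesis using comp_le[OF that, of i] unfolding C_def by linarith
      qed
      show "(\<lambda>\<omega>. drift (L s \<omega>) i - drift (L' s \<omega>) i) \<in> borel_measurable (F s)" if "0 \<le> s" for s
        by (intro borel_measurable_diff drift_adapted adapted_LH that)
      show "(\<lambda>\<omega>. K * S s \<omega>) \<in> borel_measurable (F s)" if "0 \<le> s" for s
        by (intro borel_measurable_times borel_measurable_const S_adapted that)
      show "(\<lambda>\<omega>. L t \<omega> $ i) \<in> borel_measurable M" "(\<lambda>\<omega>. L' t \<omega> $ i) \<in> borel_measurable M"
        using component_adapted[of t i] t by (auto intro: measurable_F_M)
      show "AE \<omega> in M. \<forall>s\<in>{0..T \<omega>}. L s \<omega> $ i - L' s \<omega> $ i
          = Y s \<omega> - Y' s \<omega> + (LINT u:{0..s}|lborel. drift (L u \<omega>) i - drift (L' u \<omega>) i)"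
        using Y(2) Y'(2) same_init AE_space
      proof eventually_elim
        case (elim \<omega>)
        show ?case
        proof
          fix s assume s: "s \<in> {0..T \<omega>}"
          have lt: "ereal s < \<tau> \<omega>" "ereal s < \<tau>' \<omega>"
            using before[of \<omega>] elim s by (auto intro: le_less_trans[of _ "ereal (T \<omega>)"])
          have e: "set_integrable lborel {0..s} (\<lambda>s. drift (L s \<omega>) i)"
            "L s \<omega> $ i = L 0 \<omega> $ i + Y s \<omega> + (LINT s:{0..s}|lborel. drift (L s \<omega>) i)"
            "set_integrable lborel {0..s} (\<lambda>s. drift (L' s \<omega>) i)"
            "L' s \<omega> $ i = L' 0 \<omega> $ i + Y' s \<omega> + (LINT s:{0..s}|lborel. drift (L' s \<omega>) i)"
            using elim lt s by auto
          show "L s \<omega> $ i - L' s \<omega> $ i = Y s \<omega> - Y' s \<omega> + (LINT u:{0..s}|lborel. drift (L u \<omega>) i - drift (L' u \<omega>) i)"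
            using e(2,4) elim unfolding set_integral_diff(2)[OF e(1,3)] by simp
        qed
      qed
    qed (auto simp: algebra_simps)
  qed
  have "AE \<omega> in M. \<forall>t\<in>{0..T \<omega>}. S t \<omega> = 0"
  proof (rule gronwall_process[where K="CARD('n) * K" and B="CARD('n) * (2 * N)", OF T_meas _ S_cont S_bound])
    show "S s \<in> borel_measurable M" if "0 \<le> s" for s using S_adapted[OF that] by (rule measurable_F_M)
    show "AE \<omega> in M. S 0 \<omega> = 0" using same_init by eventually_elim (simp add: S_def)
    fix t :: real assume t: "0 < t"
    have int: "integrable M (\<lambda>\<omega>. indicator {0..T \<omega>} t * \<bar>L t \<omega> $ i - L' t \<omega> $ i\<bar>)" for i
    proof (rule integrable_const_bound[where B="2 * N"])
      show "AE \<omega> in M. norm (indicator {0..T \<omega>} t * \<bar>L t \<omega> $ i - L' t \<omega> $ i\<bar>) \<le> 2 * N"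
        using comp_le N by (intro AE_I2) (auto simp: indicator_def)
      have [measurable]: "(\<lambda>\<omega>. L t \<omega> $ i) \<in> borel_measurable M" "(\<lambda>\<omega>. L' t \<omega> $ i) \<in> borel_measurable M"
        using component_adapted[of t i] t by (auto intro: measurable_F_M)
      show "(\<lambda>\<omega>. indicator {0..T \<omega>} t * \<bar>L t \<omega> $ i - L' t \<omega> $ i\<bar>) \<in> borel_measurable M" by measurable
    qed
    have "expectation (\<lambda>\<omega>. indicator {0..T \<omega>} t * S t \<omega>)
        = (\<Sum>i\<in>UNIV. expectation (\<lambda>\<omega>. indicator {0..T \<omega>} t * \<bar>L t \<omega> $ i - L' t \<omega> $ i\<bar>))"
      unfolding S_def sum_distrib_left using int by (intro Bochner_Integration.integral_sum) auto
    also have "\<dots> \<le> (\<Sum>i\<in>(UNIV :: 'n set). expectation (\<lambda>\<omega>. LINT s:{0..min t (T \<omega>)}|lborel. K * S s \<omega>))"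
      using ineq[OF t] by (intro sum_mono) auto
    also have "\<dots> = CARD('n) * K * expectation (\<lambda>\<omega>. LINT s:{0..min t (T \<omega>)}|lborel. S s \<omega>)" by simp
    finally show "expectation (\<lambda>\<omega>. indicator {0..T \<omega>} t * S t \<omega>)
        \<le> CARD('n) * K * expectation (\<lambda>\<omega>. LINT s:{0..min t (T \<omega>)}|lborel. S s \<omega>)" .
  qed (use K(1) in simp_all)
  then show ?thesis using AE_space
  proof eventually_elim
    case (elim \<omega>)
    show ?case
    proof (intro allI impI)
      fix t assume t: "0 \<le> t" "t \<le> N" "\<forall>r\<in>{0..t}. ?good r \<omega>"
      then have "t \<in> {0..T \<omega>}" using T_iff[of \<omega> t] elim by auto
      then have "(\<Sum>k\<in>UNIV. \<bar>L t \<omega> $ k - L' t \<omega> $ k\<bar>) = 0" using elim by (simp add: S_def)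
      then have "\<forall>k. L t \<omega> $ k = L' t \<omega> $ k" by (subst (asm) sum_nonneg_eq_0_iff) auto
      then show "L t \<omega> = L' t \<omega>" by (simp add: vec_eq_iff)
    qed
  qed
qed

lemma separated_before_collision:
  assumes w: "\<omega> \<in> space M" and t: "0 \<le> t" "ereal t < \<tau> \<omega>" "ereal t < \<tau>' \<omega>"
  obtains N0 where "\<And>N r. N0 \<le> N \<Longrightarrow> r \<in> {0..t} \<Longrightarrow> separated N (L r \<omega>) \<and> separated N (L' r \<omega>)"
proof -
  have lt: "ereal s < \<tau> \<omega>" "ereal s < \<tau>' \<omega>" if "s \<in> {0..t}" for s
    using t that by (auto intro: le_less_trans[of _ "ereal t"])
  have c: "continuous_on {0..t} (\<lambda>s. L s \<omega>)" "continuous_on {0..t} (\<lambda>s. L' s \<omega>)"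
    using continuous_L[OF w] continuous_L'[OF w] by (auto intro: continuous_on_subset)
  obtain N1 where N1: "\<And>N s. N1 \<le> N \<Longrightarrow> s \<in> {0..t} \<Longrightarrow> separated N (L s \<omega>)"
    using continuous_path_separated[OF c(1) _ t(1)] collision_timeD[OF _ lt(1)] by (metis atLeastAtMost_iff)
  obtain N2 where N2: "\<And>N s. N2 \<le> N \<Longrightarrow> s \<in> {0..t} \<Longrightarrow> separated N (L' s \<omega>)"
    using continuous_path_separated[OF c(2) _ t(1)] collision_timeD[OF _ lt(2)] by (metis atLeastAtMost_iff)
  show thesis by (rule that[of "max N1 N2"]) (use N1 N2 in auto)
qed

lemma eigenvalues_agree:
  "AE \<omega> in M. \<forall>t\<ge>0. ereal t < \<tau> \<omega> \<longrightarrow> ereal t < \<tau>' \<omega> \<longrightarrow> L t \<omega> = L' t \<omega>"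
proof -
  \<comment> \<open>Countably many localization levels share one null set. Before both collisions,
    compactness of the path supplies a sufficient level, taken large enough to exceed the time as
    well.\<close>
  have "AE \<omega> in M. \<forall>n. \<forall>t\<ge>0. t \<le> real (Suc n) \<longrightarrow>
      (\<forall>r\<in>{0..t}. separated (real (Suc n)) (L r \<omega>) \<and> separated (real (Suc n)) (L' r \<omega>)) \<longrightarrow> L t \<omega> = L' t \<omega>"
    by (subst AE_all_countable) (intro allI eigenvalues_agree_separated, simp)
  then show ?thesis using AE_space
  proof eventually_elim
    case (elim \<omega>)
    show ?case
    proof (intro allI impI)
      fix t assume t: "0 \<le> t" "ereal t < \<tau> \<omega>" "ereal t < \<tau>' \<omega>"
      then obtain N0 where N0: "\<And>N r. N0 \<le> N \<Longrightarrow> r \<in> {0..t} \<Longrightarrow> separated N (L r \<omega>) \<and> separated N (L' r \<omega>)"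
        using separated_before_collision elim by metis
      obtain n where n: "max N0 t < real n" using reals_Archimedean2 by blast
      then have "N0 \<le> real (Suc n)" "t \<le> real (Suc n)" by auto
      then show "L t \<omega> = L' t \<omega>" using elim N0 t(1) by blast
    qed
  qed
qed

text \<open>If one solution collided strictly earlier, both would agree before that moment and, by
  continuity, at it. The other would then collide at the same moment, which is before its own
  collision time. A collision at time 0 is handled by the common initial value.\<close>

lemma collision_times_agree: "AE \<omega> in M. \<tau> \<omega> = \<tau>' \<omega>"
  using eigenvalues_agree same_init AE_space
proof eventually_elim
  case (elim \<omega>)
  have le: "collision_time X2 \<omega> \<le> collision_time X1 \<omega>"
    if X: "continuous_on {0..} (\<lambda>t. X1 t \<omega>)" "continuous_on {0..} (\<lambda>t. X2 t \<omega>)" "X1 0 \<omega> = X2 0 \<omega>"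
      and agree: "\<And>t. 0 \<le> t \<Longrightarrow> ereal t < collision_time X1 \<omega> \<Longrightarrow> ereal t < collision_time X2 \<omega> \<Longrightarrow> X1 t \<omega> = X2 t \<omega>"
    for X1 X2 :: "real \<Rightarrow> 'a \<Rightarrow> real^('n::{finite,linorder})"
  proof (rule ccontr)
    assume "\<not> ?thesis"
    then have less: "collision_time X1 \<omega> < collision_time X2 \<omega>" by simp
    then have "collision_time X1 \<omega> \<noteq> \<infinity>" by auto
    with X(1) obtain t i j where t: "0 \<le> t" "collision_time X1 \<omega> = ereal t" "i \<noteq> j" "X1 t \<omega> $ i = X1 t \<omega> $ j"
      by (rule collision_time_attained)
    have "X1 t \<omega> = X2 t \<omega>"
    proof (cases "t = 0")
      case False
      then have "0 < t" using t by simp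
      then obtain x where x: "\<And>n. 0 < x n" "\<And>n. x n < t" "x \<longlonglongrightarrow> t"
        using rational_sequence_below by metis
      have "X1 (x n) \<omega> = X2 (x n) \<omega>" for n
      proof (rule agree)
        show "ereal (x n) < collision_time X1 \<omega>" using x(2)[of n] t(2) by simp
        then show "ereal (x n) < collision_time X2 \<omega>" using less by (rule less_trans)
      qed (use x(1)[of n] in simp)
      moreover have "(\<lambda>n. X1 (x n) \<omega>) \<longlonglongrightarrow> X1 t \<omega>" "(\<lambda>n. X2 (x n) \<omega>) \<longlonglongrightarrow> X2 t \<omega>"
        using t(1) x(1) by (auto intro!: continuous_on_tendsto_compose[OF X(1) x(3)]
            continuous_on_tendsto_compose[OF X(2) x(3)] always_eventually less_imp_le)
      ultimately show ?thesis by (simp add: LIMSEQ_unique)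
    qed (use X(3) in simp)
    then have "X2 t \<omega> $ i = X2 t \<omega> $ j" using t(4) by simp
    moreover have "X2 t \<omega> $ i \<noteq> X2 t \<omega> $ j" using collision_timeD[OF t(1) _ t(3)] less t(2) by metis
    ultimately show False by simp
  qed
  show ?case
  proof (rule antisym)
    show "\<tau> \<omega> \<le> \<tau>' \<omega>"
      by (rule le[of L' L]) (use elim continuous_L continuous_L' in auto)
    show "\<tau>' \<omega> \<le> \<tau> \<omega>"
      by (rule le[of L L']) (use elim continuous_L continuous_L' in auto)
  qed
qed

end

lemma closed_matrix_box: "closed {A :: real^'n^'m. \<forall>i j. \<bar>A $ i $ j\<bar> \<le> N}"
  by (intro closed_Collect_all closed_Collect_le continuous_intros)

section \<open>Agreement of the eigenvectors\<close>

context eigensystem_pair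
begin

text \<open>Orthogonality of H at later times is not part of being a solution, so bounded entries
  are made part of the localization. With the eigenvalues identified, the differences D solve a
  linear system, and Gronwall's inequality is applied to the sum of their squares.\<close>

lemma eigenvectors_agree_bounded:
  assumes N: "0 < N"
  shows "AE \<omega> in M. \<forall>t\<ge>0. t \<le> N \<longrightarrow>
    (\<forall>r\<in>{0..t}. separated N (L r \<omega>) \<and> separated N (L' r \<omega>) \<and>
      (\<forall>i j. \<bar>H r \<omega> $ i $ j\<bar> \<le> N) \<and> (\<forall>i j. \<bar>H' r \<omega> $ i $ j\<bar> \<le> N)) \<longrightarrow> H t \<omega> = H' t \<omega>"
proof -
  let ?box = "{A :: real^('n::{finite,linorder})^('n::{finite,linorder}). \<forall>i j. \<bar>A $ i $ j\<bar> \<le> N}"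
  let ?good = "\<lambda>r \<omega>. separated N (L r \<omega>) \<and> separated N (L' r \<omega>) \<and>
      (\<forall>i j. \<bar>H r \<omega> $ i $ j\<bar> \<le> N) \<and> (\<forall>i j. \<bar>H' r \<omega> $ i $ j\<bar> \<le> N)"
  obtain T where T_meas: "T \<in> borel_measurable M"
    and T: "\<And>s. 0 \<le> s \<Longrightarrow> {\<omega> \<in> space M. s \<le> T \<omega>} \<in> sets (F s)"
    and T_iff: "\<And>\<omega> s. \<omega> \<in> space M \<Longrightarrow> 0 \<le> s \<Longrightarrow> s \<le> T \<omega> \<longleftrightarrow> s \<le> N \<and> (\<forall>r\<in>{0..s}. ?good r \<omega>)"
  proof (rule exit_time_exists[of ?good N])
    show "{\<omega> \<in> space M. ?good r \<omega>} \<in> sets (F r)" if r: "0 \<le> r" for r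
    proof -
      have "{\<omega> \<in> space M. ?good r \<omega>}
          = ({\<omega> \<in> space M. L r \<omega> \<in> {v. separated N v}} \<inter> {\<omega> \<in> space M. L' r \<omega> \<in> {v. separated N v}})
            \<inter> ({\<omega> \<in> space M. H r \<omega> \<in> ?box} \<inter> {\<omega> \<in> space M. H' r \<omega> \<in> ?box})" by auto
      then show ?thesis
        using closed_event[OF adapted_LH(1)[OF r] closed_separated] closed_event[OF adapted_LH(2)[OF r] closed_separated]
          closed_event[OF adapted_LH(3)[OF r] closed_matrix_box] closed_event[OF adapted_LH(4)[OF r] closed_matrix_box]
        by (simp only:) (intro sets.Int)
    qed
    show "\<forall>r\<in>{0..s}. ?good r \<omega>"
      if w: "\<omega> \<in> space M" and s: "0 < s" and rat: "\<And>r. r \<in> \<rat> \<Longrightarrow> 0 \<le> r \<Longrightarrow> r < s \<Longrightarrow> ?good r \<omega>" for \<omega> s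
    proof
      fix r assume r: "r \<in> {0..s}"
      have c: "continuous_on {0..s} (\<lambda>t. L t \<omega>)" "continuous_on {0..s} (\<lambda>t. L' t \<omega>)"
        using continuous_L[OF w] continuous_L'[OF w] by (auto intro: continuous_on_subset)
      have sep: "separated N (L q \<omega>)" "separated N (L' q \<omega>)" if "q \<in> {0..s}" for q
        using closed_on_interval_of_rationals[OF s c(1) closed_separated _ that]
          closed_on_interval_of_rationals[OF s c(2) closed_separated _ that] rat by simp_all
      have nq: "L q \<omega> $ i \<noteq> L q \<omega> $ k" "L' q \<omega> $ i \<noteq> L' q \<omega> $ k" if "q \<in> {0..s}" "i \<noteq> k" for q i k
        using separated_neq[OF sep(1)[OF that(1)] N that(2)] separated_neq[OF sep(2)[OF that(1)] N that(2)] by auto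
      \<comment> \<open>The order matters: H is continuous only before the collision time.
        Separation is therefore extended from the rationals first, and only then does the path of H
        admit the same argument.\<close>
      have "ereal s < \<tau> \<omega>" "ereal s < \<tau>' \<omega>"
        using less_collision_timeI[where L=L and \<omega>=\<omega> and T=s, OF continuous_L[OF w] nq(1)]
          less_collision_timeI[where L=L' and \<omega>=\<omega> and T=s, OF continuous_L'[OF w] nq(2)] by auto
      then have cH: "continuous_on {0..s} (\<lambda>t. H t \<omega>)" "continuous_on {0..s} (\<lambda>t. H' t \<omega>)"
        using continuous_H[OF w] continuous_H'[OF w] by auto
      show "?good r \<omega>"
        using sep[OF r] closed_on_interval_of_rationals[OF s cH(1) closed_matrix_box _ r]
          closed_on_interval_of_rationals[OF s cH(2) closed_matrix_box _ r] rat by simp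
    qed
  qed (use N in simp_all)
  have sep: "separated N (L s \<omega>)" "separated N (L' s \<omega>)"
    and box: "\<bar>H s \<omega> $ i $ j\<bar> \<le> N" "\<bar>H' s \<omega> $ i $ j\<bar> \<le> N"
    if "\<omega> \<in> space M" "s \<in> {0..T \<omega>}" for \<omega> s i j
    using T_iff[OF that(1), of s] that(2) by auto
  have neq: "L s \<omega> $ i \<noteq> L s \<omega> $ k" "L' s \<omega> $ i \<noteq> L' s \<omega> $ k"
    if "\<omega> \<in> space M" "s \<in> {0..T \<omega>}" "i \<noteq> k" for \<omega> s i k
    using sep[OF that(1,2)] N that(3) by (auto dest: separated_neq)
  have cont: "continuous_on {0..T \<omega>} (\<lambda>s. L s \<omega>)" "continuous_on {0..T \<omega>} (\<lambda>s. L' s \<omega>)" if "\<omega> \<in> space M" for \<omega>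
    using continuous_L[OF that] continuous_L'[OF that] by (auto intro: continuous_on_subset)
  have before: "ereal (T \<omega>) < \<tau> \<omega> \<and> ereal (T \<omega>) < \<tau>' \<omega>" if "\<omega> \<in> space M" for \<omega>
    using neq[OF that] continuous_L[OF that] continuous_L'[OF that] by (auto intro!: less_collision_timeI)
  have contH: "continuous_on {0..T \<omega>} (\<lambda>s. H s \<omega>)" "continuous_on {0..T \<omega>} (\<lambda>s. H' s \<omega>)" if "\<omega> \<in> space M" for \<omega>
    using continuous_H[OF that] continuous_H'[OF that] before[OF that] by auto
  have agree: "AE \<omega> in M. \<forall>s\<in>{0..T \<omega>}. L s \<omega> = L' s \<omega>"
    using eigenvalues_agree AE_space
  proof eventually_elim
    case (elim \<omega>)
    show ?case
    proof
      fix s assume s: "s \<in> {0..T \<omega>}"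
      then have "ereal s < \<tau> \<omega>" "ereal s < \<tau>' \<omega>"
        using before[of \<omega>] elim by (auto intro: le_less_trans[of _ "ereal (T \<omega>)"])
      then show "L s \<omega> = L' s \<omega>" using elim s by simp
    qed
  qed
  obtain B where B: "0 \<le> B" "\<And>v j k. separated N v \<Longrightarrow> j \<noteq> k \<Longrightarrow> \<bar>noise_coeff v j k\<bar> \<le> B"
    "\<And>v j. separated N v \<Longrightarrow> \<bar>decay v j\<bar> \<le> B"
    using coefficient_bounds[OF N] by metis
  define D where "D = (\<lambda>i j s \<omega>. H s \<omega> $ i $ j - H' s \<omega> $ i $ j)"
  define S where "S = (\<lambda>s \<omega>. \<Sum>i\<in>UNIV. \<Sum>j\<in>UNIV. (D i j s \<omega>)\<^sup>2)"
  define S1 where "S1 = real CARD('n) * (real CARD('n) * (2 * N)\<^sup>2)"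
  have S1: "0 \<le> S1" by (simp add: S1_def)
  have D_le: "(D i j s \<omega>)\<^sup>2 \<le> (2 * N)\<^sup>2" if "\<omega> \<in> space M" "s \<in> {0..T \<omega>}" for i j s \<omega>
  proof -
    have "\<bar>D i j s \<omega>\<bar> \<le> 2 * N" using box[OF that, of i j] unfolding D_def by linarith
    then have "\<bar>D i j s \<omega>\<bar>\<^sup>2 \<le> (2 * N)\<^sup>2" by (rule power_mono) simp
    then show ?thesis by (simp only: power2_abs)
  qed
  have D_le_S: "(D i j s \<omega>)\<^sup>2 \<le> S s \<omega>" for i j s \<omega>
  proof -
    have "(D i j s \<omega>)\<^sup>2 \<le> (\<Sum>j\<in>UNIV. (D i j s \<omega>)\<^sup>2)" by (rule member_le_sum) auto
    also have "\<dots> \<le> S s \<omega>" unfolding S_def by (rule member_le_sum) (auto intro: sum_nonneg)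
    finally show ?thesis .
  qed
  have S_adapted: "S s \<in> borel_measurable (F s)" if "0 \<le> s" for s
    unfolding S_def D_def
    by (intro borel_measurable_sum borel_measurable_power borel_measurable_diff component_adapted that)
  have S_cont: "continuous_on {0..T \<omega>} (\<lambda>s. S s \<omega>)" if "\<omega> \<in> space M" for \<omega>
    unfolding S_def D_def by (intro continuous_intros contH[OF that])
  have S_bound: "0 \<le> S s \<omega> \<and> S s \<omega> \<le> S1" if "\<omega> \<in> space M" "s \<in> {0..T \<omega>}" for \<omega> s
  proof -
    have "S s \<omega> \<le> (\<Sum>i\<in>(UNIV :: 'n set). \<Sum>j\<in>(UNIV :: 'n set). (2 * N)\<^sup>2)"
      unfolding S_def using D_le[OF that] by (intro sum_mono)
    then show ?thesis unfolding S_def S1_def by (auto intro!: sum_nonneg)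
  qed
  define J where "J = (\<lambda>t \<omega>. LINT s:{0..min t (T \<omega>)}|lborel. S s \<omega>)"
  have J_int: "integrable M (J t)" if "0 \<le> t" for t
    unfolding J_def
    by (rule stopped_integral_integrable[OF T S_adapted S_cont _ S1 that]) (use S_bound in auto)
  have J_nonneg: "0 \<le> J t \<omega>" if "\<omega> \<in> space M" for t \<omega>
    unfolding J_def set_lebesgue_integral_def
    using S_bound[OF that] by (intro integral_nonneg_AE AE_I2) (auto simp: indicator_def)
  have EJ_nonneg: "0 \<le> expectation (J t)" for t using J_nonneg by (intro integral_nonneg_AE AE_I2)
  note [measurable] = measurable_stopping[OF T]
  have D_meas: "D i j t \<in> borel_measurable M" if "0 \<le> t" for i j t
    unfolding D_def using component_adapted(3,4)[OF that, of i j] by (intro borel_measurable_diff measurable_F_M)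
  have int_D: "integrable M (\<lambda>\<omega>. indicator {0..T \<omega>} t * (D i j t \<omega>)\<^sup>2)" if t: "0 < t" for i j t
  proof (rule integrable_const_bound[where B="(2 * N)\<^sup>2"])
    show "AE \<omega> in M. norm (indicator {0..T \<omega>} t * (D i j t \<omega>)\<^sup>2) \<le> (2 * N)\<^sup>2"
      using D_le by (intro AE_I2) (auto simp: indicator_def)
    have [measurable]: "D i j t \<in> borel_measurable M" using D_meas t by simp
    show "(\<lambda>\<omega>. indicator {0..T \<omega>} t * (D i j t \<omega>)\<^sup>2) \<in> borel_measurable M" by measurable
  qed
  \<comment> \<open>The factor 2 comes from squaring noise plus drift. For the noise, Cauchy-Schwarz
    over k gives one factor CARD('n) and adding the bounds gives the other; for the drift,
    Cauchy-Schwarz in time gives a factor t, which is at most N.\<close>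
  define K where "K = 2 * real CARD('n) * (real CARD('n) * B\<^sup>2) + 2 * N * B\<^sup>2"
  have K: "0 \<le> K" using N by (simp add: K_def)
  have ineq: "expectation (\<lambda>\<omega>. indicator {0..T \<omega>} t * (D i j t \<omega>)\<^sup>2) \<le> K * expectation (J t)"
    if t: "0 < t" and tN: "t \<le> N" for t i j
  proof -
    obtain Y where Y: "\<forall>k\<in>UNIV - {j}. has_ito_integral_before M F \<tau> (\<beta> k j) (\<lambda>t \<omega>. H t \<omega> $ i $ k * noise_coeff (L t \<omega>) j k) (Y k)"
      "AE \<omega> in M. \<forall>t\<ge>0. ereal t < \<tau> \<omega> \<longrightarrow>
        set_integrable lborel {0..t} (\<lambda>s. - (1/2) * H s \<omega> $ i $ j * decay (L s \<omega>) j) \<and>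
        H t \<omega> $ i $ j = H 0 \<omega> $ i $ j + (\<Sum>k\<in>UNIV - {j}. Y k t \<omega>)
          + (LINT s:{0..t}|lborel. - (1/2) * H s \<omega> $ i $ j * decay (L s \<omega>) j)"
      by (rule eigenvector_equation[OF sol])
    obtain Y' where Y': "\<forall>k\<in>UNIV - {j}. has_ito_integral_before M F \<tau>' (\<beta> k j) (\<lambda>t \<omega>. H' t \<omega> $ i $ k * noise_coeff (L' t \<omega>) j k) (Y' k)"
      "AE \<omega> in M. \<forall>t\<ge>0. ereal t < \<tau>' \<omega> \<longrightarrow>
        set_integrable lborel {0..t} (\<lambda>s. - (1/2) * H' s \<omega> $ i $ j * decay (L' s \<omega>) j) \<and>
        H' t \<omega> $ i $ j = H' 0 \<omega> $ i $ j + (\<Sum>k\<in>UNIV - {j}. Y' k t \<omega>)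
          + (LINT s:{0..t}|lborel. - (1/2) * H' s \<omega> $ i $ j * decay (L' s \<omega>) j)"
      by (rule eigenvector_equation[OF sol'])
    \<comment> \<open>Each noise index k is treated alone, with its own motion. The sum over k is
      later handled by Cauchy-Schwarz, so no covariation between different motions has to be
      computed.\<close>
    let ?P = "\<lambda>k Z. Z \<in> borel_measurable M \<and> (AE \<omega> in M. t \<le> T \<omega> \<longrightarrow> Z \<omega> = Y k t \<omega> - Y' k t \<omega>) \<and>
        integrable M (\<lambda>\<omega>. indicator {0..T \<omega>} t * (Z \<omega>)\<^sup>2) \<and>
        expectation (\<lambda>\<omega>. indicator {0..T \<omega>} t * (Z \<omega>)\<^sup>2) \<le> B\<^sup>2 * expectation (J t)"
    have ex: "\<exists>Z. ?P k Z" if k: "k \<noteq> j" for k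
    proof -
      interpret W: filtered_brownian M F "\<beta> k j" by (rule brownian_\<beta>[OF k])
      have k': "k \<in> UNIV - {j}" using k by simp
      let ?f = "\<lambda>t \<omega>. H t \<omega> $ i $ k * noise_coeff (L t \<omega>) j k" and ?f' = "\<lambda>t \<omega>. H' t \<omega> $ i $ k * noise_coeff (L' t \<omega>) j k"
      have cf: "continuous_on {0..T \<omega>} (\<lambda>s. ?f s \<omega>)" "continuous_on {0..T \<omega>} (\<lambda>s. ?f' s \<omega>)" if w: "\<omega> \<in> space M" for \<omega>
        using neq[OF w] k
        by (auto intro!: continuous_on_mult continuous_coefficients(3) cont[OF w] continuous_on_component contH[OF w])
      have bf: "\<bar>?f s \<omega> - ?f' s \<omega>\<bar> \<le> 2 * (N * B)" if "\<omega> \<in> space M" "s \<in> {0..T \<omega>}" for \<omega> s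
      proof -
        have "\<bar>?f s \<omega>\<bar> \<le> N * B" "\<bar>?f' s \<omega>\<bar> \<le> N * B"
          unfolding abs_mult using box[OF that, of i k] B(2)[OF sep(1)[OF that], of j k] B(2)[OF sep(2)[OF that], of j k] k N B(1)
          by (auto intro!: mult_mono)
        then show ?thesis by linarith
      qed
      have Q: "AE \<omega> in M. (LINT s:{0..min t (T \<omega>)}|lborel. (?f s \<omega> - ?f' s \<omega>)\<^sup>2) \<le> B\<^sup>2 * J t \<omega>"
        using agree AE_space
      proof eventually_elim
        case (elim \<omega>)
        let ?I = "{0..min t (T \<omega>)}"
        have "continuous_on ?I (\<lambda>s. S s \<omega>)" using S_cont[of \<omega>] elim by (auto intro: continuous_on_subset)
        then have "integrable lborel (\<lambda>s. indicator ?I s *\<^sub>R S s \<omega>)" by (rule borel_integrable_compact[rotated]) simp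
        then have iS: "integrable lborel (\<lambda>s. B\<^sup>2 * (indicator ?I s *\<^sub>R S s \<omega>))" by (rule integrable_mult_right)
        have "(LINT s:?I|lborel. (?f s \<omega> - ?f' s \<omega>)\<^sup>2) \<le> (\<integral>s. B\<^sup>2 * (indicator ?I s *\<^sub>R S s \<omega>) \<partial>lborel)"
          unfolding set_lebesgue_integral_def
        proof (rule integral_mono'[OF iS])
          fix s
          show "0 \<le> B\<^sup>2 * (indicator ?I s *\<^sub>R S s \<omega>)" using S_bound[of \<omega> s] elim by (auto simp: indicator_def)
          show "indicator ?I s *\<^sub>R (?f s \<omega> - ?f' s \<omega>)\<^sup>2 \<le> B\<^sup>2 * (indicator ?I s *\<^sub>R S s \<omega>)"
          proof (cases "s \<in> ?I")
            case True
            then have s: "s \<in> {0..T \<omega>}" by auto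
            \<comment> \<open>Equality of the eigenvalues up to T turns the difference of the
              integrands into a common coefficient times an entry of D.\<close>
            have "?f s \<omega> - ?f' s \<omega> = noise_coeff (L s \<omega>) j k * D i k s \<omega>"
              using elim s by (simp add: D_def algebra_simps)
            then have "(?f s \<omega> - ?f' s \<omega>)\<^sup>2 = (noise_coeff (L s \<omega>) j k)\<^sup>2 * (D i k s \<omega>)\<^sup>2" by (simp add: power_mult_distrib)
            also have "\<dots> \<le> B\<^sup>2 * S s \<omega>"
            proof (rule mult_mono)
              show "(noise_coeff (L s \<omega>) j k)\<^sup>2 \<le> B\<^sup>2"
                using B(2)[OF sep(1)[of \<omega> s], of j k] elim s k B(1) by (simp add: abs_le_square_iff[symmetric])
            qed (use D_le_S in auto)
            finally show ?thesis using True by simp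
          qed simp
        qed
        then show ?case by (simp add: J_def set_lebesgue_integral_def)
      qed
      have int_Q: "integrable M (\<lambda>\<omega>. B\<^sup>2 * J t \<omega>)" using J_int t by simp
      have E_Q: "0 \<le> expectation (\<lambda>\<omega>. B\<^sup>2 * J t \<omega>)" using EJ_nonneg by simp
      have C: "0 \<le> 2 * (N * B)" using N B(1) by simp
      obtain Z where "Z \<in> borel_measurable M" "AE \<omega> in M. t \<le> T \<omega> \<longrightarrow> Z \<omega> = Y k t \<omega> - Y' k t \<omega>"
        "integrable M (\<lambda>\<omega>. indicator {0..T \<omega>} t * (Z \<omega>)\<^sup>2)"
        "expectation (\<lambda>\<omega>. indicator {0..T \<omega>} t * (Z \<omega>)\<^sup>2) \<le> expectation (\<lambda>\<omega>. B\<^sup>2 * J t \<omega>)"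
        by (rule W.ito_difference_square[OF bspec[OF Y(1) k'] bspec[OF Y'(1) k'] T before C t cf bf int_Q Q E_Q])
      then show ?thesis by auto
    qed
    have "\<forall>k\<in>UNIV - {j}. \<exists>Z. ?P k Z" by (intro ballI ex) simp
    from bchoice[OF this] obtain Z where "\<forall>k\<in>UNIV - {j}. ?P k (Z k)" by (rule exE)
    then have Z: "\<And>k. k \<noteq> j \<Longrightarrow> AE \<omega> in M. t \<le> T \<omega> \<longrightarrow> Z k \<omega> = Y k t \<omega> - Y' k t \<omega>"
      "\<And>k. k \<noteq> j \<Longrightarrow> integrable M (\<lambda>\<omega>. indicator {0..T \<omega>} t * (Z k \<omega>)\<^sup>2)"
      "\<And>k. k \<noteq> j \<Longrightarrow> expectation (\<lambda>\<omega>. indicator {0..T \<omega>} t * (Z k \<omega>)\<^sup>2) \<le> B\<^sup>2 * expectation (J t)"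
      by simp_all
    have "AE \<omega> in M. \<forall>k\<in>UNIV - {j}. t \<le> T \<omega> \<longrightarrow> Z k \<omega> = Y k t \<omega> - Y' k t \<omega>"
      by (subst AE_ball_countable) (use Z(1) in auto)
    then have pointwise: "AE \<omega> in M. indicator {0..T \<omega>} t * (D i j t \<omega>)\<^sup>2
        \<le> 2 * (real CARD('n) * (\<Sum>k\<in>UNIV - {j}. indicator {0..T \<omega>} t * (Z k \<omega>)\<^sup>2)) + 2 * (N * B\<^sup>2 * J t \<omega>)"
      using Y(2) Y'(2) same_init agree AE_space
    proof eventually_elim
      case (elim \<omega>)
      note w = \<open>\<omega> \<in> space M\<close>
      show ?case
      proof (cases "t \<le> T \<omega>")
        case True
        have sub: "{0..t} \<subseteq> {0..T \<omega>}" using True by auto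
        have lt: "ereal t < \<tau> \<omega>" "ereal t < \<tau>' \<omega>"
          using before[OF w] True by (auto intro: le_less_trans[of _ "ereal (T \<omega>)"])
        let ?u = "\<lambda>s. - (1/2) * H s \<omega> $ i $ j * decay (L s \<omega>) j" and ?u' = "\<lambda>s. - (1/2) * H' s \<omega> $ i $ j * decay (L' s \<omega>) j"
        have e: "set_integrable lborel {0..t} ?u" "set_integrable lborel {0..t} ?u'"
          "H t \<omega> $ i $ j = H 0 \<omega> $ i $ j + (\<Sum>k\<in>UNIV - {j}. Y k t \<omega>) + (LINT s:{0..t}|lborel. ?u s)"
          "H' t \<omega> $ i $ j = H' 0 \<omega> $ i $ j + (\<Sum>k\<in>UNIV - {j}. Y' k t \<omega>) + (LINT s:{0..t}|lborel. ?u' s)"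
          using elim lt t by auto
        define I where "I = (LINT s:{0..t}|lborel. ?u s - ?u' s)"
        have "(\<Sum>k\<in>UNIV - {j}. Z k \<omega>) = (\<Sum>k\<in>UNIV - {j}. Y k t \<omega>) - (\<Sum>k\<in>UNIV - {j}. Y' k t \<omega>)"
          unfolding sum_subtractf[symmetric] using elim True by (intro sum.cong) auto
        then have D_eq: "D i j t \<omega> = (\<Sum>k\<in>UNIV - {j}. Z k \<omega>) + I"
          using e(3,4) elim unfolding D_def I_def set_integral_diff(2)[OF e(1,2)] by simp
        have sum_le: "(\<Sum>k\<in>UNIV - {j}. Z k \<omega>)\<^sup>2 \<le> real CARD('n) * (\<Sum>k\<in>UNIV - {j}. (Z k \<omega>)\<^sup>2)"
        proof -
          have "(\<Sum>k\<in>UNIV - {j}. Z k \<omega>)\<^sup>2 \<le> (\<Sum>k\<in>UNIV - {j}. (Z k \<omega>)\<^sup>2) * real (card (UNIV - {j}))"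
            by (rule sum_squared_le_sum_of_squares)
          also have "\<dots> \<le> (\<Sum>k\<in>UNIV - {j}. (Z k \<omega>)\<^sup>2) * real CARD('n)"
            by (intro mult_left_mono sum_nonneg) (auto intro!: card_mono)
          finally show ?thesis by (simp add: mult.commute)
        qed
        have I_le: "I\<^sup>2 \<le> N * B\<^sup>2 * J t \<omega>"
        proof -
          have cu: "continuous_on {0..t} (\<lambda>s. ?u s - ?u' s)"
            by (rule continuous_on_subset[OF _ sub])
               (intro continuous_on_diff continuous_on_mult continuous_on_const continuous_on_component
                 continuous_coefficients(2) cont[OF w] contH[OF w]; use neq[OF w] in blast)
          have "I\<^sup>2 \<le> t * (LINT s:{0..t}|lborel. (?u s - ?u' s)\<^sup>2)"
            unfolding I_def by (rule square_of_integral_le[OF cu t])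
          also have "(LINT s:{0..t}|lborel. (?u s - ?u' s)\<^sup>2) \<le> (LINT s:{0..t}|lborel. B\<^sup>2 * S s \<omega>)"
          proof (rule set_integral_mono)
            show "set_integrable lborel {0..t} (\<lambda>s. (?u s - ?u' s)\<^sup>2)" "set_integrable lborel {0..t} (\<lambda>s. B\<^sup>2 * S s \<omega>)"
              unfolding set_integrable_def
              by (rule borel_integrable_compact; intro compact_Icc continuous_on_power cu continuous_on_mult
                  continuous_on_const continuous_on_subset[OF S_cont[OF w] sub])+
            fix s assume s: "s \<in> {0..t}"
            then have sT: "s \<in> {0..T \<omega>}" using sub by auto
            have "?u s - ?u' s = - (1/2) * decay (L s \<omega>) j * D i j s \<omega>"
              using elim sT by (simp add: D_def algebra_simps)
            then have "(?u s - ?u' s)\<^sup>2 = (1/2)\<^sup>2 * ((decay (L s \<omega>) j)\<^sup>2 * (D i j s \<omega>)\<^sup>2)"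
              by (simp add: power_mult_distrib power_divide)
            also have "\<dots> \<le> 1 * (B\<^sup>2 * S s \<omega>)"
            proof (intro mult_mono)
              show "(decay (L s \<omega>) j)\<^sup>2 \<le> B\<^sup>2"
                using B(3)[OF sep(1)[OF w sT], of j] B(1) by (simp add: abs_le_square_iff[symmetric])
            qed (use D_le_S in \<open>auto simp: power2_eq_square\<close>)
            finally show "(?u s - ?u' s)\<^sup>2 \<le> B\<^sup>2 * S s \<omega>" by simp
          qed
          also have "(LINT s:{0..t}|lborel. B\<^sup>2 * S s \<omega>) = B\<^sup>2 * J t \<omega>" using True by (simp add: J_def)
          also have "t * (B\<^sup>2 * J t \<omega>) \<le> N * (B\<^sup>2 * J t \<omega>)" using tN J_nonneg[OF w] by (intro mult_right_mono) auto
          finally show ?thesis using t by (simp add: mult.assoc)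
        qed
        have "(D i j t \<omega>)\<^sup>2 \<le> 2 * (\<Sum>k\<in>UNIV - {j}. Z k \<omega>)\<^sup>2 + 2 * I\<^sup>2"
          using zero_le_power2[of "(\<Sum>k\<in>UNIV - {j}. Z k \<omega>) - I"] unfolding D_eq by (simp add: power2_sum power2_diff)
        also have "\<dots> \<le> 2 * (real CARD('n) * (\<Sum>k\<in>UNIV - {j}. (Z k \<omega>)\<^sup>2)) + 2 * (N * B\<^sup>2 * J t \<omega>)"
          using sum_le I_le by (intro add_mono mult_left_mono) auto
        finally show ?thesis using True t by simp
      next
        case False
        have "0 \<le> N * B\<^sup>2 * J t \<omega>" using N J_nonneg[OF w] by simp
        then show ?thesis using False by simp
      qed
    qed
    have iZ: "integrable M (\<lambda>\<omega>. \<Sum>k\<in>UNIV - {j}. indicator {0..T \<omega>} t * (Z k \<omega>)\<^sup>2)"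
      using Z(2) by (intro Bochner_Integration.integrable_sum) auto
    have iJ: "integrable M (J t)" using J_int t by simp
    have "expectation (\<lambda>\<omega>. indicator {0..T \<omega>} t * (D i j t \<omega>)\<^sup>2)
        \<le> expectation (\<lambda>\<omega>. 2 * (real CARD('n) * (\<Sum>k\<in>UNIV - {j}. indicator {0..T \<omega>} t * (Z k \<omega>)\<^sup>2)) + 2 * (N * B\<^sup>2 * J t \<omega>))"
      using int_D[OF t] iZ iJ pointwise by (intro integral_mono_AE) auto
    also have "\<dots> = 2 * (real CARD('n) * expectation (\<lambda>\<omega>. \<Sum>k\<in>UNIV - {j}. indicator {0..T \<omega>} t * (Z k \<omega>)\<^sup>2))
        + 2 * (N * B\<^sup>2 * expectation (J t))"
      using iZ iJ by simp
    also have "expectation (\<lambda>\<omega>. \<Sum>k\<in>UNIV - {j}. indicator {0..T \<omega>} t * (Z k \<omega>)\<^sup>2)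
        = (\<Sum>k\<in>UNIV - {j}. expectation (\<lambda>\<omega>. indicator {0..T \<omega>} t * (Z k \<omega>)\<^sup>2))"
      using Z(2) by (intro Bochner_Integration.integral_sum) auto
    also have "\<dots> \<le> (\<Sum>k\<in>UNIV - {j}. B\<^sup>2 * expectation (J t))" using Z(3) by (intro sum_mono) auto
    also have "\<dots> \<le> (\<Sum>k\<in>(UNIV :: 'n set). B\<^sup>2 * expectation (J t))"
      using EJ_nonneg by (intro sum_mono2) auto
    also have "\<dots> = real CARD('n) * B\<^sup>2 * expectation (J t)" by simp
    finally have "expectation (\<lambda>\<omega>. indicator {0..T \<omega>} t * (D i j t \<omega>)\<^sup>2)
        \<le> 2 * (real CARD('n) * (real CARD('n) * B\<^sup>2 * expectation (J t))) + 2 * (N * B\<^sup>2 * expectation (J t))"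
      by (simp add: mult_left_mono)
    also have "\<dots> = K * expectation (J t)" by (simp add: K_def algebra_simps)
    finally show ?thesis .
  qed
  have "AE \<omega> in M. \<forall>t\<in>{0..T \<omega>}. S t \<omega> = 0"
  proof (rule gronwall_process[where K="real CARD('n) * (real CARD('n) * K)" and B=S1, OF T_meas _ S_cont S_bound])
    show "S s \<in> borel_measurable M" if "0 \<le> s" for s using S_adapted[OF that] by (rule measurable_F_M)
    show "AE \<omega> in M. S 0 \<omega> = 0" using same_init by eventually_elim (simp add: S_def D_def)
    fix t :: real assume t: "0 < t"
    show "expectation (\<lambda>\<omega>. indicator {0..T \<omega>} t * S t \<omega>)
        \<le> real CARD('n) * (real CARD('n) * K) * expectation (\<lambda>\<omega>. LINT s:{0..min t (T \<omega>)}|lborel. S s \<omega>)"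
    \<comment> \<open>The estimate \<open>ineq\<close> is available only up to time N. Beyond it the
      indicator vanishes, because T never exceeds N.\<close>
    proof (cases "t \<le> N")
      case True
      have "expectation (\<lambda>\<omega>. indicator {0..T \<omega>} t * S t \<omega>)
          = (\<Sum>i\<in>UNIV. \<Sum>j\<in>UNIV. expectation (\<lambda>\<omega>. indicator {0..T \<omega>} t * (D i j t \<omega>)\<^sup>2))"
      proof -
        have "expectation (\<lambda>\<omega>. indicator {0..T \<omega>} t * S t \<omega>)
            = (\<Sum>i\<in>UNIV. expectation (\<lambda>\<omega>. \<Sum>j\<in>UNIV. indicator {0..T \<omega>} t * (D i j t \<omega>)\<^sup>2))"
          unfolding S_def sum_distrib_left
          by (intro Bochner_Integration.integral_sum Bochner_Integration.integrable_sum int_D[OF t])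
        also have "\<dots> = (\<Sum>i\<in>UNIV. \<Sum>j\<in>UNIV. expectation (\<lambda>\<omega>. indicator {0..T \<omega>} t * (D i j t \<omega>)\<^sup>2))"
          by (intro sum.cong refl Bochner_Integration.integral_sum int_D[OF t])
        finally show ?thesis .
      qed
      also have "\<dots> \<le> (\<Sum>i\<in>(UNIV :: 'n set). \<Sum>j\<in>(UNIV :: 'n set). K * expectation (J t))"
        using ineq[OF t True] by (intro sum_mono)
      also have "\<dots> = real CARD('n) * (real CARD('n) * K) * expectation (J t)" by simp
      finally show ?thesis by (simp add: J_def)
    next
      case False
      have "indicator {0..T \<omega>} t * S t \<omega> = 0" if "\<omega> \<in> space M" for \<omega>
        using T_iff[OF that, of t] False t by (auto simp: indicator_def)
      then have "expectation (\<lambda>\<omega>. indicator {0..T \<omega>} t * S t \<omega>) = 0"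
        by (intro integral_eq_zero_AE AE_I2)
      then show ?thesis using K EJ_nonneg[of t] by (simp add: J_def)
    qed
  qed (use K in simp_all)
  then show ?thesis using AE_space
  proof eventually_elim
    case (elim \<omega>)
    show ?case
    proof (intro allI impI)
      fix t assume t: "0 \<le> t" "t \<le> N" "\<forall>r\<in>{0..t}. ?good r \<omega>"
      then have "t \<in> {0..T \<omega>}" using T_iff[of \<omega> t] elim by auto
      then have "S t \<omega> = 0" using elim by simp
      then have "(D i j t \<omega>)\<^sup>2 \<le> 0" for i j using D_le_S[of i j t \<omega>] by simp
      then show "H t \<omega> = H' t \<omega>" by (simp add: vec_eq_iff D_def)
    qed
  qed
qed

lemma eigenvectors_agree:
  "AE \<omega> in M. \<forall>t\<ge>0. ereal t < \<tau> \<omega> \<longrightarrow> ereal t < \<tau>' \<omega> \<longrightarrow> H t \<omega> = H' t \<omega>"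
proof -
  have "AE \<omega> in M. \<forall>n. \<forall>t\<ge>0. t \<le> real (Suc n) \<longrightarrow>
    (\<forall>r\<in>{0..t}. separated (real (Suc n)) (L r \<omega>) \<and> separated (real (Suc n)) (L' r \<omega>) \<and>
      (\<forall>i j. \<bar>H r \<omega> $ i $ j\<bar> \<le> real (Suc n)) \<and> (\<forall>i j. \<bar>H' r \<omega> $ i $ j\<bar> \<le> real (Suc n))) \<longrightarrow> H t \<omega> = H' t \<omega>"
    by (subst AE_all_countable) (intro allI eigenvectors_agree_bounded, simp)
  then show ?thesis using AE_space
  proof eventually_elim
    case (elim \<omega>)
    note w = \<open>\<omega> \<in> space M\<close>
    show ?case
    proof (intro allI impI)
      fix t assume t: "0 \<le> t" "ereal t < \<tau> \<omega>" "ereal t < \<tau>' \<omega>"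
      obtain N0 where N0: "\<And>N r. N0 \<le> N \<Longrightarrow> r \<in> {0..t} \<Longrightarrow> separated N (L r \<omega>) \<and> separated N (L' r \<omega>)"
        using separated_before_collision[OF w t] by metis
      have bound: "\<exists>B. \<forall>r\<in>{0..t}. \<forall>i j. \<bar>V r $ i $ j\<bar> \<le> B" if "continuous_on {0..t} V"
        for V :: "real \<Rightarrow> real^('n::{finite,linorder})^('n::{finite,linorder})"
      proof -
        have "bounded (V ` {0..t})" using that by (intro compact_imp_bounded compact_continuous_image) auto
        then obtain B where "\<forall>A\<in>V ` {0..t}. norm A \<le> B" unfolding bounded_iff by (rule exE)
        then have "norm (V r) \<le> B" if "r \<in> {0..t}" for r using imageI[OF that] by (rule bspec)
        then have "\<bar>V r $ i $ j\<bar> \<le> B" if "r \<in> {0..t}" for r i j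
          using component_le_norm_cart[of "V r $ i" j] Finite_Cartesian_Product.norm_nth_le[of "V r" i] that
          by (meson order_trans)
        then show ?thesis by blast
      qed
      obtain B1 where B1: "\<forall>r\<in>{0..t}. \<forall>i j. \<bar>H r \<omega> $ i $ j\<bar> \<le> B1"
        using bound[OF continuous_H[OF w t(2)]] by (rule exE)
      obtain B2 where B2: "\<forall>r\<in>{0..t}. \<forall>i j. \<bar>H' r \<omega> $ i $ j\<bar> \<le> B2"
        using bound[OF continuous_H'[OF w t(3)]] by (rule exE)
      obtain n where n: "max (max N0 t) (max B1 B2) < real n" using reals_Archimedean2 by blast
      then have n': "N0 \<le> real (Suc n)" "t \<le> real (Suc n)" "B1 \<le> real (Suc n)" "B2 \<le> real (Suc n)" by auto
      have "\<forall>r\<in>{0..t}. separated (real (Suc n)) (L r \<omega>) \<and> separated (real (Suc n)) (L' r \<omega>) \<and>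
        (\<forall>i j. \<bar>H r \<omega> $ i $ j\<bar> \<le> real (Suc n)) \<and> (\<forall>i j. \<bar>H' r \<omega> $ i $ j\<bar> \<le> real (Suc n))"
        using N0[OF n'(1)] B1 B2 n'(3,4) by (meson order_trans)
      then show "H t \<omega> = H' t \<omega>" using elim n'(2) t(1) by blast
    qed
  qed
qed

end

theorem theorem6:
  fixes g h b \<rho> :: "real \<Rightarrow> real"
    and M :: "'a measure" and F :: "real \<Rightarrow> 'a measure"
    and \<nu> :: "'n::{finite,linorder} \<Rightarrow> real \<Rightarrow> 'a \<Rightarrow> real"
    and \<beta> :: "'n \<Rightarrow> 'n \<Rightarrow> real \<Rightarrow> 'a \<Rightarrow> real"
    and X0 :: "'a \<Rightarrow> real^('n::{finite,linorder})^('n::{finite,linorder})"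
    and L L' :: "real \<Rightarrow> 'a \<Rightarrow> real^('n::{finite,linorder})"
    and H H' :: "real \<Rightarrow> 'a \<Rightarrow> real^('n::{finite,linorder})^('n::{finite,linorder})"
  assumes rho_measurable: "\<rho> \<in> borel_measurable (restrict_space borel {0<..})"
    and rho_pos: "\<And>x. x > 0 \<Longrightarrow> \<rho> x > 0"
    and rho_int: "\<And>\<epsilon>. \<epsilon> > 0 \<Longrightarrow> (\<integral>\<^sup>+ x\<in>{0<..<\<epsilon>}. ennreal (1 / \<rho> x) \<partial>lborel) = \<infinity>"
    and gh: "\<And>x y. x \<noteq> y \<Longrightarrow> \<bar>g x * h x - g y * h y\<bar>\<^sup>2 \<le> \<rho> \<bar>x - y\<bar>"
    and G_lipschitz: "locally_lipschitz_on {(x, y). x \<noteq> y} (\<lambda>(x, y). G_fun g h x y)"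
    and G_pos: "\<And>x y. x \<noteq> y \<Longrightarrow> G_fun g h x y > 0"
    and b_lipschitz: "locally_lipschitz_on UNIV b"
    and filtered: "filtered_prob_space M F"
    and noise: "eigensystem_noise M F \<nu> \<beta>"
    and sol: "eigensystem_solution M F g h b \<nu> \<beta> L H"
    and sol': "eigensystem_solution M F g h b \<nu> \<beta> L' H'"
    and X0: "AE \<omega> in M. X0 \<omega> \<in> sym_distinct"
    and init: "AE \<omega> in M. diagonalizes (X0 \<omega>) (L 0 \<omega>) (H 0 \<omega>)"
    and same_init: "AE \<omega> in M. L' 0 \<omega> = L 0 \<omega> \<and> H' 0 \<omega> = H 0 \<omega>"
  shows "AE \<omega> in M. collision_time L \<omega> = collision_time L' \<omega> \<and>
           (\<forall>t\<ge>0. ereal t < collision_time L \<omega> \<longrightarrow> L t \<omega> = L' t \<omega> \<and> H t \<omega> = H' t \<omega>)"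
proof -
  interpret eigensystem_pair g h b \<rho> M F \<nu> \<beta> L L' H H'
    by (rule eigensystem_pair.intro)
       (fact rho_measurable rho_pos rho_int gh G_lipschitz b_lipschitz filtered noise sol sol' same_init)+
  show ?thesis
    using collision_times_agree eigenvalues_agree eigenvectors_agree by eventually_elim simp
qed

end
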